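(* Let $G$ be a finite group, $p$ a prime, $N \trianglelefteq G$, and let $\theta \in \mathrm{IBr}(N)$ be an irreducible $p$-Brauer character of $N$ which is $G$-conjugate to its complex conjugate $\overline{\theta}$. Then the number of real-valued irreducible $p$-Brauer characters of $G$ lying over $\theta$ is equal to the number of $p$-regular $\theta$-good conjugacy classes of $G_\theta/N$ of $\sigma_+$ type minus the number of $p$-regular $\theta$-good conjugacy classes of $G_\theta/N$ of $\sigma_-$ type.
   Context: $\mathrm{IBr}(H)$ denotes the set of irreducible $p$-Brauer characters of a finite group $H$ (complex-valued functions on the $p$-regular elements of $H$, i.e. those of order prime to $p$). An irreducible Brauer character $\varphi$ of $G$ lies over $\theta$ if $\theta$ is a constituent of the restriction $\varphi_N$. Write $y^g = g^{-1}yg$ and $[g,x]=g^{-1}x^{-1}gx$. For a Brauer character $\psi$ of a subgroup $H\le G$ and $g\in G$, $\psi^g$ is the Brauer character of $H^g = g^{-1}Hg$ with $\psi^g(y)=\psi(gyg^{-1})$. $G_\theta=\{g\in G : \theta^g=\theta\}$ is the inertia group of $\theta$ in $G$, and $G_\theta^*=\{g\in G : \theta^g\in\{\theta,\overline{\theta}\}\}$ is the extended inertia group. Since $\theta$ is $G$-conjugate to $\overline\theta$, one can fix $e\in G_\theta^*$ with $\theta^e=\overline{\theta}$. For $Nx\in G_\theta/N$, $\mathrm{Cl}(Nx)$ denotes the conjugacy class of $Nx$ in $G_\theta/N$. $\theta$-good classes: for $p$-regular $Nx\in G_\theta/N$ (represented by a $p$-regular $x\in G_\theta$), $\theta$ extends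 to an irreducible Brauer character $\theta_x$ of $N\langle x\rangle$. Let $C_{G_\theta}(Nx)=\{g\in G_\theta : [g,x]\in N\}$. Then $Nx$ is called $\theta$-good if $\theta_x^c=\theta_x$ for all $c\in C_{G_\theta}(Nx)$. This does not depend on the choice of $\theta_x$ and is invariant under conjugation in $G_\theta/N$; a conjugacy class of $G_\theta/N$ is $\theta$-good if its elements are. Indicator: let $Nx\in G_\theta/N$ be $\theta$-good and $p$-regular, and let $\theta_x$ be any extension of $\theta$ to $N\langle x\rangle$. If $\mathrm{Cl}(Nx)=\mathrm{Cl}(N(x^{-1})^{e^{-1}})$, then there exists $\varepsilon\in G_\theta^*$ with $\theta^\varepsilon=\overline{\theta}$ and $Nx^{\varepsilon^{-1}}=Nx^{-1}$ (where $x^{\varepsilon^{-1}}=\varepsilon x\varepsilon^{-1}$); set $\sigma(Nx)=+1$ if $\theta_x^\varepsilon=\overline{\theta_x}$ and $\sigma(Nx)=-1$ if $\theta_x^\varepsilon\neq\overline{\theta_x}$. If $\mathrm{Cl}(Nx)\neq\mathrm{Cl}(N(x^{-1})^{e^{-1}})$, no such $\varepsilon$ exists, and $\sigma(Nx)=0$. The value $\sigma(Nx)$ is independent of the choices of $\varepsilon$ and $\theta_x$ and constant on conjugacy classes of $G_\theta/N$. A $p$-regular $\theta$-good class is of $\sigma_+$, $\sigma_-$ or $\sigma_0$ type according as $\sigma=+1,-1,0$ on it. *)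

theory Defs
  imports
    "HOL-Algebra.Group_Action"
    "HOL-Algebra.Multiplicative_Group"
    "HOL-Computational_Algebra.Computational_Algebra"
    "Jordan_Normal_Form.Char_Poly"
    "Jordan_Normal_Form.VS_Connect"
begin

section \<open>Brauer characters\<close>

text \<open>
  Brauer characters depend on a ring homomorphism from the ring of algebraic integers onto a
  residue field of characteristic p (reduction modulo a maximal ideal containing p).  Here this
  homomorphism \<open>red\<close> takes values in an algebraically closed field \<open>'k\<close> of characteristic p;
  its values outside the algebraic integers are irrelevant.
\<close>

definition reduction_hom :: "(complex \<Rightarrow> 'k::field) \<Rightarrow> bool" where
  "reduction_hom red \<longleftrightarrow>
     red 1 = 1 \<and>
     (\<forall>x y. algebraic_int x \<longrightarrow> algebraic_int y \<longrightarrow>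
        red (x + y) = red x + red y \<and> red (x * y) = red x * red y)"

text \<open>
  The reduction restricts to a bijection between the roots of unity of order prime to p in the
  complex numbers and those in \<open>'k\<close>; \<open>root_lift\<close> is the inverse of this bijection.
\<close>

definition root_lift :: "nat \<Rightarrow> (complex \<Rightarrow> 'k::field) \<Rightarrow> 'k \<Rightarrow> complex" where
  "root_lift p red a = (THE \<xi>. (\<exists>n>0. coprime n p \<and> \<xi> ^ n = 1) \<and> red \<xi> = a)"

definition p_regular :: "('a, 'm) monoid_scheme \<Rightarrow> nat \<Rightarrow> 'a \<Rightarrow> bool" where
  "p_regular G p g \<longleftrightarrow> g \<in> carrier G \<and> coprime (group.ord G g) p"

definition irreducible_rep ::
  "('a, 'm) monoid_scheme \<Rightarrow> nat \<Rightarrow> ('a \<Rightarrow> 'k::field mat) \<Rightarrow> bool" where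
  "irreducible_rep G n X \<longleftrightarrow>
     n > 0 \<and> X \<in> hom G (units_of (ring_mat TYPE('k) n ())) \<and>
     (\<forall>W. VectorSpace.subspace class_ring W (module_vec TYPE('k) n) \<and>
          (\<forall>g\<in>carrier G. \<forall>w\<in>W. X g *\<^sub>v w \<in> W) \<longrightarrow>
          W = {0\<^sub>v n} \<or> W = carrier_vec n)"

text \<open>
  Functions on the p-regular elements are represented as functions that are 0 everywhere else,
  so that equality of Brauer characters is equality of functions.  The multiset \<open>proots\<close>
  lists the eigenvalues with their algebraic multiplicities.
\<close>

definition brauer_char ::
  "nat \<Rightarrow> (complex \<Rightarrow> 'k::field) \<Rightarrow> ('a, 'm) monoid_scheme \<Rightarrow> ('a \<Rightarrow> 'k mat) \<Rightarrow> 'a \<Rightarrow> complex" where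
  "brauer_char p red G X g =
     (if p_regular G p g then (\<Sum>a\<in>#proots (char_poly (X g)). root_lift p red a) else 0)"

definition IBr ::
  "nat \<Rightarrow> (complex \<Rightarrow> 'k::field) \<Rightarrow> ('a, 'm) monoid_scheme \<Rightarrow> ('a \<Rightarrow> complex) set" where
  "IBr p red G = {brauer_char p red G X | n X. irreducible_rep G n X}"

definition res :: "'a set \<Rightarrow> ('a \<Rightarrow> complex) \<Rightarrow> 'a \<Rightarrow> complex" where
  "res H \<phi> y = (if y \<in> H then \<phi> y else 0)"

definition conj_fun :: "('a, 'm) monoid_scheme \<Rightarrow> ('a \<Rightarrow> complex) \<Rightarrow> 'a \<Rightarrow> 'a \<Rightarrow> complex" where
  "conj_fun G \<psi> g y =
     (if y \<in> carrier G then \<psi> (g \<otimes>\<^bsub>G\<^esub> y \<otimes>\<^bsub>G\<^esub> inv\<^bsub>G\<^esub> g) else 0)"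

definition cnj_fun :: "('a \<Rightarrow> complex) \<Rightarrow> 'a \<Rightarrow> complex" where
  "cnj_fun \<psi> y = cnj (\<psi> y)"

text \<open>
  \<open>\<theta>\<close> is a constituent of the Brauer character \<open>\<chi>\<close> of \<open>H\<close>: it occurs in the decomposition of
  \<open>\<chi>\<close> (unique, by linear independence) as a sum of irreducible Brauer characters.
\<close>

definition constituent ::
  "nat \<Rightarrow> (complex \<Rightarrow> 'k::field) \<Rightarrow> ('a, 'm) monoid_scheme \<Rightarrow>
   ('a \<Rightarrow> complex) \<Rightarrow> ('a \<Rightarrow> complex) \<Rightarrow> bool" where
  "constituent p red H \<theta> \<chi> \<longleftrightarrow>
     (\<exists>M. set_mset M \<subseteq> IBr p red H \<and> \<theta> \<in># M \<and> (\<forall>y. \<chi> y = (\<Sum>\<mu>\<in>#M. \<mu> y)))"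

definition lies_over ::
  "nat \<Rightarrow> (complex \<Rightarrow> 'k::field) \<Rightarrow> ('a, 'm) monoid_scheme \<Rightarrow> 'a set \<Rightarrow>
   ('a \<Rightarrow> complex) \<Rightarrow> ('a \<Rightarrow> complex) \<Rightarrow> bool" where
  "lies_over p red G N \<theta> \<phi> \<longleftrightarrow> constituent p red (G\<lparr>carrier := N\<rparr>) \<theta> (res N \<phi>)"

definition real_valued :: "('a \<Rightarrow> complex) \<Rightarrow> bool" where
  "real_valued \<phi> \<longleftrightarrow> (\<forall>y. \<phi> y \<in> \<real>)"

section \<open>Inertia groups and conjugacy classes\<close>

definition inertia :: "('a, 'm) monoid_scheme \<Rightarrow> ('a \<Rightarrow> complex) \<Rightarrow> 'a set" where
  "inertia G \<theta> = {g \<in> carrier G. conj_fun G \<theta> g = \<theta>}"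

definition ext_inertia :: "('a, 'm) monoid_scheme \<Rightarrow> ('a \<Rightarrow> complex) \<Rightarrow> 'a set" where
  "ext_inertia G \<theta> = {g \<in> carrier G. conj_fun G \<theta> g \<in> {\<theta>, cnj_fun \<theta>}}"

definition inertia_quot ::
  "('a, 'm) monoid_scheme \<Rightarrow> 'a set \<Rightarrow> ('a \<Rightarrow> complex) \<Rightarrow> 'a set monoid" where
  "inertia_quot G N \<theta> = (G\<lparr>carrier := inertia G \<theta>\<rparr>) Mod N"

definition conj_class :: "('a, 'm) monoid_scheme \<Rightarrow> 'a \<Rightarrow> 'a set" where
  "conj_class Q = orbit Q (\<lambda>g. \<lambda>h\<in>carrier Q. g \<otimes>\<^bsub>Q\<^esub> h \<otimes>\<^bsub>Q\<^esub> inv\<^bsub>Q\<^esub> g)"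

section \<open>Good classes and the indicator\<close>

definition extensions ::
  "nat \<Rightarrow> (complex \<Rightarrow> 'k::field) \<Rightarrow> ('a, 'm) monoid_scheme \<Rightarrow> 'a set \<Rightarrow>
   ('a \<Rightarrow> complex) \<Rightarrow> 'a \<Rightarrow> ('a \<Rightarrow> complex) set" where
  "extensions p red G N \<theta> x =
     {\<psi> \<in> IBr p red (G\<lparr>carrier := N <#>\<^bsub>G\<^esub> generate G {x}\<rparr>). res N \<psi> = \<theta>}"

definition coset_centralizer ::
  "('a, 'm) monoid_scheme \<Rightarrow> 'a set \<Rightarrow> ('a \<Rightarrow> complex) \<Rightarrow> 'a \<Rightarrow> 'a set" where
  "coset_centralizer G N \<theta> x =
     {g \<in> inertia G \<theta>. inv\<^bsub>G\<^esub> g \<otimes>\<^bsub>G\<^esub> inv\<^bsub>G\<^esub> x \<otimes>\<^bsub>G\<^esub> g \<otimes>\<^bsub>G\<^esub> x \<in> N}"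

definition coset_rep ::
  "nat \<Rightarrow> ('a, 'm) monoid_scheme \<Rightarrow> 'a set \<Rightarrow> ('a \<Rightarrow> complex) \<Rightarrow> 'a set \<Rightarrow> 'a \<Rightarrow> bool" where
  "coset_rep p G N \<theta> C x \<longleftrightarrow> x \<in> inertia G \<theta> \<and> p_regular G p x \<and> C = N #>\<^bsub>G\<^esub> x"

text \<open>
  For a p-regular coset \<open>C\<close> of \<open>N\<close> in the inertia group of \<open>\<theta>\<close>, a p-regular representative \<open>x\<close> and an
  extension \<open>\<psi>\<close> exist, and the condition below does not depend on their choice.
\<close>

definition theta_good ::
  "nat \<Rightarrow> (complex \<Rightarrow> 'k::field) \<Rightarrow> ('a, 'm) monoid_scheme \<Rightarrow> 'a set \<Rightarrow>
   ('a \<Rightarrow> complex) \<Rightarrow> 'a set \<Rightarrow> bool" where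
  "theta_good p red G N \<theta> C \<longleftrightarrow>
     (\<exists>x \<psi>. coset_rep p G N \<theta> C x \<and> \<psi> \<in> extensions p red G N \<theta> x \<and>
            (\<forall>c\<in>coset_centralizer G N \<theta> x. conj_fun G \<psi> c = \<psi>))"

definition good_classes ::
  "nat \<Rightarrow> (complex \<Rightarrow> 'k::field) \<Rightarrow> ('a, 'm) monoid_scheme \<Rightarrow> 'a set \<Rightarrow>
   ('a \<Rightarrow> complex) \<Rightarrow> 'a set set set" where
  "good_classes p red G N \<theta> =
     {K \<in> conj_class (inertia_quot G N \<theta>) ` carrier (inertia_quot G N \<theta>).
        \<forall>C\<in>K. p_regular (inertia_quot G N \<theta>) p C \<and> theta_good p red G N \<theta> C}"

text \<open>
  \<open>has_indicator \<dots> e C s\<close> says that \<open>s\<close> is the indicator of the coset \<open>C\<close> as computed from some choice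
  of \<open>x\<close>, \<open>\<psi>\<close> and \<open>\<epsilon>\<close>, where \<open>e\<close> is a fixed element taking \<open>\<theta>\<close> to its complex conjugate.  On p-regular
  good cosets \<open>s\<close> exists and is unique.
\<close>

definition has_indicator ::
  "nat \<Rightarrow> (complex \<Rightarrow> 'k::field) \<Rightarrow> ('a, 'm) monoid_scheme \<Rightarrow> 'a set \<Rightarrow>
   ('a \<Rightarrow> complex) \<Rightarrow> 'a \<Rightarrow> 'a set \<Rightarrow> int \<Rightarrow> bool" where
  "has_indicator p red G N \<theta> e C s \<longleftrightarrow>
     (\<exists>x \<psi>. coset_rep p G N \<theta> C x \<and> \<psi> \<in> extensions p red G N \<theta> x \<and>
        (if conj_class (inertia_quot G N \<theta>) (N #>\<^bsub>G\<^esub> x) =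
            conj_class (inertia_quot G N \<theta>) (N #>\<^bsub>G\<^esub> (e \<otimes>\<^bsub>G\<^esub> inv\<^bsub>G\<^esub> x \<otimes>\<^bsub>G\<^esub> inv\<^bsub>G\<^esub> e))
         then \<exists>\<epsilon>\<in>ext_inertia G \<theta>. conj_fun G \<theta> \<epsilon> = cnj_fun \<theta> \<and>
                N #>\<^bsub>G\<^esub> (\<epsilon> \<otimes>\<^bsub>G\<^esub> x \<otimes>\<^bsub>G\<^esub> inv\<^bsub>G\<^esub> \<epsilon>) = N #>\<^bsub>G\<^esub> inv\<^bsub>G\<^esub> x \<and>
                s = (if conj_fun G \<psi> \<epsilon> = cnj_fun \<psi> then 1 else -1)
         else s = 0))"

definition indicator_sigma ::
  "nat \<Rightarrow> (complex \<Rightarrow> 'k::field) \<Rightarrow> ('a, 'm) monoid_scheme \<Rightarrow> 'a set \<Rightarrow>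
   ('a \<Rightarrow> complex) \<Rightarrow> 'a \<Rightarrow> 'a set \<Rightarrow> int" where
  "indicator_sigma p red G N \<theta> e C = (THE s. has_indicator p red G N \<theta> e C s)"

definition sigma_classes ::
  "nat \<Rightarrow> (complex \<Rightarrow> 'k::field) \<Rightarrow> ('a, 'm) monoid_scheme \<Rightarrow> 'a set \<Rightarrow>
   ('a \<Rightarrow> complex) \<Rightarrow> 'a \<Rightarrow> int \<Rightarrow> 'a set set set" where
  "sigma_classes p red G N \<theta> e s =
     {K \<in> good_classes p red G N \<theta>. \<forall>C\<in>K. indicator_sigma p red G N \<theta> e C = s}"

end

theory Submission
  imports Defs "HOL-Number_Theory.Cong" "HOL-Algebra.Zassenhaus"
begin

text \<open>
  Cut a class function \<open>f\<close> on the p-regular elements of \<open>G\<close> down to a coset \<open>Nx\<close> and let \<open>c(x, \<psi>, f)\<close> be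
  its coefficient at an irreducible Brauer character \<open>\<psi>\<close> of \<open>N\<langle>x\<rangle>\<close>.  Twisting \<open>\<psi>\<close> by a linear character
  of \<open>N\<langle>x\<rangle>/N\<close> multiplies the coefficient by the inverse of the value of that character at \<open>x\<close>.  Hence
  it vanishes unless \<open>\<psi>\<close> restricts irreducibly to \<open>N\<close>, and for an extension \<open>\<psi>\<close> of \<open>\<theta>\<close> it vanishes for
  all \<open>f\<close> unless \<open>Nx\<close> is \<open>\<theta>\<close>-good.  Up to scalars it then depends only on the class \<open>K\<close> of \<open>Nx\<close>, and the
  resulting functionals \<open>c\<^sub>K\<close> form a basis of the dual of the span of the Brauer characters of \<open>G\<close> over
  \<open>\<theta>\<close>; a dual basis (up to scalars) consists of the functions \<open>F\<^sub>K\<close> induced from \<open>\<psi>\<close> cut down to \<open>Nx\<close>.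

  The number of real-valued Brauer characters over \<open>\<theta>\<close> is the trace, on this span, of complex
  conjugation of the basis of Brauer characters, which is the linear map \<open>f(y) \<mapsto> f(y\<^sup>-\<^sup>1)\<close>.  In the
  basis \<open>F\<^sub>K\<close> its diagonal entry at \<open>K\<close> is the indicator of \<open>K\<close>.
\<close>

text \<open>Coefficients are coordinates in the basis of irreducible Brauer characters, so
  everything rests on their independence and on their spanning the class functions on the p-regular
  elements. Independence is a statement about traces over \<open>'k\<close>, lifted to the complex
  numbers through a nonzero minor. Spanning comes from commuting permutation matrices, whose Brauer
  values are numbers of fixed points.

  A coset is isolated by Fourier inversion on the cyclic group N\<langle>x\<rangle>/N, whose order
  is prime to p and hence invertible in \<open>'k\<close>. Extensions of \<theta> have two sources:
  a nonzero coefficient forces \<psi> to restrict irreducibly to N, and a good coset carries an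
  extension by definition.

  That the indicator is a sign or 0 reflects that inversion of the argument is an involution which
  sends the functional of a class to a multiple of the functional of one class, possibly another
  one.\<close>

no_notation fps_nth (infixl "$" 75)

section \<open>Block decompositions, eigenvalues and traces of matrices\<close>

text \<open>Subspaces as bare closure conditions on sets of vectors, which can be checked by
  rewriting; the next lemma ties them to the notion used in \<open>irreducible_rep\<close>.\<close>

definition lin_subspace :: "nat \<Rightarrow> 'k::field vec set \<Rightarrow> bool" where
  "lin_subspace n W \<longleftrightarrow> W \<subseteq> carrier_vec n \<and> 0\<^sub>v n \<in> W \<and>
     (\<forall>u\<in>W. \<forall>v\<in>W. u + v \<in> W) \<and> (\<forall>c. \<forall>v\<in>W. c \<cdot>\<^sub>v v \<in> W)"

lemma lin_subspace_iff_subspace: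
  "VectorSpace.subspace class_ring W (module_vec TYPE('k::field) n) \<longleftrightarrow> lin_subspace n W"
proof
  assume "VectorSpace.subspace class_ring W (module_vec TYPE('k::field) n)"
  then have s: "LinearCombinations.submodule class_ring W (module_vec TYPE('k) n)"
    by (simp add: VectorSpace.subspace_def)
  show "lin_subspace n W"
    using s unfolding LinearCombinations.submodule_def lin_subspace_def
    by (auto simp: module_vec_simps class_ring_simps subset_iff)
next
  assume l: "lin_subspace n W"
  have "LinearCombinations.submodule class_ring W (module_vec TYPE('k) n)"
    using l unfolding LinearCombinations.submodule_def lin_subspace_def
    by (auto simp: module_vec_simps class_ring_simps vec_module)
  then show "VectorSpace.subspace class_ring W (module_vec TYPE('k::field) n)"
    by (simp add: VectorSpace.subspace_def vec_vs)
qed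

lemma inverse_mult_mat_vec:
  assumes "Q \<in> carrier_mat n n" "P \<in> carrier_mat n n" "Q * P = 1\<^sub>m n" "v \<in> carrier_vec n"
  shows "Q *\<^sub>v (P *\<^sub>v v) = (v :: 'k::field vec)"
  using assms assoc_mult_mat_vec[of Q n n P n v] by simp

text \<open>Independence of the columns, expressed as a trivial kernel; dimension counts below
  become inequalities between numbers of columns and rows.\<close>

definition inj_mat :: "'k::field mat \<Rightarrow> bool" where
  "inj_mat S \<longleftrightarrow> (\<forall>v\<in>carrier_vec (dim_col S). S *\<^sub>v v = 0\<^sub>v (dim_row S) \<longrightarrow> v = 0\<^sub>v (dim_col S))"

text \<open>With more columns than rows, padding \<open>S\<close> by zero rows gives a singular
  square matrix (its transpose kills a unit vector), and a kernel vector of it lies in the kernel of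
  \<open>S\<close>.\<close>

lemma inj_mat_le:
  assumes S: "S \<in> carrier_mat n m" and inj: "inj_mat (S :: 'k::field mat)"
  shows "m \<le> n"
proof (rule ccontr)
  assume "\<not> m \<le> n"
  then have nm: "n < m" by simp
  define A where "A = mat m m (\<lambda>(i,j). if i < n then S $$ (i,j) else 0)"
  have A: "A \<in> carrier_mat m m" by (simp add: A_def)
  have "A\<^sup>T *\<^sub>v unit_vec m n = 0\<^sub>v m"
    using nm by (intro eq_vecI) (auto simp: A_def)
  moreover have "unit_vec m n \<noteq> (0\<^sub>v m :: 'k vec)" "unit_vec m n \<in> carrier_vec m"
    using nm by auto
  moreover have "A\<^sup>T \<in> carrier_mat m m" using A by simp
  ultimately have "det A\<^sup>T = 0"
    using det_0_iff_vec_prod_zero_field[of "A\<^sup>T" m] by blast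
  then have "det A = 0" using det_transpose[OF A] by simp
  then obtain v where v: "v \<in> carrier_vec m" "v \<noteq> 0\<^sub>v m" "A *\<^sub>v v = 0\<^sub>v m"
    using det_0_iff_vec_prod_zero_field[OF A] by auto
  have "S *\<^sub>v v = 0\<^sub>v n"
  proof (rule eq_vecI)
    fix i assume i: "i < dim_vec (0\<^sub>v n :: 'k vec)"
    then have "(A *\<^sub>v v) $ i = 0" using v nm by simp
    moreover have "row A i = row S i"
      using i S nm by (intro eq_vecI) (auto simp: A_def)
    ultimately show "(S *\<^sub>v v) $ i = 0\<^sub>v n $ i" using i S A nm by simp
  qed (use S in auto)
  then show False using inj S v by (auto simp: inj_mat_def)
qed

text \<open>Preimages of the unit vectors are the columns of a right inverse \<open>V\<close>; a
  matrix with a left inverse is injective, so \<open>inj_mat_le\<close> applies to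
  \<open>V\<close>.\<close>

lemma surj_mat_ge:
  assumes S: "(S :: 'k::field mat) \<in> carrier_mat n m"
    and surj: "\<And>w. w \<in> carrier_vec n \<Longrightarrow> \<exists>v\<in>carrier_vec m. S *\<^sub>v v = w"
  shows "n \<le> m"
proof -
  have "\<forall>i. \<exists>v. i < n \<longrightarrow> v \<in> carrier_vec m \<and> S *\<^sub>v v = unit_vec n i"
    using surj by (metis unit_vec_carrier)
  then obtain f where f: "\<And>i. i < n \<Longrightarrow> f i \<in> carrier_vec m \<and> S *\<^sub>v f i = unit_vec n i"
    by metis
  define V where "V = mat m n (\<lambda>(i,j). f j $ i)"
  have V: "V \<in> carrier_mat m n" by (simp add: V_def)
  have cV: "col V j = f j" if "j < n" for j
    using that f[OF that] by (intro eq_vecI) (auto simp: V_def)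
  have SV: "S * V = 1\<^sub>m n"
  proof (rule eq_matI)
    fix i j assume ij: "i < dim_row (1\<^sub>m n :: 'k mat)" "j < dim_col (1\<^sub>m n :: 'k mat)"
    then have "(S * V) $$ (i,j) = (S *\<^sub>v f j) $ i" using S V cV by simp
    also have "\<dots> = 1\<^sub>m n $$ (i,j)" using f[of j] ij by simp
    finally show "(S * V) $$ (i,j) = 1\<^sub>m n $$ (i,j)" .
  qed (use S V in auto)
  have "inj_mat (V)" unfolding inj_mat_def
  proof (intro ballI impI)
    fix v assume v: "v \<in> carrier_vec (dim_col V)" "V *\<^sub>v v = 0\<^sub>v (dim_row V)"
    have "S * V *\<^sub>v v = S *\<^sub>v (V *\<^sub>v v)" using S V v by (intro assoc_mult_mat_vec) auto
    also have "\<dots> = 0\<^sub>v n" using v V S by (intro eq_vecI) auto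
    finally have "S * V *\<^sub>v v = 0\<^sub>v n" .
    then show "v = 0\<^sub>v (dim_col V)" using SV v V by simp
  qed
  from inj_mat_le[OF V this] show ?thesis .
qed

lemma mat_of_cols_snoc_mult_vec:
  assumes "set vs \<subseteq> carrier_vec n" "w \<in> carrier_vec n" "v \<in> carrier_vec (Suc (length vs))"
  shows "mat_of_cols n (vs @ [w]) *\<^sub>v v =
         mat_of_cols n vs *\<^sub>v vec (length vs) (\<lambda>i. v $ i) + (v $ length vs) \<cdot>\<^sub>v (w :: 'k::field vec)"
proof (rule eq_vecI)
  fix i assume "i < dim_vec (mat_of_cols n vs *\<^sub>v vec (length vs) (\<lambda>i. v $ i) + (v $ length vs) \<cdot>\<^sub>v w)"
  then have i: "i < n" using assms by simp
  have "(mat_of_cols n (vs @ [w]) *\<^sub>v v) $ i = (\<Sum>j<Suc (length vs). (vs @ [w]) ! j $ i * v $ j)"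
    using i assms by (simp add: scalar_prod_def mat_of_cols_def lessThan_atLeast0)
  also have "\<dots> = (\<Sum>j<length vs. vs ! j $ i * v $ j) + w $ i * v $ length vs"
    by (auto simp: nth_append intro!: sum.cong)
  also have "(\<Sum>j<length vs. vs ! j $ i * v $ j) = (mat_of_cols n vs *\<^sub>v vec (length vs) (\<lambda>i. v $ i)) $ i"
    using i assms by (simp add: scalar_prod_def mat_of_cols_def lessThan_atLeast0)
  finally show "(mat_of_cols n (vs @ [w]) *\<^sub>v v) $ i =
    (mat_of_cols n vs *\<^sub>v vec (length vs) (\<lambda>i. v $ i) + (v $ length vs) \<cdot>\<^sub>v w) $ i"
    using i assms by (simp add: mult.commute)
qed (use assms in auto)

lemma mat_of_cols_mult_in_subspace:
  assumes "lin_subspace n W" "set vs \<subseteq> W" "v \<in> carrier_vec (length vs)"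
  shows "mat_of_cols n vs *\<^sub>v v \<in> (W :: 'k::field vec set)"
  using assms(2,3)
proof (induction vs arbitrary: v rule: rev_induct)
  case Nil
  have "mat_of_cols n [] *\<^sub>v v = 0\<^sub>v n" using Nil
    by (intro eq_vecI) (auto simp: scalar_prod_def)
  then show ?case using assms(1) by (auto simp: lin_subspace_def)
next
  case (snoc w vs)
  have c: "set vs \<subseteq> carrier_vec n" "w \<in> carrier_vec n" using snoc assms(1) by (auto simp: lin_subspace_def)
  have "mat_of_cols n vs *\<^sub>v vec (length vs) (\<lambda>i. v $ i) \<in> W" using snoc by auto
  moreover have "(v $ length vs) \<cdot>\<^sub>v w \<in> W" using snoc assms(1) by (auto simp: lin_subspace_def)
  ultimately show ?case
    using mat_of_cols_snoc_mult_vec[OF c, of v] snoc assms(1) by (auto simp: lin_subspace_def)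
qed

lemma inj_mat_snoc:
  assumes vs: "set vs \<subseteq> carrier_vec n" and w: "w \<in> carrier_vec n" and inj: "inj_mat (mat_of_cols n vs)"
    and nin: "\<And>v. v \<in> carrier_vec (length vs) \<Longrightarrow> mat_of_cols n vs *\<^sub>v v \<noteq> (w :: 'k::field vec)"
  shows "inj_mat (mat_of_cols n (vs @ [w]))"
  unfolding inj_mat_def
proof (intro ballI impI)
  fix v assume "v \<in> carrier_vec (dim_col (mat_of_cols n (vs @ [w])))"
    and z: "mat_of_cols n (vs @ [w]) *\<^sub>v v = 0\<^sub>v (dim_row (mat_of_cols n (vs @ [w])))"
  then have v: "v \<in> carrier_vec (Suc (length vs))" by simp
  let ?u = "vec (length vs) (\<lambda>i. v $ i)" and ?c = "v $ length vs"
  have c: "mat_of_cols n vs \<in> carrier_mat n (length vs)" by simp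
  have e: "mat_of_cols n vs *\<^sub>v ?u + ?c \<cdot>\<^sub>v w = 0\<^sub>v n"
    using mat_of_cols_snoc_mult_vec[OF vs w v] z by simp
  have c0: "?c = 0"
  proof (rule ccontr)
    assume nz: "?c \<noteq> 0"
    have "mat_of_cols n vs *\<^sub>v ((- inverse ?c) \<cdot>\<^sub>v ?u) = (- inverse ?c) \<cdot>\<^sub>v (mat_of_cols n vs *\<^sub>v ?u)"
      by (rule mult_mat_vec[OF c]) simp
    also have "\<dots> = w"
    proof (rule eq_vecI)
      fix i assume i: "i < dim_vec w"
      have "(mat_of_cols n vs *\<^sub>v ?u) $ i + ?c * w $ i = 0"
        using arg_cong[OF e, of "\<lambda>x. x $ i"] i w by simp
      then show "((- inverse ?c) \<cdot>\<^sub>v (mat_of_cols n vs *\<^sub>v ?u)) $ i = w $ i"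
        using i w nz by (simp add: field_simps add_eq_0_iff2)
    qed (use w in auto)
    finally show False using nin[of "(- inverse ?c) \<cdot>\<^sub>v ?u"] by simp
  qed
  then have "mat_of_cols n vs *\<^sub>v ?u = 0\<^sub>v n"
  proof (intro eq_vecI)
    fix i assume i: "i < dim_vec (0\<^sub>v n :: 'k vec)"
    then show "(mat_of_cols n vs *\<^sub>v ?u) $ i = 0\<^sub>v n $ i"
      using arg_cong[OF e, of "\<lambda>x. x $ i"] w c0 by simp
  qed simp
  then have u: "?u = 0\<^sub>v (length vs)" using inj by (simp add: inj_mat_def)
  have "v = 0\<^sub>v (Suc (length vs))"
  proof (rule eq_vecI)
    fix i assume "i < dim_vec (0\<^sub>v (Suc (length vs)) :: 'k vec)"
    then show "v $ i = 0\<^sub>v (Suc (length vs)) $ i"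
      using c0 arg_cong[OF u, of "\<lambda>x. x $ i"] by (cases "i = length vs") auto
  qed (use v in auto)
  then show "v = 0\<^sub>v (dim_col (mat_of_cols n (vs @ [w])))" by simp
qed

text \<open>As long as some vector of \<open>W\<close> is not a combination of the columns, it can
  be appended without losing independence; \<open>inj_mat_le\<close> bounds the number of columns by
  \<open>n\<close>, which gives the decreasing measure.\<close>

lemma basis_extension:
  assumes W: "lin_subspace n (W :: 'k::field vec set)" and vs: "set vs \<subseteq> W" and inj: "inj_mat (mat_of_cols n vs)"
  shows "\<exists>us. set (vs @ us) \<subseteq> W \<and> inj_mat (mat_of_cols n (vs @ us)) \<and>
           (\<forall>w\<in>W. \<exists>v\<in>carrier_vec (length (vs @ us)). mat_of_cols n (vs @ us) *\<^sub>v v = w)"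
  using vs inj
proof (induction "n - length vs" arbitrary: vs rule: less_induct)
  case less
  have Wc: "W \<subseteq> carrier_vec n" using W by (simp add: lin_subspace_def)
  show ?case
  proof (cases "\<forall>w\<in>W. \<exists>v\<in>carrier_vec (length vs). mat_of_cols n vs *\<^sub>v v = w")
    case True
    then show ?thesis using less by (intro exI[of _ "[]"]) auto
  next
    case False
    then obtain w where w: "w \<in> W" "\<And>v. v \<in> carrier_vec (length vs) \<Longrightarrow> mat_of_cols n vs *\<^sub>v v \<noteq> w" by auto
    have i: "inj_mat (mat_of_cols n (vs @ [w]))"
      by (rule inj_mat_snoc) (use w less Wc in auto)
    have "length (vs @ [w]) \<le> n" by (rule inj_mat_le[OF _ i]) (simp add: mat_of_cols_def)
    then have "n - length (vs @ [w]) < n - length vs" by simp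
    from less(1)[OF this _ i] w less obtain us where "set ((vs @ [w]) @ us) \<subseteq> W \<and> inj_mat (mat_of_cols n ((vs @ [w]) @ us)) \<and>
           (\<forall>x\<in>W. \<exists>v\<in>carrier_vec (length ((vs @ [w]) @ us)). mat_of_cols n ((vs @ [w]) @ us) *\<^sub>v v = x)"
      by auto
    then show ?thesis by (intro exI[of _ "w # us"]) (simp del: mat_of_cols_Cons_index_0)
  qed
qed

lemma inj_square_invertible:
  assumes P: "(P :: 'k::field mat) \<in> carrier_mat n n" and inj: "inj_mat P"
  shows "\<exists>Q\<in>carrier_mat n n. P * Q = 1\<^sub>m n \<and> Q * P = 1\<^sub>m n"
proof -
  have "det P \<noteq> 0"
    using det_0_iff_vec_prod_zero_field[OF P] inj P by (auto simp: inj_mat_def)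
  from det_non_zero_imp_unit[OF P this, of "()"] obtain Q where
    "Q \<in> carrier_mat n n" "Q * P = 1\<^sub>m n" "P * Q = 1\<^sub>m n"
    unfolding Units_def ring_mat_def by auto
  then show ?thesis by auto
qed

lemma mat_of_cols_append_zero:
  assumes vs: "set vs \<subseteq> carrier_vec n" and us: "set us \<subseteq> carrier_vec n"
    and v: "v \<in> carrier_vec (length (vs @ us))" and z: "\<And>i. length vs \<le> i \<Longrightarrow> i < length (vs @ us) \<Longrightarrow> v $ i = 0"
  shows "mat_of_cols n (vs @ us) *\<^sub>v v = mat_of_cols n vs *\<^sub>v vec (length vs) (\<lambda>i. (v :: 'k::field vec) $ i)"
proof (rule eq_vecI)
  fix i assume "i < dim_vec (mat_of_cols n vs *\<^sub>v vec (length vs) (\<lambda>i. v $ i))"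
  then have i: "i < n" by simp
  have "(mat_of_cols n (vs @ us) *\<^sub>v v) $ i = (\<Sum>j<length (vs @ us). (vs @ us) ! j $ i * v $ j)"
    using i v by (simp add: scalar_prod_def mat_of_cols_def lessThan_atLeast0)
  also have "\<dots> = (\<Sum>j<length vs. (vs @ us) ! j $ i * v $ j)"
    by (rule sum.mono_neutral_right) (use z in auto)
  also have "\<dots> = (\<Sum>j<length vs. vs ! j $ i * v $ j)"
    by (auto simp: nth_append intro!: sum.cong)
  also have "\<dots> = (mat_of_cols n vs *\<^sub>v vec (length vs) (\<lambda>i. v $ i)) $ i"
    using i by (simp add: scalar_prod_def mat_of_cols_def lessThan_atLeast0)
  finally show "(mat_of_cols n (vs @ us) *\<^sub>v v) $ i = \<dots>" .
qed simp

text \<open>The columns of \<open>P\<close> are a basis of \<open>W\<close>, \<open>d\<close> in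
  number, completed to a basis of the whole space. In the new coordinates \<open>W\<close> consists
  of the vectors supported on the first \<open>d\<close> entries.\<close>

lemma block_decomposition:
  assumes W: "lin_subspace n (W :: 'k::field vec set)" "W \<noteq> {0\<^sub>v n}" "W \<noteq> carrier_vec n"
  obtains d P Q where "0 < d" "d < n" "P \<in> carrier_mat n n" "Q \<in> carrier_mat n n"
    "P * Q = 1\<^sub>m n" "Q * P = 1\<^sub>m n"
    "\<And>v. v \<in> carrier_vec n \<Longrightarrow> P *\<^sub>v v \<in> W \<longleftrightarrow> (\<forall>i. d \<le> i \<longrightarrow> i < n \<longrightarrow> v $ i = 0)"
proof -
  have Wc: "W \<subseteq> carrier_vec n" using W by (simp add: lin_subspace_def)
  have "inj_mat (mat_of_cols n [] :: 'k mat)" by (auto simp: inj_mat_def intro!: eq_vecI)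
  from basis_extension[OF W(1) _ this] obtain vs where vs: "set vs \<subseteq> W" "inj_mat (mat_of_cols n vs)"
    "\<And>w. w \<in> W \<Longrightarrow> \<exists>v\<in>carrier_vec (length vs). mat_of_cols n vs *\<^sub>v v = w" by auto
  have full: "lin_subspace n (carrier_vec n :: 'k vec set)" by (auto simp: lin_subspace_def)
  from basis_extension[OF full _ vs(2)] vs(1) Wc obtain us where
    us: "set (vs @ us) \<subseteq> carrier_vec n" "inj_mat (mat_of_cols n (vs @ us))"
    "\<And>w. w \<in> carrier_vec n \<Longrightarrow> \<exists>v\<in>carrier_vec (length (vs @ us)). mat_of_cols n (vs @ us) *\<^sub>v v = w" by blast
  define P where "P = mat_of_cols n (vs @ us)"
  have "P \<in> carrier_mat n (length (vs @ us))" by (simp add: P_def del: length_append)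
  with inj_mat_le[OF this] surj_mat_ge[OF this] us have len: "length (vs @ us) = n"
    by (simp add: P_def)
  have P: "P \<in> carrier_mat n n" using \<open>P \<in> carrier_mat n (length (vs @ us))\<close> len by simp
  obtain Q where Q: "Q \<in> carrier_mat n n" "P * Q = 1\<^sub>m n" "Q * P = 1\<^sub>m n"
    using inj_square_invertible[OF P] us by (auto simp: P_def)
  have vc: "set vs \<subseteq> carrier_vec n" using vs Wc by auto
  have key: "P *\<^sub>v v \<in> W \<longleftrightarrow> (\<forall>i. length vs \<le> i \<longrightarrow> i < n \<longrightarrow> v $ i = 0)" if v: "v \<in> carrier_vec n" for v
  proof
    assume "\<forall>i. length vs \<le> i \<longrightarrow> i < n \<longrightarrow> v $ i = 0"
    then have "P *\<^sub>v v = mat_of_cols n vs *\<^sub>v vec (length vs) (\<lambda>i. v $ i)"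
      unfolding P_def by (intro mat_of_cols_append_zero) (use us v len vc in auto)
    then show "P *\<^sub>v v \<in> W" using mat_of_cols_mult_in_subspace[OF W(1) vs(1)] by simp
  next
    assume "P *\<^sub>v v \<in> W"
    then obtain u where u: "u \<in> carrier_vec (length vs)" "mat_of_cols n vs *\<^sub>v u = P *\<^sub>v v" using vs by auto
    define u' where "u' = vec n (\<lambda>i. if i < length vs then u $ i else 0)"
    have "P *\<^sub>v u' = mat_of_cols n vs *\<^sub>v vec (length vs) (\<lambda>i. u' $ i)"
      unfolding P_def by (intro mat_of_cols_append_zero) (use us len vc in \<open>auto simp: u'_def\<close>)
    also have "vec (length vs) (\<lambda>i. u' $ i) = u" using u len by (intro eq_vecI) (auto simp: u'_def)
    finally have "P *\<^sub>v u' = P *\<^sub>v v" using u by simp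
    then have "Q *\<^sub>v (P *\<^sub>v u') = Q *\<^sub>v (P *\<^sub>v v)" by simp
    then have "u' = v" using v Q P inverse_mult_mat_vec[of Q n P] by (simp add: u'_def)
    then show "\<forall>i. length vs \<le> i \<longrightarrow> i < n \<longrightarrow> v $ i = 0" by (auto simp: u'_def)
  qed
  have "length vs \<noteq> 0"
  proof
    assume "length vs = 0"
    then have "W \<subseteq> {0\<^sub>v n}"
      using vs(3) by (fastforce simp: scalar_prod_def)
    then show False using W by (auto simp: lin_subspace_def)
  qed
  moreover have "length vs \<noteq> n"
  proof
    assume l: "length vs = n"
    have "w \<in> W" if w: "w \<in> carrier_vec n" for w
    proof -
      have "P *\<^sub>v (Q *\<^sub>v w) \<in> W" using key[of "Q *\<^sub>v w"] l w Q by simp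
      moreover have "P *\<^sub>v (Q *\<^sub>v w) = w" using P Q w by (simp flip: assoc_mult_mat_vec)
      ultimately show ?thesis by simp
    qed
    then show False using W Wc by auto
  qed
  moreover have "length vs \<le> n" using len by simp
  ultimately show thesis using that[of "length vs" P Q] P Q key by simp
qed

lemma block_triangular:
  assumes d: "d < n" and P: "P \<in> carrier_mat n n" and Q: "Q \<in> carrier_mat n n"
    and PQ: "P * Q = 1\<^sub>m n"
    and key: "\<And>v. v \<in> carrier_vec n \<Longrightarrow> P *\<^sub>v v \<in> W \<longleftrightarrow> (\<forall>i. d \<le> i \<longrightarrow> i < n \<longrightarrow> v $ i = 0)"
    and A: "(A :: 'k::field mat) \<in> carrier_mat n n" and inv: "\<And>w. w \<in> W \<Longrightarrow> A *\<^sub>v w \<in> W"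
    and ij: "d \<le> i" "i < n" "j < d"
  shows "(Q * A * P) $$ (i,j) = 0"
proof -
  have "P *\<^sub>v unit_vec n j \<in> W" using key[of "unit_vec n j"] ij by simp
  then have "A *\<^sub>v (P *\<^sub>v unit_vec n j) \<in> W" by (rule inv)
  moreover have "P *\<^sub>v (Q * A * P *\<^sub>v unit_vec n j) = A *\<^sub>v (P *\<^sub>v unit_vec n j)"
  proof -
    have "P *\<^sub>v (Q * A * P *\<^sub>v unit_vec n j) = P * (Q * A * P) *\<^sub>v unit_vec n j"
      using P Q A by (intro assoc_mult_mat_vec[symmetric, of _ n n _ n]) auto
    also have "P * (Q * A * P) = P * Q * (A * P)" using P Q A by (simp add: assoc_mult_mat[of _ n n _ n _ n])
    also have "\<dots> = A * P" using PQ A P by simp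
    finally show ?thesis using A P by (simp add: assoc_mult_mat_vec[of _ n n _ n])
  qed
  ultimately have "(Q * A * P *\<^sub>v unit_vec n j) $ i = 0"
    using key[of "Q * A * P *\<^sub>v unit_vec n j"] P Q A ij by (metis mult_carrier_mat mult_mat_vec_carrier unit_vec_carrier)
  then show ?thesis using ij d P Q A by simp
qed

section \<open>Traces and block triangular matrices\<close>

definition mtrace :: "'k::semiring_1 mat \<Rightarrow> 'k" where
  "mtrace A = (\<Sum>i<dim_row A. A $$ (i,i))"

lemma mtrace_mult_commute:
  assumes "A \<in> carrier_mat n m" "B \<in> carrier_mat m n"
  shows "mtrace (A * B) = mtrace (B * A :: 'k::comm_ring_1 mat)"
proof -
  have "mtrace (A * B) = (\<Sum>i<n. \<Sum>j<m. A $$ (i,j) * B $$ (j,i))"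
    using assms by (auto simp: mtrace_def scalar_prod_def lessThan_atLeast0 intro!: sum.cong)
  also have "\<dots> = (\<Sum>j<m. \<Sum>i<n. B $$ (j,i) * A $$ (i,j))"
    by (subst sum.swap) (simp add: mult.commute)
  also have "\<dots> = mtrace (B * A)"
    using assms by (auto simp: mtrace_def scalar_prod_def lessThan_atLeast0 intro!: sum.cong)
  finally show ?thesis .
qed

lemma mtrace_similar:
  assumes "similar_mat A (B :: 'k::comm_ring_1 mat)"
  shows "mtrace A = mtrace B"
proof -
  obtain n P Q where c: "A \<in> carrier_mat n n" "B \<in> carrier_mat n n" "P \<in> carrier_mat n n" "Q \<in> carrier_mat n n"
    and e: "Q * P = 1\<^sub>m n" "A = P * B * Q" using similar_matD[OF assms] by auto
  have "mtrace A = mtrace (Q * (P * B))" using e c mtrace_mult_commute[of "P * B" n n Q] by auto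
  also have "Q * (P * B) = B" using e c assoc_mult_mat[of Q n n P n B n] by simp
  finally show ?thesis .
qed

definition upper_left :: "nat \<Rightarrow> 'k mat \<Rightarrow> 'k mat" where
  "upper_left d M = mat d d (\<lambda>(i,j). M $$ (i,j))"

definition upper_right :: "nat \<Rightarrow> 'k mat \<Rightarrow> 'k mat" where
  "upper_right d M = mat d (dim_col M - d) (\<lambda>(i,j). M $$ (i,j + d))"

definition lower_right :: "nat \<Rightarrow> 'k mat \<Rightarrow> 'k mat" where
  "lower_right d M = mat (dim_row M - d) (dim_col M - d) (\<lambda>(i,j). M $$ (i + d,j + d))"

text \<open>In a basis adapted to an invariant subspace, \<open>upper_left\<close> is the action on
  the subspace and \<open>lower_right\<close> the action on the quotient.\<close>

definition block_upper :: "nat \<Rightarrow> nat \<Rightarrow> 'k::zero mat \<Rightarrow> bool" where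
  "block_upper n d M \<longleftrightarrow> d \<le> n \<and> M \<in> carrier_mat n n \<and> (\<forall>i j. d \<le> i \<longrightarrow> i < n \<longrightarrow> j < d \<longrightarrow> M $$ (i,j) = 0)"

lemma upper_left_carrier [simp]: "upper_left d M \<in> carrier_mat d d"
  by (simp add: upper_left_def)

lemma upper_right_carrier: "block_upper n d M \<Longrightarrow> upper_right d M \<in> carrier_mat d (n - d)"
  by (auto simp: upper_right_def block_upper_def)

lemma lower_right_carrier: "block_upper n d M \<Longrightarrow> lower_right d M \<in> carrier_mat (n - d) (n - d)"
  by (auto simp: lower_right_def block_upper_def)

lemma block_upper_eq:
  assumes "block_upper n d M"
  shows "M = four_block_mat (upper_left d M) (upper_right d M) (0\<^sub>m (n - d) d) (lower_right d M)"
  using assms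
  by (intro eq_matI) (auto simp: block_upper_def upper_left_def upper_right_def lower_right_def)

lemma upper_left_four_block:
  "A \<in> carrier_mat d d \<Longrightarrow> D \<in> carrier_mat m m \<Longrightarrow> upper_left d (four_block_mat A B C D) = A"
  by (intro eq_matI) (auto simp: upper_left_def)

lemma lower_right_four_block:
  "A \<in> carrier_mat d d \<Longrightarrow> D \<in> carrier_mat m m \<Longrightarrow> lower_right d (four_block_mat A B C D) = D"
  by (intro eq_matI) (auto simp: lower_right_def)

lemma block_upper_mult:
  assumes M: "block_upper n d M" and L: "block_upper n d (L :: 'k::comm_ring_1 mat)"
  shows "block_upper n d (M * L)" "upper_left d (M * L) = upper_left d M * upper_left d L"
    "lower_right d (M * L) = lower_right d M * lower_right d L"
proof -
  note c = upper_right_carrier[OF M] upper_right_carrier[OF L] lower_right_carrier[OF M] lower_right_carrier[OF L]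
  have d: "d \<le> n" using M by (simp add: block_upper_def)
  let ?B = "upper_left d M * upper_right d L + upper_right d M * lower_right d L"
  have B: "?B \<in> carrier_mat d (n - d)"
    using c by (metis add_carrier_mat mult_carrier_mat)
  have "M * L = four_block_mat (upper_left d M * upper_left d L + upper_right d M * 0\<^sub>m (n - d) d) ?B
     (0\<^sub>m (n - d) d * upper_left d L + lower_right d M * 0\<^sub>m (n - d) d)
     (0\<^sub>m (n - d) d * upper_right d L + lower_right d M * lower_right d L)"
    by (subst (1) block_upper_eq[OF M], subst (1) block_upper_eq[OF L],
        rule mult_four_block_mat[of _ d d _ "n - d" _ "n - d" _ _ d _ "n - d"]) (use c in auto)
  also have "upper_left d M * upper_left d L + upper_right d M * 0\<^sub>m (n - d) d = upper_left d M * upper_left d L"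
    using c by (metis mult_carrier_mat right_add_zero_mat right_mult_zero_mat upper_left_carrier)
  also have "0\<^sub>m (n - d) d * upper_left d L + lower_right d M * 0\<^sub>m (n - d) d = 0\<^sub>m (n - d) d"
    using c by (simp add: left_mult_zero_mat[of _ d d])
  also have "0\<^sub>m (n - d) d * upper_right d L + lower_right d M * lower_right d L = lower_right d M * lower_right d L"
    using c by (metis left_add_zero_mat left_mult_zero_mat mult_carrier_mat)
  finally have e: "M * L = four_block_mat (upper_left d M * upper_left d L) ?B (0\<^sub>m (n - d) d)
     (lower_right d M * lower_right d L)" .
  have UL: "upper_left d M * upper_left d L \<in> carrier_mat d d"
    by (metis mult_carrier_mat upper_left_carrier)
  have LR: "lower_right d M * lower_right d L \<in> carrier_mat (n - d) (n - d)"
    using c by (metis mult_carrier_mat)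
  show "block_upper n d (M * L)"
    unfolding block_upper_def
  proof (intro conjI allI impI)
    show "M * L \<in> carrier_mat n n" using M L by (auto simp: block_upper_def)
    fix i j assume "d \<le> i" "i < n" "j < d"
    then show "(M * L) $$ (i,j) = 0" unfolding e using carrier_matD[OF UL] carrier_matD[OF LR]
      by (subst index_mat_four_block) auto
  qed (rule d)
  show "upper_left d (M * L) = upper_left d M * upper_left d L"
    unfolding e by (rule upper_left_four_block[OF UL LR])
  show "lower_right d (M * L) = lower_right d M * lower_right d L"
    unfolding e by (rule lower_right_four_block[OF UL LR])
qed

lemma block_upper_one: "d \<le> n \<Longrightarrow> block_upper n d (1\<^sub>m n)" "d \<le> n \<Longrightarrow> upper_left d (1\<^sub>m n) = 1\<^sub>m d"
  "d \<le> n \<Longrightarrow> lower_right d (1\<^sub>m n) = 1\<^sub>m (n - d)"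
  by (auto simp: block_upper_def upper_left_def lower_right_def intro!: eq_matI)

section \<open>Eigenvalue multisets and triangularization\<close>

definition eigs :: "'k::idom mat \<Rightarrow> 'k multiset" where
  "eigs A = proots (char_poly A)"

lemma eigs_similar: "similar_mat A B \<Longrightarrow> eigs A = eigs B"
  by (simp add: eigs_def char_poly_similar)

lemma similar_conj:
  assumes "A \<in> carrier_mat n n" "P \<in> carrier_mat n n" "Q \<in> carrier_mat n n"
    "P * Q = 1\<^sub>m n" "Q * P = 1\<^sub>m n"
  shows "similar_mat A (Q * A * P :: 'k::comm_ring_1 mat)"
proof (rule similar_matI[of _ _ P Q n])
  have "P * (Q * A * P) * Q = (P * Q) * A * (P * Q)"
  proof -
    have "Q * A * P = Q * (A * P)"
      using assms by (simp add: assoc_mult_mat[of _ n n _ n _ n])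
    then have "P * (Q * A * P) = P * Q * (A * P)"
      using assms assoc_mult_mat[of P n n Q n "A * P" n] by simp
    then show ?thesis using assms by (simp add: assoc_mult_mat[of _ n n _ n _ n])
  qed
  then show "A = P * (Q * A * P) * Q" using assms by simp
qed (use assms in auto)

text \<open>The characteristic matrix is block triangular as well, so the characteristic polynomial
  factors; the factors are monic, hence nonzero, as additivity of \<open>proots\<close>
  requires.\<close>

lemma eigs_block:
  assumes M: "block_upper n d (M :: 'k::idom mat)"
  shows "eigs M = eigs (upper_left d M) + eigs (lower_right d M)"
proof -
  note c = upper_right_carrier[OF M] lower_right_carrier[OF M]
  have Mc: "M \<in> carrier_mat n n" "d \<le> n" using M by (auto simp: block_upper_def)
  let ?C = "char_poly_matrix M"
  have "?C = four_block_mat (char_poly_matrix (upper_left d M)) (upper_right d ?C) (0\<^sub>m (n - d) d)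
     (char_poly_matrix (lower_right d M))"
    using M by (intro eq_matI)
      (auto simp: block_upper_def upper_left_def upper_right_def lower_right_def char_poly_matrix_def)
  moreover have "upper_right d ?C \<in> carrier_mat d (n - d)"
    using Mc by (auto simp: upper_right_def char_poly_matrix_def)
  ultimately have "det ?C = det (char_poly_matrix (upper_left d M)) * det (char_poly_matrix (lower_right d M))"
    using det_four_block_mat_lower_left_zero[of "char_poly_matrix (upper_left d M)" d "upper_right d ?C" "n - d"
       "0\<^sub>m (n - d) d" "char_poly_matrix (lower_right d M)"] c by simp
  then have "char_poly M = char_poly (upper_left d M) * char_poly (lower_right d M)"
    by (simp add: char_poly_def)
  moreover have "char_poly (upper_left d M) \<noteq> 0" "char_poly (lower_right d M) \<noteq> 0"
    using degree_monic_char_poly[of "upper_left d M" d] degree_monic_char_poly[OF c(2)] by auto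
  ultimately show ?thesis by (simp add: eigs_def proots_mult)
qed

lemma eigs_upper_triangular:
  assumes "A \<in> carrier_mat n n" "upper_triangular (A :: 'k::idom mat)"
  shows "eigs A = mset (diag_mat A)"
proof -
  have "proots (\<Prod>a\<leftarrow>as. [:- a, 1:]) = mset as" for as :: "'k list"
  proof (induction as)
    case (Cons a as)
    have "(\<Prod>a\<leftarrow>as. [:- a, 1:]) \<noteq> 0" by (auto simp: prod_list_zero_iff)
    then show ?case using Cons by (simp add: proots_mult del: mult_pCons_left)
  qed simp
  then show ?thesis using char_poly_upper_triangular[OF assms] by (simp add: eigs_def)
qed

lemma mtrace_upper_triangular_eigs:
  assumes "A \<in> carrier_mat n n" "upper_triangular (A :: 'k::idom mat)"
  shows "mtrace A = \<Sum>\<^sub># (eigs A)"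
  using assms eigs_upper_triangular[OF assms]
  by (simp add: mtrace_def diag_mat_def sum_mset_sum_list interv_sum_list_conv_sum_set_nat lessThan_atLeast0
      sum_unfold_sum_mset)

lemma lin_subspace_eigenspace:
  assumes "A \<in> carrier_mat n n"
  shows "lin_subspace n {v \<in> carrier_vec n. A *\<^sub>v v = a \<cdot>\<^sub>v (v :: 'k::field vec)}"
  using assms
  by (auto simp: lin_subspace_def mult_add_distrib_mat_vec mult_mat_vec smult_add_distrib_vec
      smult_smult_assoc mult.commute)

lemma eigenvalue_exists:
  assumes A: "A \<in> carrier_mat n n" and n: "n > 0"
  obtains a v where "v \<in> carrier_vec n" "v \<noteq> 0\<^sub>v n" "A *\<^sub>v v = a \<cdot>\<^sub>v (v :: 'k::alg_closed_field vec)"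
proof -
  have "degree (char_poly A) > 0" using degree_monic_char_poly[OF A] n by simp
  from alg_closed_imp_poly_has_root[OF this] obtain a where "poly (char_poly A) a = 0" by auto
  then have "eigenvalue A a" using eigenvalue_root_char_poly[OF A] by simp
  then show thesis using that A unfolding eigenvalue_def eigenvector_def by auto
qed

lemma scalar_if_eigenspace_full:
  assumes A: "A \<in> carrier_mat n n" and full: "\<And>v. v \<in> carrier_vec n \<Longrightarrow> A *\<^sub>v v = a \<cdot>\<^sub>v (v :: 'k::field vec)"
  shows "A = a \<cdot>\<^sub>m 1\<^sub>m n"
proof (rule eq_matI)
  fix i j assume ij: "i < dim_row (a \<cdot>\<^sub>m 1\<^sub>m n)" "j < dim_col (a \<cdot>\<^sub>m 1\<^sub>m n)"
  have "A $$ (i,j) = (A *\<^sub>v unit_vec n j) $ i" using A ij by simp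
  also have "\<dots> = (a \<cdot>\<^sub>m 1\<^sub>m n) $$ (i,j)" using full[of "unit_vec n j"] ij by simp
  finally show "A $$ (i,j) = (a \<cdot>\<^sub>m 1\<^sub>m n) $$ (i,j)" .
qed (use A in auto)

text \<open>The matrix is split along a full eigenspace rather than a line: either the eigenspace is
  everything and the matrix is scalar, or both diagonal blocks are smaller and the induction
  hypothesis applies to each.\<close>

lemma triangularization:
  assumes "A \<in> carrier_mat n n"
  shows "\<exists>B \<in> carrier_mat n n. upper_triangular B \<and> similar_mat A (B :: 'k::alg_closed_field mat)"
  using assms
proof (induction n arbitrary: A rule: less_induct)
  case (less n)
  note A = less.prems
  show ?case
  proof (cases "n = 0")
    case True
    then show ?thesis using A by (intro bexI[of _ A]) (auto intro: similar_mat_refl)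
  next
    case False
    then obtain a v where v: "v \<in> carrier_vec n" "v \<noteq> 0\<^sub>v n" "A *\<^sub>v v = a \<cdot>\<^sub>v v"
      using eigenvalue_exists[OF A] by blast
    define W where "W = {v \<in> carrier_vec n. A *\<^sub>v v = a \<cdot>\<^sub>v v}"
    have W: "lin_subspace n W" unfolding W_def by (rule lin_subspace_eigenspace[OF A])
    have W0: "W \<noteq> {0\<^sub>v n}" using v by (auto simp: W_def)
    show ?thesis
    proof (cases "W = carrier_vec n")
      case True
      then have "A = a \<cdot>\<^sub>m 1\<^sub>m n" by (intro scalar_if_eigenspace_full[OF A]) (auto simp: W_def)
      then have "upper_triangular A" by auto
      then show ?thesis using A similar_mat_refl[OF A] by auto
    next
      case False
      from block_decomposition[OF W W0 False] obtain d P Q where d: "0 < d" "d < n"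
        and P: "P \<in> carrier_mat n n" and Q: "Q \<in> carrier_mat n n" and PQ: "P * Q = 1\<^sub>m n" "Q * P = 1\<^sub>m n"
        and key: "\<And>v. v \<in> carrier_vec n \<Longrightarrow> P *\<^sub>v v \<in> W \<longleftrightarrow> (\<forall>i. d \<le> i \<longrightarrow> i < n \<longrightarrow> v $ i = 0)" by blast
      define M where "M = Q * A * P"
      have inv: "A *\<^sub>v w \<in> W" if "w \<in> W" for w
        using that W by (auto simp: W_def lin_subspace_def)
      have M: "block_upper n d M" unfolding block_upper_def
      proof (intro conjI allI impI)
        show "M \<in> carrier_mat n n" using P Q A by (simp add: M_def)
        show "\<And>i j. d \<le> i \<Longrightarrow> i < n \<Longrightarrow> j < d \<Longrightarrow> M $$ (i, j) = 0"
          unfolding M_def by (rule block_triangular[OF d(2) P Q PQ(1) key A inv])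
      qed (use d in auto)
      note c = upper_right_carrier[OF M] lower_right_carrier[OF M]
      obtain B1 where B1: "B1 \<in> carrier_mat d d" "upper_triangular B1" "similar_mat (upper_left d M) B1"
        using less.IH[OF d(2), of "upper_left d M"] by auto
      obtain B4 where B4: "B4 \<in> carrier_mat (n - d) (n - d)" "upper_triangular B4" "similar_mat (lower_right d M) B4"
        using less.IH[of "n - d", OF _ c(2)] d by auto
      from similar_mat_four_block_0_ex[OF B1(3) B4(3) c(1) _ c(2)] obtain B0 where
        B0: "B0 \<in> carrier_mat d (n - d)" "similar_mat M (four_block_mat B1 B0 (0\<^sub>m (n - d) d) B4)"
        using block_upper_eq[OF M] by auto
      have "upper_triangular (four_block_mat B1 B0 (0\<^sub>m (n - d) d) B4)"
        by (rule upper_triangular_four_block[OF B1(1) B4(1) B1(2) B4(2)])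
      moreover have "four_block_mat B1 B0 (0\<^sub>m (n - d) d) B4 \<in> carrier_mat n n"
        using B1 B4 d by (intro carrier_matI) auto
      moreover have "similar_mat A M" unfolding M_def by (rule similar_conj[OF A P Q PQ])
      ultimately show ?thesis using similar_mat_trans B0(2) by blast
    qed
  qed
qed

lemma mtrace_eq_sum_eigs:
  assumes "A \<in> carrier_mat n n"
  shows "mtrace A = \<Sum>\<^sub># (eigs (A :: 'k::alg_closed_field mat))"
  using triangularization[OF assms] mtrace_similar eigs_similar mtrace_upper_triangular_eigs by metis

lemma size_eigs:
  assumes "A \<in> carrier_mat n n"
  shows "size (eigs (A :: 'k::alg_closed_field mat)) = n"
proof -
  obtain B where B: "B \<in> carrier_mat n n" "upper_triangular B" "similar_mat A B"
    using triangularization[OF assms] by auto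
  then show ?thesis using eigs_similar[OF B(3)] eigs_upper_triangular[OF B(1,2)] by (simp add: diag_mat_def)
qed

lemma upper_triangular_mult:
  assumes A: "A \<in> carrier_mat n n" "upper_triangular A" and B: "B \<in> carrier_mat n n" "upper_triangular (B :: 'k::comm_ring_1 mat)"
  shows "upper_triangular (A * B)" and "i < n \<Longrightarrow> (A * B) $$ (i,i) = A $$ (i,i) * B $$ (i,i)"
proof -
  have e: "(A * B) $$ (i,j) = (\<Sum>k<n. A $$ (i,k) * B $$ (k,j))" if "i < n" "j < n" for i j
    using that A B by (simp add: scalar_prod_def lessThan_atLeast0)
  show "upper_triangular (A * B)"
  proof (rule upper_triangularI)
    fix i j assume ij: "j < i" "i < dim_row (A * B)"
    have "(\<Sum>k<n. A $$ (i,k) * B $$ (k,j)) = 0"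
    proof (rule sum.neutral, rule ballI)
      fix k assume "k \<in> {..<n}"
      then show "A $$ (i,k) * B $$ (k,j) = 0"
        using A B ij upper_triangularD[of A k i] upper_triangularD[of B j k]
        by (cases "k < i") auto
    qed
    then show "(A * B) $$ (i,j) = 0" using e ij A by simp
  qed
  assume i: "i < n"
  have "(\<Sum>k<n. A $$ (i,k) * B $$ (k,i)) = (\<Sum>k\<in>{i}. A $$ (i,k) * B $$ (k,i))"
  proof (rule sum.mono_neutral_right)
    show "\<forall>k\<in>{..<n} - {i}. A $$ (i,k) * B $$ (k,i) = 0"
      using A B i upper_triangularD[of A _ i] upper_triangularD[of B i]
      by (metis DiffD1 DiffD2 carrier_matD(1) insertI1 lessThan_iff linorder_neqE_nat mult_zero_left mult_zero_right)
  qed (use i in auto)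
  then show "(A * B) $$ (i,i) = A $$ (i,i) * B $$ (i,i)" using e i by simp
qed

lemma eigs_power:
  assumes A: "A \<in> carrier_mat n n"
  shows "eigs (A ^\<^sub>m k) = image_mset (\<lambda>a. a ^ k) (eigs (A :: 'k::alg_closed_field mat))"
proof -
  obtain B where B: "B \<in> carrier_mat n n" "upper_triangular B" "similar_mat A B"
    using triangularization[OF A] by auto
  have p: "B ^\<^sub>m k \<in> carrier_mat n n \<and> upper_triangular (B ^\<^sub>m k) \<and> (\<forall>i<n. (B ^\<^sub>m k) $$ (i,i) = B $$ (i,i) ^ k)"
  proof (induction k)
    case 0
    then show ?case using B by auto
  next
    case (Suc k)
    then show ?case
      using B upper_triangular_mult[of "B ^\<^sub>m k" n B] by (auto simp: mult.commute)
  qed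
  obtain P Q where "similar_mat_wit A B P Q" using B by (auto simp: similar_mat_def)
  then have "similar_mat (A ^\<^sub>m k) (B ^\<^sub>m k)" using similar_mat_wit_pow unfolding similar_mat_def by blast
  then have "eigs (A ^\<^sub>m k) = mset (diag_mat (B ^\<^sub>m k))"
    using p by (simp add: eigs_similar eigs_upper_triangular[of _ n])
  also have "\<dots> = image_mset (\<lambda>a. a ^ k) (mset (diag_mat B))"
    using p B by (auto simp: diag_mat_def simp flip: mset_map intro!: arg_cong[where f = mset])
  also have "mset (diag_mat B) = eigs A"
    using B by (simp add: eigs_similar eigs_upper_triangular[of _ n])
  finally show ?thesis .
qed

lemma eigs_smult:
  assumes A: "A \<in> carrier_mat n n"
  shows "eigs (c \<cdot>\<^sub>m A) = image_mset (\<lambda>a. c * a) (eigs (A :: 'k::alg_closed_field mat))"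
proof -
  obtain B where B: "B \<in> carrier_mat n n" "upper_triangular B" "similar_mat A B"
    using triangularization[OF A] by auto
  have "similar_mat (c \<cdot>\<^sub>m A) (c \<cdot>\<^sub>m B)" using B(3) by (rule similar_mat_smult)
  then have "eigs (c \<cdot>\<^sub>m A) = mset (diag_mat (c \<cdot>\<^sub>m B))"
    using B by (subst eigs_upper_triangular[symmetric, of _ n])
      (auto simp: eigs_similar intro!: upper_triangularI dest: upper_triangularD)
  also have "\<dots> = image_mset (\<lambda>a. c * a) (mset (diag_mat B))"
    using B by (auto simp: diag_mat_def simp flip: mset_map intro!: arg_cong[where f = mset])
  also have "mset (diag_mat B) = eigs A"
    using B by (simp add: eigs_similar eigs_upper_triangular[of _ n])
  finally show ?thesis .
qed

lemma eigs_transpose: "A \<in> carrier_mat n n \<Longrightarrow> eigs (A\<^sup>T) = eigs A"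
  by (simp add: eigs_def)

lemma eigs_one: "eigs (1\<^sub>m n :: 'k::idom mat) = replicate_mset n 1"
  by (subst eigs_upper_triangular[of _ n]) (auto simp: mset_replicate)

section \<open>Lifting eigenvalues to characteristic zero\<close>

text \<open>Substitution of \<open>z\<close> in an integer polynomial, with values in any
  commutative ring. One and the same polynomial is evaluated at a complex root of unity and at its
  reduction, which transfers identities between the characteristics.\<close>

definition int_eval :: "'b::comm_ring_1 \<Rightarrow> int poly \<Rightarrow> 'b" where
  "int_eval z q = poly (map_poly of_int q) z"

lemma comm_ring_hom_int_eval: "comm_ring_hom (int_eval (z :: 'b::comm_ring_1))"
  by unfold_locales (auto simp: int_eval_def of_int_poly_hom.hom_add of_int_poly_hom.hom_mult)

lemma int_eval_pCons: "int_eval z (pCons a q) = of_int a + z * int_eval z q"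
  by (cases "a = 0 \<and> q = 0") (auto simp: int_eval_def map_poly_pCons)

lemma int_eval_monom: "int_eval z (monom 1 i) = z ^ i"
  by (simp add: int_eval_def map_poly_monom poly_monom)

lemma int_eval_const: "int_eval z [:c:] = of_int c"
  by (simp add: int_eval_pCons) (simp add: int_eval_def)

text \<open>The characteristic polynomial of an integer matrix is a monic integer
  polynomial.\<close>

lemma algebraic_int_of_eigenvalue:
  fixes x :: complex
  assumes A: "A \<in> carrier_mat n n" and v: "v \<in> carrier_vec n" "v \<noteq> 0\<^sub>v n"
    and e: "map_mat of_int A *\<^sub>v v = x \<cdot>\<^sub>v v"
  shows "algebraic_int x"
proof -
  have c: "(map_mat of_int A :: complex mat) \<in> carrier_mat n n" using A by simp
  have "eigenvalue (map_mat of_int A) x"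
    using v e c unfolding eigenvalue_def eigenvector_def by auto
  then have "poly (char_poly (map_mat of_int A)) x = 0"
    using eigenvalue_root_char_poly[OF c] by simp
  then have "poly (map_poly of_int (char_poly A)) x = 0"
    by (simp add: of_int_hom.char_poly_hom[OF A])
  moreover have "lead_coeff (char_poly A) = 1" using degree_monic_char_poly[OF A] by simp
  ultimately show ?thesis unfolding algebraic_int_altdef_ipoly by blast
qed

text \<open>Multiplication by \<open>int_eval z q\<close> on the powers of \<open>z\<close> with
  exponents below \<open>L\<close> is given by an integer matrix that has the vector of these powers
  as an eigenvector. This is what allows \<open>red\<close> to be applied to integral combinations
  of powers of \<open>z\<close>.\<close>

lemma algebraic_int_int_eval:
  fixes z :: complex
  assumes z: "z ^ L = 1" and L: "L > 0"
  shows "algebraic_int (int_eval z q)"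
proof -
  \<comment> \<open>Row \<open>j\<close> collects the coefficients of \<open>q\<close> multiplied by
    the \<open>j\<close>-th power of the variable, with exponents reduced modulo
    \<open>L\<close>.\<close>
  define A where "A = mat L L (\<lambda>(j,l). \<Sum>i\<le>degree q. if (i + j) mod L = l then coeff q i else 0)"
  define v where "v = vec L (\<lambda>j. z ^ j)"
  have zmod: "z ^ (k mod L) = z ^ k" for k
  proof -
    have "z ^ k = z ^ (L * (k div L) + k mod L)" by simp
    also have "\<dots> = z ^ (k mod L)" unfolding power_add power_mult z by simp
    finally show ?thesis by simp
  qed
  have x: "int_eval z q = (\<Sum>i\<le>degree q. of_int (coeff q i) * z ^ i)"
    by (simp add: int_eval_def poly_altdef coeff_map_poly degree_map_poly)
  have "map_mat of_int A *\<^sub>v v = int_eval z q \<cdot>\<^sub>v v"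
  proof (rule eq_vecI)
    fix j assume "j < dim_vec (int_eval z q \<cdot>\<^sub>v v)"
    then have j: "j < L" by (simp add: v_def)
    have "(map_mat of_int A *\<^sub>v v) $ j = (\<Sum>l<L. (\<Sum>i\<le>degree q. if (i + j) mod L = l then of_int (coeff q i) else 0) * z ^ l)"
      using j by (auto simp: A_def v_def scalar_prod_def lessThan_atLeast0 if_distrib[of of_int] cong: if_cong intro!: sum.cong)
    also have "\<dots> = (\<Sum>i\<le>degree q. \<Sum>l<L. if (i + j) mod L = l then of_int (coeff q i) * z ^ l else 0)"
      by (subst sum.swap) (auto simp: sum_distrib_right intro!: sum.cong)
    also have "\<dots> = (\<Sum>i\<le>degree q. of_int (coeff q i) * z ^ (i + j))"
      using L by (intro sum.cong refl) (simp add: zmod)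
    also have "\<dots> = (int_eval z q \<cdot>\<^sub>v v) $ j"
      using j by (simp add: x v_def sum_distrib_right power_add mult.assoc)
    finally show "(map_mat of_int A *\<^sub>v v) $ j = (int_eval z q \<cdot>\<^sub>v v) $ j" .
  qed (simp add: A_def v_def)
  moreover have "v $ 0 \<noteq> 0\<^sub>v L $ 0" using L by (simp add: v_def)
  then have "v \<noteq> 0\<^sub>v L" by metis
  ultimately show ?thesis
    by (intro algebraic_int_of_eigenvalue[of A L v]) (auto simp: A_def v_def)
qed

lemma algebraic_int_root_of_unity:
  fixes z :: complex
  assumes "z ^ L = 1" "L > 0"
  shows "algebraic_int z"
  using algebraic_int_int_eval[OF assms, of "monom 1 1"] by (simp add: int_eval_monom)

lemma algebraic_int_of_int': "algebraic_int (of_int c :: complex)"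
  using algebraic_int_int_eval[of 1 1 "[:c:]"] by (simp add: int_eval_const)

lemma int_eval_sum_monom: "int_eval w (\<Sum>i\<in>#M. monom 1 i) = (\<Sum>i\<in>#M. w ^ i)"
proof -
  interpret comm_ring_hom "int_eval w" by (rule comm_ring_hom_int_eval)
  show ?thesis by (induction M) (auto simp: hom_add int_eval_monom)
qed

lemma proots_prod_mset_linear: "proots (\<Prod>a\<in>#S. [:- a, 1:]) = (S :: 'b::idom multiset)"
proof (induction S)
  case (add x S)
  have "(\<Prod>a\<in>#S. [:- a, 1:]) \<noteq> 0" by (auto simp: prod_mset_zero_iff)
  then show ?case using add by (simp add: proots_mult del: mult_pCons_left)
qed simp

lemma char_poly_eq_prod_eigs:
  assumes "B \<in> carrier_mat m m"
  shows "char_poly (B :: 'b::alg_closed_field mat) = (\<Prod>a\<in>#eigs B. [:- a, 1:])"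
proof -
  have "char_poly B \<noteq> 0" "lead_coeff (char_poly B) = 1" using degree_monic_char_poly[OF assms] by auto
  with alg_closed_imp_factorization[of "char_poly B"] obtain S where
    S: "char_poly B = (\<Prod>a\<in>#S. [:- a, 1:])" by auto
  then show ?thesis by (simp add: eigs_def proots_prod_mset_linear)
qed

lemma map_poly_int_eval_prod:
  "map_poly (int_eval w) (\<Prod>e\<in>#M. [:- monom 1 e, 1:]) = (\<Prod>e\<in>#M. [:- (w ^ e), 1:])"
proof -
  interpret h: comm_ring_hom "int_eval w" by (rule comm_ring_hom_int_eval)
  interpret hp: map_poly_comm_ring_hom "int_eval w" ..
  have "map_poly (int_eval w) [:- monom 1 e, 1:] = [:- (w ^ e), 1:]" for e
    by (rule poly_eqI) (simp add: coeff_map_poly coeff_pCons h.hom_uminus int_eval_monom split: nat.split)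
  then show ?thesis
    by (induction M) (simp_all add: hp.hom_mult del: mult_pCons_left mult_pCons_right)
qed

lemma map_poly_int_eval_char_poly:
  assumes "A \<in> carrier_mat m m"
  shows "map_poly (int_eval w) (map_poly (\<lambda>a. [:a:]) (char_poly A)) = char_poly (map_mat of_int A)"
proof -
  interpret h: comm_ring_hom "int_eval w" by (rule comm_ring_hom_int_eval)
  have "map_poly (int_eval w) (map_poly (\<lambda>a. [:a:]) (char_poly A)) = map_poly of_int (char_poly A)"
    by (subst map_poly_map_poly) (auto simp: o_def int_eval_const)
  then show ?thesis by (simp add: of_int_hom.char_poly_hom[OF assms])
qed

section \<open>Roots of unity and their reductions\<close>

locale modular_reduction =
  fixes p :: nat and red :: "complex \<Rightarrow> 'k::alg_closed_field"
  assumes prime_p: "prime p" and char_p: "CHAR('k) = p" and red_hom: "reduction_hom red"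
begin

lemma red_one [simp]: "red 1 = 1" using red_hom by (simp add: reduction_hom_def)

lemma red_add: "algebraic_int x \<Longrightarrow> algebraic_int y \<Longrightarrow> red (x + y) = red x + red y"
  using red_hom by (simp add: reduction_hom_def)

lemma red_mult: "algebraic_int x \<Longrightarrow> algebraic_int y \<Longrightarrow> red (x * y) = red x * red y"
  using red_hom by (simp add: reduction_hom_def)

lemma red_zero [simp]: "red 0 = 0"
  using red_add[of 0 0] by (metis add.right_neutral add_left_imp_eq algebraic_int_0)

lemma red_of_int: "red (of_int c) = of_int c"
proof (cases c rule: int_cases2)
  have n: "red (of_nat n) = of_nat n" for n
  proof (induction n)
    case (Suc n)
    then show ?case using red_add[of 1 "of_nat n"] algebraic_int_of_int'[of "int n"] algebraic_int_of_int'[of 1] by simp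
  qed simp
  {
    case (nonneg n)
    then show ?thesis using n by simp
  next
    case (nonpos n)
    have "red (of_nat n + - of_nat n) = red (of_nat n) + red (- of_nat n)"
      using algebraic_int_of_int'[of "int n"] algebraic_int_of_int'[of "- int n"] by (intro red_add) auto
    then have "red (- of_nat n) = - of_nat n" using n by (simp add: eq_neg_iff_add_eq_0 add.commute)
    then show ?thesis using nonpos by simp
  }
qed

lemma red_int_eval:
  assumes z: "z ^ L = 1" and L: "L > 0"
  shows "red (int_eval z q) = int_eval (red z) q"
proof (induction q)
  case 0
  then show ?case by (simp add: int_eval_def)
next
  case (pCons a q)
  note ai = algebraic_int_root_of_unity[OF z L] algebraic_int_int_eval[OF z L]
  have "algebraic_int (z * int_eval z q)"
    using algebraic_int_int_eval[OF z L, of "pCons 0 q"] by (simp add: int_eval_pCons)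
  then show ?case using pCons ai
    by (simp add: int_eval_pCons red_add[OF algebraic_int_of_int'] red_mult red_of_int)
qed

text \<open>The bridge between the characteristics: integral relations among powers of
  \<open>z\<close> survive reduction. Read backwards, a determinant that is nonzero over
  \<open>'k\<close> was already nonzero over the complex numbers.\<close>

lemma int_eval_red_eq_0:
  assumes "z ^ L = 1" "L > 0" "int_eval z q = 0"
  shows "int_eval (red z) q = 0"
  using red_int_eval[OF assms(1,2), of q] assms(3) by simp

lemma red_power: "z ^ L = 1 \<Longrightarrow> L > 0 \<Longrightarrow> red (z ^ i) = red z ^ i"
  using red_int_eval[of z L "monom 1 i"] by (simp add: int_eval_monom)

lemma coprime_of_nat_neq_0: "coprime n p \<Longrightarrow> (of_nat n :: 'k) \<noteq> 0"
  using prime_p char_p of_nat_eq_0_iff_char_dvd[of n, where 'a = 'k]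
  by (metis coprime_absorb_right not_prime_unit)

text \<open>For \<open>z\<close> different from 1 the sum of the powers of \<open>z\<close> with
  exponents below \<open>L\<close> vanishes; if \<open>z\<close> reduced to 1, this sum would reduce
  to \<open>L\<close>, which is nonzero in \<open>'k\<close>.\<close>

lemma red_eq_1:
  assumes z: "z ^ L = 1" and L: "L > 0" and cop: "coprime L p" and r: "red z = 1"
  shows "z = 1"
proof (rule ccontr)
  assume "z \<noteq> 1"
  then have "(\<Sum>i<L. z ^ i) = 0" using z by (simp add: sum_gp_strict)
  then have "int_eval z (\<Sum>i\<in>#mset_set {..<L}. monom 1 i) = 0"
    by (simp add: int_eval_sum_monom sum_unfold_sum_mset)
  from int_eval_red_eq_0[OF z L this] have "(\<Sum>i<L. red z ^ i) = 0"
    by (simp add: int_eval_sum_monom sum_unfold_sum_mset)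
  then show False using r coprime_of_nat_neq_0[OF cop] by simp
qed

text \<open>Apply \<open>red_eq_1\<close> to the quotient of the two roots, where the inverse of
  \<open>z\<close> is written as \<open>z ^ (m - 1)\<close>.\<close>

lemma red_inj:
  assumes "y ^ n = 1" "n > 0" "coprime n p" "z ^ m = 1" "m > 0" "coprime m p" "red y = red z"
  shows "y = z"
proof -
  let ?w = "y * z ^ (m - 1)"
  have zz: "z ^ (m - 1) * z = 1" using assms by (metis Suc_diff_1 power_Suc2)
  have "(z ^ (m - 1)) ^ m = 1" using assms by (metis power_mult mult.commute power_one)
  then have w: "?w ^ (n * m) = 1"
    using assms(1) by (simp add: power_mult_distrib) (metis mult.commute mult_1 power_mult power_one)
  have "red ?w = red y * red (z ^ (m - 1))"
    by (rule red_mult[OF algebraic_int_root_of_unity[OF assms(1,2)]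
          algebraic_int_root_of_unity[OF \<open>(z ^ (m - 1)) ^ m = 1\<close> assms(5)]])
  also have "\<dots> = red z * red z ^ (m - 1)"
    using assms(7) red_power[OF assms(4,5)] by simp
  also have "\<dots> = red z ^ m" using assms(5) by (simp flip: power_Suc)
  also have "\<dots> = red (z ^ m)" by (simp only: red_power[OF assms(4,5)])
  finally have "red ?w = 1" using assms by simp
  then have "?w = 1" using red_eq_1[OF w] assms by simp
  then have "y * (z ^ (m - 1) * z) = z" by (metis mult.assoc mult_1)
  then show ?thesis by (simp only: zz mult_1_right)
qed

definition unity_root :: "nat \<Rightarrow> complex" where
  "unity_root L = cis (2 * pi / real L)"

lemma unity_root_power: "L > 0 \<Longrightarrow> unity_root L ^ L = 1"
  by (simp add: unity_root_def DeMoivre)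

lemma unity_root_cover:
  assumes L: "L > 0" and z: "z ^ L = 1"
  shows "\<exists>i<L. z = unity_root L ^ i"
proof -
  have "bij_betw (\<lambda>k. cis (2 * pi * real k / real L)) {..<L} {z. z ^ L = 1}"
    by (rule bij_betw_roots_unity[OF L])
  then obtain k where "k < L" "z = cis (2 * pi * real k / real L)"
    using z by (auto simp: bij_betw_def image_iff set_eq_iff)
  moreover have "cis (2 * pi * real k / real L) = unity_root L ^ k"
    by (simp add: unity_root_def DeMoivre mult_ac)
  ultimately show ?thesis by blast
qed

text \<open>By counting: there are \<open>L\<close> complex roots of unity, reduction is injective
  on them, and a polynomial of degree at most \<open>L\<close> has at most \<open>L\<close> roots in
  \<open>'k\<close>.\<close>

lemma red_surj:
  assumes L: "L > 0" and cop: "coprime L p" and a: "(a :: 'k) ^ L = 1"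
  shows "\<exists>z. z ^ L = 1 \<and> red z = a"
proof -
  let ?R = "{z :: complex. z ^ L = 1}" and ?S = "{a :: 'k. a ^ L = 1}"
  have sub: "red ` ?R \<subseteq> ?S" using L by (auto simp flip: red_power[of _ L])
  have inj: "inj_on red ?R" by (rule inj_onI) (use red_inj L cop in blast)
  have S: "?S = {x. poly (monom 1 L - 1) x = 0}" by (simp add: poly_monom)
  have nz: "monom (1 :: 'k) L - 1 \<noteq> 0"
  proof
    assume "monom (1 :: 'k) L - 1 = 0"
    then have "coeff (monom (1 :: 'k) L - 1) L = 0" by simp
    then show False using L by simp
  qed
  have deg: "degree (monom (1 :: 'k) L - 1) \<le> L"
    by (rule degree_diff_le) (auto simp: degree_monom_le)
  have fin: "finite ?S" using poly_roots_finite[OF nz] S by simp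
  have "card ?S \<le> L" using card_poly_roots_bound[OF nz] S deg by simp
  also have "L = card (red ` ?R)" using card_roots_unity_eq[OF L] inj by (simp add: card_image)
  finally have "red ` ?R = ?S" using card_seteq[OF fin sub] by simp
  with a have "a \<in> red ` ?R" by blast
  then show ?thesis by blast
qed

abbreviation "lift \<equiv> root_lift p red"

lemma lift_red:
  assumes z: "z ^ n = 1" "n > 0" "coprime n p"
  shows "lift (red z) = z"
  unfolding root_lift_def
proof (rule the_equality)
  fix y assume "(\<exists>n>0. coprime n p \<and> y ^ n = 1) \<and> red y = red z"
  then show "y = z" using z red_inj by blast
qed (use z in auto)

lemma lift_exists:
  assumes "n > 0" "coprime n p" "a ^ n = 1"
  obtains z where "z ^ n = 1" "red z = a" "lift a = z"
  using red_surj[OF assms] lift_red assms by metis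

lemma lift_power_eq_1: "n > 0 \<Longrightarrow> coprime n p \<Longrightarrow> a ^ n = 1 \<Longrightarrow> lift a ^ n = 1"
  by (metis lift_exists)

lemma red_lift: "n > 0 \<Longrightarrow> coprime n p \<Longrightarrow> a ^ n = 1 \<Longrightarrow> red (lift a) = a"
  by (metis lift_exists)

lemma lift_mult:
  assumes n: "n > 0" "coprime n p" "a ^ n = 1" "b ^ n = 1"
  shows "lift (a * b) = lift a * lift b"
proof -
  obtain y where y: "y ^ n = 1" "red y = a" "lift a = y" using lift_exists n by metis
  obtain z where z: "z ^ n = 1" "red z = b" "lift b = z" using lift_exists n by metis
  have "red (y * z) = a * b" using y z red_mult algebraic_int_root_of_unity n by metis
  moreover have "(y * z) ^ n = 1" using y z by (simp add: power_mult_distrib)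
  ultimately show ?thesis using lift_red n y z by metis
qed

lemma lift_power:
  assumes n: "n > 0" "coprime n p" "a ^ n = 1"
  shows "lift (a ^ k) = lift a ^ k"
proof -
  obtain y where y: "y ^ n = 1" "red y = a" "lift a = y" using lift_exists n by metis
  have "(y ^ k) ^ n = 1" using y by (metis power_mult mult.commute power_one)
  then show ?thesis using red_power[of y n k] y n lift_red by metis
qed

lemma cnj_root_of_unity:
  assumes z: "(z :: complex) ^ n = 1" "n > 0"
  shows "z ^ (n - 1) = cnj z"
proof -
  have "norm z ^ n = 1" using z by (simp flip: norm_power)
  then have "norm z = 1" using z(2) power_eq_iff_eq_base[of n "norm z" 1] by simp
  then have "z * cnj z = 1" by (metis complex_norm_square of_real_1 power_one)
  moreover have "z * z ^ (n - 1) = 1" using z by (metis power_minus_mult mult.commute)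
  ultimately show ?thesis by (metis mult_cancel_left mult_zero_left zero_neq_one)
qed

definition brauer_val :: "'k mat \<Rightarrow> complex" where
  "brauer_val A = (\<Sum>a\<in>#eigs A. lift a)"

lemma eigs_root_of_unity:
  assumes "(A :: 'b::alg_closed_field mat) \<in> carrier_mat m m" "A ^\<^sub>m n = 1\<^sub>m m" "a \<in># eigs A"
  shows "a ^ n = 1"
proof -
  have "a ^ n \<in># image_mset (\<lambda>a. a ^ n) (eigs A)" using assms by simp
  also have "image_mset (\<lambda>a. a ^ n) (eigs A) = replicate_mset m 1"
    using eigs_power[OF assms(1), of n] assms(2) eigs_one by metis
  finally show ?thesis by (simp split: if_splits)
qed

lemma brauer_val_similar: "similar_mat A B \<Longrightarrow> brauer_val A = brauer_val B"
  by (simp add: brauer_val_def eigs_similar)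

lemma brauer_val_block:
  "block_upper n d M \<Longrightarrow> brauer_val M = brauer_val (upper_left d M) + brauer_val (lower_right d M)"
  by (simp add: brauer_val_def eigs_block)

lemma brauer_val_one: "brauer_val (1\<^sub>m n) = of_nat n"
  using lift_red[of 1 1] by (simp add: brauer_val_def eigs_one)

lemma brauer_val_smult:
  assumes A: "A \<in> carrier_mat m m" "A ^\<^sub>m n = 1\<^sub>m m" and n: "n > 0" "coprime n p" and c: "c ^ n = 1"
  shows "brauer_val (c \<cdot>\<^sub>m A) = lift c * brauer_val A"
proof -
  have "brauer_val (c \<cdot>\<^sub>m A) = (\<Sum>a\<in>#eigs A. lift (c * a))"
    by (simp add: brauer_val_def eigs_smult[OF A(1)] image_mset.compositionality o_def)
  also have "\<dots> = (\<Sum>a\<in>#eigs A. lift c * lift a)"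
    using lift_mult[OF n c] eigs_root_of_unity[OF A] by (intro arg_cong[where f = sum_mset] image_mset_cong) auto
  finally show ?thesis
    by (simp add: brauer_val_def sum_mset_distrib_left image_mset.compositionality o_def)
qed

text \<open>The power is the inverse of \<open>A\<close>. It raises every eigenvalue to the power
  \<open>n - 1\<close>, which on complex roots of unity of order dividing \<open>n\<close> is
  complex conjugation.\<close>

lemma brauer_val_inverse:
  assumes A: "A \<in> carrier_mat m m" "A ^\<^sub>m n = 1\<^sub>m m" and n: "n > 0" "coprime n p"
  shows "brauer_val (A ^\<^sub>m (n - 1)) = cnj (brauer_val A)"
proof -
  have "brauer_val (A ^\<^sub>m (n - 1)) = (\<Sum>a\<in>#eigs A. lift (a ^ (n - 1)))"
    by (simp add: brauer_val_def eigs_power[OF A(1)] image_mset.compositionality o_def)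
  also have "\<dots> = (\<Sum>a\<in>#eigs A. cnj (lift a))"
  proof (intro arg_cong[where f = sum_mset] image_mset_cong)
    fix a assume "a \<in># eigs A"
    then have a: "a ^ n = 1" by (rule eigs_root_of_unity[OF A])
    then show "lift (a ^ (n - 1)) = cnj (lift a)"
      using lift_power[OF n a] cnj_root_of_unity[OF lift_power_eq_1[OF n a] n(1)] by simp
  qed
  also have "(\<Sum>a\<in>#E. cnj (lift a)) = cnj (\<Sum>a\<in>#E. lift a)" for E
    by (induction E) auto
  also have "cnj (\<Sum>a\<in>#eigs A. lift a) = cnj (brauer_val A)"
    by (simp add: brauer_val_def)
  finally show ?thesis .
qed

lemma exponents_exist:
  assumes A: "(A :: 'b::alg_closed_field mat) \<in> carrier_mat m m" "A ^\<^sub>m L = 1\<^sub>m m"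
    and cover: "\<And>a :: 'b. a ^ L = 1 \<Longrightarrow> \<exists>i. a = z ^ i"
  obtains M where "eigs A = image_mset (\<lambda>i. z ^ i) M"
proof -
  have "\<forall>a\<in>#eigs A. \<exists>i. a = z ^ i" using eigs_root_of_unity[OF A] cover by auto
  then obtain f where f: "\<And>a. a \<in># eigs A \<Longrightarrow> a = z ^ f a" by metis
  have "eigs A = image_mset (\<lambda>i. z ^ i) (image_mset f (eigs A))"
    using f by (simp add: image_mset.compositionality o_def) (metis (mono_tags, lifting) image_mset_cong multiset.map_ident)
  then show thesis by (rule that)
qed

lemma red_unity_root_cover:
  assumes L: "L > 0" "coprime L p" and a: "a ^ L = 1"
  shows "\<exists>i. a = red (unity_root L) ^ i"
  using red_surj[OF L a] unity_root_cover[OF L(1)] red_power[OF unity_root_power[OF L(1)] L(1)] by metis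

lemma lift_red_unity_root:
  assumes L: "L > 0" "coprime L p"
  shows "lift (red (unity_root L) ^ i) = unity_root L ^ i"
proof -
  have "(unity_root L ^ i) ^ L = 1" using unity_root_power[OF L(1)] by (metis power_mult mult.commute power_one)
  then show ?thesis using lift_red[of "unity_root L ^ i" L] L red_power[OF unity_root_power[OF L(1)] L(1)] by metis
qed

text \<open>The values of a Brauer character and the traces of the representation are the two
  specialisations of one integer polynomial.\<close>

lemma brauer_val_int_eval:
  assumes A: "A \<in> carrier_mat m m" "A ^\<^sub>m L = 1\<^sub>m m" and L: "L > 0" "coprime L p"
  obtains q where "brauer_val A = int_eval (unity_root L) q" "mtrace A = int_eval (red (unity_root L)) q"
proof -
  let ?z = "unity_root L"
  obtain M where M: "eigs A = image_mset (\<lambda>i. red ?z ^ i) M"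
    using exponents_exist[OF A red_unity_root_cover[OF L]] .
  show thesis
  proof (rule that[of "\<Sum>i\<in>#M. monom 1 i"])
    show "brauer_val A = int_eval ?z (\<Sum>i\<in>#M. monom 1 i)"
      by (simp add: brauer_val_def M int_eval_sum_monom lift_red_unity_root[OF L] image_mset.compositionality o_def)
    show "mtrace A = int_eval (red ?z) (\<Sum>i\<in>#M. monom 1 i)"
      by (simp add: mtrace_eq_sum_eigs[OF A(1)] M int_eval_sum_monom)
  qed
qed

text \<open>The complex eigenvalues of \<open>A\<close> are powers of one root of unity. The same
  exponents describe the eigenvalues over \<open>'k\<close>, because the factorization of the
  characteristic polynomial is an integral relation in that root and survives reduction. Lifting
  returns the complex eigenvalues, whose sum is the ordinary trace.\<close>

lemma brauer_val_of_int:
  assumes A: "A \<in> carrier_mat m m" "A ^\<^sub>m L = 1\<^sub>m m" and L: "L > 0" "coprime L p"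
  shows "brauer_val (map_mat of_int A) = of_int (mtrace A)"
proof -
  let ?z = "unity_root L"
  let ?C = "map_mat of_int A :: complex mat"
  have C: "?C \<in> carrier_mat m m" "?C ^\<^sub>m L = 1\<^sub>m m"
    using A of_int_hom.mat_hom_pow[OF A(1), of L, where ?'a = complex] by (auto simp: of_int_hom.mat_hom_one)
  obtain M where M: "eigs ?C = image_mset (\<lambda>i. ?z ^ i) M"
    using exponents_exist[OF C, of ?z] unity_root_cover[OF L(1)] by metis
  \<comment> \<open>\<open>Q1\<close> and \<open>Q2\<close> are polynomials over the integer
    polynomials that agree at the complex root of unity; each coefficient of their difference is
    passed through \<open>int_eval_red_eq_0\<close>.\<close>
  define Q1 where "Q1 = (\<Prod>e\<in>#M. [:- monom (1 :: int) e, 1:])"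
  define Q2 where "Q2 = map_poly (\<lambda>a. [:a:]) (char_poly A)"
  have "(\<Prod>e\<in>#M. [:- (?z ^ e), 1:]) = char_poly ?C"
    using char_poly_eq_prod_eigs[OF C(1)] M by (simp add: image_mset.compositionality o_def)
  then have e: "map_poly (int_eval ?z) Q1 = map_poly (int_eval ?z) Q2"
    unfolding Q1_def Q2_def by (simp add: map_poly_int_eval_prod map_poly_int_eval_char_poly[OF A(1)])
  interpret hz: comm_ring_hom "int_eval ?z" by (rule comm_ring_hom_int_eval)
  interpret hr: comm_ring_hom "int_eval (red ?z)" by (rule comm_ring_hom_int_eval)
  have "int_eval ?z (coeff (Q1 - Q2) i) = 0" for i
    using arg_cong[OF e, of "\<lambda>q. coeff q i"] by (simp add: coeff_map_poly hz.hom_minus)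
  then have k: "int_eval (red ?z) (coeff (Q1 - Q2) i) = 0" for i
    using int_eval_red_eq_0[OF unity_root_power[OF L(1)] L(1)] by simp
  have "map_poly (int_eval (red ?z)) Q1 = map_poly (int_eval (red ?z)) Q2"
    using k by (intro poly_eqI) (simp add: coeff_map_poly hr.hom_minus)
  then have "char_poly (map_mat of_int A :: 'k mat) = (\<Prod>a\<in>#image_mset (\<lambda>e. red ?z ^ e) M. [:- a, 1:])"
    unfolding Q1_def Q2_def
    by (simp add: map_poly_int_eval_prod map_poly_int_eval_char_poly[OF A(1)] image_mset.compositionality o_def)
  then have ek: "eigs (map_mat of_int A :: 'k mat) = image_mset (\<lambda>e. red ?z ^ e) M"
    by (simp only: eigs_def proots_prod_mset_linear)
  have "brauer_val (map_mat of_int A) = (\<Sum>i\<in>#M. ?z ^ i)"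
    by (simp add: brauer_val_def ek lift_red_unity_root[OF L] image_mset.compositionality o_def)
  also have "\<dots> = mtrace ?C"
    using mtrace_eq_sum_eigs[OF C(1)] M by simp
  also have "\<dots> = of_int (mtrace A)" using A(1) by (simp add: mtrace_def)
  finally show ?thesis .
qed

end

section \<open>Irreducible matrix representations\<close>

text \<open>In a group these equations make \<open>X (inv g)\<close> an inverse of
  \<open>X g\<close>, so the values are invertible. Degree 0 is allowed, as a base case for
  inductions that split off subrepresentations.\<close>

definition is_rep :: "('a, 'm) monoid_scheme \<Rightarrow> nat \<Rightarrow> ('a \<Rightarrow> 'k::field mat) \<Rightarrow> bool" where
  "is_rep G n X \<longleftrightarrow> (\<forall>g\<in>carrier G. X g \<in> carrier_mat n n) \<and> X \<one>\<^bsub>G\<^esub> = 1\<^sub>m n \<and>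
     (\<forall>g\<in>carrier G. \<forall>h\<in>carrier G. X (g \<otimes>\<^bsub>G\<^esub> h) = X g * X h)"

lemma is_rep_carrier: "is_rep G n X \<Longrightarrow> g \<in> carrier G \<Longrightarrow> X g \<in> carrier_mat n n"
  by (simp add: is_rep_def)

lemma is_rep_one: "is_rep G n X \<Longrightarrow> X \<one>\<^bsub>G\<^esub> = 1\<^sub>m n"
  by (simp add: is_rep_def)

lemma is_rep_mult: "is_rep G n X \<Longrightarrow> g \<in> carrier G \<Longrightarrow> h \<in> carrier G \<Longrightarrow> X (g \<otimes>\<^bsub>G\<^esub> h) = X g * X h"
  by (simp add: is_rep_def)

lemma is_repI:
  assumes "\<And>g. g \<in> carrier G \<Longrightarrow> X g \<in> carrier_mat n n" "X \<one>\<^bsub>G\<^esub> = 1\<^sub>m n"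
    "\<And>g h. g \<in> carrier G \<Longrightarrow> h \<in> carrier G \<Longrightarrow> X (g \<otimes>\<^bsub>G\<^esub> h) = X g * X h"
  shows "is_rep G n X"
  using assms by (simp add: is_rep_def)

lemma mult_mat_zero_vec: "A \<in> carrier_mat n m \<Longrightarrow> A *\<^sub>v 0\<^sub>v m = (0\<^sub>v n :: 'k::semiring_0 vec)"
  by (intro eq_vecI) auto

definition invariant :: "('a, 'm) monoid_scheme \<Rightarrow> ('a \<Rightarrow> 'k::field mat) \<Rightarrow> 'k vec set \<Rightarrow> bool" where
  "invariant G X W \<longleftrightarrow> (\<forall>g\<in>carrier G. \<forall>w\<in>W. X g *\<^sub>v w \<in> W)"

lemma (in group) irreducible_rep_iff:
  "irreducible_rep G n X \<longleftrightarrow> n > 0 \<and> is_rep G n (X :: 'a \<Rightarrow> 'k::field mat) \<and>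
     (\<forall>W. lin_subspace n W \<and> invariant G X W \<longrightarrow> W = {0\<^sub>v n} \<or> W = carrier_vec n)"
proof -
  let ?R = "ring_mat TYPE('k) n ()"
  interpret R: ring ?R by (rule ring_mat)
  have c: "carrier (units_of ?R) = Units ?R" "\<one>\<^bsub>units_of ?R\<^esub> = 1\<^sub>m n" "A \<otimes>\<^bsub>units_of ?R\<^esub> B = A * B" for A B
    by (auto simp: units_of_def ring_mat_def)
  have "X \<in> hom G (units_of ?R) \<longleftrightarrow> is_rep G n X"
  proof
    assume h: "X \<in> hom G (units_of ?R)"
    then interpret X: group_hom G "units_of ?R" X
      by (intro group_hom.intro is_group R.units_group) (simp add: group_hom_axioms_def)
    have "X g \<in> carrier_mat n n" if "g \<in> carrier G" for g
      using that h c(1) by (auto simp: hom_def Units_def ring_mat_def)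
    then show "is_rep G n X" unfolding is_rep_def using X.hom_one X.hom_mult c by simp
  next
    assume r: "is_rep G n X"
    have "X g \<in> Units ?R" if g: "g \<in> carrier G" for g
    proof -
      have "X (inv g) * X g = 1\<^sub>m n" "X g * X (inv g) = 1\<^sub>m n"
        using r g is_rep_mult[OF r, of g "inv g"] is_rep_mult[OF r, of "inv g" g] by (auto simp: is_rep_one)
      then show ?thesis using r g unfolding is_rep_def Units_def ring_mat_def
        by (auto intro!: bexI[of _ "X (inv g)"])
    qed
    then show "X \<in> hom G (units_of ?R)" using r c by (auto simp: hom_def is_rep_def)
  qed
  then show ?thesis unfolding irreducible_rep_def invariant_def lin_subspace_iff_subspace by simp
qed

lemma mat_eqI_mult_vec:
  assumes "A \<in> carrier_mat n m" "B \<in> carrier_mat n m"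
    and e: "\<And>v. v \<in> carrier_vec m \<Longrightarrow> A *\<^sub>v v = B *\<^sub>v (v :: 'k::comm_ring_1 vec)"
  shows "A = B"
proof (rule eq_matI)
  fix i j assume ij: "i < dim_row B" "j < dim_col B"
  then have "A $$ (i,j) = (A *\<^sub>v unit_vec m j) $ i" "B $$ (i,j) = (B *\<^sub>v unit_vec m j) $ i"
    using assms(1,2) by auto
  then show "A $$ (i,j) = B $$ (i,j)" by (simp only: e[OF unit_vec_carrier])
qed (use assms in auto)

lemma invariant_block:
  assumes W: "lin_subspace n (W :: 'k::field vec set)" "W \<noteq> {0\<^sub>v n}" "W \<noteq> carrier_vec n"
  obtains d P Q where "0 < d" "d < n" "P \<in> carrier_mat n n" "Q \<in> carrier_mat n n"
    "P * Q = 1\<^sub>m n" "Q * P = 1\<^sub>m n"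
    "\<And>A. A \<in> carrier_mat n n \<Longrightarrow> (\<And>w. w \<in> W \<Longrightarrow> A *\<^sub>v w \<in> W) \<Longrightarrow> block_upper n d (Q * A * P)"
proof -
  from block_decomposition[OF W] obtain d P Q where d: "0 < d" "d < n"
    and P: "P \<in> carrier_mat n n" and Q: "Q \<in> carrier_mat n n" and PQ: "P * Q = 1\<^sub>m n" "Q * P = 1\<^sub>m n"
    and key: "\<And>v. v \<in> carrier_vec n \<Longrightarrow> P *\<^sub>v v \<in> W \<longleftrightarrow> (\<forall>i. d \<le> i \<longrightarrow> i < n \<longrightarrow> v $ i = 0)" by blast
  show thesis
  proof (rule that[OF d P Q PQ])
    fix A assume A: "A \<in> carrier_mat n n" and inv: "\<And>w. w \<in> W \<Longrightarrow> A *\<^sub>v w \<in> W"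
    show "block_upper n d (Q * A * P)" unfolding block_upper_def
      using block_triangular[OF d(2) P Q PQ(1) key A inv] d P Q A by auto
  qed
qed

lemma conj_mult:
  assumes "A \<in> carrier_mat n n" "B \<in> carrier_mat n n" "P \<in> carrier_mat n n" "Q \<in> carrier_mat n n" "P * Q = 1\<^sub>m n"
  shows "Q * (A * B) * P = (Q * A * P) * (Q * B * P :: 'k::comm_ring_1 mat)"
proof -
  have "(Q * A * P) * (Q * B * P) = Q * A * (P * (Q * B * P))"
    using assms by (intro assoc_mult_mat[of _ n n _ n _ n]) auto
  also have "P * (Q * B * P) = P * (Q * (B * P))"
    using assms by (simp add: assoc_mult_mat[of _ n n _ n _ n])
  also have "\<dots> = B * P" using assms assoc_mult_mat[of P n n Q n "B * P" n] by simp
  finally show ?thesis using assms by (simp add: assoc_mult_mat[of _ n n _ n _ n])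
qed

lemma is_rep_conj:
  assumes X: "is_rep G n X" and P: "P \<in> carrier_mat n n" "Q \<in> carrier_mat n n" "P * Q = 1\<^sub>m n" "Q * P = 1\<^sub>m n"
  shows "is_rep G n (\<lambda>g. Q * X g * P)"
proof (rule is_repI)
  fix g h assume "g \<in> carrier G" "h \<in> carrier G"
  then show "Q * X (g \<otimes>\<^bsub>G\<^esub> h) * P = Q * X g * P * (Q * X h * P)"
    using conj_mult[of "X g" n "X h" P Q] X P by (simp only: is_rep_mult is_rep_carrier)
qed (use X P in \<open>auto simp: is_rep_def\<close>)

lemma is_rep_upper_left:
  assumes "monoid G" and X: "is_rep G n X" and b: "\<And>g. g \<in> carrier G \<Longrightarrow> block_upper n d (X g)"
  shows "is_rep G d (\<lambda>g. upper_left d (X g))"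
proof -
  interpret monoid G by fact
  have "d \<le> n" using b[OF one_closed] by (simp add: block_upper_def)
  then show ?thesis using X b
    by (intro is_repI) (auto simp: is_rep_mult is_rep_one block_upper_mult(2)[of n] block_upper_one(2))
qed

lemma is_rep_lower_right:
  assumes "monoid G" and X: "is_rep G n X" and b: "\<And>g. g \<in> carrier G \<Longrightarrow> block_upper n d (X g)"
  shows "is_rep G (n - d) (\<lambda>g. lower_right d (X g))"
proof -
  interpret monoid G by fact
  have "d \<le> n" using b[OF one_closed] by (simp add: block_upper_def)
  then show ?thesis using X b lower_right_carrier
    by (intro is_repI) (auto simp: is_rep_mult is_rep_one block_upper_mult(3)[of n] block_upper_one(3))
qed

context group
begin

lemma rep_inv:
  assumes "is_rep G n X" "g \<in> carrier G"
  shows "X g * X (inv g) = 1\<^sub>m n" "X (inv g) * X g = 1\<^sub>m n"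
  using assms is_rep_mult[OF assms(1), of g "inv g"] is_rep_mult[OF assms(1), of "inv g" g] by (auto simp: is_rep_one)

lemma rep_pow: "is_rep G n X \<Longrightarrow> g \<in> carrier G \<Longrightarrow> X (g [^] (k::nat)) = X g ^\<^sub>m k"
  by (induction k) (auto simp: is_rep_one is_rep_mult is_rep_carrier nat_pow_Suc carrier_matD[OF is_rep_carrier])

lemma irreducible_repD:
  assumes "irreducible_rep G n X"
  shows "n > 0" "is_rep G n X"
    "lin_subspace n W \<Longrightarrow> invariant G X W \<Longrightarrow> W = {0\<^sub>v n} \<or> W = carrier_vec n"
  using assms by (auto simp: irreducible_rep_iff)

lemma rep_reducible_blocks:
  assumes X: "is_rep G n (X :: 'a \<Rightarrow> 'k::field mat)" and n: "n > 0" and red: "\<not> irreducible_rep G n X"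
  obtains d P Q where "0 < d" "d < n" "P \<in> carrier_mat n n" "Q \<in> carrier_mat n n"
    "P * Q = 1\<^sub>m n" "Q * P = 1\<^sub>m n"
    "\<And>g. g \<in> carrier G \<Longrightarrow> block_upper n d (Q * X g * P)"
proof -
  obtain W where W: "lin_subspace n W" "invariant G X W" "W \<noteq> {0\<^sub>v n}" "W \<noteq> carrier_vec n"
    using X n red by (auto simp: irreducible_rep_iff)
  from invariant_block[OF W(1,3,4)] obtain d P Q where d: "0 < d" "d < n" "P \<in> carrier_mat n n" "Q \<in> carrier_mat n n"
    "P * Q = 1\<^sub>m n" "Q * P = 1\<^sub>m n"
    "\<And>A. A \<in> carrier_mat n n \<Longrightarrow> (\<And>w. w \<in> W \<Longrightarrow> A *\<^sub>v w \<in> W) \<Longrightarrow> block_upper n d (Q * A * P)" by blast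
  show thesis
    by (rule that[OF d(1-6)]) (use d(7) X W(2) in \<open>auto simp: is_rep_def invariant_def\<close>)
qed

text \<open>The first \<open>d\<close> columns of \<open>P\<close> span an invariant subspace, so
  they embed the action on the upper left block.\<close>

lemma block_embedding:
  assumes b: "block_upper n d (Q * A * P)" and A: "A \<in> carrier_mat n n" and d: "d \<le> n"
    and P: "P \<in> carrier_mat n n" "Q \<in> carrier_mat n n" "P * Q = 1\<^sub>m n"
  shows "A * mat n d (\<lambda>(i,j). P $$ (i,j)) = mat n d (\<lambda>(i,j). P $$ (i,j)) * upper_left d (Q * A * P :: 'k::comm_ring_1 mat)"
proof (rule eq_matI)
  fix i j assume "i < dim_row (mat n d (\<lambda>(i,j). P $$ (i,j)) * upper_left d (Q * A * P))"
    "j < dim_col (mat n d (\<lambda>(i,j). P $$ (i,j)) * upper_left d (Q * A * P))"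
  then have ij: "i < n" "j < d" by (auto simp: upper_left_def)
  have "A * P = P * (Q * A * P)"
  proof -
    have "P * (Q * A * P) = P * (Q * (A * P))" using assms by (simp add: assoc_mult_mat[of _ n n _ n _ n])
    also have "\<dots> = P * Q * (A * P)" using assms assoc_mult_mat[of P n n Q n "A * P" n] by simp
    finally show ?thesis using assms by simp
  qed
  then have "(A * P) $$ (i,j) = (P * (Q * A * P)) $$ (i,j)" by simp
  also have "\<dots> = (\<Sum>l<n. P $$ (i,l) * (Q * A * P) $$ (l,j))"
    using assms ij by (simp add: scalar_prod_def lessThan_atLeast0 del: index_mult_mat(1))
      (simp add: index_mult_mat(1)[of _ P] scalar_prod_def)
  also have "\<dots> = (\<Sum>l<d. P $$ (i,l) * (Q * A * P) $$ (l,j))"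
    by (rule sum.mono_neutral_right) (use d b ij in \<open>auto simp: block_upper_def\<close>)
  also have "\<dots> = (mat n d (\<lambda>(i,j). P $$ (i,j)) * upper_left d (Q * A * P)) $$ (i,j)"
    using ij by (simp add: scalar_prod_def upper_left_def lessThan_atLeast0)
  also have "(A * P) $$ (i,j) = (A * mat n d (\<lambda>(i,j). P $$ (i,j))) $$ (i,j)"
    using ij assms by (simp add: scalar_prod_def)
  finally show "(A * mat n d (\<lambda>(i,j). P $$ (i,j))) $$ (i,j) = (mat n d (\<lambda>(i,j). P $$ (i,j)) * upper_left d (Q * A * P)) $$ (i,j)" .
qed (use A in \<open>auto simp: upper_left_def\<close>)

lemma inj_mat_first_cols:
  assumes P: "P \<in> carrier_mat n n" "Q \<in> carrier_mat n n" "Q * P = 1\<^sub>m n" and d: "d \<le> n"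
  shows "inj_mat (mat n d (\<lambda>(i,j). (P :: 'k::field mat) $$ (i,j)))"
  unfolding inj_mat_def
proof (intro ballI impI)
  let ?S = "mat n d (\<lambda>(i,j). P $$ (i,j))"
  fix v assume v: "v \<in> carrier_vec (dim_col ?S)" and z: "?S *\<^sub>v v = 0\<^sub>v (dim_row ?S)"
  define u where "u = vec n (\<lambda>i. if i < d then v $ i else 0)"
  have u: "u \<in> carrier_vec n" by (simp add: u_def)
  have "P *\<^sub>v u = ?S *\<^sub>v v"
  proof (rule eq_vecI)
    fix i assume i: "i < dim_vec (?S *\<^sub>v v)"
    have "(P *\<^sub>v u) $ i = (\<Sum>l<n. P $$ (i,l) * u $ l)"
      using i P u by (simp add: scalar_prod_def lessThan_atLeast0)
    also have "\<dots> = (\<Sum>l<d. P $$ (i,l) * u $ l)"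
      by (rule sum.mono_neutral_right) (use d in \<open>auto simp: u_def\<close>)
    also have "\<dots> = (?S *\<^sub>v v) $ i"
      using i v d by (simp add: scalar_prod_def lessThan_atLeast0 u_def)
    finally show "(P *\<^sub>v u) $ i = (?S *\<^sub>v v) $ i" .
  qed (use P in auto)
  then have "Q *\<^sub>v (P *\<^sub>v u) = Q *\<^sub>v 0\<^sub>v n" using z by simp
  then have "u = 0\<^sub>v n" using inverse_mult_mat_vec[OF P(2,1,3) u] P by (simp add: mult_mat_zero_vec)
  then have "u $ i = 0" if "i < d" for i using that d by simp
  then show "v = 0\<^sub>v (dim_col ?S)" using v d by (intro eq_vecI) (auto simp: u_def)
qed

text \<open>Descend through invariant subspaces; \<open>S\<close> is the composite of the
  inclusions. The last alternative records that the inclusion is proper when \<open>X\<close> is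
  reducible, for the rank argument in \<open>endomorphisms_scalar_imp_irreducible\<close>.\<close>

lemma irreducible_sub_exists:
  assumes X: "is_rep G n (X :: 'a \<Rightarrow> 'k::field mat)" and n: "n > 0"
  obtains d Y S where "irreducible_rep G d Y" "S \<in> carrier_mat n d" "inj_mat S"
    "\<And>g. g \<in> carrier G \<Longrightarrow> X g * S = S * Y g" "irreducible_rep G n X \<or> d < n"
proof -
  have "\<exists>d Y S. irreducible_rep G d Y \<and> S \<in> carrier_mat n d \<and> inj_mat S \<and>
    (\<forall>g\<in>carrier G. X g * S = S * Y g) \<and> (irreducible_rep G n X \<or> d < n)" using X n
  proof (induction n arbitrary: X rule: less_induct)
    case (less n)
    show ?case
    proof (cases "irreducible_rep G n X")
      case True
      then show ?thesis using less.prems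
        by (intro exI[of _ n] exI[of _ X] exI[of _ "1\<^sub>m n"]) (auto simp: is_rep_def inj_mat_def)
    next
      case False
      from rep_reducible_blocks[OF less.prems False] obtain d P Q where
        d: "0 < d" "d < n" and P: "P \<in> carrier_mat n n" "Q \<in> carrier_mat n n"
        "P * Q = 1\<^sub>m n" "Q * P = 1\<^sub>m n" and b: "\<And>g. g \<in> carrier G \<Longrightarrow> block_upper n d (Q * X g * P)" by blast
      let ?T = "mat n d (\<lambda>(i,j). P $$ (i,j))"
      define Y where "Y g = upper_left d (Q * X g * P)" for g
      have Y: "is_rep G d Y" unfolding Y_def
        by (rule is_rep_upper_left[OF monoid_axioms is_rep_conj[OF less.prems(1) P] b])
      from less.IH[OF d(2) Y d(1)] obtain e Z S where S: "irreducible_rep G e Z" "S \<in> carrier_mat d e" "inj_mat S"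
        "\<And>g. g \<in> carrier G \<Longrightarrow> Y g * S = S * Z g" by blast
      have e: "e < n" using inj_mat_le[OF S(2,3)] d by simp
      have TS: "?T * S \<in> carrier_mat n e" using S by (intro mult_carrier_mat[of _ _ d]) auto
      have it: "inj_mat ?T" by (rule inj_mat_first_cols[OF P(1,2,4)]) (use d in simp)
      have "inj_mat (?T * S)" unfolding inj_mat_def
      proof (intro ballI impI)
        fix v assume v: "v \<in> carrier_vec (dim_col (?T * S))" and z: "?T * S *\<^sub>v v = 0\<^sub>v (dim_row (?T * S))"
        have v': "v \<in> carrier_vec e" using v S by simp
        have "?T *\<^sub>v (S *\<^sub>v v) = 0\<^sub>v n"
          using z assoc_mult_mat_vec[of ?T n d S e v] S v' by simp
        moreover have "S *\<^sub>v v \<in> carrier_vec d" using S v' by simp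
        ultimately have "S *\<^sub>v v = 0\<^sub>v d" using it by (simp add: inj_mat_def)
        then show "v = 0\<^sub>v (dim_col (?T * S))" using S v' by (simp add: inj_mat_def)
      qed
      moreover have "X g * (?T * S) = ?T * S * Z g" if g: "g \<in> carrier G" for g
      proof -
        have Xg: "X g \<in> carrier_mat n n" and Zg: "Z g \<in> carrier_mat e e" and Yg: "Y g \<in> carrier_mat d d"
          using g less.prems(1) irreducible_repD(2)[OF S(1)] Y by (auto simp: is_rep_def)
        have "X g * (?T * S) = X g * ?T * S"
          using Xg S assoc_mult_mat[of "X g" n n ?T d S e] by simp
        also have "X g * ?T = ?T * Y g" unfolding Y_def
          by (rule block_embedding[OF b[OF g] Xg _ P(1-3)]) (use d in simp)
        also have "?T * Y g * S = ?T * (Y g * S)" using Yg S assoc_mult_mat[of ?T n d "Y g" d S e] by simp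
        also have "Y g * S = S * Z g" by (rule S(4)[OF g])
        also have "?T * (S * Z g) = ?T * S * Z g" using Zg S assoc_mult_mat[of ?T n d S e "Z g" e] by simp
        finally show ?thesis .
      qed
      ultimately show ?thesis using S(1) TS e by blast
    qed
  qed
  then show thesis using that by blast
qed

lemma lin_subspace_kernel:
  assumes "S \<in> carrier_mat n m"
  shows "lin_subspace m {v \<in> carrier_vec m. S *\<^sub>v v = (0\<^sub>v n :: 'k::field vec)}"
  using assms by (auto simp: lin_subspace_def mult_add_distrib_mat_vec mult_mat_vec intro!: eq_vecI)

lemma lin_subspace_image:
  assumes "S \<in> carrier_mat n m"
  shows "lin_subspace n ((\<lambda>v. S *\<^sub>v v :: 'k::field vec) ` carrier_vec m)"
  unfolding lin_subspace_def
proof (intro conjI ballI allI)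
  show "0\<^sub>v n \<in> (\<lambda>v. S *\<^sub>v v) ` carrier_vec m"
    using assms by (intro image_eqI[of _ _ "0\<^sub>v m"]) (auto intro!: eq_vecI)
next
  fix u v assume "u \<in> (\<lambda>v. S *\<^sub>v v) ` carrier_vec m" "v \<in> (\<lambda>v. S *\<^sub>v v) ` carrier_vec m"
  then show "u + v \<in> (\<lambda>v. S *\<^sub>v v) ` carrier_vec m"
    using assms by (auto simp flip: mult_add_distrib_mat_vec)
next
  fix c v assume "v \<in> (\<lambda>v. S *\<^sub>v v) ` carrier_vec m"
  then show "c \<cdot>\<^sub>v v \<in> (\<lambda>v. S *\<^sub>v v) ` carrier_vec m"
    using assms by (auto simp flip: mult_mat_vec)
qed (use assms in auto)

text \<open>The kernel and the image of \<open>S\<close> are invariant, so \<open>S\<close> is both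
  injective and surjective.\<close>

lemma schur:
  assumes X: "irreducible_rep G n X" and Y: "irreducible_rep G m Y"
    and S: "S \<in> carrier_mat n m" "\<And>g. g \<in> carrier G \<Longrightarrow> X g * S = S * Y g"
    and nz: "S \<noteq> 0\<^sub>m n m"
  shows "n = m" "\<exists>R\<in>carrier_mat n n. S * R = 1\<^sub>m n \<and> R * S = (1\<^sub>m n :: 'k::field mat)"
proof -
  note Xr = irreducible_repD(2)[OF X] and Yr = irreducible_repD(2)[OF Y]
  have comm: "X g *\<^sub>v (S *\<^sub>v v) = S *\<^sub>v (Y g *\<^sub>v v)" if "g \<in> carrier G" "v \<in> carrier_vec m" for g v
  proof -
    have "X g *\<^sub>v (S *\<^sub>v v) = X g * S *\<^sub>v v"
      using is_rep_carrier[OF Xr that(1)] S that assoc_mult_mat_vec[of "X g" n n S m v] by simp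
    also have "\<dots> = S *\<^sub>v (Y g *\<^sub>v v)"
      using is_rep_carrier[OF Yr that(1)] S that assoc_mult_mat_vec[of S n m "Y g" m v] by simp
    finally show ?thesis .
  qed
  have "\<exists>u\<in>carrier_vec m. S *\<^sub>v u \<noteq> 0\<^sub>v n"
  proof (rule ccontr)
    assume neg: "\<not> (\<exists>u\<in>carrier_vec m. S *\<^sub>v u \<noteq> 0\<^sub>v n)"
    then have "S *\<^sub>v v = 0\<^sub>v n" if "v \<in> carrier_vec m" for v
      using that neg by blast
    then have "S *\<^sub>v v = 0\<^sub>m n m *\<^sub>v v" if "v \<in> carrier_vec m" for v
      using that by (auto intro!: eq_vecI)
    then show False using nz mat_eqI_mult_vec[OF S(1), of "0\<^sub>m n m"] by auto
  qed
  then obtain u where u: "u \<in> carrier_vec m" "S *\<^sub>v u \<noteq> 0\<^sub>v n" by blast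
  let ?K = "{v \<in> carrier_vec m. S *\<^sub>v v = 0\<^sub>v n}"
  have "invariant G Y ?K" unfolding invariant_def
  proof (intro ballI)
    fix g w assume g: "g \<in> carrier G" and w: "w \<in> ?K"
    have "S *\<^sub>v (Y g *\<^sub>v w) = X g *\<^sub>v 0\<^sub>v n" using comm[OF g, of w] w by simp
    also have "\<dots> = 0\<^sub>v n" using is_rep_carrier[OF Xr g] by (intro eq_vecI) auto
    finally show "Y g *\<^sub>v w \<in> ?K" using is_rep_carrier[OF Yr g] w by simp
  qed
  then have "?K = {0\<^sub>v m} \<or> ?K = carrier_vec m"
    by (rule irreducible_repD(3)[OF Y lin_subspace_kernel[OF S(1)]])
  then have K: "?K = {0\<^sub>v m}" using u by blast
  then have inj: "inj_mat S" using S(1) by (auto simp: inj_mat_def)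
  let ?I = "(\<lambda>v. S *\<^sub>v v) ` carrier_vec m"
  have "invariant G X ?I" unfolding invariant_def
  proof (intro ballI)
    fix g w assume g: "g \<in> carrier G" and w: "w \<in> ?I"
    then obtain v where v: "v \<in> carrier_vec m" "w = S *\<^sub>v v" by auto
    then have "X g *\<^sub>v w = S *\<^sub>v (Y g *\<^sub>v v)" using comm g by simp
    then show "X g *\<^sub>v w \<in> ?I" using is_rep_carrier[OF Yr g] v by simp
  qed
  then have "?I = {0\<^sub>v n} \<or> ?I = carrier_vec n"
    by (rule irreducible_repD(3)[OF X lin_subspace_image[OF S(1)]])
  then have "?I = carrier_vec n" using u by blast
  then have "\<exists>v\<in>carrier_vec m. S *\<^sub>v v = w" if "w \<in> carrier_vec n" for w
    using that by (metis imageE)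
  then have "n \<le> m" by (rule surj_mat_ge[OF S(1)])
  then show nm: "n = m" using inj_mat_le[OF S(1) inj] by simp
  show "\<exists>R\<in>carrier_mat n n. S * R = 1\<^sub>m n \<and> R * S = 1\<^sub>m n"
    using inj_square_invertible[of S n] S(1) inj nm by simp
qed

text \<open>Over an algebraically closed field \<open>S\<close> has a nonzero eigenspace; it is
  invariant, hence everything.\<close>

lemma schur_scalar:
  assumes X: "irreducible_rep G n X"
    and S: "S \<in> carrier_mat n n" "\<And>g. g \<in> carrier G \<Longrightarrow> X g * S = S * X g"
  shows "\<exists>c. S = c \<cdot>\<^sub>m (1\<^sub>m n :: 'k::alg_closed_field mat)"
proof -
  note Xr = irreducible_repD(2)[OF X]
  obtain a v where v: "v \<in> carrier_vec n" "v \<noteq> 0\<^sub>v n" "S *\<^sub>v v = a \<cdot>\<^sub>v v"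
    using eigenvalue_exists[OF S(1) irreducible_repD(1)[OF X]] by blast
  let ?W = "{v \<in> carrier_vec n. S *\<^sub>v v = a \<cdot>\<^sub>v v}"
  have "invariant G X ?W" unfolding invariant_def
  proof (intro ballI)
    fix g w assume g: "g \<in> carrier G" and w: "w \<in> ?W"
    note Xg = is_rep_carrier[OF Xr g]
    have "S *\<^sub>v (X g *\<^sub>v w) = S * X g *\<^sub>v w" using Xg S w assoc_mult_mat_vec[of S n n "X g" n w] by simp
    also have "\<dots> = X g *\<^sub>v (S *\<^sub>v w)" using S(2)[OF g] Xg S w assoc_mult_mat_vec[of "X g" n n S n w] by simp
    also have "\<dots> = a \<cdot>\<^sub>v (X g *\<^sub>v w)" using w Xg by (simp add: mult_mat_vec)
    finally show "X g *\<^sub>v w \<in> ?W" using Xg w by simp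
  qed
  then have "?W = {0\<^sub>v n} \<or> ?W = carrier_vec n"
    by (rule irreducible_repD(3)[OF X lin_subspace_eigenspace[OF S(1)]])
  then have "?W = carrier_vec n" using v by blast
  then have "S = a \<cdot>\<^sub>m 1\<^sub>m n" by (intro scalar_if_eigenspace_full[OF S(1)]) blast
  then show ?thesis ..
qed

definition dual_rep :: "('a \<Rightarrow> 'k mat) \<Rightarrow> 'a \<Rightarrow> 'k mat" where
  "dual_rep X g = (X (inv g))\<^sup>T"

lemma is_rep_dual:
  assumes X: "is_rep G n (X :: 'a \<Rightarrow> 'k::field mat)"
  shows "is_rep G n (dual_rep X)"
  unfolding is_rep_def
proof (intro conjI ballI)
  fix g h assume g: "g \<in> carrier G" and h: "h \<in> carrier G"
  have "X (inv h) \<in> carrier_mat n n" "X (inv g) \<in> carrier_mat n n" using X g h by (auto simp: is_rep_def)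
  then show "dual_rep X (g \<otimes> h) = dual_rep X g * dual_rep X h"
    using X g h by (simp add: dual_rep_def inv_mult_group is_rep_mult[of _ n] transpose_mult[of _ n n _ n])
qed (use X in \<open>auto simp: dual_rep_def is_rep_def\<close>)

text \<open>A proper nonzero invariant subspace \<open>W\<close> for the dual has a proper nonzero
  annihilator \<open>U\<close>, which is invariant under \<open>X\<close>.\<close>

lemma irreducible_dual:
  assumes X: "irreducible_rep G n (X :: 'a \<Rightarrow> 'k::field mat)"
  shows "irreducible_rep G n (dual_rep X)"
  unfolding irreducible_rep_iff
proof (intro conjI allI impI)
  note Xr = irreducible_repD(2)[OF X]
  fix W assume W: "lin_subspace n W \<and> invariant G (dual_rep X) W"
  show "W = {0\<^sub>v n} \<or> W = carrier_vec n"
  proof (rule ccontr)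
    assume "\<not> ?thesis"
    then have W1: "W \<noteq> {0\<^sub>v n}" "W \<noteq> carrier_vec n" by auto
    have Wc: "W \<subseteq> carrier_vec n" using W by (simp add: lin_subspace_def)
    define U where "U = {u \<in> carrier_vec n. \<forall>w\<in>W. w \<bullet> u = 0}"
    have "lin_subspace n U"
      using Wc by (auto simp: U_def lin_subspace_def scalar_prod_add_distrib[of _ n] subset_iff)
    moreover have "invariant G X U" unfolding invariant_def
    proof (intro ballI)
      fix g u assume g: "g \<in> carrier G" and u: "u \<in> U"
      have "w \<bullet> (X g *\<^sub>v u) = 0" if w: "w \<in> W" for w
      proof -
        have Xg: "X g \<in> carrier_mat n n" using Xr g by (simp add: is_rep_def)
        have "dual_rep X (inv g) *\<^sub>v w \<in> W" using W w g by (auto simp: invariant_def)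
        then have "((X g)\<^sup>T *\<^sub>v w) \<bullet> u = 0" using u g by (simp add: dual_rep_def U_def)
        moreover have "((X g)\<^sup>T *\<^sub>v w) \<bullet> u = w \<bullet> (X g *\<^sub>v u)"
          using transpose_vec_mult_scalar[OF Xg, of u w] u w Wc by (auto simp: U_def)
        ultimately show ?thesis by simp
      qed
      then show "X g *\<^sub>v u \<in> U" using u Xr g by (auto simp: U_def is_rep_def)
    qed
    ultimately have "U = {0\<^sub>v n} \<or> U = carrier_vec n" by (rule irreducible_repD(3)[OF X])
    moreover have "U \<noteq> carrier_vec n"
    proof
      assume "U = carrier_vec n"
      then have z: "w \<bullet> u = 0" if "w \<in> W" "u \<in> carrier_vec n" for w u using that by (auto simp: U_def)
      have "W \<subseteq> {0\<^sub>v n}"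
      proof
        fix w assume w: "w \<in> W"
        have wc: "w \<in> carrier_vec n" using w Wc by auto
        have "w $ i = 0" if "i < n" for i
          using z[OF w, of "unit_vec n i"] scalar_prod_right_unit[OF that, of w] by simp
        then have "w = 0\<^sub>v n" using wc by (intro eq_vecI) auto
        then show "w \<in> {0\<^sub>v n}" by simp
      qed
      then show False using W1 W by (auto simp: lin_subspace_def)
    qed
    moreover have "U \<noteq> {0\<^sub>v n}"
    proof -
      from block_decomposition[OF conjunct1[OF W] W1] obtain d P Q where d: "0 < d" "d < n"
        and P: "P \<in> carrier_mat n n" and Q: "Q \<in> carrier_mat n n" and PQ: "P * Q = 1\<^sub>m n" "Q * P = 1\<^sub>m n"
        and key: "\<And>v. v \<in> carrier_vec n \<Longrightarrow> P *\<^sub>v v \<in> W \<longleftrightarrow> (\<forall>i. d \<le> i \<longrightarrow> i < n \<longrightarrow> v $ i = 0)" by blast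
      \<comment> \<open>In coordinates adapted to \<open>W\<close> the last entry of
        \<open>Q *\<^sub>v w\<close> is 0 for \<open>w\<close> in \<open>W\<close>, so the last row
        of \<open>Q\<close> is a nonzero vector annihilating \<open>W\<close>.\<close>
      define r where "r = row Q (n - 1)"
      have r: "r \<in> carrier_vec n" unfolding r_def using Q by (intro carrier_vecI) simp
      have "w \<bullet> r = 0" if w: "w \<in> W" for w
      proof -
        have wc: "w \<in> carrier_vec n" using w Wc by auto
        have "P *\<^sub>v (Q *\<^sub>v w) \<in> W" by (simp only: inverse_mult_mat_vec[OF P Q PQ(1) wc] w)
        moreover have "Q *\<^sub>v w \<in> carrier_vec n" using wc Q by simp
        ultimately have "\<forall>i. d \<le> i \<longrightarrow> i < n \<longrightarrow> (Q *\<^sub>v w) $ i = 0" using key by blast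
        then have "(Q *\<^sub>v w) $ (n - 1) = 0" using d by auto
        then have "r \<bullet> w = 0" using Q d by (simp add: r_def)
        then show ?thesis using comm_scalar_prod[OF r wc] by simp
      qed
      then have "r \<in> U" using r by (simp add: U_def)
      moreover have "r \<noteq> 0\<^sub>v n"
      proof
        assume "r = 0\<^sub>v n"
        then have "r \<bullet> col P (n - 1) = 0" using P by (simp add: scalar_prod_def)
        then have "(Q * P) $$ (n - 1, n - 1) = 0" using P Q d by (simp add: r_def)
        then show False using PQ d by simp
      qed
      ultimately show ?thesis by blast
    qed
    ultimately show False by blast
  qed
qed (use irreducible_repD[OF X] is_rep_dual in auto)

text \<open>Transpose the inclusion of an irreducible subrepresentation of the dual.\<close>

lemma irreducible_quotient_exists:
  assumes X: "is_rep G n (X :: 'a \<Rightarrow> 'k::field mat)" and n: "n > 0"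
  obtains d Z R where "irreducible_rep G d Z" "R \<in> carrier_mat d n" "R \<noteq> 0\<^sub>m d n"
    "\<And>g. g \<in> carrier G \<Longrightarrow> R * X g = Z g * R"
proof -
  from irreducible_sub_exists[OF is_rep_dual[OF X] n] obtain d Y S where
    Y: "irreducible_rep G d Y" and S: "S \<in> carrier_mat n d" "inj_mat S"
    "\<And>g. g \<in> carrier G \<Longrightarrow> dual_rep X g * S = S * Y g" by metis
  have "S\<^sup>T * X g = dual_rep Y g * S\<^sup>T" if g: "g \<in> carrier G" for g
  proof -
    have Xg: "X g \<in> carrier_mat n n" and Yg: "Y (inv g) \<in> carrier_mat d d"
      using X irreducible_repD(2)[OF Y] g by (auto simp: is_rep_def)
    have "(X g)\<^sup>T * S = S * Y (inv g)" using S(3)[of "inv g"] g by (simp add: dual_rep_def)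
    then have "((X g)\<^sup>T * S)\<^sup>T = (S * Y (inv g))\<^sup>T" by simp
    then show ?thesis
      using Xg Yg S(1) transpose_mult[of "(X g)\<^sup>T" n n S d] transpose_mult[of S n d "Y (inv g)" d]
      by (simp add: dual_rep_def)
  qed
  moreover have "S\<^sup>T \<noteq> 0\<^sub>m d n"
  proof
    assume "S\<^sup>T = 0\<^sub>m d n"
    then have "S = 0\<^sub>m n d" by (metis transpose_transpose zero_transpose_mat)
    then have "S *\<^sub>v unit_vec d 0 = 0\<^sub>v n" by (auto intro!: eq_vecI)
    then have "unit_vec d 0 = (0\<^sub>v d :: 'k vec)" using S by (auto simp: inj_mat_def)
    then have "unit_vec d 0 $ 0 = (0\<^sub>v d :: 'k vec) $ 0" by simp
    then show False using irreducible_repD(1)[OF Y] by simp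
  qed
  ultimately show thesis using that[OF irreducible_dual[OF Y], of "S\<^sup>T"] S(1) by simp
qed

end

lemma linear_map_matrix:
  assumes c: "\<And>v. v \<in> carrier_vec m \<Longrightarrow> f v \<in> carrier_vec n"
    and a: "\<And>u v. u \<in> carrier_vec m \<Longrightarrow> v \<in> carrier_vec m \<Longrightarrow> f (u + v) = f u + f v"
    and s: "\<And>c v. v \<in> carrier_vec m \<Longrightarrow> f (c \<cdot>\<^sub>v v) = c \<cdot>\<^sub>v (f v :: 'k::field vec)"
  shows "\<exists>S\<in>carrier_mat n m. \<forall>v\<in>carrier_vec m. f v = S *\<^sub>v v"
proof -
  define S where "S = mat n m (\<lambda>(i,j). f (unit_vec m j) $ i)"
  have "f v = S *\<^sub>v v" if v: "v \<in> carrier_vec m" for v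
  proof -
    have p: "f (vec m (\<lambda>i. if i < t then v $ i else 0)) $ i = (\<Sum>j<t. S $$ (i,j) * v $ j)"
      if "t \<le> m" "i < n" for t i using that
    proof (induction t)
      case 0
      have "f (0 \<cdot>\<^sub>v 0\<^sub>v m) = 0 \<cdot>\<^sub>v f (0\<^sub>v m)" by (rule s) simp
      moreover have "vec m (\<lambda>i. if i < 0 then v $ i else 0) = 0 \<cdot>\<^sub>v 0\<^sub>v m" by (intro eq_vecI) auto
      ultimately show ?case using c[of "0\<^sub>v m"] 0 by simp
    next
      case (Suc t)
      let ?v = "\<lambda>t. vec m (\<lambda>i. if i < t then v $ i else 0)"
      have "?v (Suc t) = ?v t + (v $ t) \<cdot>\<^sub>v unit_vec m t"
        using Suc.prems by (intro eq_vecI) (auto simp: less_Suc_eq)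
      then have "f (?v (Suc t)) = f (?v t) + (v $ t) \<cdot>\<^sub>v f (unit_vec m t)"
        using a s by simp
      then show ?case using Suc c[of "?v t"] c[of "unit_vec m t"]
        by (simp add: S_def mult.commute)
    qed
    have vv: "vec m (\<lambda>i. if i < m then v $ i else 0) = v" using v by (intro eq_vecI) auto
    show ?thesis
    proof (rule eq_vecI)
      fix i assume i: "i < dim_vec (S *\<^sub>v v)"
      then have "f v $ i = (\<Sum>j<m. S $$ (i,j) * v $ j)" using p[of m i] vv by (simp add: S_def)
      also have "\<dots> = (S *\<^sub>v v) $ i" using i v by (simp add: S_def scalar_prod_def lessThan_atLeast0)
      finally show "f v $ i = (S *\<^sub>v v) $ i" .
    qed (use c[OF v] in \<open>auto simp: S_def\<close>)
  qed
  moreover have "S \<in> carrier_mat n m" by (simp add: S_def)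
  ultimately show ?thesis by blast
qed

text \<open>Keep the sample points of the induction hypothesis. Expanding along the new last column
  writes the determinant as a combination of the functions in which the new function has the old
  minor as its coefficient. This is nonzero, so independence yields a point where the combination
  does not vanish.\<close>

lemma nonzero_minor:
  fixes f :: "nat \<Rightarrow> 'b \<Rightarrow> 'k::field"
  assumes "\<And>c. (\<And>x. x \<in> A \<Longrightarrow> (\<Sum>i<r. c i * f i x) = 0) \<Longrightarrow> \<forall>i<r. c i = 0"
  shows "\<exists>pt. (\<forall>j<r. pt j \<in> A) \<and> det (mat r r (\<lambda>(i,j). f i (pt j))) \<noteq> 0"
  using assms
proof (induction r)
  case 0
  then show ?case by (intro exI[of _ undefined]) simp
next
  case (Suc r)
  have "\<exists>pt. (\<forall>j<r. pt j \<in> A) \<and> det (mat r r (\<lambda>(i,j). f i (pt j))) \<noteq> 0"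
  proof (rule Suc.IH)
    fix c assume "\<And>x. x \<in> A \<Longrightarrow> (\<Sum>i<r. c i * f i x) = 0"
    then have "\<forall>i<Suc r. (if i < r then c i else 0) = 0"
      by (intro Suc.prems) auto
    then show "\<forall>i<r. c i = 0" by (metis less_Suc_eq)
  qed
  then obtain pt where pt: "\<And>j. j < r \<Longrightarrow> pt j \<in> A" "det (mat r r (\<lambda>(i,j). f i (pt j))) \<noteq> 0" by auto
  define D where "D x = mat (Suc r) (Suc r) (\<lambda>(i,j). if j < r then f i (pt j) else f i x)" for x
  \<comment> \<open>Deleting the last column removes the dependence on the new point, so these
    cofactors may be computed at any argument.\<close>
  define c where "c i = cofactor (D undefined) i r" for i
  have del: "mat_delete (D x) i r = mat_delete (D undefined) i r" for x i
    by (auto simp: mat_delete_def D_def intro!: eq_matI)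
  have Dr: "i < Suc r \<Longrightarrow> D x $$ (i,r) = f i x" for x i by (simp add: D_def)
  have dD: "det (D x) = (\<Sum>i<Suc r. c i * f i x)" for x
  proof -
    have "det (D x) = (\<Sum>i<Suc r. D x $$ (i,r) * cofactor (D x) i r)"
      by (rule laplace_expansion_column) (auto simp: D_def)
    also have "\<dots> = (\<Sum>i<Suc r. c i * f i x)"
      by (intro sum.cong) (simp_all add: c_def cofactor_def del[of x] Dr)
    finally show ?thesis .
  qed
  have "mat_delete (D undefined) r r = mat r r (\<lambda>(i,j). f i (pt j))"
    by (auto simp: mat_delete_def D_def intro!: eq_matI)
  then have "c r \<noteq> 0" using pt(2) by (simp add: c_def cofactor_def)
  then obtain x where x: "x \<in> A" "det (D x) \<noteq> 0" using Suc.prems[of c] unfolding dD by blast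
  have "mat (Suc r) (Suc r) (\<lambda>(i,j). f i ((pt(r := x)) j)) = D x"
    by (auto simp: D_def intro!: eq_matI)
  then show ?case using x pt(1) by (intro exI[of _ "pt(r := x)"]) (auto simp: less_Suc_eq)
qed

text \<open>Raising to the power \<open>q\<close> is additive in this characteristic and acts on
  each eigenvalue.\<close>

lemma mtrace_power_char:
  assumes A: "A \<in> carrier_mat n n" and "prime CHAR('k::alg_closed_field)" "q = CHAR('k) ^ e"
  shows "mtrace (A ^\<^sub>m q) = mtrace (A :: 'k mat) ^ q"
proof -
  have "(\<Sum>a\<in>#E. a ^ q) = (\<Sum>\<^sub># E) ^ q" for E :: "'k multiset"
  proof (induction E)
    case empty
    then show ?case using assms by (simp add: prime_gt_0_nat power_0_left)
  next
    case (add x E)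
    then show ?case using freshmans_dream'[OF assms(2,3), of x "\<Sum>\<^sub># E"] by simp
  qed
  then show ?thesis
    using A by (simp add: mtrace_eq_sum_eigs[of _ n] eigs_power pow_carrier_mat)
qed

section \<open>The p-regular part of an element\<close>

context group
begin

lemma p_regular_iff: "p_regular G p g \<longleftrightarrow> g \<in> carrier G \<and> (\<exists>n. coprime n p \<and> g [^] n = \<one>)"
  unfolding p_regular_def
  by (metis coprime_divisors dvd_refl pow_eq_id pow_ord_eq_1)

lemma pow_mod_ord:
  assumes g: "g \<in> carrier G"
  shows "g [^] (n mod ord g) = g [^] (n :: nat)"
proof -
  have "g [^] n = g [^] (ord g * (n div ord g) + n mod ord g)" by simp
  also have "\<dots> = (g [^] ord g) [^] (n div ord g) \<otimes> g [^] (n mod ord g)"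
    using g by (simp only: nat_pow_mult nat_pow_pow nat_pow_closed)
  finally show ?thesis using g by simp
qed

end

locale finite_modular_group = group G + modular_reduction p red
  for G :: "('a, 'm) monoid_scheme" (structure) and p :: nat and red :: "complex \<Rightarrow> 'k::alg_closed_field" +
  assumes fin: "finite (carrier G)"
begin

abbreviation "regular \<equiv> p_regular G p"
abbreviation "bchar \<equiv> brauer_char p red G"

lemma bchar_eq: "bchar X g = (if regular g then brauer_val (X g) else 0)"
  by (simp add: brauer_char_def brauer_val_def eigs_def)

lemma regular_ord: "regular g \<Longrightarrow> ord g > 0 \<and> coprime (ord g) p"
  using prime_p by (metis coprime_0_left_iff gr0I not_prime_unit p_regular_def)

lemma rep_pow_ord: "is_rep G n X \<Longrightarrow> g \<in> carrier G \<Longrightarrow> X g ^\<^sub>m ord g = 1\<^sub>m n"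
  using rep_pow[of n X g "ord g"] by (simp add: is_rep_one)

text \<open>\<open>h\<close> is the p-regular part of \<open>g\<close>: if the order of
  \<open>g\<close> is \<open>p ^ e * m\<close> with \<open>m\<close> prime to p, take
  \<open>g [^] (p ^ e * k)\<close>, where \<open>k\<close> inverts \<open>p ^ e\<close> modulo
  \<open>m\<close>. Agreement after raising to the power \<open>p ^ e\<close> is the form in which
  traces are compared.\<close>

lemma p_part_decomposition:
  assumes g: "g \<in> carrier G"
  obtains h e where "regular h" "h [^] (p ^ e) = g [^] (p ^ e)"
proof -
  have o: "ord g \<noteq> 0" using ord_ge_1[OF fin g] by simp
  obtain m where m: "ord g = p ^ multiplicity p (ord g) * m" "\<not> p dvd m"
    using multiplicity_decompose'[of "ord g" p] o prime_p not_prime_unit by metis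
  let ?e = "multiplicity p (ord g)"
  have cop: "coprime m p" using m(2) prime_p by (metis coprime_commute prime_imp_coprime)
  then have "coprime (p ^ ?e) m" by (simp add: coprime_commute)
  then obtain k where k: "[p ^ ?e * k = 1] (mod m)" using cong_solve_coprime_nat by (metis One_nat_def)
  let ?h = "g [^] (p ^ ?e * k)"
  have "?h [^] m = g [^] (p ^ ?e * m * k)" using g by (simp add: nat_pow_pow mult_ac)
  also have "\<dots> = g [^] (ord g * k)" using m(1) by metis
  also have "\<dots> = (g [^] ord g) [^] k" using g by (simp only: nat_pow_pow)
  finally have "?h [^] m = (g [^] ord g) [^] k" .
  then have "regular ?h" using g cop by (auto simp: p_regular_iff)
  moreover have "?h [^] (p ^ ?e) = g [^] (p ^ ?e)"
  proof -
    have "[p ^ ?e * k * p ^ ?e = 1 * p ^ ?e] (mod (m * p ^ ?e))"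
      using k by (metis cong_cmult_rightI)
    then have "[p ^ ?e * k * p ^ ?e = p ^ ?e] (mod ord g)" using m(1) by (simp add: mult.commute)
    then have "g [^] (p ^ ?e * k * p ^ ?e) = g [^] (p ^ ?e)"
      using pow_mod_ord g by (metis cong_def)
    then show ?thesis using g by (simp add: nat_pow_pow)
  qed
  ultimately show thesis by (rule that)
qed

text \<open>The two traces have the same \<open>p ^ e\<close>-th power, and this power map is
  injective on a field of characteristic p.\<close>

lemma mtrace_p_part:
  assumes X: "is_rep G n X" and g: "g \<in> carrier G" "h \<in> carrier G" "h [^] (p ^ e) = g [^] (p ^ e)"
  shows "mtrace (X g) = (mtrace (X h) :: 'k)"
proof -
  have pc: "prime CHAR('k)" using prime_p char_p by simp
  have "mtrace (X g) ^ (p ^ e) = mtrace (X g ^\<^sub>m (p ^ e))"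
    using mtrace_power_char[OF is_rep_carrier[OF X g(1)] pc] char_p by simp
  also have "\<dots> = mtrace (X h ^\<^sub>m (p ^ e))"
    using g rep_pow[OF X g(1), of "p ^ e"] rep_pow[OF X g(2), of "p ^ e"] by simp
  also have "\<dots> = mtrace (X h) ^ (p ^ e)"
    using mtrace_power_char[OF is_rep_carrier[OF X g(2)] pc] char_p by simp
  finally have e: "mtrace (X g) ^ (p ^ e) = mtrace (X h) ^ (p ^ e)" .
  have "((mtrace (X g) - mtrace (X h)) + mtrace (X h)) ^ (p ^ e) =
        (mtrace (X g) - mtrace (X h)) ^ (p ^ e) + mtrace (X h) ^ (p ^ e)"
    by (rule freshmans_dream'[OF pc]) (use char_p in simp)
  then have "(mtrace (X g) - mtrace (X h)) ^ (p ^ e) = 0" using e by simp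
  then show ?thesis by simp
qed

end

section \<open>Independence of matrix coefficients and of traces\<close>

context group
begin

text \<open>Entry \<open>b\<close> of \<open>v (i,a)\<close> is the coefficient of the entry
  \<open>(a,b)\<close> of \<open>X i\<close>, so the subject is the linear independence of the
  matrix coefficients of pairwise inequivalent irreducible representations. Rows
  \<open>(i,a)\<close> are added one at a time: the vectors that relations allow at a new row form
  an invariant subspace. If it is zero, the induction hypothesis applies. If it is everything, the
  other vectors of a relation depend on the one at the new row through intertwiners, and Schur's
  lemma leads to a contradiction at the identity.\<close>

lemma coefficient_independence:
  fixes X :: "'i \<Rightarrow> 'a \<Rightarrow> 'k::alg_closed_field mat"
  assumes irr: "\<And>i. i \<in> I \<Longrightarrow> irreducible_rep G (n i) (X i)"
    and ineq: "\<And>i j S. i \<in> I \<Longrightarrow> j \<in> I \<Longrightarrow> i \<noteq> j \<Longrightarrow> S \<in> carrier_mat (n i) (n j) \<Longrightarrow>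
       (\<And>g. g \<in> carrier G \<Longrightarrow> X i g * S = S * X j g) \<Longrightarrow> S = 0\<^sub>m (n i) (n j)"
  shows "finite J \<Longrightarrow> J \<subseteq> Sigma I (\<lambda>i. {..<n i}) \<Longrightarrow> (\<And>i a. (i,a) \<in> J \<Longrightarrow> v (i,a) \<in> carrier_vec (n i)) \<Longrightarrow>
    (\<And>g. g \<in> carrier G \<Longrightarrow> (\<Sum>(i,a)\<in>J. (X i g *\<^sub>v v (i,a)) $ a) = 0) \<Longrightarrow> (i,a) \<in> J \<Longrightarrow> v (i,a) = 0\<^sub>v (n i)"
proof (induction J arbitrary: v i a rule: finite_induct)
  case (insert j0 J)
  obtain i0 a0 where j0: "j0 = (i0,a0)" by (cases j0)
  have i0: "i0 \<in> I" "a0 < n i0" using insert.prems(1) j0 by auto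
  have rep: "is_rep G (n i) (X i)" if "i \<in> I" for i using irreducible_repD(2)[OF irr[OF that]] .
  have JI: "i \<in> I \<and> a < n i" if "(i,a) \<in> insert j0 J" for i a using insert.prems(1) that by auto
  define Rel where "Rel = {v. (\<forall>i a. (i,a) \<in> insert j0 J \<longrightarrow> v (i,a) \<in> carrier_vec (n i)) \<and>
     (\<forall>g\<in>carrier G. (\<Sum>(i,a)\<in>insert j0 J. (X i g *\<^sub>v v (i,a)) $ a) = 0)}"
  have Rc: "v (i,a) \<in> carrier_vec (n i)" if "v \<in> Rel" "(i,a) \<in> insert j0 J" for v i a using that by (auto simp: Rel_def)
  have Rs: "(\<Sum>(i,a)\<in>insert j0 J. (X i g *\<^sub>v v (i,a)) $ a) = 0" if "v \<in> Rel" "g \<in> carrier G" for v g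
    using that by (auto simp: Rel_def)
  have zero: "v (i,a) = 0\<^sub>v (n i)" if v: "v \<in> Rel" "v j0 = 0\<^sub>v (n i0)" and ia: "(i,a) \<in> J" for v i a
  proof (rule insert.IH[OF _ _ _ ia])
    show "J \<subseteq> Sigma I (\<lambda>i. {..<n i})" using insert.prems(1) by auto
    show "\<And>i a. (i,a) \<in> J \<Longrightarrow> v (i,a) \<in> carrier_vec (n i)" using Rc[OF v(1)] by auto
    fix g assume g: "g \<in> carrier G"
    have "(\<Sum>(i,a)\<in>insert j0 J. (X i g *\<^sub>v v (i,a)) $ a) = (X i0 g *\<^sub>v v j0) $ a0 + (\<Sum>(i,a)\<in>J. (X i g *\<^sub>v v (i,a)) $ a)"
      using insert.hyps by (simp add: j0)
    moreover have "(X i0 g *\<^sub>v v j0) $ a0 = 0"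
      using is_rep_carrier[OF rep[OF i0(1)] g] i0 by (simp add: v(2) mult_mat_zero_vec)
    ultimately show "(\<Sum>(i,a)\<in>J. (X i g *\<^sub>v v (i,a)) $ a) = 0" using Rs[OF v(1) g] by simp
  qed
  have add: "(\<lambda>j. u j + v j) \<in> Rel" if u: "u \<in> Rel" and v: "v \<in> Rel" for u v
  proof -
    have "(\<Sum>(i,a)\<in>insert j0 J. (X i g *\<^sub>v (u (i,a) + v (i,a))) $ a) = 0" if g: "g \<in> carrier G" for g
    proof -
      have "(X i g *\<^sub>v (u (i,a) + v (i,a))) $ a = (X i g *\<^sub>v u (i,a)) $ a + (X i g *\<^sub>v v (i,a)) $ a"
        if ia: "(i,a) \<in> insert j0 J" for i a
        using is_rep_carrier[OF rep g, of i] JI[OF ia] Rc[OF u ia] Rc[OF v ia] by (simp add: mult_add_distrib_mat_vec)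
      then have "(\<Sum>(i,a)\<in>insert j0 J. (X i g *\<^sub>v (u (i,a) + v (i,a))) $ a) =
        (\<Sum>(i,a)\<in>insert j0 J. (X i g *\<^sub>v u (i,a)) $ a) + (\<Sum>(i,a)\<in>insert j0 J. (X i g *\<^sub>v v (i,a)) $ a)"
        unfolding sum.distrib[symmetric] by (intro sum.cong) auto
      then show ?thesis using Rs[OF u g] Rs[OF v g] by simp
    qed
    then show ?thesis using Rc[OF u] Rc[OF v] by (auto simp: Rel_def)
  qed
  have smult: "(\<lambda>j. c \<cdot>\<^sub>v v j) \<in> Rel" if v: "v \<in> Rel" for c v
  proof -
    have "(\<Sum>(i,a)\<in>insert j0 J. (X i g *\<^sub>v (c \<cdot>\<^sub>v v (i,a))) $ a) = 0" if g: "g \<in> carrier G" for g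
    proof -
      have "(X i g *\<^sub>v (c \<cdot>\<^sub>v v (i,a))) $ a = c * (X i g *\<^sub>v v (i,a)) $ a"
        if ia: "(i,a) \<in> insert j0 J" for i a
        using is_rep_carrier[OF rep g, of i] JI[OF ia] Rc[OF v ia] by (simp add: mult_mat_vec)
      then have "(\<Sum>(i,a)\<in>insert j0 J. (X i g *\<^sub>v (c \<cdot>\<^sub>v v (i,a))) $ a) =
        c * (\<Sum>(i,a)\<in>insert j0 J. (X i g *\<^sub>v v (i,a)) $ a)"
        unfolding sum_distrib_left by (auto intro!: sum.cong)
      then show ?thesis using Rs[OF v g] by simp
    qed
    then show ?thesis using Rc[OF v] by (auto simp: Rel_def)
  qed
  have act: "(\<lambda>(i,a). X i h *\<^sub>v v (i,a)) \<in> Rel" if v: "v \<in> Rel" and h: "h \<in> carrier G" for h v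
  proof -
    have "(\<Sum>(i,a)\<in>insert j0 J. (X i g *\<^sub>v (X i h *\<^sub>v v (i,a))) $ a) = 0" if g: "g \<in> carrier G" for g
    proof -
      have "X i g *\<^sub>v (X i h *\<^sub>v v (i,a)) = X i (g \<otimes> h) *\<^sub>v v (i,a)"
        if ia: "(i,a) \<in> insert j0 J" for i a
        using is_rep_carrier[OF rep g, of i] is_rep_carrier[OF rep h, of i] JI[OF ia] Rc[OF v ia]
          assoc_mult_mat_vec[of "X i g" "n i" "n i" "X i h" "n i" "v (i,a)"] is_rep_mult[OF rep g h, of i] by simp
      then have "(\<Sum>(i,a)\<in>insert j0 J. (X i g *\<^sub>v (X i h *\<^sub>v v (i,a))) $ a) =
        (\<Sum>(i,a)\<in>insert j0 J. (X i (g \<otimes> h) *\<^sub>v v (i,a)) $ a)"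
        by (intro sum.cong) auto
      then show ?thesis using Rs[OF v, of "g \<otimes> h"] g h by simp
    qed
    moreover have "X i h *\<^sub>v v (i,a) \<in> carrier_vec (n i)" if "(i,a) \<in> insert j0 J" for i a
      using is_rep_carrier[OF rep h, of i] JI[OF that] Rc[OF v that] by simp
    ultimately show ?thesis by (auto simp: Rel_def)
  qed
  define W where "W = (\<lambda>v. v j0) ` Rel"
  have "lin_subspace (n i0) W" unfolding lin_subspace_def
  proof (intro conjI ballI allI)
    show "W \<subseteq> carrier_vec (n i0)" using Rc by (auto simp: W_def j0)
    have "(\<Sum>(i,a)\<in>insert j0 J. (X i g *\<^sub>v 0\<^sub>v (n i)) $ a) = 0" if "g \<in> carrier G" for g
    proof (intro sum.neutral ballI, clarify)
      fix i a assume "(i,a) \<in> insert j0 J"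
      then have "i \<in> I" "a < n i" using JI by auto
      then show "(X i g *\<^sub>v 0\<^sub>v (n i)) $ a = 0"
        using mult_mat_zero_vec[OF is_rep_carrier[OF rep that]] by simp
    qed
    then have "(\<lambda>(i,a). 0\<^sub>v (n i)) \<in> Rel" by (auto simp: Rel_def)
    then show "0\<^sub>v (n i0) \<in> W" unfolding W_def by (rule image_eqI[rotated]) (simp add: j0)
  next
    fix x y assume "x \<in> W" "y \<in> W"
    then obtain u v where "u \<in> Rel" "v \<in> Rel" "x = u j0" "y = v j0" by (auto simp: W_def)
    then show "x + y \<in> W" using add[of u v] unfolding W_def by (intro image_eqI[of _ _ "\<lambda>j. u j + v j"]) auto
  next
    fix c x assume "x \<in> W"
    then obtain u where "u \<in> Rel" "x = u j0" by (auto simp: W_def)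
    then show "c \<cdot>\<^sub>v x \<in> W" using smult[of u c] unfolding W_def by (intro image_eqI[of _ _ "\<lambda>j. c \<cdot>\<^sub>v u j"]) auto
  qed
  moreover have "invariant G (X i0) W" unfolding invariant_def
  proof (intro ballI)
    fix h x assume h: "h \<in> carrier G" and "x \<in> W"
    then obtain u where "u \<in> Rel" "x = u j0" by (auto simp: W_def)
    then show "X i0 h *\<^sub>v x \<in> W" using act[of u h] h unfolding W_def
      by (intro image_eqI[of _ _ "\<lambda>(i,a). X i h *\<^sub>v u (i,a)"]) (auto simp: j0)
  qed
  ultimately have "W = {0\<^sub>v (n i0)} \<or> W = carrier_vec (n i0)"
    by (rule irreducible_repD(3)[OF irr[OF i0(1)]])
  moreover have "W \<noteq> carrier_vec (n i0)"
  proof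
    assume full: "W = carrier_vec (n i0)"
    have "\<forall>w\<in>carrier_vec (n i0). \<exists>v. v \<in> Rel \<and> v j0 = w"
    proof
      fix w :: "'k vec" assume "w \<in> carrier_vec (n i0)"
      then have "w \<in> (\<lambda>v. v j0) ` Rel" using full W_def by simp
      then show "\<exists>v. v \<in> Rel \<and> v j0 = w" by blast
    qed
    then obtain F where F: "\<And>w. w \<in> carrier_vec (n i0) \<Longrightarrow> F w \<in> Rel \<and> F w j0 = w" by metis
    \<comment> \<open>Two relations with the same vector at \<open>j0\<close> differ by a relation
      on \<open>J\<close>, which is zero by induction; hence \<open>F\<close> is linear and commutes
      with the group action.\<close>
    have uniq: "F w (i,a) = v (i,a)" if w: "w \<in> carrier_vec (n i0)" and v: "v \<in> Rel" "v j0 = w" and ia: "(i,a) \<in> J" for w v i a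
    proof -
      have "(\<lambda>j. F w j + (- 1) \<cdot>\<^sub>v v j) \<in> Rel" using add[OF _ smult[OF v(1)], of "F w"] F[OF w] by blast
      moreover have "F w j0 + (- 1) \<cdot>\<^sub>v v j0 = 0\<^sub>v (n i0)" using F[OF w] v w by (intro eq_vecI) auto
      ultimately have z: "F w (i,a) + (- 1) \<cdot>\<^sub>v v (i,a) = 0\<^sub>v (n i)"
        using zero[of "\<lambda>j. F w j + (- 1) \<cdot>\<^sub>v v j"] ia by blast
      have c: "F w (i,a) \<in> carrier_vec (n i)" "v (i,a) \<in> carrier_vec (n i)" using Rc F[OF w] v ia by auto
      show ?thesis
      proof (rule eq_vecI)
        fix l assume l: "l < dim_vec (v (i,a))"
        have "(F w (i,a) + (- 1) \<cdot>\<^sub>v v (i,a)) $ l = 0\<^sub>v (n i) $ l" using z by simp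
        then show "F w (i,a) $ l = v (i,a) $ l" using l c by simp
      qed (use c in auto)
    qed
    have S: "\<exists>c. (\<forall>w\<in>carrier_vec (n i0). F w (i,a) = (if i = i0 then c \<cdot>\<^sub>v w else 0\<^sub>v (n i)))" if ia: "(i,a) \<in> J" for i a
    proof -
      have iI: "i \<in> I" using ia JI by auto
      have "\<exists>S\<in>carrier_mat (n i) (n i0). \<forall>w\<in>carrier_vec (n i0). F w (i,a) = S *\<^sub>v w"
      proof (rule linear_map_matrix)
        show "F v (i,a) \<in> carrier_vec (n i)" if "v \<in> carrier_vec (n i0)" for v using Rc F[OF that] ia by auto
        show "F (u + v) (i,a) = F u (i,a) + F v (i,a)" if "u \<in> carrier_vec (n i0)" "v \<in> carrier_vec (n i0)" for u v
          using uniq[of "u + v" "\<lambda>j. F u j + F v j", OF _ add _ ia] F that by auto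
        show "F (c \<cdot>\<^sub>v v) (i,a) = c \<cdot>\<^sub>v F v (i,a)" if "v \<in> carrier_vec (n i0)" for c v
          using uniq[of "c \<cdot>\<^sub>v v" "\<lambda>j. c \<cdot>\<^sub>v F v j", OF _ smult _ ia] F that by auto
      qed
      then obtain S where S: "S \<in> carrier_mat (n i) (n i0)" "\<And>w. w \<in> carrier_vec (n i0) \<Longrightarrow> F w (i,a) = S *\<^sub>v w" by auto
      have comm: "X i g * S = S * X i0 g" if g: "g \<in> carrier G" for g
      proof -
        have c: "X i g \<in> carrier_mat (n i) (n i)" "X i0 g \<in> carrier_mat (n i0) (n i0)"
          using is_rep_carrier[OF rep g] iI i0 by auto
        show ?thesis
        proof (rule mat_eqI_mult_vec)
          fix w assume w: "(w :: 'k vec) \<in> carrier_vec (n i0)"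
          have "F (X i0 g *\<^sub>v w) (i,a) = (\<lambda>(i,a). X i g *\<^sub>v F w (i,a)) (i,a)"
            by (rule uniq[OF _ act _ ia]) (use F w c g in \<open>auto simp: j0\<close>)
          then have "S *\<^sub>v (X i0 g *\<^sub>v w) = X i g *\<^sub>v (S *\<^sub>v w)" using S w c by simp
          then show "X i g * S *\<^sub>v w = S * X i0 g *\<^sub>v w"
            using S(1) c w assoc_mult_mat_vec[of S "n i" "n i0" "X i0 g" "n i0" w]
              assoc_mult_mat_vec[of "X i g" "n i" "n i" S "n i0" w] by simp
        qed (use c S in auto)
      qed
      show ?thesis
      proof (cases "i = i0")
        case True
        then obtain c where "S = c \<cdot>\<^sub>m 1\<^sub>m (n i0)" using schur_scalar[OF irr[OF i0(1)], of S] S comm by auto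
        then show ?thesis using S True by (intro exI[of _ c]) auto
      next
        case False
        then have "S = 0\<^sub>m (n i) (n i0)" using ineq[OF iI i0(1) False S(1)] comm by auto
        then show ?thesis using S False by (intro exI[of _ 0]) (auto intro!: eq_vecI)
      qed
    qed
    \<comment> \<open>With this unit vector at \<open>j0\<close>, the new row contributes 1 at the
      identity. Every other row contributes 0, because its vector is zero or is a multiple of the
      unit vector read at a position different from \<open>a0\<close>.\<close>
    let ?w = "unit_vec (n i0) a0 :: 'k vec"
    have one: "X i \<one> *\<^sub>v u = u" if "i \<in> I" "u \<in> carrier_vec (n i)" for i u
      using is_rep_one[OF rep[OF that(1)]] that by simp
    have "(\<Sum>(i,a)\<in>insert j0 J. (X i \<one> *\<^sub>v F ?w (i,a)) $ a) = 0" using Rs F by auto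
    then have "(X i0 \<one> *\<^sub>v F ?w j0) $ a0 + (\<Sum>(i,a)\<in>J. (X i \<one> *\<^sub>v F ?w (i,a)) $ a) = 0"
      using insert.hyps by (simp add: j0)
    moreover have "(X i0 \<one> *\<^sub>v F ?w j0) $ a0 = 1"
      using F[of ?w] one[OF i0(1), of ?w] i0 by simp
    moreover have "(\<Sum>(i,a)\<in>J. (X i \<one> *\<^sub>v F ?w (i,a)) $ a) = 0"
    proof (rule sum.neutral, rule ballI, clarify)
      fix i a assume ia: "(i,a) \<in> J"
      obtain c where c: "F ?w (i,a) = (if i = i0 then c \<cdot>\<^sub>v ?w else 0\<^sub>v (n i))" using S[OF ia] by auto
      have "a \<noteq> a0" if "i = i0" using ia insert.hyps j0 that by auto
      moreover have "F ?w (i,a) \<in> carrier_vec (n i)" using Rc F[of ?w] ia by auto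
      ultimately show "(X i \<one> *\<^sub>v F ?w (i,a)) $ a = 0"
        using one[of i "F ?w (i,a)"] JI[of i a] ia c i0 by auto
    qed
    ultimately show False by simp
  qed
  ultimately have W0: "W = {0\<^sub>v (n i0)}" by blast
  have vR: "v \<in> Rel" unfolding Rel_def using insert.prems(2,3) by auto
  then have "v j0 = 0\<^sub>v (n i0)" using W0 by (auto simp: W_def)
  then show ?case using zero[OF vR] insert.prems(4) j0 by auto
qed simp

text \<open>A combination of traces is a relation among diagonal matrix coefficients, with
  \<open>c i\<close> times the unit vector \<open>a\<close> in row \<open>(i,a)\<close>.\<close>

lemma trace_independence:
  fixes X :: "'i \<Rightarrow> 'a \<Rightarrow> 'k::alg_closed_field mat"
  assumes fin: "finite I" and irr: "\<And>i. i \<in> I \<Longrightarrow> irreducible_rep G (n i) (X i)"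
    and ineq: "\<And>i j S. i \<in> I \<Longrightarrow> j \<in> I \<Longrightarrow> i \<noteq> j \<Longrightarrow> S \<in> carrier_mat (n i) (n j) \<Longrightarrow>
       (\<And>g. g \<in> carrier G \<Longrightarrow> X i g * S = S * X j g) \<Longrightarrow> S = 0\<^sub>m (n i) (n j)"
    and z: "\<And>g. g \<in> carrier G \<Longrightarrow> (\<Sum>i\<in>I. c i * mtrace (X i g)) = 0" and i: "i \<in> I"
  shows "c i = 0"
proof -
  have n: "n i > 0" if "i \<in> I" for i using irreducible_repD(1)[OF irr[OF that]] .
  define v where "v = (\<lambda>(i,a). c i \<cdot>\<^sub>v unit_vec (n i) a)"
  have "(\<Sum>(i,a)\<in>Sigma I (\<lambda>i. {..<n i}). (X i g *\<^sub>v v (i,a)) $ a) = 0" if g: "g \<in> carrier G" for g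
  proof -
    have "(\<Sum>(i,a)\<in>Sigma I (\<lambda>i. {..<n i}). (X i g *\<^sub>v v (i,a)) $ a) = (\<Sum>i\<in>I. \<Sum>a<n i. (X i g *\<^sub>v v (i,a)) $ a)"
      using fin by (subst sum.Sigma) auto
    also have "\<dots> = (\<Sum>i\<in>I. c i * mtrace (X i g))"
    proof (rule sum.cong)
      fix i assume i: "i \<in> I"
      have c: "X i g \<in> carrier_mat (n i) (n i)" using is_rep_carrier[OF irreducible_repD(2)[OF irr[OF i]] g] .
      show "(\<Sum>a<n i. (X i g *\<^sub>v v (i,a)) $ a) = c i * mtrace (X i g)"
        using c by (auto simp: mtrace_def v_def sum_distrib_left mult_mat_vec[OF c] intro!: sum.cong)
    qed simp
    finally show ?thesis using z[OF g] by simp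
  qed
  then have "v (i,0) = 0\<^sub>v (n i)"
    using i n[OF i] fin by (intro coefficient_independence[OF irr ineq, where J = "Sigma I (\<lambda>i. {..<n i})"]) (auto simp: v_def)
  then have "v (i,0) $ 0 = 0" using n[OF i] by simp
  then show ?thesis using n[OF i] by (simp add: v_def)
qed

end

section \<open>Irreducible Brauer characters as a basis of the class functions\<close>

definition class_fun :: "nat \<Rightarrow> ('a, 'm) monoid_scheme \<Rightarrow> ('a \<Rightarrow> complex) \<Rightarrow> bool" where
  "class_fun p G f \<longleftrightarrow> (\<forall>y. \<not> p_regular G p y \<longrightarrow> f y = 0) \<and>
     (\<forall>y g. p_regular G p y \<longrightarrow> g \<in> carrier G \<longrightarrow> f (g \<otimes>\<^bsub>G\<^esub> y \<otimes>\<^bsub>G\<^esub> inv\<^bsub>G\<^esub> g) = f y)"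

text \<open>The coordinates in the basis of irreducible Brauer characters. For functions in their
  span the choice is determined on \<open>IBr p red G\<close> (see \<open>ibr_coef_unique\<close>);
  values at other arguments carry no meaning.\<close>

definition ibr_coef ::
  "nat \<Rightarrow> (complex \<Rightarrow> 'k::field) \<Rightarrow> ('a, 'm) monoid_scheme \<Rightarrow> ('a \<Rightarrow> complex) \<Rightarrow> ('a \<Rightarrow> complex) \<Rightarrow> complex" where
  "ibr_coef p red G f = (SOME a. \<forall>y. f y = (\<Sum>\<phi>\<in>IBr p red G. a \<phi> * \<phi> y))"

lemma block_upper_pow:
  assumes "block_upper n d (M :: 'k::comm_ring_1 mat)"
  shows "block_upper n d (M ^\<^sub>m k) \<and> upper_left d (M ^\<^sub>m k) = upper_left d M ^\<^sub>m k \<and>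
    lower_right d (M ^\<^sub>m k) = lower_right d M ^\<^sub>m k"
proof (induction k)
  case 0
  have M: "M \<in> carrier_mat n n" "d \<le> n" using assms by (auto simp: block_upper_def)
  have "dim_row (upper_left d M) = d" "dim_row (lower_right d M) = n - d"
    using carrier_matD[OF lower_right_carrier[OF assms]] by (auto simp: upper_left_def)
  then show ?case
    using M by (simp add: block_upper_one)
next
  case (Suc k)
  then show ?case using block_upper_mult[OF _ assms, of "M ^\<^sub>m k"] by simp
qed

lemma conj_pow:
  assumes "A \<in> carrier_mat n n" "P \<in> carrier_mat n n" "Q \<in> carrier_mat n n" "P * Q = 1\<^sub>m n" "Q * P = 1\<^sub>m n"
  shows "(Q * A * P) ^\<^sub>m k = Q * (A ^\<^sub>m k) * (P :: 'k::comm_ring_1 mat)"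
proof (induction k)
  case 0
  then show ?case using assms by simp
next
  case (Suc k)
  then show ?case using assms conj_mult[of "A ^\<^sub>m k" n A P Q] by (simp add: pow_carrier_mat)
qed

lemma pow_mat_add:
  assumes "A \<in> carrier_mat n n"
  shows "A ^\<^sub>m (k + l) = A ^\<^sub>m k * (A ^\<^sub>m l :: 'k::comm_ring_1 mat)"
proof (induction l)
  case 0
  then show ?case using assms pow_carrier_mat[OF assms, of k] by simp
next
  case (Suc l)
  then show ?case
    using assms assoc_mult_mat[of "A ^\<^sub>m k" n n "A ^\<^sub>m l" n A n] pow_carrier_mat[OF assms] by simp
qed

lemma pow_mat_dvd:
  assumes "A \<in> carrier_mat n n" "A ^\<^sub>m a = 1\<^sub>m n" "a dvd b"
  shows "A ^\<^sub>m b = (1\<^sub>m n :: 'k::comm_ring_1 mat)"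
proof -
  obtain c where "b = a * c" using assms(3) by auto
  moreover have "A ^\<^sub>m (a * c) = 1\<^sub>m n"
  proof (induction c)
    case (Suc c)
    have "A ^\<^sub>m (a * Suc c) = A ^\<^sub>m a * A ^\<^sub>m (a * c)" using pow_mat_add[OF assms(1), of a "a * c"] by simp
    then show ?case using Suc assms by simp
  qed (use assms in simp)
  ultimately show ?thesis by simp
qed

definition perm_mat :: "nat \<Rightarrow> (nat \<Rightarrow> nat) \<Rightarrow> 'b::{zero,one} mat" where
  "perm_mat n f = mat n n (\<lambda>(i,j). if i = f j then 1 else 0)"

lemma perm_mat_carrier [simp]: "perm_mat n f \<in> carrier_mat n n"
  by (simp add: perm_mat_def)

lemma perm_mat_mult:
  assumes "\<And>j. j < n \<Longrightarrow> g j < n"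
  shows "perm_mat n f * perm_mat n g = (perm_mat n (\<lambda>j. f (g j)) :: 'b::comm_ring_1 mat)"
proof (rule eq_matI)
  fix i j assume ij: "i < dim_row (perm_mat n (\<lambda>j. f (g j)) :: 'b mat)" "j < dim_col (perm_mat n (\<lambda>j. f (g j)) :: 'b mat)"
  then have "(perm_mat n f * perm_mat n g :: 'b mat) $$ (i,j) = (\<Sum>l<n. (if i = f l then 1 else 0) * (if l = g j then 1 else 0))"
    by (auto simp: perm_mat_def scalar_prod_def lessThan_atLeast0)
  also have "\<dots> = (\<Sum>l<n. if l = g j then (if i = f l then 1 else 0) else 0)"
    by (intro sum.cong) auto
  also have "\<dots> = perm_mat n (\<lambda>j. f (g j)) $$ (i,j)"
    using ij assms by (simp add: perm_mat_def)
  finally show "(perm_mat n f * perm_mat n g) $$ (i,j) = (perm_mat n (\<lambda>j. f (g j)) :: 'b mat) $$ (i,j)" .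
qed (auto simp: perm_mat_def)

lemma perm_mat_cong: "(\<And>j. j < n \<Longrightarrow> f j = g j) \<Longrightarrow> perm_mat n f = perm_mat n g"
  by (auto simp: perm_mat_def intro!: eq_matI)

lemma perm_mat_id: "(\<And>j. j < n \<Longrightarrow> f j = j) \<Longrightarrow> perm_mat n f = 1\<^sub>m n"
  by (auto simp: perm_mat_def intro!: eq_matI)

lemma map_mat_perm_mat: "map_mat of_int (perm_mat n f) = perm_mat n f"
  by (auto simp: perm_mat_def intro!: eq_matI)

lemma mtrace_perm_mat: "mtrace (perm_mat n f) = of_nat (card {i. i < n \<and> f i = i})"
proof -
  have "mtrace (perm_mat n f) = (\<Sum>i<n. if f i = i then 1 else 0)"
    by (auto simp: mtrace_def perm_mat_def intro!: sum.cong)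
  also have "\<dots> = (\<Sum>i\<in>{i. i < n \<and> f i = i}. 1)"
    by (rule sum.mono_neutral_cong_right) auto
  finally show ?thesis by simp
qed

lemma sum_mset_count:
  assumes "finite A" "set_mset M \<subseteq> A"
  shows "(\<Sum>x\<in>#M. f x) = (\<Sum>x\<in>A. of_nat (count M x) * (f x :: 'b::comm_semiring_1))"
  using assms(2)
proof (induction M)
  case (add x M)
  have "(\<Sum>y\<in>A. of_nat (count (add_mset x M) y) * f y) = (\<Sum>y\<in>A. of_nat (count M y) * f y + (if y = x then f x else 0))"
    by (intro sum.cong) (auto simp: algebra_simps)
  also have "\<dots> = (\<Sum>y\<in>A. of_nat (count M y) * f y) + f x"
    using add.prems assms(1) by (simp add: sum.distrib)
  finally show ?case using add by (simp add: add.commute)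
qed simp

lemma intertwiner_inverse:
  assumes "A \<in> carrier_mat n n" "B \<in> carrier_mat n n" "S \<in> carrier_mat n n" "R \<in> carrier_mat n n"
    and "S * R = 1\<^sub>m n" "R * S = 1\<^sub>m n" and c: "A * S = S * (B :: 'k::comm_ring_1 mat)"
  shows "B * R = R * A" "R * A * S = B"
proof -
  have "B * R = R * S * (B * R)" using assms by simp
  also have "\<dots> = R * (S * (B * R))" using assms(1-4) by (intro assoc_mult_mat[of _ n n _ n _ n]) auto
  also have "S * (B * R) = S * B * R" using assms(1-4) by (intro assoc_mult_mat[symmetric, of _ n n _ n _ n]) auto
  also have "S * B * R = A * S * R" using c by simp
  also have "A * S * R = A * (S * R)" using assms(1-4) by (rule_tac assoc_mult_mat)
  finally show "B * R = R * A" using assms by simp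
  have "R * A * S = R * (A * S)" using assms(1-4) by (rule_tac assoc_mult_mat)
  also have "\<dots> = R * S * B" using c assms(1-4) assoc_mult_mat[of R n n S n B n] by simp
  finally show "R * A * S = B" using assms by simp
qed

lemma perm_mat_dim [simp]: "dim_row (perm_mat n f) = n" "dim_col (perm_mat n f) = n"
  by (auto simp: perm_mat_def)

lemma (in group) mult_inv_cancel:
  assumes "u \<in> carrier G" "z \<in> carrier G"
  shows "u \<otimes> (inv u \<otimes> z) = z" "inv u \<otimes> (u \<otimes> z) = z"
  using assms by (auto simp flip: m_assoc)

section \<open>Equivalence and independence of irreducible Brauer characters\<close>

context finite_modular_group
begin

lemma regular_carrier: "regular g \<Longrightarrow> g \<in> carrier G"
  by (simp add: p_regular_def)

lemma red_brauer_val: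
  assumes A: "A \<in> carrier_mat m m" "A ^\<^sub>m L = 1\<^sub>m m" and L: "L > 0" "coprime L p"
  shows "red (brauer_val A) = mtrace A"
  using brauer_val_int_eval[OF assms] red_int_eval[OF unity_root_power[OF L(1)] L(1)] by metis

lemma bchar_conj:
  assumes X: "is_rep G n X" and P: "P \<in> carrier_mat n n" "Q \<in> carrier_mat n n" "P * Q = 1\<^sub>m n" "Q * P = 1\<^sub>m n"
  shows "bchar (\<lambda>g. Q * X g * P) = bchar X"
proof
  fix y
  show "bchar (\<lambda>g. Q * X g * P) y = bchar X y"
    using brauer_val_similar[OF similar_conj[OF is_rep_carrier[OF X] P]] regular_carrier[of y]
    by (simp add: bchar_eq)
qed

lemma bchar_blocks:
  assumes "\<And>g. g \<in> carrier G \<Longrightarrow> block_upper n d (X g)"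
  shows "bchar X y = bchar (\<lambda>g. upper_left d (X g)) y + bchar (\<lambda>g. lower_right d (X g)) y"
  using brauer_val_block[OF assms] regular_carrier by (simp add: bchar_eq)

text \<open>Composition factors, found by splitting off blocks. The nonemptiness clause serves
  \<open>res_IBr_sum\<close>; the bound on the size makes reducible representations recognizable in
  \<open>bchar_IBr_irreducible\<close>.\<close>

lemma bchar_sum_IBr:
  assumes "is_rep G n (X :: 'a \<Rightarrow> 'k mat)"
  shows "\<exists>M. set_mset M \<subseteq> IBr p red G \<and> (\<forall>y. bchar X y = (\<Sum>\<mu>\<in>#M. \<mu> y)) \<and>
    (n > 0 \<longrightarrow> M \<noteq> {#}) \<and> (n > 0 \<and> \<not> irreducible_rep G n X \<longrightarrow> size M \<ge> 2)"
  using assms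
proof (induction n arbitrary: X rule: less_induct)
  case (less n)
  consider "n = 0" | "n > 0" "irreducible_rep G n X" | "n > 0" "\<not> irreducible_rep G n X" by blast
  then show ?case
  proof cases
    case 1
    have "bchar X y = 0" for y
    proof -
      have "eigs (X y) = {#}" if "y \<in> carrier G"
        using size_eigs[OF is_rep_carrier[OF less.prems that]] 1 by simp
      then show ?thesis using regular_carrier by (simp add: bchar_eq brauer_val_def)
    qed
    then show ?thesis using 1 by (intro exI[of _ "{#}"]) auto
  next
    case 2
    then show ?thesis by (intro exI[of _ "{#bchar X#}"]) (auto simp: IBr_def)
  next
    case 3
    from rep_reducible_blocks[OF less.prems 3] obtain d P Q where
      d: "0 < d" "d < n" and P: "P \<in> carrier_mat n n" "Q \<in> carrier_mat n n"
      "P * Q = 1\<^sub>m n" "Q * P = 1\<^sub>m n" and b: "\<And>g. g \<in> carrier G \<Longrightarrow> block_upper n d (Q * X g * P)" by blast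
    note Y = is_rep_conj[OF less.prems P]
    from less.IH[OF d(2) is_rep_upper_left[OF monoid_axioms Y b]] d obtain M1 where
      M1: "set_mset M1 \<subseteq> IBr p red G" "\<And>y. bchar (\<lambda>g. upper_left d (Q * X g * P)) y = (\<Sum>\<mu>\<in>#M1. \<mu> y)" "M1 \<noteq> {#}" by blast
    from less.IH[OF _ is_rep_lower_right[OF monoid_axioms Y b]] d obtain M2 where
      M2: "set_mset M2 \<subseteq> IBr p red G" "\<And>y. bchar (\<lambda>g. lower_right d (Q * X g * P)) y = (\<Sum>\<mu>\<in>#M2. \<mu> y)" "M2 \<noteq> {#}" by auto
    have "bchar X y = (\<Sum>\<mu>\<in>#M1 + M2. \<mu> y)" for y
      using bchar_blocks[of n d "\<lambda>g. Q * X g * P" y, OF b] bchar_conj[OF less.prems P] M1(2) M2(2) by simp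
    moreover have "size (M1 + M2) \<ge> 2"
      using M1(3) M2(3) by (cases M1; cases M2) auto
    ultimately show ?thesis using M1 M2 by (intro exI[of _ "M1 + M2"]) auto
  qed
qed

lemma intertwiner_bchar_eq:
  assumes X: "irreducible_rep G n X" and Y: "irreducible_rep G m Y"
    and S: "S \<in> carrier_mat n m" "\<And>g. g \<in> carrier G \<Longrightarrow> X g * S = S * Y g"
    and nz: "S \<noteq> 0\<^sub>m n m"
  shows "bchar X = bchar Y"
proof -
  from schur[OF X Y S nz] obtain R where nm: "n = m" and R: "R \<in> carrier_mat n n" "S * R = 1\<^sub>m n" "R * S = 1\<^sub>m n" by auto
  have "R * X g * S = Y g" if g: "g \<in> carrier G" for g
    using is_rep_carrier[OF irreducible_repD(2)[OF X] g] is_rep_carrier[OF irreducible_repD(2)[OF Y] g] nm R S g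
    by (intro intertwiner_inverse(2)[of "X g" n "Y g" S R]) auto
  then have "bchar (\<lambda>g. R * X g * S) = bchar Y"
    using regular_carrier by (auto simp: bchar_eq fun_eq_iff)
  then show ?thesis
    using bchar_conj[OF irreducible_repD(2)[OF X], of S R] S R nm by simp
qed

text \<open>Every element has the same traces as its p-regular part, so a relation on the p-regular
  elements holds on the whole group.\<close>

lemma trace_independence_regular:
  fixes X :: "'i \<Rightarrow> 'a \<Rightarrow> 'k mat"
  assumes fin: "finite I" and irr: "\<And>i. i \<in> I \<Longrightarrow> irreducible_rep G (n i) (X i)"
    and ineq: "\<And>i j S. i \<in> I \<Longrightarrow> j \<in> I \<Longrightarrow> i \<noteq> j \<Longrightarrow> S \<in> carrier_mat (n i) (n j) \<Longrightarrow>
       (\<And>g. g \<in> carrier G \<Longrightarrow> X i g * S = S * X j g) \<Longrightarrow> S = 0\<^sub>m (n i) (n j)"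
    and z: "\<And>g. regular g \<Longrightarrow> (\<Sum>i\<in>I. c i * mtrace (X i g)) = 0" and i: "i \<in> I"
  shows "c i = 0"
proof (rule trace_independence[OF fin irr ineq _ i])
  fix g assume g: "g \<in> carrier G"
  obtain h e where h: "regular h" "h [^] (p ^ e) = g [^] (p ^ e)" using p_part_decomposition[OF g] .
  have "mtrace (X i g) = mtrace (X i h)" if "i \<in> I" for i
    by (rule mtrace_p_part[OF irreducible_repD(2)[OF irr[OF that]] g regular_carrier[OF h(1)] h(2)])
  then show "(\<Sum>i\<in>I. c i * mtrace (X i g)) = 0" using z[OF h(1)] by simp
qed

text \<open>Since \<open>red\<close> sends Brauer values to traces, the two representations have
  equal traces at p-regular elements. If there were no nonzero intertwiner, in either direction, the
  relation with coefficients 1 and -1 would contradict the independence of traces.\<close>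

lemma bchar_eq_imp_equivalent:
  assumes X: "irreducible_rep G n X" and Y: "irreducible_rep G m Y" and e: "bchar X = bchar Y"
  obtains S R where "n = m" "S \<in> carrier_mat n n" "R \<in> carrier_mat n n" "S * R = 1\<^sub>m n" "R * S = 1\<^sub>m n"
    "\<And>g. g \<in> carrier G \<Longrightarrow> X g * S = S * Y g"
proof -
  have "\<exists>S\<in>carrier_mat n m. (\<forall>g\<in>carrier G. X g * S = S * Y g) \<and> S \<noteq> 0\<^sub>m n m"
  proof (rule ccontr)
    assume neg: "\<not> ?thesis"
    have swap: "S = 0\<^sub>m m n" if S: "S \<in> carrier_mat m n" "\<And>g. g \<in> carrier G \<Longrightarrow> Y g * S = S * X g" for S
    proof (rule ccontr)
      assume nz: "S \<noteq> 0\<^sub>m m n"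
      from schur[OF Y X S nz] obtain R where nm: "m = n" and R: "R \<in> carrier_mat m m" "S * R = 1\<^sub>m m" "R * S = 1\<^sub>m m" by auto
      have "X g * R = R * Y g" if g: "g \<in> carrier G" for g
        using is_rep_carrier[OF irreducible_repD(2)[OF X] g] is_rep_carrier[OF irreducible_repD(2)[OF Y] g] nm R S g
        by (intro intertwiner_inverse(1)[of "Y g" n "X g" S R]) auto
      then have "R = 0\<^sub>m n m" using neg R nm by auto
      then have "S * R = 0\<^sub>m m m" using S(1) nm by simp
      then have "(1\<^sub>m m :: 'k mat) $$ (0,0) = 0\<^sub>m m m $$ (0,0)" by (simp only: R(2))
      then show False using irreducible_repD(1)[OF Y] by simp
    qed
    have "(if True then 1 else - 1 :: 'k) = 0"
    proof (rule trace_independence_regular[where I = UNIV and n = "\<lambda>b. if b then n else m" and X = "\<lambda>b. if b then X else Y"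
          and c = "\<lambda>b. if b then 1 else - 1" and i = True])
      show "irreducible_rep G (if i then n else m) (if i then X else Y)" for i using X Y by simp
      fix i j :: bool and S :: "'k mat" assume "i \<noteq> j" "S \<in> carrier_mat (if i then n else m) (if j then n else m)"
        "\<And>g. g \<in> carrier G \<Longrightarrow> (if i then X else Y) g * S = S * (if j then X else Y) g"
      then show "S = 0\<^sub>m (if i then n else m) (if j then n else m)"
        using neg swap by (cases i; cases j) auto
    next
      fix g assume g: "regular g"
      have "brauer_val (X g) = brauer_val (Y g)" using fun_cong[OF e, of g] g by (simp add: bchar_eq)
      moreover have "red (brauer_val (X g)) = mtrace (X g)" "red (brauer_val (Y g)) = mtrace (Y g)"
        using red_brauer_val[OF is_rep_carrier[OF irreducible_repD(2)[OF X] regular_carrier[OF g]]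
            rep_pow_ord[OF irreducible_repD(2)[OF X] regular_carrier[OF g]]]
          red_brauer_val[OF is_rep_carrier[OF irreducible_repD(2)[OF Y] regular_carrier[OF g]]
            rep_pow_ord[OF irreducible_repD(2)[OF Y] regular_carrier[OF g]]] regular_ord[OF g] by auto
      ultimately have "mtrace (X g) = mtrace (Y g)" by simp
      then show "(\<Sum>i\<in>UNIV. (if i then 1 else - 1) * mtrace ((if i then X else Y) g)) = 0" by (simp add: UNIV_bool)
    qed auto
    then show False by simp
  qed
  then obtain S where S: "S \<in> carrier_mat n m" "\<And>g. g \<in> carrier G \<Longrightarrow> X g * S = S * Y g" "S \<noteq> 0\<^sub>m n m" by auto
  from schur[OF X Y S] show thesis using that S by auto
qed

text \<open>One exponent prime to p for all p-regular elements, so that all Brauer values become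
  integer polynomials in the same root of unity.\<close>

definition reg_exp :: nat where
  "reg_exp = (\<Prod>g\<in>{g. regular g}. ord g)"

lemma finite_regular: "finite {g. regular g}"
  by (rule finite_subset[OF _ fin]) (auto simp: p_regular_def)

lemma reg_exp: "reg_exp > 0" "coprime reg_exp p" "regular g \<Longrightarrow> ord g dvd reg_exp"
proof -
  show "reg_exp > 0" unfolding reg_exp_def using regular_ord by (intro prod_pos) auto
  show "coprime reg_exp p" unfolding reg_exp_def using regular_ord by (intro prod_coprime_left) auto
  show "regular g \<Longrightarrow> ord g dvd reg_exp" unfolding reg_exp_def using finite_regular by (intro dvd_prodI) auto
qed

lemma rep_pow_reg_exp: "is_rep G n X \<Longrightarrow> regular g \<Longrightarrow> X g ^\<^sub>m reg_exp = 1\<^sub>m n"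
  by (rule pow_mat_dvd[OF is_rep_carrier rep_pow_ord reg_exp(3)]) (auto simp: regular_carrier)

text \<open>A nonvanishing minor of the traces in characteristic p lifts to a nonvanishing minor of the
  values of the Brauer characters.\<close>

lemma IBr_independent_finite:
  assumes F: "finite F" "F \<subseteq> IBr p red G"
  shows "card F \<le> card (carrier G)"
    and "(\<And>y. (\<Sum>\<phi>\<in>F. a \<phi> * \<phi> y) = 0) \<Longrightarrow> \<phi> \<in> F \<Longrightarrow> a \<phi> = 0"
proof -
  define r where "r = card F"
  obtain b where b: "bij_betw b {0..<r} F" using ex_bij_betw_nat_finite[OF F(1)] r_def by auto
  have bF: "b i \<in> F" if "i < r" for i using b that by (auto simp: bij_betw_def)
  have "\<forall>i. \<exists>n X. i < r \<longrightarrow> irreducible_rep G n (X :: 'a \<Rightarrow> 'k mat) \<and> b i = bchar X"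
    using bF F(2) by (fastforce simp: IBr_def)
  then obtain n X where X: "\<And>i. i < r \<Longrightarrow> irreducible_rep G (n i) (X i :: 'a \<Rightarrow> 'k mat)" "\<And>i. i < r \<Longrightarrow> b i = bchar (X i)" by metis
  note rep = irreducible_repD(2)[OF X(1)]
  have "\<exists>pt. (\<forall>j<r. pt j \<in> {g. regular g}) \<and> det (mat r r (\<lambda>(i,j). mtrace (X i (pt j)))) \<noteq> 0"
  proof (rule nonzero_minor)
    fix c assume z: "\<And>x. x \<in> {g. regular g} \<Longrightarrow> (\<Sum>i<r. c i * mtrace (X i x)) = 0"
    show "\<forall>i<r. c i = 0"
    proof (intro allI impI)
      fix i assume i: "i < r"
      show "c i = 0"
      proof (rule trace_independence_regular[of "{..<r}" n X c i])
        fix i j S assume ij: "i \<in> {..<r}" "j \<in> {..<r}" "i \<noteq> j" "S \<in> carrier_mat (n i) (n j)"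
          "\<And>g. g \<in> carrier G \<Longrightarrow> X i g * S = S * X j g"
        show "S = 0\<^sub>m (n i) (n j)"
        proof (rule ccontr)
          assume "S \<noteq> 0\<^sub>m (n i) (n j)"
          then have "bchar (X i) = bchar (X j)"
            using ij by (intro intertwiner_bchar_eq[OF X(1) X(1)]) auto
          then have "b i = b j" using X(2) ij by simp
          then show False using b ij by (auto simp: bij_betw_def inj_on_def)
        qed
      qed (use X i z in auto)
    qed
  qed
  then obtain pt where pt: "\<And>j. j < r \<Longrightarrow> regular (pt j)" "det (mat r r (\<lambda>(i,j). mtrace (X i (pt j)))) \<noteq> 0" by auto
  let ?z = "unity_root reg_exp"
  have "\<forall>i j. \<exists>q. i < r \<longrightarrow> j < r \<longrightarrow> brauer_val (X i (pt j)) = int_eval ?z q \<and> mtrace (X i (pt j)) = int_eval (red ?z) q"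
  proof (intro allI)
    fix i j
    show "\<exists>q. i < r \<longrightarrow> j < r \<longrightarrow> brauer_val (X i (pt j)) = int_eval ?z q \<and> mtrace (X i (pt j)) = int_eval (red ?z) q"
    proof (cases "i < r \<and> j < r")
      case True
      then have "X i (pt j) \<in> carrier_mat (n i) (n i)" "X i (pt j) ^\<^sub>m reg_exp = 1\<^sub>m (n i)"
        using is_rep_carrier[OF rep] rep_pow_reg_exp[OF rep] pt(1) regular_carrier by blast+
      from brauer_val_int_eval[OF this reg_exp(1,2)] show ?thesis by metis
    qed auto
  qed
  then obtain q where q: "\<And>i j. i < r \<Longrightarrow> j < r \<Longrightarrow> brauer_val (X i (pt j)) = int_eval ?z (q i j)"
    "\<And>i j. i < r \<Longrightarrow> j < r \<Longrightarrow> mtrace (X i (pt j)) = int_eval (red ?z) (q i j)" by metis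
  define D where "D = mat r r (\<lambda>(i,j). q i j)"
  interpret hz: comm_ring_hom "int_eval ?z" by (rule comm_ring_hom_int_eval)
  interpret hr: comm_ring_hom "int_eval (red ?z)" by (rule comm_ring_hom_int_eval)
  have "mat r r (\<lambda>(i,j). mtrace (X i (pt j))) = map_mat (int_eval (red ?z)) D"
    by (rule eq_matI) (auto simp: D_def q)
  then have "int_eval (red ?z) (det D) \<noteq> 0" using pt(2) by simp
  then have "int_eval ?z (det D) \<noteq> 0"
    using int_eval_red_eq_0[OF unity_root_power[OF reg_exp(1)] reg_exp(1)] by blast
  moreover have e: "mat r r (\<lambda>(i,j). b i (pt j)) = map_mat (int_eval ?z) D"
    using pt(1) X(2) q by (intro eq_matI) (auto simp: D_def bchar_eq)
  ultimately have dn: "det (mat r r (\<lambda>(i,j). b i (pt j))) \<noteq> 0" (is "det ?M \<noteq> 0") by simp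
  \<comment> \<open>Distinct sample points bound the size of \<open>F\<close> by the order of the
    group; this bound makes the whole set of irreducible Brauer characters finite.\<close>
  have "inj_on pt {..<r}"
  proof (rule inj_onI, rule ccontr)
    fix i j assume ij: "i \<in> {..<r}" "j \<in> {..<r}" "pt i = pt j" "i \<noteq> j"
    then have "col ?M i = col ?M j" by (intro eq_vecI) auto
    then show False using det_identical_columns[of ?M r i j] ij dn by auto
  qed
  then have "card (pt ` {..<r}) = r" by (simp add: card_image)
  moreover have "pt ` {..<r} \<subseteq> carrier G" using pt(1) regular_carrier by auto
  ultimately show "card F \<le> card (carrier G)" using card_mono[OF fin] r_def by metis
  assume z: "\<And>y. (\<Sum>\<phi>\<in>F. a \<phi> * \<phi> y) = 0" and p: "\<phi> \<in> F"
  define v where "v = vec r (\<lambda>i. a (b i))"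
  have "?M\<^sup>T *\<^sub>v v = 0\<^sub>v r"
  proof (rule eq_vecI)
    fix j assume j: "j < dim_vec (0\<^sub>v r :: complex vec)"
    have "(?M\<^sup>T *\<^sub>v v) $ j = (\<Sum>i=0..<r. a (b i) * b i (pt j))"
      using j by (auto simp: v_def scalar_prod_def mult.commute intro!: sum.cong)
    also have "\<dots> = (\<Sum>\<phi>\<in>F. a \<phi> * \<phi> (pt j))" using sum.reindex_bij_betw[OF b, of "\<lambda>\<phi>. a \<phi> * \<phi> (pt j)"] by simp
    finally show "(?M\<^sup>T *\<^sub>v v) $ j = 0\<^sub>v r $ j" using z j by simp
  qed simp
  moreover have "?M\<^sup>T \<in> carrier_mat r r" "det ?M\<^sup>T \<noteq> 0" using dn det_transpose[of ?M r] by auto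
  moreover have "v \<in> carrier_vec r" by (simp add: v_def)
  ultimately have "v = 0\<^sub>v r" using det_0_iff_vec_prod_zero_field[of "?M\<^sup>T" r] by blast
  moreover obtain i where "i < r" "\<phi> = b i" using b p by (auto simp: bij_betw_def)
  ultimately have "v $ i = 0" by simp
  then show "a \<phi> = 0" using \<open>i < r\<close> \<open>\<phi> = b i\<close> by (simp add: v_def)
qed

lemma finite_IBr: "finite (IBr p red G)"
proof (rule ccontr)
  assume "infinite (IBr p red G)"
  then obtain F where "F \<subseteq> IBr p red G" "finite F" "card F = Suc (card (carrier G))"
    using infinite_arbitrarily_large by metis
  then show False using IBr_independent_finite(1)[of F] by simp
qed

lemma IBr_independent:
  assumes "\<And>y. (\<Sum>\<phi>\<in>IBr p red G. a \<phi> * \<phi> y) = 0" "\<phi> \<in> IBr p red G"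
  shows "a \<phi> = 0"
  by (rule IBr_independent_finite(2)[OF finite_IBr subset_refl assms])

lemma ibr_coef_unique:
  assumes "\<And>y. f y = (\<Sum>\<phi>\<in>IBr p red G. a \<phi> * \<phi> y)" "\<phi> \<in> IBr p red G"
  shows "ibr_coef p red G f \<phi> = a \<phi>"
proof -
  have "\<exists>a. \<forall>y. f y = (\<Sum>\<phi>\<in>IBr p red G. a \<phi> * \<phi> y)" using assms(1) by blast
  then have "\<forall>y. f y = (\<Sum>\<phi>\<in>IBr p red G. ibr_coef p red G f \<phi> * \<phi> y)"
    unfolding ibr_coef_def by (rule someI_ex)
  then have "(\<Sum>\<phi>\<in>IBr p red G. (ibr_coef p red G f \<phi> - a \<phi>) * \<phi> y) = 0" for y
    using assms(1)[of y] by (simp add: left_diff_distrib sum_subtractf)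
  then have "ibr_coef p red G f \<phi> - a \<phi> = 0" by (rule IBr_independent[OF _ assms(2)])
  then show ?thesis by simp
qed

section \<open>Irreducible Brauer characters span the class functions\<close>

definition in_span :: "('a \<Rightarrow> complex) \<Rightarrow> bool" where
  "in_span f \<longleftrightarrow> (\<exists>a. \<forall>y. f y = (\<Sum>\<phi>\<in>IBr p red G. a \<phi> * \<phi> y))"

lemma in_span_add: "in_span f \<Longrightarrow> in_span g \<Longrightarrow> in_span (\<lambda>y. f y + g y)"
  unfolding in_span_def
proof (elim exE)
  fix a b assume "\<forall>y. f y = (\<Sum>\<phi>\<in>IBr p red G. a \<phi> * \<phi> y)" "\<forall>y. g y = (\<Sum>\<phi>\<in>IBr p red G. b \<phi> * \<phi> y)"
  then show "\<exists>a. \<forall>y. f y + g y = (\<Sum>\<phi>\<in>IBr p red G. a \<phi> * \<phi> y)"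
    by (intro exI[of _ "\<lambda>\<phi>. a \<phi> + b \<phi>"]) (simp add: distrib_right sum.distrib)
qed

lemma in_span_scale: "in_span f \<Longrightarrow> in_span (\<lambda>y. c * f y)"
  unfolding in_span_def
proof (elim exE)
  fix a assume "\<forall>y. f y = (\<Sum>\<phi>\<in>IBr p red G. a \<phi> * \<phi> y)"
  then show "\<exists>a. \<forall>y. c * f y = (\<Sum>\<phi>\<in>IBr p red G. a \<phi> * \<phi> y)"
    by (intro exI[of _ "\<lambda>\<phi>. c * a \<phi>"]) (simp add: sum_distrib_left mult.assoc)
qed

lemma in_span_zero: "in_span (\<lambda>y. 0)"
  unfolding in_span_def by (rule exI[of _ "\<lambda>_. 0"]) simp

lemma in_span_sum: "finite A \<Longrightarrow> (\<And>x. x \<in> A \<Longrightarrow> in_span (f x)) \<Longrightarrow> in_span (\<lambda>y. \<Sum>x\<in>A. f x y)"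
  by (induction A rule: finite_induct) (auto simp: in_span_zero in_span_add)

lemma in_span_bchar: "is_rep G n X \<Longrightarrow> in_span (bchar X)"
proof -
  assume "is_rep G n X"
  from bchar_sum_IBr[OF this] obtain M where M: "set_mset M \<subseteq> IBr p red G" "\<forall>y. bchar X y = (\<Sum>\<mu>\<in>#M. \<mu> y)" by blast
  have "bchar X y = (\<Sum>\<phi>\<in>IBr p red G. of_nat (count M \<phi>) * \<phi> y)" for y
    using M(2) sum_mset_count[OF finite_IBr M(1), of "\<lambda>\<mu>. \<mu> y"] by simp
  then show "in_span (bchar X)" unfolding in_span_def
    by (intro exI[of _ "\<lambda>\<phi>. of_nat (count M \<phi>)"]) simp
qed

text \<open>An eigenspace of \<open>R\<close> is invariant because \<open>R\<close> commutes with
  \<open>X\<close>. If it is everything, \<open>R\<close> is a scalar root of unity of order prime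
  to p and multiplies the Brauer character by its lift; otherwise both diagonal blocks carry the
  same situation in smaller degree.\<close>

lemma in_span_commuting:
  assumes "is_rep G n (X :: 'a \<Rightarrow> 'k mat)" "R \<in> carrier_mat n n" "\<And>g. g \<in> carrier G \<Longrightarrow> X g * R = R * X g"
    "R ^\<^sub>m m = 1\<^sub>m n" and m: "m > 0" "coprime m p"
  shows "in_span (bchar (\<lambda>g. X g * R))"
  using assms(1-4)
proof (induction n arbitrary: X R rule: less_induct)
  case (less n)
  note X = less.prems(1) and R = less.prems(2) and comm = less.prems(3) and Rm = less.prems(4)
  show ?case
  proof (cases "n = 0")
    case True
    have "bchar (\<lambda>g. X g * R) y = 0" for y
    proof -
      have "eigs (X y * R) = {#}" if "y \<in> carrier G"
        using size_eigs[OF mult_carrier_mat[OF is_rep_carrier[OF X that] R]] True by simp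
      then show ?thesis using regular_carrier by (simp add: bchar_eq brauer_val_def)
    qed
    then have "bchar (\<lambda>g. X g * R) = (\<lambda>_. 0)" by blast
    then show ?thesis using in_span_zero by simp
  next
    case False
    then obtain a v where v: "v \<in> carrier_vec n" "v \<noteq> 0\<^sub>v n" "R *\<^sub>v v = a \<cdot>\<^sub>v v"
      using eigenvalue_exists[OF R] by blast
    let ?W = "{v \<in> carrier_vec n. R *\<^sub>v v = a \<cdot>\<^sub>v v}"
    have W: "lin_subspace n ?W" by (rule lin_subspace_eigenspace[OF R])
    have W0: "?W \<noteq> {0\<^sub>v n}" using v by blast
    have inv: "X g *\<^sub>v w \<in> ?W" if g: "g \<in> carrier G" and w: "w \<in> ?W" for g w
    proof -
      note Xg = is_rep_carrier[OF X g]
      have "R *\<^sub>v (X g *\<^sub>v w) = R * X g *\<^sub>v w" using Xg R w assoc_mult_mat_vec[of R n n "X g" n w] by simp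
      also have "\<dots> = X g *\<^sub>v (R *\<^sub>v w)" using comm[OF g] Xg R w assoc_mult_mat_vec[of "X g" n n R n w] by simp
      also have "\<dots> = a \<cdot>\<^sub>v (X g *\<^sub>v w)" using w Xg by (simp add: mult_mat_vec)
      finally show ?thesis using Xg w by simp
    qed
    have invR: "R *\<^sub>v w \<in> ?W" if w: "w \<in> ?W" for w
      using w R by (auto simp: mult_mat_vec smult_smult_assoc)
    show ?thesis
    proof (cases "?W = carrier_vec n")
      case True
      then have Ra: "R = a \<cdot>\<^sub>m 1\<^sub>m n" by (intro scalar_if_eigenspace_full[OF R]) blast
      have "R ^\<^sub>m k = a ^ k \<cdot>\<^sub>m 1\<^sub>m n" for k
        by (induction k) (auto simp: Ra)
      then have "(a ^ m \<cdot>\<^sub>m 1\<^sub>m n) $$ (0,0) = (1\<^sub>m n :: 'k mat) $$ (0,0)" using Rm by metis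
      then have am: "a ^ m = 1" using False by simp
      have "bchar (\<lambda>g. X g * R) y = lift a * bchar X y" for y
      proof (cases "regular y")
        case True
        note Xy = is_rep_carrier[OF X regular_carrier[OF True]]
        have "X y * R = a \<cdot>\<^sub>m X y" unfolding Ra using Xy by (simp add: mult_smult_distrib[of _ n n _ n])
        moreover have "brauer_val (a \<cdot>\<^sub>m X y) = lift a * brauer_val (X y)"
        proof (rule brauer_val_smult[OF Xy])
          show "X y ^\<^sub>m (ord y * m) = 1\<^sub>m n"
            by (rule pow_mat_dvd[OF Xy rep_pow_ord[OF X regular_carrier[OF True]]]) simp
          show "a ^ (ord y * m) = 1" using am by (simp add: mult.commute power_mult)
        qed (use regular_ord[OF True] m in auto)
        ultimately show ?thesis using True by (simp add: bchar_eq)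
      qed (simp add: bchar_eq)
      then have "bchar (\<lambda>g. X g * R) = (\<lambda>y. lift a * bchar X y)" by blast
      then show ?thesis using in_span_scale[OF in_span_bchar[OF X]] by simp
    next
      case False
      from invariant_block[OF W W0 False] obtain d P Q where
        d: "0 < d" "d < n" and P: "P \<in> carrier_mat n n" "Q \<in> carrier_mat n n" "P * Q = 1\<^sub>m n" "Q * P = 1\<^sub>m n"
        and b: "\<And>A. A \<in> carrier_mat n n \<Longrightarrow> (\<And>w. w \<in> ?W \<Longrightarrow> A *\<^sub>v w \<in> ?W) \<Longrightarrow> block_upper n d (Q * A * P)" by blast
      have bX: "block_upper n d (Q * X g * P)" if "g \<in> carrier G" for g
        by (rule b[OF is_rep_carrier[OF X that] inv[OF that]])
      have bR: "block_upper n d (Q * R * P)" by (rule b[OF R invR])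
      have e: "Q * (X g * R) * P = (Q * X g * P) * (Q * R * P)" "Q * (X g * R) * P = (Q * R * P) * (Q * X g * P)"
        if "g \<in> carrier G" for g
        using conj_mult[OF is_rep_carrier[OF X that] R P(1-3)] conj_mult[OF R is_rep_carrier[OF X that] P(1-3)] comm[OF that] by auto
      note Y = is_rep_conj[OF X P]
      have "(Q * R * P) ^\<^sub>m m = 1\<^sub>m n" using conj_pow[OF R P] Rm P by simp
      then have Rpow: "upper_left d (Q * R * P) ^\<^sub>m m = 1\<^sub>m d" "lower_right d (Q * R * P) ^\<^sub>m m = 1\<^sub>m (n - d)"
        using block_upper_pow[OF bR, of m] d by (auto simp: block_upper_one)
      have s1: "in_span (bchar (\<lambda>g. upper_left d (Q * X g * P) * upper_left d (Q * R * P)))"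
      proof (rule less.IH[OF d(2) is_rep_upper_left[OF monoid_axioms Y bX]])
        fix g assume g: "g \<in> carrier G"
        then show "upper_left d (Q * X g * P) * upper_left d (Q * R * P) = upper_left d (Q * R * P) * upper_left d (Q * X g * P)"
          using e[OF g] block_upper_mult(2)[OF bX[OF g] bR] block_upper_mult(2)[OF bR bX[OF g]] by metis
      qed (use Rpow in auto)
      have s2: "in_span (bchar (\<lambda>g. lower_right d (Q * X g * P) * lower_right d (Q * R * P)))"
      proof (rule less.IH[OF _ is_rep_lower_right[OF monoid_axioms Y bX]])
        fix g assume g: "g \<in> carrier G"
        then show "lower_right d (Q * X g * P) * lower_right d (Q * R * P) = lower_right d (Q * R * P) * lower_right d (Q * X g * P)"
          using e[OF g] block_upper_mult(3)[OF bX[OF g] bR] block_upper_mult(3)[OF bR bX[OF g]] by metis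
      qed (use Rpow d lower_right_carrier[OF bR] in auto)
      have "bchar (\<lambda>g. X g * R) = (\<lambda>y. bchar (\<lambda>g. upper_left d (Q * X g * P) * upper_left d (Q * R * P)) y +
        bchar (\<lambda>g. lower_right d (Q * X g * P) * lower_right d (Q * R * P)) y)"
      proof
        fix y
        show "bchar (\<lambda>g. X g * R) y = bchar (\<lambda>g. upper_left d (Q * X g * P) * upper_left d (Q * R * P)) y +
          bchar (\<lambda>g. lower_right d (Q * X g * P) * lower_right d (Q * R * P)) y"
        proof (cases "regular y")
          case True
          note y = regular_carrier[OF True]
          have "brauer_val (X y * R) = brauer_val (Q * (X y * R) * P)"
            by (rule brauer_val_similar[OF similar_conj[OF mult_carrier_mat[OF is_rep_carrier[OF X y] R] P]])
          then show ?thesis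
            using True e(1)[OF y] block_upper_mult[OF bX[OF y] bR] brauer_val_block[OF block_upper_mult(1)[OF bX[OF y] bR]]
            by (simp add: bchar_eq)
        qed (simp add: bchar_eq)
      qed
      then show ?thesis using in_span_add[OF s1 s2] by simp
    qed
  qed
qed

text \<open>Right translation by \<open>x\<close> commutes with the regular representation; the Brauer lift of the trace
  of the composite at \<open>y\<close> counts the fixed points of \<open>u \<mapsto> y u x\<^sup>-\<^sup>1\<close>.\<close>

lemma in_span_class_count:
  assumes x: "regular x"
  shows "in_span (\<lambda>y. if regular y then of_nat (card {u \<in> carrier G. inv u \<otimes> y \<otimes> u = x}) else 0)"
proof -
  define N where "N = card (carrier G)"
  obtain b where b: "bij_betw b {0..<N} (carrier G)" using ex_bij_betw_nat_finite[OF fin] N_def by auto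
  define c where "c = the_inv_into {0..<N} b"
  have bc: "b j \<in> carrier G" if "j < N" for j using b that by (auto simp: bij_betw_def)
  have cb: "c (b j) = j" if "j < N" for j
    using b that by (auto simp: c_def bij_betw_def intro: the_inv_into_f_f)
  have cN: "c u < N" "b (c u) = u" if "u \<in> carrier G" for u
    using b that f_the_inv_into_f[of b "{0..<N}" u] the_inv_into_into[of b "{0..<N}" u "{0..<N}"]
    by (auto simp: c_def bij_betw_def)
  note xc = regular_carrier[OF x]
  define act where "act g h j = c (g \<otimes> b j \<otimes> inv h)" for g h j
  have actN: "act g h j < N" if "g \<in> carrier G" "h \<in> carrier G" "j < N" for g h j
    using that cN bc by (simp add: act_def)
  have bact: "b (act g h j) = g \<otimes> b j \<otimes> inv h" if "g \<in> carrier G" "h \<in> carrier G" "j < N" for g h j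
    using that cN bc by (simp add: act_def)
  have act_mult: "act g h (act g' h' j) = act (g \<otimes> g') (h \<otimes> h') j"
    if "g \<in> carrier G" "h \<in> carrier G" "g' \<in> carrier G" "h' \<in> carrier G" "j < N" for g h g' h' j
    using that bc bact[of g' h' j] by (simp add: act_def m_assoc inv_mult_group)
  have pm: "perm_mat N (act g h) * perm_mat N (act g' h') = (perm_mat N (act (g \<otimes> g') (h \<otimes> h')) :: 'b::comm_ring_1 mat)"
    if "g \<in> carrier G" "h \<in> carrier G" "g' \<in> carrier G" "h' \<in> carrier G" for g h g' h'
  proof -
    have "perm_mat N (act g h) * perm_mat N (act g' h') = (perm_mat N (\<lambda>j. act g h (act g' h' j)) :: 'b mat)"
      by (rule perm_mat_mult) (use actN that in auto)
    also have "\<dots> = perm_mat N (act (g \<otimes> g') (h \<otimes> h'))"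
      by (rule perm_mat_cong) (use act_mult that in auto)
    finally show ?thesis .
  qed
  have pm1: "perm_mat N (act \<one> \<one>) = (1\<^sub>m N :: 'b::comm_ring_1 mat)"
    by (rule perm_mat_id) (use bc cb in \<open>auto simp: act_def\<close>)
  have pow: "perm_mat N (act g h) ^\<^sub>m k = (perm_mat N (act (g [^] k) (h [^] k)) :: 'b::comm_ring_1 mat)"
    if "g \<in> carrier G" "h \<in> carrier G" for g h and k :: nat
  proof (induction k)
    case 0
    then show ?case by (simp add: pm1)
  next
    case (Suc k)
    then show ?case using pm[of "g [^] k" "h [^] k" g h] that by simp
  qed
  define L where "L g = (perm_mat N (act g \<one>) :: 'k mat)" for g
  define R where "R = (perm_mat N (act \<one> x) :: 'k mat)"
  have LR: "L g * R = perm_mat N (act g x)" "R * L g = perm_mat N (act g x)" if "g \<in> carrier G" for g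
    using pm[of g \<one> \<one> x] pm[of \<one> x g \<one>] that xc by (auto simp: L_def R_def)
  have "is_rep G N L"
    by (rule is_repI) (auto simp: L_def pm pm1)
  moreover have "R ^\<^sub>m ord x = 1\<^sub>m N" using xc by (simp add: R_def pow pm1)
  ultimately have s: "in_span (bchar (\<lambda>g. L g * R))"
    using LR regular_ord[OF x] by (intro in_span_commuting) (auto simp: R_def)
  have "brauer_val (L y * R) = of_nat (card {u \<in> carrier G. inv u \<otimes> y \<otimes> u = x})" if y: "regular y" for y
  proof -
    note yc = regular_carrier[OF y]
    let ?A = "perm_mat N (act y x) :: int mat"
    have k: "y [^] (ord y * ord x) = \<one>" "x [^] (ord y * ord x) = \<one>" using yc xc by (auto simp: pow_eq_id)
    have "?A ^\<^sub>m (ord y * ord x) = perm_mat N (act (y [^] (ord y * ord x)) (x [^] (ord y * ord x)))"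
      by (rule pow[OF yc xc])
    then have "?A ^\<^sub>m (ord y * ord x) = 1\<^sub>m N" using k pm1 by simp
    then have "brauer_val (map_mat of_int ?A) = of_int (mtrace ?A)"
      using regular_ord[OF x] regular_ord[OF y] by (intro brauer_val_of_int[of _ N "ord y * ord x"]) auto
    then have "brauer_val (L y * R) = of_nat (card {i. i < N \<and> act y x i = i})"
      using LR(1)[OF yc] by (simp add: map_mat_perm_mat mtrace_perm_mat)
    also have "card {i. i < N \<and> act y x i = i} = card {u \<in> carrier G. inv u \<otimes> y \<otimes> u = x}"
    proof (rule bij_betw_same_card[of b])
      have eq: "y \<otimes> u \<otimes> inv x = u \<longleftrightarrow> inv u \<otimes> y \<otimes> u = x" if u: "u \<in> carrier G" for u
      proof -
        have "y \<otimes> u \<otimes> inv x = u \<longleftrightarrow> y \<otimes> u = u \<otimes> x" using u yc xc by (metis inv_solve_right m_closed)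
        also have "\<dots> \<longleftrightarrow> inv u \<otimes> y \<otimes> u = x" using u yc xc by (metis inv_closed inv_solve_left m_assoc m_closed)
        finally show ?thesis .
      qed
      have act_iff: "act y x i = i \<longleftrightarrow> inv (b i) \<otimes> y \<otimes> b i = x" if i: "i < N" for i
      proof -
        have "act y x i = i \<longleftrightarrow> b (act y x i) = b i" using cb[OF i] cb[OF actN[OF yc xc i]] by metis
        then show ?thesis using bact[OF yc xc i] eq[OF bc[OF i]] by simp
      qed
      show "bij_betw b {i. i < N \<and> act y x i = i} {u \<in> carrier G. inv u \<otimes> y \<otimes> u = x}"
      proof (rule bij_betw_imageI)
        show "inj_on b {i. i < N \<and> act y x i = i}"
          using b by (auto simp: bij_betw_def inj_on_def)
        show "b ` {i. i < N \<and> act y x i = i} = {u \<in> carrier G. inv u \<otimes> y \<otimes> u = x}"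
        proof (intro subset_antisym subsetI)
          fix u assume "u \<in> b ` {i. i < N \<and> act y x i = i}"
          then obtain i where "i < N" "act y x i = i" "u = b i" by blast
          then show "u \<in> {u \<in> carrier G. inv u \<otimes> y \<otimes> u = x}" using act_iff[of i] bc[of i] by simp
        next
          fix u assume "u \<in> {u \<in> carrier G. inv u \<otimes> y \<otimes> u = x}"
          then have u: "u \<in> carrier G" "inv u \<otimes> y \<otimes> u = x" by auto
          then have "act y x (c u) = c u" using cN[of u] act_iff[of "c u"] by simp
          then show "u \<in> b ` {i. i < N \<and> act y x i = i}"
            using cN[OF u(1)] by (intro image_eqI[of _ _ "c u"]) auto
        qed
      qed
    qed
    finally show ?thesis .
  qed
  then have "bchar (\<lambda>g. L g * R) = (\<lambda>y. if regular y then of_nat (card {u \<in> carrier G. inv u \<otimes> y \<otimes> u = x}) else 0)"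
    by (auto simp: bchar_eq fun_eq_iff)
  then show ?thesis using s by simp
qed

text \<open>Write \<open>f y\<close> as the average of \<open>f\<close> over all conjugates of
  \<open>y\<close> and sort the terms by the value of \<open>inv u \<otimes> y \<otimes> u\<close>;
  the counting functions of \<open>in_span_class_count\<close> appear with weights
  \<open>f x\<close>.\<close>

lemma class_fun_in_span:
  assumes f: "class_fun p G f"
  shows "in_span f"
proof -
  let ?c = "\<lambda>x y. if regular y then of_nat (card {u \<in> carrier G. inv u \<otimes> y \<otimes> u = x}) else (0 :: complex)"
  have "f y = inverse (of_nat (card (carrier G))) * (\<Sum>x\<in>{x. regular x}. f x * ?c x y)" for y
  proof (cases "regular y")
    case True
    note yc = regular_carrier[OF True]
    have reg: "regular (inv u \<otimes> y \<otimes> u)" if u: "u \<in> carrier G" for u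
    proof -
      have "(inv u \<otimes> y \<otimes> u) [^] k = inv u \<otimes> y [^] k \<otimes> u" for k :: nat
      proof (induction k)
        case (Suc k)
        have "inv u \<otimes> y [^] k \<otimes> u \<otimes> (inv u \<otimes> y \<otimes> u) = inv u \<otimes> (y [^] k \<otimes> (u \<otimes> (inv u \<otimes> (y \<otimes> u))))"
          using u yc by (simp add: m_assoc)
        also have "u \<otimes> (inv u \<otimes> (y \<otimes> u)) = y \<otimes> u" using u yc by (simp add: mult_inv_cancel)
        finally show ?case using Suc u yc by (simp add: m_assoc)
      qed (use u in simp)
      then show ?thesis using True u by (auto simp: p_regular_iff)
    qed
    have fu: "f (inv u \<otimes> y \<otimes> u) = f y" if u: "u \<in> carrier G" for u
      using f True u unfolding class_fun_def by (metis inv_closed inv_inv)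
    have "(\<Sum>x\<in>{x. regular x}. f x * ?c x y) = (\<Sum>x\<in>{x. regular x}. \<Sum>u\<in>{u \<in> carrier G. inv u \<otimes> y \<otimes> u = x}. f (inv u \<otimes> y \<otimes> u))"
      using True by (intro sum.cong) auto
    also have "\<dots> = (\<Sum>u\<in>carrier G. f (inv u \<otimes> y \<otimes> u))"
      using reg by (intro sum.group[OF fin finite_regular]) auto
    also have "\<dots> = of_nat (card (carrier G)) * f y" using fu by simp
    finally have s: "(\<Sum>x\<in>{x. regular x}. f x * ?c x y) = of_nat (card (carrier G)) * f y" .
    have "card (carrier G) \<noteq> 0" using fin one_closed by (metis card_gt_0_iff emptyE less_numeral_extra(3))
    then show ?thesis by (simp only: s) simp
  qed (use f in \<open>auto simp: class_fun_def\<close>)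
  then have "f = (\<lambda>y. inverse (of_nat (card (carrier G))) * (\<Sum>x\<in>{x. regular x}. f x * ?c x y))" by blast
  moreover have "in_span (\<lambda>y. inverse (of_nat (card (carrier G))) * (\<Sum>x\<in>{x. regular x}. f x * ?c x y))"
    by (intro in_span_scale in_span_sum finite_regular) (simp add: in_span_class_count)
  ultimately show ?thesis by simp
qed

lemma ibr_coef_expand:
  assumes "class_fun p G f"
  shows "f y = (\<Sum>\<phi>\<in>IBr p red G. ibr_coef p red G f \<phi> * \<phi> y)"
proof -
  have "\<exists>a. \<forall>y. f y = (\<Sum>\<phi>\<in>IBr p red G. a \<phi> * \<phi> y)" using class_fun_in_span[OF assms] by (simp add: in_span_def)
  then have "\<forall>y. f y = (\<Sum>\<phi>\<in>IBr p red G. ibr_coef p red G f \<phi> * \<phi> y)"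
    unfolding ibr_coef_def by (rule someI_ex)
  then show ?thesis by blast
qed

end

section \<open>Subgroups, isomorphisms, duals and twists\<close>

context group
begin

lemma conj_pow_group:
  assumes "g \<in> carrier G" "y \<in> carrier G"
  shows "(g \<otimes> y \<otimes> inv g) [^] (k::nat) = g \<otimes> y [^] k \<otimes> inv g"
proof (induction k)
  case (Suc k)
  have "g \<otimes> y [^] k \<otimes> inv g \<otimes> (g \<otimes> y \<otimes> inv g) = g \<otimes> (y [^] k \<otimes> (inv g \<otimes> (g \<otimes> (y \<otimes> inv g))))"
    using assms by (simp add: m_assoc)
  also have "inv g \<otimes> (g \<otimes> (y \<otimes> inv g)) = y \<otimes> inv g" using assms by (simp add: mult_inv_cancel)
  finally show ?case using Suc assms by (simp add: m_assoc)
qed (use assms in simp)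

lemma p_regular_conj:
  assumes "g \<in> carrier G" "y \<in> carrier G"
  shows "p_regular G p (g \<otimes> y \<otimes> inv g) \<longleftrightarrow> p_regular G p y"
proof -
  have "g \<otimes> z \<otimes> inv g = \<one> \<longleftrightarrow> z = \<one>" if "z \<in> carrier G" for z
    using that assms by (metis inv_equality inv_solve_right' l_cancel_one m_closed r_inv r_one one_closed inv_closed inv_inv)
  then show ?thesis using assms by (simp add: p_regular_iff conj_pow_group)
qed

lemma p_regular_inv: "y \<in> carrier G \<Longrightarrow> p_regular G p (inv y) \<longleftrightarrow> p_regular G p y"
  by (simp add: p_regular_def)

lemma p_regular_subgroup:
  assumes "subgroup H G"
  shows "p_regular (G\<lparr>carrier := H\<rparr>) p y \<longleftrightarrow> y \<in> H \<and> p_regular G p y"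
proof -
  interpret H: group "G\<lparr>carrier := H\<rparr>" by (rule subgroup.subgroup_is_group[OF assms is_group])
  have "z [^]\<^bsub>G\<lparr>carrier := H\<rparr>\<^esub> k = z [^] k" for z and k :: nat
    by (simp add: nat_pow_def)
  then show ?thesis
    using subgroup.mem_carrier[OF assms] by (auto simp: p_regular_iff H.p_regular_iff)
qed

lemma is_rep_subgroup: "subgroup H G \<Longrightarrow> is_rep G n X \<Longrightarrow> is_rep (G\<lparr>carrier := H\<rparr>) n X"
  using subgroup.mem_carrier by (fastforce simp: is_rep_def)

end

lemma index_mult_mat_sum:
  assumes "A \<in> carrier_mat n m" "B \<in> carrier_mat m l" "i < n" "j < l"
  shows "(A * B) $$ (i,j) = (\<Sum>k<m. A $$ (i,k) * B $$ (k,j))"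
  using assms by (simp add: scalar_prod_def lessThan_atLeast0)

lemma is_rep_pullback:
  assumes "group G" "group H" and f: "f \<in> hom H G" and X: "is_rep G n X"
  shows "is_rep H n (X \<circ> f)"
proof -
  interpret group_hom H G f by (intro group_hom.intro assms) (simp add: group_hom_axioms_def f)
  show ?thesis by (rule is_repI) (use X in \<open>auto simp: is_rep_def hom_one\<close>)
qed

lemma irreducible_rep_pullback:
  assumes G: "group G" "group H" and f: "f \<in> hom H G" "f ` carrier H = carrier G"
    and X: "irreducible_rep G n X"
  shows "irreducible_rep H n (X \<circ> f)"
proof -
  interpret G: group G by fact
  interpret H: group H by fact
  have "invariant G X W" if "invariant H (X \<circ> f) W" for W
    unfolding invariant_def
  proof (intro ballI)
    fix g w assume g: "g \<in> carrier G" and w: "w \<in> W"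
    then obtain h where "h \<in> carrier H" "g = f h" using f(2) by blast
    then show "X g *\<^sub>v w \<in> W" using that w by (simp add: invariant_def)
  qed
  moreover have "is_rep H n (X \<circ> f)" by (rule is_rep_pullback[OF G f(1) G.irreducible_repD(2)[OF X]])
  ultimately show ?thesis using X
    by (simp add: G.irreducible_rep_iff H.irreducible_rep_iff)
qed

context finite_modular_group
begin

lemma subgroup_modular: "subgroup H G \<Longrightarrow> finite_modular_group (G\<lparr>carrier := H\<rparr>) p red"
  using subgroup.subgroup_is_group[OF _ is_group] fin modular_reduction_axioms subgroup.subset[of H G]
  by (auto simp: finite_modular_group_def finite_modular_group_axioms_def intro: finite_subset)

lemma regular_conj: "g \<in> carrier G \<Longrightarrow> y \<in> carrier G \<Longrightarrow> regular (g \<otimes> y \<otimes> inv g) \<longleftrightarrow> regular y"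
  by (rule p_regular_conj)

lemma bchar_subgroup: "subgroup H G \<Longrightarrow> brauer_char p red (G\<lparr>carrier := H\<rparr>) X = res H (bchar X)"
  by (auto simp: fun_eq_iff brauer_char_def res_def p_regular_subgroup)

lemma IBrE:
  assumes "\<phi> \<in> IBr p red G"
  obtains n X where "irreducible_rep G n (X :: 'a \<Rightarrow> 'k mat)" "\<phi> = bchar X"
  using assms by (auto simp: IBr_def)

lemma bchar_in_IBr: "irreducible_rep G n X \<Longrightarrow> bchar X \<in> IBr p red G"
  by (auto simp: IBr_def)

lemma bchar_class_fun:
  assumes X: "is_rep G n X"
  shows "class_fun p G (bchar X)"
  unfolding class_fun_def
proof (intro conjI allI impI)
  fix y g assume y: "regular y" and g: "g \<in> carrier G"
  note yc = regular_carrier[OF y]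
  have c: "X g \<in> carrier_mat n n" "X (inv g) \<in> carrier_mat n n" "X y \<in> carrier_mat n n"
    using X g yc by (auto simp: is_rep_def)
  have "X (g \<otimes> y \<otimes> inv g) = X g * X y * X (inv g)" using g yc by (simp add: is_rep_mult[OF X])
  then have "similar_mat (X (g \<otimes> y \<otimes> inv g)) (X y)"
    using c rep_inv[OF X g] by (intro similar_matI[of _ _ "X g" "X (inv g)" n]) auto
  then show "bchar X (g \<otimes> y \<otimes> inv g) = bchar X y"
    using y g yc by (simp add: bchar_eq regular_conj brauer_val_similar)
qed (simp add: bchar_eq)

lemma IBr_class_fun: "\<phi> \<in> IBr p red G \<Longrightarrow> class_fun p G \<phi>"
  by (auto elim!: IBrE intro!: bchar_class_fun dest: irreducible_repD(2))

lemma bchar_inv: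
  assumes X: "is_rep G n X" and y: "y \<in> carrier G"
  shows "bchar X (inv y) = cnj (bchar X y)"
proof (cases "regular y")
  case True
  have o: "ord y > 0" "coprime (ord y) p" using regular_ord[OF True] by auto
  have "y [^] (ord y - 1) \<otimes> y = \<one>" using o y by (simp flip: nat_pow_Suc)
  then have "inv y = y [^] (ord y - 1)" using y by (metis inv_equality nat_pow_closed)
  then have "X (inv y) = X y ^\<^sub>m (ord y - 1)" using rep_pow[OF X y] by simp
  then show ?thesis
    using brauer_val_inverse[OF is_rep_carrier[OF X y] rep_pow_ord[OF X y] o] True y
    by (simp add: bchar_eq p_regular_inv)
qed (use y in \<open>simp add: bchar_eq p_regular_inv\<close>)

lemma IBr_inv: "\<phi> \<in> IBr p red G \<Longrightarrow> y \<in> carrier G \<Longrightarrow> \<phi> (inv y) = cnj (\<phi> y)"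
  by (auto elim!: IBrE intro!: bchar_inv dest: irreducible_repD(2))

lemma cnj_fun_IBr:
  assumes "\<phi> \<in> IBr p red G"
  shows "cnj_fun \<phi> \<in> IBr p red G"
proof -
  obtain n X where X: "irreducible_rep G n (X :: 'a \<Rightarrow> 'k mat)" "\<phi> = bchar X" using IBrE[OF assms] .
  have "bchar (dual_rep X) = cnj_fun \<phi>"
  proof
    fix y
    show "bchar (dual_rep X) y = cnj_fun \<phi> y"
    proof (cases "regular y")
      case True
      note yc = regular_carrier[OF True]
      have "brauer_val (dual_rep X y) = brauer_val (X (inv y))"
        using is_rep_carrier[OF irreducible_repD(2)[OF X(1)], of "inv y"] yc
        by (simp add: dual_rep_def brauer_val_def eigs_transpose)
      then show ?thesis
        using True yc bchar_inv[OF irreducible_repD(2)[OF X(1)] yc] X(2) by (simp add: cnj_fun_def bchar_eq p_regular_inv)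
    qed (simp add: cnj_fun_def X(2) bchar_eq)
  qed
  then show ?thesis using bchar_in_IBr[OF irreducible_dual[OF X(1)]] by simp
qed

lemma IBr_pullback:
  assumes H: "finite_modular_group H p red" and f: "f \<in> iso H G" and \<phi>: "\<phi> \<in> IBr p red G"
  shows "(\<lambda>y. if y \<in> carrier H then \<phi> (f y) else 0) \<in> IBr p red H"
proof -
  interpret H: finite_modular_group H p red by fact
  have fh: "f \<in> hom H G" "f ` carrier H = carrier G" "inj_on f (carrier H)"
    using f by (auto simp: iso_def bij_betw_def)
  interpret h: group_hom H G f by unfold_locales (rule fh)
  obtain n X where X: "irreducible_rep G n (X :: 'a \<Rightarrow> 'k mat)" "\<phi> = bchar X" using IBrE[OF \<phi>] .
  have reg: "p_regular H p y \<longleftrightarrow> regular (f y)" if y: "y \<in> carrier H" for y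
  proof -
    have "f z = \<one> \<longleftrightarrow> z = \<one>\<^bsub>H\<^esub>" if "z \<in> carrier H" for z
      using fh(3) that by (metis H.one_closed h.hom_one inj_onD)
    then show ?thesis using y by (simp add: H.p_regular_iff p_regular_iff flip: h.hom_nat_pow)
  qed
  have "(\<lambda>y. if y \<in> carrier H then \<phi> (f y) else 0) = brauer_char p red H (X \<circ> f)"
    using reg H.regular_carrier by (auto simp: fun_eq_iff X(2) brauer_char_def)
  then show ?thesis
    using irreducible_rep_pullback[OF is_group H.is_group fh(1,2) X(1)] unfolding IBr_def by blast
qed

text \<open>The reduced values of the linear character \<open>l\<close> are scalars by which a
  representation may be multiplied; lifting returns \<open>l\<close>, because its values have order
  prime to p. Nonzero scalars do not change invariant subspaces, so irreducibility is kept.\<close>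

lemma IBr_twist:
  assumes \<phi>: "\<phi> \<in> IBr p red G" and l: "\<And>g h. g \<in> carrier G \<Longrightarrow> h \<in> carrier G \<Longrightarrow> l (g \<otimes> h) = l g * l h"
    and n: "\<And>g. g \<in> carrier G \<Longrightarrow> l g ^ n = 1" "n > 0" "coprime n p"
  shows "(\<lambda>y. l y * \<phi> y) \<in> IBr p red G"
    and "\<phi> = bchar X \<Longrightarrow> is_rep G m X \<Longrightarrow> (\<lambda>y. l y * \<phi> y) = bchar (\<lambda>y. red (l y) \<cdot>\<^sub>m X y)"
    and "irreducible_rep G m X \<Longrightarrow> irreducible_rep G m (\<lambda>y. red (l y) \<cdot>\<^sub>m X y)"
proof -
  let ?Y = "\<lambda>X y. red (l y) \<cdot>\<^sub>m X y"
  have rl: "red (l (g \<otimes> h)) = red (l g) * red (l h)" if "g \<in> carrier G" "h \<in> carrier G" for g h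
    using l[OF that] red_mult algebraic_int_root_of_unity n that by metis
  have rn: "red (l g) ^ n = 1" if "g \<in> carrier G" for g
    using red_power[OF n(1)[OF that] n(2), of n] n(1)[OF that] by simp
  have rnz: "red (l g) \<noteq> 0" if "g \<in> carrier G" for g
    using rn[OF that] n(2) by (metis power_0_left less_not_refl zero_neq_one)
  have l1: "l \<one> = 1"
  proof -
    have "l \<one> * l \<one> = l \<one> * 1" using l[OF one_closed one_closed] by simp
    moreover have "l \<one> \<noteq> 0" using n(1)[OF one_closed] n(2) by (metis power_0_left less_not_refl zero_neq_one)
    ultimately show ?thesis using mult_left_cancel by blast
  qed
  have repY: "is_rep G m (?Y X)" if X: "is_rep G m X" for m X
  proof (rule is_repI)
    fix g h assume gh: "g \<in> carrier G" "h \<in> carrier G"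
    have c: "X g \<in> carrier_mat m m" "X h \<in> carrier_mat m m" using X gh by (auto simp: is_rep_def)
    have "red (l g) \<cdot>\<^sub>m X g * (red (l h) \<cdot>\<^sub>m X h) = (red (l g) * red (l h)) \<cdot>\<^sub>m (X g * X h)"
      using c by (simp add: mult_smult_assoc_mat[of _ m m _ m] mult_smult_distrib[of _ m m _ m])
        (auto simp: mult.assoc intro!: eq_matI)
    then show "red (l (g \<otimes> h)) \<cdot>\<^sub>m X (g \<otimes> h) = red (l g) \<cdot>\<^sub>m X g * (red (l h) \<cdot>\<^sub>m X h)"
      using rl[OF gh] is_rep_mult[OF X gh] by simp
  qed (use X l1 in \<open>auto simp: is_rep_def\<close>)
  show irrY: "irreducible_rep G m (?Y X)" if X: "irreducible_rep G m X" for m X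
    unfolding irreducible_rep_iff
  proof (intro conjI allI impI)
    fix W assume W: "lin_subspace m W \<and> invariant G (?Y X) W"
    have "invariant G X W" unfolding invariant_def
    proof (intro ballI)
      fix g w assume g: "g \<in> carrier G" and w: "w \<in> W"
      have Xg: "X g \<in> carrier_mat m m" using irreducible_repD(2)[OF X] g by (simp add: is_rep_def)
      have wc: "w \<in> carrier_vec m" using W w by (auto simp: lin_subspace_def)
      have "(red (l g) \<cdot>\<^sub>m X g) *\<^sub>v w \<in> W" using W w g by (simp add: invariant_def)
      then have "inverse (red (l g)) \<cdot>\<^sub>v ((red (l g) \<cdot>\<^sub>m X g) *\<^sub>v w) \<in> W" using W by (simp add: lin_subspace_def)
      moreover have "(red (l g) \<cdot>\<^sub>m X g) *\<^sub>v w = red (l g) \<cdot>\<^sub>v (X g *\<^sub>v w)"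
        using Xg wc by (intro eq_vecI) auto
      ultimately show "X g *\<^sub>v w \<in> W" using rnz[OF g] by (simp add: smult_smult_assoc)
    qed
    then show "W = {0\<^sub>v m} \<or> W = carrier_vec m" using irreducible_repD(3)[OF X] W by blast
  qed (use irreducible_repD[OF X] repY in auto)
  show eY: "(\<lambda>y. l y * \<phi> y) = bchar (?Y X)" if "\<phi> = bchar X" and X: "is_rep G m X" for m X
  proof
    fix y
    show "l y * \<phi> y = bchar (?Y X) y"
    proof (cases "regular y")
      case True
      note yc = regular_carrier[OF True]
      have "brauer_val (red (l y) \<cdot>\<^sub>m X y) = lift (red (l y)) * brauer_val (X y)"
      proof (rule brauer_val_smult[OF is_rep_carrier[OF X yc]])
        show "X y ^\<^sub>m (ord y * n) = 1\<^sub>m m"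
          by (rule pow_mat_dvd[OF is_rep_carrier[OF X yc] rep_pow_ord[OF X yc]]) simp
        show "red (l y) ^ (ord y * n) = 1" using rn[OF yc] by (simp add: mult.commute power_mult)
      qed (use regular_ord[OF True] n in auto)
      then show ?thesis using True that(1) lift_red[OF n(1)[OF yc] n(2,3)] by (simp add: bchar_eq)
    qed (simp add: that(1) bchar_eq)
  qed
  obtain m X where X: "irreducible_rep G m (X :: 'a \<Rightarrow> 'k mat)" "\<phi> = bchar X" using IBrE[OF \<phi>] .
  then show "(\<lambda>y. l y * \<phi> y) \<in> IBr p red G"
    using eY[OF X(2) irreducible_repD(2)[OF X(1)]] bchar_in_IBr[OF irrY[OF X(1)]] by simp
qed

lemma sum_IBr_unique:
  assumes M: "set_mset M \<subseteq> IBr p red G" "set_mset M' \<subseteq> IBr p red G"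
    and e: "\<And>y. (\<Sum>\<mu>\<in>#M. \<mu> y) = (\<Sum>\<mu>\<in>#M'. \<mu> y)"
  shows "M = M'"
proof (rule multiset_eqI)
  fix \<phi>
  show "count M \<phi> = count M' \<phi>"
  proof (cases "\<phi> \<in> IBr p red G")
    case True
    have "(\<Sum>\<phi>\<in>IBr p red G. (of_nat (count M \<phi>) - of_nat (count M' \<phi>)) * \<phi> y) = 0" for y
      using e[of y] sum_mset_count[OF finite_IBr M(1), of "\<lambda>\<mu>. \<mu> y"] sum_mset_count[OF finite_IBr M(2), of "\<lambda>\<mu>. \<mu> y"]
      by (simp add: left_diff_distrib sum_subtractf)
    from IBr_independent[OF this True] show ?thesis by simp
  next
    case False
    then show ?thesis using M by (metis not_in_iff subsetD)
  qed
qed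

text \<open>A reducible representation of positive degree has at least two composition factors,
  against the uniqueness of decompositions; degree 0 is excluded by the value at the
  identity.\<close>

lemma bchar_IBr_irreducible:
  assumes X: "is_rep G n X" and b: "bchar X \<in> IBr p red G"
  shows "irreducible_rep G n X"
proof (rule ccontr)
  assume neg: "\<not> irreducible_rep G n X"
  from bchar_sum_IBr[OF X] obtain M where M: "set_mset M \<subseteq> IBr p red G" "\<And>y. bchar X y = (\<Sum>\<mu>\<in>#M. \<mu> y)"
    "n > 0 \<Longrightarrow> size M \<ge> 2" using neg by blast
  have "M = {#bchar X#}" using sum_IBr_unique[OF M(1), of "{#bchar X#}"] M(2) b by simp
  then have "n = 0" using M(3) by (cases "n = 0") auto
  obtain m Y where Y: "irreducible_rep G m (Y :: 'a \<Rightarrow> 'k mat)" "bchar X = bchar Y" using IBrE[OF b] .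
  have r1: "regular \<one>" by (auto simp: p_regular_iff intro: exI[of _ 1])
  have "bchar X \<one> = of_nat n" "bchar Y \<one> = of_nat m"
    using r1 X irreducible_repD(2)[OF Y(1)] by (auto simp: bchar_eq is_rep_def brauer_val_one)
  then show False using Y \<open>n = 0\<close> irreducible_repD(1)[OF Y(1)] by simp
qed

text \<open>Peeling off one irreducible image after the other shows that a representation generated by
  images of irreducible ones has no other composition factors.\<close>

lemma bchar_sum_of_generators:
  fixes X :: "'a \<Rightarrow> 'k mat"
  assumes "is_rep G n X"
    and "\<And>m Y S. (m,Y,S) \<in> T \<Longrightarrow> irreducible_rep G m Y \<and> bchar Y \<in> Orb \<and> S \<in> carrier_mat n m \<and> (\<forall>g\<in>carrier G. X g * S = S * Y g)"
    and "\<And>W. lin_subspace n W \<Longrightarrow> (\<And>m Y S v. (m,Y,S) \<in> T \<Longrightarrow> v \<in> carrier_vec m \<Longrightarrow> S *\<^sub>v v \<in> W) \<Longrightarrow> W = carrier_vec n"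
  shows "\<exists>M. set_mset M \<subseteq> Orb \<and> (\<forall>y. bchar X y = (\<Sum>\<mu>\<in>#M. \<mu> y))"
  using assms
proof (induction n arbitrary: X T rule: less_induct)
  case (less n)
  note X = less.prems(1) and T = less.prems(2) and span = less.prems(3)
  show ?case
  proof (cases "n = 0")
    case True
    have "bchar X y = 0" for y
    proof -
      have "eigs (X y) = {#}" if "y \<in> carrier G"
        using size_eigs[OF is_rep_carrier[OF X that]] True by simp
      then show ?thesis using regular_carrier by (simp add: bchar_eq brauer_val_def)
    qed
    then show ?thesis by (intro exI[of _ "{#}"]) auto
  next
    case False
    have "\<exists>m Y S. (m,Y,S) \<in> T \<and> S \<noteq> 0\<^sub>m n m"
    proof (rule ccontr)
      assume neg: "\<not> ?thesis"
      have "{0\<^sub>v n} = (carrier_vec n :: 'k vec set)"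
      proof (rule span)
        show "lin_subspace n {0\<^sub>v n :: 'k vec}" by (auto simp: lin_subspace_def)
        fix m Y S v assume "(m,Y,S) \<in> T" "(v :: 'k vec) \<in> carrier_vec m"
        then have "S = 0\<^sub>m n m" "v \<in> carrier_vec m" using neg by auto
        then show "S *\<^sub>v v \<in> {0\<^sub>v n}" by (auto intro!: eq_vecI)
      qed
      moreover have "unit_vec n 0 \<in> (carrier_vec n :: 'k vec set)" by simp
      ultimately have "unit_vec n 0 = (0\<^sub>v n :: 'k vec)" by blast
      then have "unit_vec n 0 $ 0 = (0\<^sub>v n :: 'k vec) $ 0" by simp
      then show False using False by simp
    qed
    then obtain m Y S where mYS: "(m,Y,S) \<in> T" "S \<noteq> 0\<^sub>m n m" by blast
    have Y: "irreducible_rep G m Y" "bchar Y \<in> Orb" and S: "S \<in> carrier_mat n m" "\<And>g. g \<in> carrier G \<Longrightarrow> X g * S = S * Y g"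
      using T[OF mYS(1)] by auto
    have inj: "inj_mat S" unfolding inj_mat_def
    proof -
      have c: "X g *\<^sub>v (S *\<^sub>v v) = S *\<^sub>v (Y g *\<^sub>v v)" if "g \<in> carrier G" "v \<in> carrier_vec m" for g v
      proof -
        have "X g *\<^sub>v (S *\<^sub>v v) = X g * S *\<^sub>v v"
          using is_rep_carrier[OF X that(1)] S that assoc_mult_mat_vec[of "X g" n n S m v] by simp
        also have "\<dots> = S *\<^sub>v (Y g *\<^sub>v v)"
          using is_rep_carrier[OF irreducible_repD(2)[OF Y(1)] that(1)] S that assoc_mult_mat_vec[of S n m "Y g" m v] by simp
        finally show ?thesis .
      qed
      have "invariant G Y {v \<in> carrier_vec m. S *\<^sub>v v = 0\<^sub>v n}" unfolding invariant_def
      proof (intro ballI)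
        fix g w assume g: "g \<in> carrier G" and w: "w \<in> {v \<in> carrier_vec m. S *\<^sub>v v = 0\<^sub>v n}"
        then have "S *\<^sub>v (Y g *\<^sub>v w) = X g *\<^sub>v 0\<^sub>v n" using c[OF g, of w] by simp
        also have "\<dots> = 0\<^sub>v n" by (rule mult_mat_zero_vec[OF is_rep_carrier[OF X g]])
        finally show "Y g *\<^sub>v w \<in> {v \<in> carrier_vec m. S *\<^sub>v v = 0\<^sub>v n}"
          using is_rep_carrier[OF irreducible_repD(2)[OF Y(1)] g] w by simp
      qed
      then have "{v \<in> carrier_vec m. S *\<^sub>v v = 0\<^sub>v n} = {0\<^sub>v m} \<or> {v \<in> carrier_vec m. S *\<^sub>v v = 0\<^sub>v n} = carrier_vec m"
        by (rule irreducible_repD(3)[OF Y(1) lin_subspace_kernel[OF S(1)]])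
      moreover have "{v \<in> carrier_vec m. S *\<^sub>v v = 0\<^sub>v n} \<noteq> carrier_vec m"
      proof
        assume full: "{v \<in> carrier_vec m. S *\<^sub>v v = 0\<^sub>v n} = carrier_vec m"
        have "S = 0\<^sub>m n m"
        proof (rule mat_eqI_mult_vec[OF S(1)])
          fix v assume v: "(v :: 'k vec) \<in> carrier_vec m"
          then have "S *\<^sub>v v = 0\<^sub>v n" using full by blast
          also have "\<dots> = 0\<^sub>m n m *\<^sub>v v" using v by (auto intro!: eq_vecI)
          finally show "S *\<^sub>v v = 0\<^sub>m n m *\<^sub>v v" .
        qed simp
        then show False using mYS by simp
      qed
      ultimately show "\<forall>v\<in>carrier_vec (dim_col S). S *\<^sub>v v = 0\<^sub>v (dim_row S) \<longrightarrow> v = 0\<^sub>v (dim_col S)"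
        using S(1) by auto
    qed
    have m0: "m > 0" using irreducible_repD(1)[OF Y(1)] .
    have cS: "mat_of_cols n (cols S) = S" "set (cols S) \<subseteq> carrier_vec n" "length (cols S) = m"
      using S(1) by (auto simp: cols_def mat_of_cols_def intro!: eq_matI)
    have full: "lin_subspace n (carrier_vec n :: 'k vec set)" by (auto simp: lin_subspace_def)
    from basis_extension[OF full cS(2)] inj cS(1) obtain us where
      us: "set (cols S @ us) \<subseteq> carrier_vec n" "inj_mat (mat_of_cols n (cols S @ us))"
      "\<And>w. w \<in> carrier_vec n \<Longrightarrow> \<exists>v\<in>carrier_vec (length (cols S @ us)). mat_of_cols n (cols S @ us) *\<^sub>v v = w" by metis
    define P where "P = mat_of_cols n (cols S @ us)"
    have "P \<in> carrier_mat n (length (cols S @ us))" by (simp add: P_def del: length_append)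
    with inj_mat_le[OF this] surj_mat_ge[OF this] us have len: "length (cols S @ us) = n"
      by (simp add: P_def)
    have P: "P \<in> carrier_mat n n" using \<open>P \<in> carrier_mat n (length (cols S @ us))\<close> len by simp
    obtain Q where Q: "Q \<in> carrier_mat n n" "P * Q = 1\<^sub>m n" "Q * P = 1\<^sub>m n"
      using inj_square_invertible[OF P] us by (auto simp: P_def)
    have mn: "m \<le> n" using len cS(3) by simp
    have PS: "P $$ (i,j) = S $$ (i,j)" if "i < n" "j < m" for i j
      using that S(1) mn len cS(3) by (simp add: P_def mat_of_cols_index nth_append)
    have QS: "(Q * S) $$ (i,j) = (if i = j then 1 else 0)" if "i < n" "j < m" for i j
    proof -
      have "(Q * S) $$ (i,j) = (Q * P) $$ (i,j)"
        using that S(1) P Q(1) PS mn by (simp add: scalar_prod_def)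
      then show ?thesis using Q(3) that mn by simp
    qed
    have XP: "(Q * X g * P) $$ (i,j) = (if i < m then Y g $$ (i,j) else 0)" if g: "g \<in> carrier G" and ij: "i < n" "j < m" for g i j
    proof -
      have Xg: "X g \<in> carrier_mat n n" and Yg: "Y g \<in> carrier_mat m m"
        using is_rep_carrier[OF X g] is_rep_carrier[OF irreducible_repD(2)[OF Y(1)] g] by auto
      have "(Q * X g * P) $$ (i,j) = (Q * X g * S) $$ (i,j)"
        using ij S(1) P Q PS Xg mn by (simp add: scalar_prod_def)
      also have "Q * X g * S = Q * (X g * S)" using Q Xg S(1) by (intro assoc_mult_mat) auto
      also have "\<dots> = Q * (S * Y g)" using S(2)[OF g] by simp
      also have "\<dots> = Q * S * Y g" using Q Yg S(1) by (intro assoc_mult_mat[symmetric]) auto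
      also have "(Q * S * Y g) $$ (i,j) = (\<Sum>l<m. (Q * S) $$ (i,l) * Y g $$ (l,j))"
        by (rule index_mult_mat_sum[OF mult_carrier_mat[OF Q(1) S(1)] Yg ij])
      also have "\<dots> = (\<Sum>l<m. if i = l then Y g $$ (l,j) else 0)"
        using QS ij by (intro sum.cong) auto
      also have "\<dots> = (if i < m then Y g $$ (i,j) else 0)" by simp
      finally show ?thesis .
    qed
    have b: "block_upper n m (Q * X g * P)" if "g \<in> carrier G" for g
      using XP[OF that] mn P Q is_rep_carrier[OF X that] by (auto simp: block_upper_def)
    have ul: "upper_left m (Q * X g * P) = Y g" if "g \<in> carrier G" for g
      using XP[OF that] mn is_rep_carrier[OF irreducible_repD(2)[OF Y(1)] that]
      by (intro eq_matI) (auto simp: upper_left_def)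
    note X' = is_rep_conj[OF X P Q]
    define Z where "Z g = lower_right m (Q * X g * P)" for g
    have Z: "is_rep G (n - m) Z" unfolding Z_def by (rule is_rep_lower_right[OF monoid_axioms X' b])
    \<comment> \<open>As \<open>P\<close> begins with the columns of \<open>S\<close>, the last rows
      of \<open>Q\<close> form the projection onto the quotient by the image of
      \<open>S\<close>.\<close>
    define \<pi> where "\<pi> = mat (n - m) n (\<lambda>(i,j). Q $$ (i + m,j))"
    have \<pi>: "\<pi> \<in> carrier_mat (n - m) n" by (simp add: \<pi>_def)
    have \<pi>Q: "(\<pi> * A) $$ (i,j) = (Q * A) $$ (i + m,j)" if "A \<in> carrier_mat n l" "i < n - m" "j < l" for A l i j
      using that Q by (simp add: \<pi>_def scalar_prod_def)
    have \<pi>X: "\<pi> * X g = Z g * \<pi>" if g: "g \<in> carrier G" for g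
    proof (rule eq_matI)
      have Xg: "X g \<in> carrier_mat n n" by (rule is_rep_carrier[OF X g])
      have Zg: "Z g \<in> carrier_mat (n - m) (n - m)" by (rule is_rep_carrier[OF Z g])
      fix i j assume "i < dim_row (Z g * \<pi>)" "j < dim_col (Z g * \<pi>)"
      then have ij: "i < n - m" "j < n" using Zg by (auto simp: \<pi>_def)
      have "Q * X g * P * Q = Q * X g * (P * Q)" using Q Xg P by (intro assoc_mult_mat) auto
      then have e: "Q * X g = Q * X g * P * Q" using Q Xg by simp
      have "(\<pi> * X g) $$ (i,j) = (Q * X g * P * Q) $$ (i + m, j)" using \<pi>Q[OF Xg ij] e by simp
      also have "\<dots> = (\<Sum>l<n. (Q * X g * P) $$ (i + m,l) * Q $$ (l,j))"
        using ij Q(1) Xg P by (intro index_mult_mat_sum[of _ n n _ n]) auto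
      also have "\<dots> = (\<Sum>l\<in>{m..<n}. (Q * X g * P) $$ (i + m,l) * Q $$ (l,j))"
        by (rule sum.mono_neutral_right) (use b[OF g] ij in \<open>auto simp: block_upper_def\<close>)
      also have "\<dots> = (\<Sum>l<n - m. (Q * X g * P) $$ (i + m,l + m) * Q $$ (l + m,j))"
        using mn by (intro sum.reindex_bij_witness[of _ "\<lambda>l. l + m" "\<lambda>l. l - m"]) auto
      also have "\<dots> = (Z g * \<pi>) $$ (i,j)"
      proof -
        have "(Z g * \<pi>) $$ (i,j) = (\<Sum>l<n - m. Z g $$ (i,l) * \<pi> $$ (l,j))"
          by (rule index_mult_mat_sum[OF Zg \<pi> ij])
        also have "\<dots> = (\<Sum>l<n - m. (Q * X g * P) $$ (i + m,l + m) * Q $$ (l + m,j))"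
          using ij carrier_matD[OF Q(1)] carrier_matD[OF P]
          by (intro sum.cong) (auto simp: \<pi>_def Z_def lower_right_def)
        finally show ?thesis by simp
      qed
      finally show "(\<pi> * X g) $$ (i,j) = (Z g * \<pi>) $$ (i,j)" .
    qed (use is_rep_carrier[OF X g] is_rep_carrier[OF Z g] in \<open>auto simp: \<pi>_def\<close>)
    \<comment> \<open>The images of the generators generate the quotient. Some of them become zero,
      at least that of \<open>S\<close>, which the conditions on the elements of \<open>T\<close>
      permit.\<close>
    define T' where "T' = (\<lambda>(m,Y,S). (m,Y,\<pi> * S)) ` T"
    have "\<exists>M. set_mset M \<subseteq> Orb \<and> (\<forall>y. bchar Z y = (\<Sum>\<mu>\<in>#M. \<mu> y))"
    proof (rule less.IH[of "n - m" Z T'])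
      show "n - m < n" using m0 False by simp
      show "is_rep G (n - m) Z" by fact
    next
      fix l Y' S' assume "(l,Y',S') \<in> T'"
      then obtain S0 where S0: "(l,Y',S0) \<in> T" "S' = \<pi> * S0" by (auto simp: T'_def)
      note t = T[OF S0(1)]
      have "Z g * S' = S' * Y' g" if g: "g \<in> carrier G" for g
      proof -
        have c: "X g \<in> carrier_mat n n" "Z g \<in> carrier_mat (n - m) (n - m)" "Y' g \<in> carrier_mat l l" "S0 \<in> carrier_mat n l"
          using is_rep_carrier[OF X g] is_rep_carrier[OF Z g] t is_rep_carrier[OF irreducible_repD(2) g] by auto
        have "Z g * S' = Z g * \<pi> * S0" using c \<pi> S0 by (simp add: assoc_mult_mat[of _ "n - m" "n - m" _ n _ l])
        also have "\<dots> = \<pi> * X g * S0" using \<pi>X[OF g] by simp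
        also have "\<dots> = \<pi> * (X g * S0)" using c \<pi> by (intro assoc_mult_mat) auto
        also have "\<dots> = \<pi> * (S0 * Y' g)" using t g by simp
        also have "\<dots> = S' * Y' g" using c \<pi> S0 by (simp add: assoc_mult_mat[of _ "n - m" n _ l _ l])
        finally show ?thesis .
      qed
      then show "irreducible_rep G l Y' \<and> bchar Y' \<in> Orb \<and> S' \<in> carrier_mat (n - m) l \<and> (\<forall>g\<in>carrier G. Z g * S' = S' * Y' g)"
        using t S0 \<pi> by auto
    next
      fix W assume W: "lin_subspace (n - m) W" and g: "\<And>l Y S v. (l,Y,S) \<in> T' \<Longrightarrow> v \<in> carrier_vec l \<Longrightarrow> S *\<^sub>v v \<in> W"
      have "{v \<in> carrier_vec n. \<pi> *\<^sub>v v \<in> W} = carrier_vec n"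
      proof (rule span)
        show "lin_subspace n {v \<in> carrier_vec n. \<pi> *\<^sub>v v \<in> W}"
          using W \<pi> by (auto simp: lin_subspace_def mult_add_distrib_mat_vec mult_mat_vec mult_mat_zero_vec)
        fix l Y' S0 v assume t: "(l,Y',S0) \<in> T" and v: "(v :: 'k vec) \<in> carrier_vec l"
        have S0: "S0 \<in> carrier_mat n l" using T[OF t] by simp
        have "(\<pi> * S0) *\<^sub>v v \<in> W" by (rule g[of l Y' "\<pi> * S0"]) (use t v in \<open>force simp: T'_def\<close>)+
        then show "S0 *\<^sub>v v \<in> {v \<in> carrier_vec n. \<pi> *\<^sub>v v \<in> W}"
          using assoc_mult_mat_vec[OF \<pi> S0 v] S0 v by simp
      qed
      then have all: "\<pi> *\<^sub>v v \<in> W" if "v \<in> carrier_vec n" for v using that by blast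
      have "w \<in> W" if w: "w \<in> carrier_vec (n - m)" for w
      proof -
        define u where "u = P *\<^sub>v vec n (\<lambda>i. if i < m then 0 else w $ (i - m))"
        have u: "u \<in> carrier_vec n" using P by (simp add: u_def)
        have Qu: "Q *\<^sub>v u = vec n (\<lambda>i. if i < m then 0 else w $ (i - m))"
          unfolding u_def by (rule inverse_mult_mat_vec[OF Q(1) P Q(3)]) simp
        have "\<pi> *\<^sub>v u = w"
        proof (rule eq_vecI)
          fix i assume i: "i < dim_vec w"
          have "(\<pi> *\<^sub>v u) $ i = (Q *\<^sub>v u) $ (i + m)" using i w Q u by (simp add: \<pi>_def scalar_prod_def)
          then show "(\<pi> *\<^sub>v u) $ i = w $ i" using Qu i w by simp
        qed (use w in \<open>auto simp: \<pi>_def\<close>)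
        then show ?thesis using all[OF u] by simp
      qed
      then show "W = carrier_vec (n - m)" using W by (auto simp: lin_subspace_def)
    qed
    then obtain M where M: "set_mset M \<subseteq> Orb" "\<And>y. bchar Z y = (\<Sum>\<mu>\<in>#M. \<mu> y)" by blast
    have "bchar X y = bchar Y y + bchar Z y" for y
    proof -
      have "bchar (\<lambda>g. upper_left m (Q * X g * P)) y = bchar Y y"
        using ul regular_carrier by (simp add: bchar_eq)
      then show ?thesis
        using bchar_blocks[of n m "\<lambda>g. Q * X g * P" y, OF b] bchar_conj[OF X P Q] by (simp add: Z_def[abs_def])
    qed
    then show ?thesis using M Y(2) by (intro exI[of _ "add_mset (bchar Y) M"]) auto
  qed
qed

end

section \<open>Restriction to a normal subgroup\<close>

lemma (in group) conj_cancel: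
  assumes "g \<in> carrier G" "y \<in> carrier G"
  shows "inv g \<otimes> (g \<otimes> y \<otimes> inv g) \<otimes> g = y" "g \<otimes> (inv g \<otimes> y \<otimes> g) \<otimes> inv g = y"
  using assms by (auto simp: m_assoc mult_inv_cancel)

lemma (in finite_modular_group) conj_fun_IBr:
  assumes H: "subgroup H G" and K: "subgroup K G" and g: "g \<in> carrier G"
    and HK: "\<And>y. y \<in> carrier G \<Longrightarrow> y \<in> K \<longleftrightarrow> g \<otimes> y \<otimes> inv g \<in> H"
    and \<psi>: "\<psi> \<in> IBr p red (G\<lparr>carrier := H\<rparr>)"
  shows "conj_fun G \<psi> g \<in> IBr p red (G\<lparr>carrier := K\<rparr>)"
proof -
  interpret H: finite_modular_group "G\<lparr>carrier := H\<rparr>" p red by (rule subgroup_modular[OF H])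
  have Kc: "y \<in> carrier G" if "y \<in> K" for y using that subgroup.mem_carrier[OF K] by simp
  have Hc: "y \<in> carrier G" if "y \<in> H" for y using that subgroup.mem_carrier[OF H] by simp
  let ?f = "\<lambda>y. g \<otimes> y \<otimes> inv g"
  have iso: "?f \<in> iso (G\<lparr>carrier := K\<rparr>) (G\<lparr>carrier := H\<rparr>)"
    unfolding iso_def
  proof (intro CollectI conjI)
    show "?f \<in> hom (G\<lparr>carrier := K\<rparr>) (G\<lparr>carrier := H\<rparr>)"
    proof (rule homI)
      fix y z assume "y \<in> carrier (G\<lparr>carrier := K\<rparr>)" "z \<in> carrier (G\<lparr>carrier := K\<rparr>)"
      then have c: "y \<in> carrier G" "z \<in> carrier G" using Kc by auto
      then have "?f y \<otimes> ?f z = g \<otimes> (y \<otimes> (inv g \<otimes> (g \<otimes> (z \<otimes> inv g))))" using g by (simp add: m_assoc)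
      also have "inv g \<otimes> (g \<otimes> (z \<otimes> inv g)) = z \<otimes> inv g" using c g by (simp add: mult_inv_cancel)
      finally show "?f (y \<otimes>\<^bsub>G\<lparr>carrier := K\<rparr>\<^esub> z) = ?f y \<otimes>\<^bsub>G\<lparr>carrier := H\<rparr>\<^esub> ?f z"
        using c g by (simp add: m_assoc)
    qed (use HK Kc in auto)
    show "bij_betw ?f (carrier (G\<lparr>carrier := K\<rparr>)) (carrier (G\<lparr>carrier := H\<rparr>))"
    proof (rule bij_betwI[where g = "\<lambda>y. inv g \<otimes> y \<otimes> g"])
      note forth = conj_cancel(1)[OF g]
      note bwd = conj_cancel(2)[OF g]
      show "?f \<in> carrier (G\<lparr>carrier := K\<rparr>) \<rightarrow> carrier (G\<lparr>carrier := H\<rparr>)" using HK Kc by auto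
      show "(\<lambda>y. inv g \<otimes> y \<otimes> g) \<in> carrier (G\<lparr>carrier := H\<rparr>) \<rightarrow> carrier (G\<lparr>carrier := K\<rparr>)"
        using HK Hc bwd g by auto
      show "\<And>y. y \<in> carrier (G\<lparr>carrier := K\<rparr>) \<Longrightarrow> inv g \<otimes> ?f y \<otimes> g = y" using forth Kc by simp
      show "\<And>y. y \<in> carrier (G\<lparr>carrier := H\<rparr>) \<Longrightarrow> ?f (inv g \<otimes> y \<otimes> g) = y" using bwd Hc by simp
    qed
  qed
  have z: "\<psi> y = 0" if "y \<notin> H" for y
  proof -
    have "\<not> p_regular (G\<lparr>carrier := H\<rparr>) p y" using that by (simp add: p_regular_def)
    then show ?thesis using H.IBr_class_fun[OF \<psi>] by (simp add: class_fun_def)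
  qed
  have "conj_fun G \<psi> g = (\<lambda>y. if y \<in> carrier (G\<lparr>carrier := K\<rparr>) then \<psi> (?f y) else 0)"
    using HK z Kc by (auto simp: conj_fun_def fun_eq_iff)
  then show ?thesis using H.IBr_pullback[OF subgroup_modular[OF K] iso \<psi>] by simp
qed

locale modular_normal = finite_modular_group G p red + normal N G
  for G :: "('a, 'm) monoid_scheme" (structure) and p and red :: "complex \<Rightarrow> 'k::alg_closed_field" and N
begin

abbreviation "GN \<equiv> G\<lparr>carrier := N\<rparr>"

sublocale N: finite_modular_group GN p red
  by (rule subgroup_modular[OF subgroup_axioms])

lemma N_subgroup: "subgroup N G" by (rule subgroup_axioms)

lemma N_carrier: "h \<in> N \<Longrightarrow> h \<in> carrier G"
  by (rule mem_carrier)

lemma N_conj_iff: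
  assumes "g \<in> carrier G" "y \<in> carrier G"
  shows "g \<otimes> y \<otimes> inv g \<in> N \<longleftrightarrow> y \<in> N"
proof
  assume "g \<otimes> y \<otimes> inv g \<in> N"
  then have "inv g \<otimes> (g \<otimes> y \<otimes> inv g) \<otimes> g \<in> N" using inv_op_closed1 assms by blast
  then show "y \<in> N" by (simp only: conj_cancel[OF assms])
qed (use inv_op_closed2 assms in blast)

lemma conj_fun_IBr_N: "\<mu> \<in> IBr p red GN \<Longrightarrow> g \<in> carrier G \<Longrightarrow> conj_fun G \<mu> g \<in> IBr p red GN"
  by (rule conj_fun_IBr[OF N_subgroup N_subgroup]) (auto simp: N_conj_iff)

lemma res_IBr_sum:
  assumes H: "subgroup H G" and \<phi>: "\<phi> \<in> IBr p red G"
  obtains M where "M \<noteq> {#}" "set_mset M \<subseteq> IBr p red (G\<lparr>carrier := H\<rparr>)" "\<And>y. res H \<phi> y = (\<Sum>\<mu>\<in>#M. \<mu> y)"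
proof -
  interpret H: finite_modular_group "G\<lparr>carrier := H\<rparr>" p red by (rule subgroup_modular[OF H])
  obtain n X where X: "irreducible_rep G n (X :: 'a \<Rightarrow> 'k mat)" "\<phi> = bchar X" using IBrE[OF \<phi>] .
  from H.bchar_sum_IBr[OF is_rep_subgroup[OF H irreducible_repD(2)[OF X(1)]]]
  show thesis using that irreducible_repD(1)[OF X(1)] X(2) bchar_subgroup[OF H, of X] by auto
qed

lemma conj_rep:
  assumes Y: "irreducible_rep GN d (Y :: 'a \<Rightarrow> 'k mat)" and g: "g \<in> carrier G"
  shows "irreducible_rep GN d (\<lambda>h. Y (inv g \<otimes> h \<otimes> g))"
    and "brauer_char p red GN (\<lambda>h. Y (inv g \<otimes> h \<otimes> g)) = conj_fun G (brauer_char p red GN Y) (inv g)"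
proof -
  let ?f = "\<lambda>h. inv g \<otimes> h \<otimes> g"
  have "?f \<in> hom GN GN"
  proof (rule homI)
    fix y z assume "y \<in> carrier GN" "z \<in> carrier GN"
    then have c: "y \<in> carrier G" "z \<in> carrier G" using N_carrier by auto
    then have "?f y \<otimes> ?f z = inv g \<otimes> (y \<otimes> (g \<otimes> (inv g \<otimes> (z \<otimes> g))))" using g by (simp add: m_assoc)
    also have "g \<otimes> (inv g \<otimes> (z \<otimes> g)) = z \<otimes> g" using c g by (simp add: mult_inv_cancel)
    finally show "?f (y \<otimes>\<^bsub>GN\<^esub> z) = ?f y \<otimes>\<^bsub>GN\<^esub> ?f z" using c g by (simp add: m_assoc)
  qed (use inv_op_closed1 g in auto)
  moreover have "?f ` carrier GN = carrier GN"
  proof (intro subset_antisym subsetI)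
    fix y assume y: "y \<in> carrier GN"
    then have yc: "y \<in> carrier G" using N_carrier by simp
    have "?f (g \<otimes> y \<otimes> inv g) = y" by (rule conj_cancel(1)[OF g yc])
    moreover have "g \<otimes> y \<otimes> inv g \<in> carrier GN" using inv_op_closed2 g y by simp
    ultimately show "y \<in> ?f ` carrier GN" by (metis image_eqI)
  qed (use inv_op_closed1 g in auto)
  ultimately show "irreducible_rep GN d (\<lambda>h. Y (inv g \<otimes> h \<otimes> g))"
    using irreducible_rep_pullback[OF N.is_group N.is_group _ _ Y, of ?f] by (simp add: o_def)
  have reg: "p_regular GN p (inv g \<otimes> y \<otimes> g) \<longleftrightarrow> p_regular GN p y" if y: "y \<in> carrier G" for y
    using p_regular_conj[of "inv g" y p] N_conj_iff[of "inv g" y] y g by (simp add: p_regular_subgroup[OF N_subgroup])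
  show "brauer_char p red GN (\<lambda>h. Y (inv g \<otimes> h \<otimes> g)) = conj_fun G (brauer_char p red GN Y) (inv g)"
  proof
    fix y
    show "brauer_char p red GN (\<lambda>h. Y (inv g \<otimes> h \<otimes> g)) y = conj_fun G (brauer_char p red GN Y) (inv g) y"
    proof (cases "y \<in> carrier G")
      case True
      then show ?thesis using reg[OF True] g by (simp add: brauer_char_def conj_fun_def)
    next
      case False
      then have "\<not> p_regular GN p y" using N_carrier by (auto simp: p_regular_def)
      then show ?thesis using False by (simp add: brauer_char_def conj_fun_def)
    qed
  qed
qed

text \<open>Moving \<open>h\<close> past \<open>g\<close> replaces it by a conjugate, which stays in
  the normal subgroup \<open>N\<close>.\<close>

lemma translate_intertwiner:
  assumes X: "is_rep G n X" and S: "S \<in> carrier_mat n d" "\<And>h. h \<in> N \<Longrightarrow> X h * S = S * Y h"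
    and Y: "is_rep GN d Y" and g: "g \<in> carrier G" and h: "h \<in> N"
  shows "X h * (X g * S) = X g * S * Y (inv g \<otimes> h \<otimes> g)"
proof -
  have hc: "h \<in> carrier G" using N_carrier h .
  have k: "inv g \<otimes> h \<otimes> g \<in> N" using inv_op_closed1 g h by simp
  have c: "X g \<in> carrier_mat n n" "X h \<in> carrier_mat n n" "X (inv g \<otimes> h \<otimes> g) \<in> carrier_mat n n"
    "Y (inv g \<otimes> h \<otimes> g) \<in> carrier_mat d d"
    using is_rep_carrier[OF X g] is_rep_carrier[OF X hc] is_rep_carrier[OF X N_carrier[OF k]]
      is_rep_carrier[OF Y, of "inv g \<otimes> h \<otimes> g"] k by auto
  have "h \<otimes> g = g \<otimes> (inv g \<otimes> (h \<otimes> g))" using g hc by (simp add: mult_inv_cancel)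
  then have "X (h \<otimes> g) = X (g \<otimes> (inv g \<otimes> h \<otimes> g))" using g hc by (simp add: m_assoc)
  then have e: "X h * X g = X g * X (inv g \<otimes> h \<otimes> g)" using g hc is_rep_mult[OF X] by simp
  have "X h * (X g * S) = X h * X g * S" using c S by (simp add: assoc_mult_mat[of _ n n _ n _ d])
  also have "\<dots> = X g * (X (inv g \<otimes> h \<otimes> g) * S)" unfolding e using c S by (simp add: assoc_mult_mat[of _ n n _ n _ d])
  also have "\<dots> = X g * (S * Y (inv g \<otimes> h \<otimes> g))" using S(2)[OF k] by simp
  also have "\<dots> = X g * S * Y (inv g \<otimes> h \<otimes> g)" using c S by (simp add: assoc_mult_mat[of _ n n _ d _ d])
  finally show ?thesis .
qed

text \<open>The vectors all of whose translates lie in \<open>W\<close> form a subspace invariant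
  under the whole group; it contains the nonzero image of \<open>S\<close>, so it is
  everything.\<close>

lemma translates_span:
  assumes X: "irreducible_rep G n X" and S: "S \<in> carrier_mat n d" "inj_mat S" "d > 0"
    and W: "lin_subspace n W" "\<And>g v. g \<in> carrier G \<Longrightarrow> v \<in> carrier_vec d \<Longrightarrow> X g *\<^sub>v (S *\<^sub>v v) \<in> (W :: 'k vec set)"
  shows "W = carrier_vec n"
proof -
  note Xr = irreducible_repD(2)[OF X]
  let ?U = "{u \<in> carrier_vec n. \<forall>g\<in>carrier G. X g *\<^sub>v u \<in> W}"
  have c: "X g \<in> carrier_mat n n" if "g \<in> carrier G" for g by (rule is_rep_carrier[OF Xr that])
  have "lin_subspace n ?U"
    using W(1) c by (auto simp: lin_subspace_def mult_add_distrib_mat_vec[OF c] mult_mat_vec[OF c] mult_mat_zero_vec[OF c])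
  moreover have "invariant G X ?U" unfolding invariant_def
  proof (intro ballI)
    fix h u assume h: "h \<in> carrier G" and u: "u \<in> ?U"
    have "X g *\<^sub>v (X h *\<^sub>v u) \<in> W" if g: "g \<in> carrier G" for g
    proof -
      have "X g *\<^sub>v (X h *\<^sub>v u) = X (g \<otimes> h) *\<^sub>v u"
        using assoc_mult_mat_vec[OF c[OF g] c[OF h], of u] u is_rep_mult[OF Xr g h] by simp
      then show ?thesis using u g h by simp
    qed
    then show "X h *\<^sub>v u \<in> ?U" using u c[OF h] by simp
  qed
  ultimately have "?U = {0\<^sub>v n} \<or> ?U = carrier_vec n" by (rule irreducible_repD(3)[OF X])
  moreover have "?U \<noteq> {0\<^sub>v n}"
  proof
    assume z: "?U = {0\<^sub>v n}"
    have "S *\<^sub>v unit_vec d 0 \<in> ?U" using W(2) S(1) by simp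
    then have "S *\<^sub>v unit_vec d 0 = 0\<^sub>v n" using z by blast
    then have "unit_vec d 0 = (0\<^sub>v d :: 'k vec)" using S by (auto simp: inj_mat_def)
    then have "unit_vec d 0 $ 0 = (0\<^sub>v d :: 'k vec) $ 0" by simp
    then show False using S(3) by simp
  qed
  ultimately have U: "?U = carrier_vec n" by blast
  have "u \<in> W" if u: "u \<in> carrier_vec n" for u
  proof -
    have "u \<in> ?U" using u U by blast
    then have "X \<one> *\<^sub>v u \<in> W" by blast
    then show ?thesis using is_rep_one[OF Xr] u by simp
  qed
  then show ?thesis using W(1) by (auto simp: lin_subspace_def)
qed

text \<open>The translates of one irreducible subrepresentation of the restriction generate the
  whole space, so by \<open>bchar_sum_of_generators\<close> all composition factors of the
  restriction are conjugate to it.\<close>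

lemma clifford:
  assumes \<phi>: "\<phi> \<in> IBr p red G"
  obtains \<mu> M where "\<mu> \<in> IBr p red GN" "M \<noteq> {#}" "set_mset M \<subseteq> conj_fun G \<mu> ` carrier G"
    "\<And>y. res N \<phi> y = (\<Sum>\<nu>\<in>#M. \<nu> y)"
proof -
  obtain n X where X: "irreducible_rep G n (X :: 'a \<Rightarrow> 'k mat)" "\<phi> = bchar X" using IBrE[OF \<phi>] .
  note Xr = irreducible_repD(2)[OF X(1)]
  note XN = is_rep_subgroup[OF N_subgroup Xr]
  from N.irreducible_sub_exists[OF XN irreducible_repD(1)[OF X(1)]] obtain d Y S where
    Y: "irreducible_rep GN d Y" and S: "S \<in> carrier_mat n d" "inj_mat S"
    "\<And>h. h \<in> carrier GN \<Longrightarrow> X h * S = S * Y h" by metis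
  let ?\<mu> = "brauer_char p red GN Y"
  let ?T = "(\<lambda>g. (d, \<lambda>h. Y (inv g \<otimes> h \<otimes> g), X g * S)) ` carrier G"
  have "\<exists>M. set_mset M \<subseteq> conj_fun G ?\<mu> ` carrier G \<and> (\<forall>y. brauer_char p red GN X y = (\<Sum>\<mu>\<in>#M. \<mu> y))"
  proof (rule N.bchar_sum_of_generators[OF XN, of ?T])
    fix m Y' S' assume "(m,Y',S') \<in> ?T"
    then obtain g where g: "g \<in> carrier G" and e: "m = d" "Y' = (\<lambda>h. Y (inv g \<otimes> h \<otimes> g))" "S' = X g * S" by auto
    show "irreducible_rep GN m Y' \<and> brauer_char p red GN Y' \<in> conj_fun G ?\<mu> ` carrier G \<and> S' \<in> carrier_mat n m \<and>
      (\<forall>h\<in>carrier GN. X h * S' = S' * Y' h)"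
      using conj_rep[OF Y g] g translate_intertwiner[OF Xr S(1) _ N.irreducible_repD(2)[OF Y] g] S(1,3) is_rep_carrier[OF Xr g]
      unfolding e by auto
  next
    fix W assume W: "lin_subspace n W" and g: "\<And>m Y S v. (m,Y,S) \<in> ?T \<Longrightarrow> v \<in> carrier_vec m \<Longrightarrow> S *\<^sub>v v \<in> (W :: 'k vec set)"
    show "W = carrier_vec n"
    proof (rule translates_span[OF X(1) S(1,2) N.irreducible_repD(1)[OF Y] W])
      fix h v assume h: "h \<in> carrier G" and v: "(v :: 'k vec) \<in> carrier_vec d"
      have "X h * S *\<^sub>v v \<in> W" by (rule g[of d "\<lambda>k. Y (inv h \<otimes> k \<otimes> h)"]) (use h v in auto)
      then show "X h *\<^sub>v (S *\<^sub>v v) \<in> W" using assoc_mult_mat_vec[OF is_rep_carrier[OF Xr h] S(1) v] by simp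
    qed
  qed
  then obtain M where M: "set_mset M \<subseteq> conj_fun G ?\<mu> ` carrier G" "\<And>y. res N \<phi> y = (\<Sum>\<mu>\<in>#M. \<mu> y)"
    using bchar_subgroup[OF N_subgroup, of X] X(2) by auto
  have "M \<noteq> {#}"
  proof
    assume "M = {#}"
    then have "res N \<phi> \<one> = 0" using M(2) by simp
    moreover have "regular \<one>" by (auto simp: p_regular_iff intro: exI[of _ 1])
    ultimately have "of_nat n = (0 :: complex)"
      using one_closed X(2) Xr by (simp add: res_def bchar_eq is_rep_def brauer_val_one)
    then show False using irreducible_repD(1)[OF X(1)] by simp
  qed
  then show thesis using that N.bchar_in_IBr[OF Y] M by blast
qed

text \<open>If the restriction is reducible, take an irreducible subrepresentation \<open>S\<close>
  and an irreducible quotient \<open>R\<close> of it. The translates of \<open>S\<close> generate,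
  so \<open>R\<close> does not kill some translate \<open>A\<close>, and Schur's lemma makes
  \<open>R * A\<close> invertible. This yields an endomorphism \<open>E\<close> with
  \<open>R * E = R\<close>. It has a kernel, because \<open>R\<close> has fewer rows than columns;
  being scalar it is then zero, which forces \<open>R\<close> to be zero.\<close>

lemma endomorphisms_scalar_imp_irreducible:
  assumes X: "irreducible_rep G n (X :: 'a \<Rightarrow> 'k mat)"
    and sc: "\<And>S. S \<in> carrier_mat n n \<Longrightarrow> (\<And>h. h \<in> N \<Longrightarrow> X h * S = S * X h) \<Longrightarrow> \<exists>c. S = c \<cdot>\<^sub>m 1\<^sub>m n"
  shows "irreducible_rep GN n X"
proof (rule ccontr)
  assume neg: "\<not> irreducible_rep GN n X"
  note Xr = irreducible_repD(2)[OF X]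
  note XN = is_rep_subgroup[OF N_subgroup Xr]
  obtain d Y S where
    Y: "irreducible_rep GN d Y" and S: "S \<in> carrier_mat n d" "inj_mat S"
    "\<And>h. h \<in> carrier GN \<Longrightarrow> X h * S = S * Y h" and or: "irreducible_rep GN n X \<or> d < n"
    using N.irreducible_sub_exists[OF XN irreducible_repD(1)[OF X]] by metis
  have dn: "d < n" using or neg by simp
  obtain z Z R where
    Z: "irreducible_rep GN z Z" and R: "R \<in> carrier_mat z n" "R \<noteq> 0\<^sub>m z n"
    "\<And>h. h \<in> carrier GN \<Longrightarrow> R * X h = Z h * R"
    using N.irreducible_quotient_exists[OF XN irreducible_repD(1)[OF X]] by metis
  have S3: "X h * S = S * Y h" and R3: "R * X h = Z h * R" if "h \<in> N" for h using S(3) R(3) that by auto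
  have "\<exists>g\<in>carrier G. R * (X g * S) \<noteq> 0\<^sub>m z d"
  proof (rule ccontr)
    assume z: "\<not> ?thesis"
    have "{v \<in> carrier_vec n. R *\<^sub>v v = 0\<^sub>v z} = carrier_vec n"
    proof (rule translates_span[OF X S(1,2) N.irreducible_repD(1)[OF Y] lin_subspace_kernel[OF R(1)]])
      fix g v assume g: "g \<in> carrier G" and v: "(v :: 'k vec) \<in> carrier_vec d"
      have c: "X g \<in> carrier_mat n n" by (rule is_rep_carrier[OF Xr g])
      have "R *\<^sub>v (X g *\<^sub>v (S *\<^sub>v v)) = R * (X g * S) *\<^sub>v v"
        using assoc_mult_mat_vec[OF c S(1) v] assoc_mult_mat_vec[OF R(1) mult_carrier_mat[OF c S(1)] v] by simp
      also have "\<dots> = 0\<^sub>v z" using z g v by (auto intro!: eq_vecI)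
      finally show "X g *\<^sub>v (S *\<^sub>v v) \<in> {v \<in> carrier_vec n. R *\<^sub>v v = 0\<^sub>v z}" using c S v by simp
    qed
    then have Rz: "R *\<^sub>v v = 0\<^sub>v z" if "v \<in> carrier_vec n" for v using that by blast
    have "R = 0\<^sub>m z n"
      by (rule mat_eqI_mult_vec[OF R(1)]) (use Rz in \<open>auto intro!: eq_vecI\<close>)
    then show False using R(2) by simp
  qed
  then obtain g where g: "g \<in> carrier G" and nz: "R * (X g * S) \<noteq> 0\<^sub>m z d" by blast
  define A where "A = X g * S"
  define Y' where "Y' h = Y (inv g \<otimes> h \<otimes> g)" for h
  have A: "A \<in> carrier_mat n d" using is_rep_carrier[OF Xr g] S(1) by (simp add: A_def)
  have Y': "irreducible_rep GN d Y'" unfolding Y'_def by (rule conj_rep(1)[OF Y g])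
  have XA: "X h * A = A * Y' h" if h: "h \<in> N" for h
    unfolding A_def Y'_def using translate_intertwiner[OF Xr S(1) S3 N.irreducible_repD(2)[OF Y] g h] by simp
  have c: "X h \<in> carrier_mat n n" "Y' h \<in> carrier_mat d d" "Z h \<in> carrier_mat z z" if h: "h \<in> N" for h
    using is_rep_carrier[OF Xr N_carrier[OF h]] is_rep_carrier[OF N.irreducible_repD(2)[OF Y'], of h]
      is_rep_carrier[OF N.irreducible_repD(2)[OF Z], of h] h by auto
  have ZRA: "Z h * (R * A) = R * A * Y' h" if h: "h \<in> N" for h
  proof -
    have "Z h * (R * A) = Z h * R * A" using c[OF h] R A by (simp add: assoc_mult_mat[of _ z z _ n _ d])
    also have "\<dots> = R * (X h * A)"     proof -
      have "R * (X h * A) = R * X h * A" using c[OF h] R A by (intro assoc_mult_mat[symmetric]) auto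
      then show ?thesis using R3[OF h] by simp
    qed
    also have "\<dots> = R * A * Y' h" using XA[OF h] c[OF h] R A by (simp add: assoc_mult_mat[of _ z n _ d _ d])
    finally show ?thesis .
  qed
  from N.schur[OF Z Y', of "R * A"] R A ZRA nz obtain B where zd: "z = d" and
    B: "B \<in> carrier_mat z z" "R * A * B = 1\<^sub>m z" "B * (R * A) = 1\<^sub>m z" by (auto simp: A_def)
  have Ac: "A \<in> carrier_mat n z" using A zd by simp
  \<comment> \<open>The projection onto the image of \<open>A\<close> along the kernel of
    \<open>R\<close>; \<open>B\<close> is the inverse of \<open>R * A\<close>.\<close>
  define E where "E = A * (B * R)"
  have BR: "B * R \<in> carrier_mat z n" using B R by simp
  have E: "E \<in> carrier_mat n n" using Ac BR by (simp add: E_def)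
  have YB: "Y' h * B = B * Z h" if h: "h \<in> N" for h
    using intertwiner_inverse(1)[of "Z h" z "Y' h" "R * A" B] ZRA[OF h] c[OF h] R Ac B zd by auto
  have "X h * E = E * X h" if h: "h \<in> N" for h
  proof -
    have "X h * E = X h * A * (B * R)" using c[OF h] Ac BR by (simp add: E_def assoc_mult_mat[of _ n n _ z _ n])
    also have "\<dots> = A * (Y' h * (B * R))" using XA[OF h] c[OF h] Ac BR zd by (simp add: assoc_mult_mat[of _ n d _ d _ n])
    also have "Y' h * (B * R) = B * (Z h * R)"
    proof -
      have "Y' h * (B * R) = Y' h * B * R" using c[OF h] B R zd by (intro assoc_mult_mat[symmetric]) auto
      also have "\<dots> = B * Z h * R" using YB[OF h] by simp
      also have "\<dots> = B * (Z h * R)" using c[OF h] B R zd by (intro assoc_mult_mat) auto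
      finally show ?thesis .
    qed
    also have "\<dots> = B * (R * X h)" using R3[OF h] by simp
    also have "A * (B * (R * X h)) = E * X h"
      using c[OF h] Ac B R BR by (simp add: E_def assoc_mult_mat[of _ n z _ n _ n] assoc_mult_mat[of _ z z _ n _ n])
    finally show ?thesis .
  qed
  from sc[OF E this] obtain a where a: "E = a \<cdot>\<^sub>m 1\<^sub>m n" by blast
  have "\<not> inj_mat R" using inj_mat_le[OF R(1)] dn zd by auto
  then obtain v where v: "v \<in> carrier_vec n" "R *\<^sub>v v = 0\<^sub>v z" "v \<noteq> 0\<^sub>v n" using R(1) by (auto simp: inj_mat_def)
  have "E *\<^sub>v v = A *\<^sub>v (B *\<^sub>v (R *\<^sub>v v))"
    using assoc_mult_mat_vec[OF Ac BR v(1)] assoc_mult_mat_vec[OF B(1) R(1) v(1)] by (simp add: E_def)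
  also have "\<dots> = 0\<^sub>v n" using v(2) mult_mat_zero_vec[OF B(1)] mult_mat_zero_vec[OF Ac] by simp
  finally have "E *\<^sub>v v = 0\<^sub>v n" .
  moreover have "(a \<cdot>\<^sub>m 1\<^sub>m n) *\<^sub>v v = a \<cdot>\<^sub>v v" using v(1) by (intro eq_vecI) auto
  ultimately have "a \<cdot>\<^sub>v v = 0\<^sub>v n" using a by simp
  then have "a = 0"
  proof -
    obtain i where i: "i < n" "v $ i \<noteq> 0" using v(1,3) by (metis carrier_vecD eq_vecI index_zero_vec)
    have "(a \<cdot>\<^sub>v v) $ i = 0\<^sub>v n $ i" using \<open>a \<cdot>\<^sub>v v = 0\<^sub>v n\<close> by simp
    then show ?thesis using i v(1) by simp
  qed
  then have E0: "E = 0\<^sub>m n n" using a by (auto intro!: eq_matI)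
  have "R = R * A * B * R" unfolding B(2) using R(1) by simp
  also have "\<dots> = R * A * (B * R)" using R(1) Ac B(1) by (intro assoc_mult_mat[of _ z z _ z _ n]) auto
  also have "\<dots> = R * E" unfolding E_def using R(1) Ac BR by (intro assoc_mult_mat[of _ z n _ z _ n]) auto
  also have "\<dots> = 0\<^sub>m z n" using E0 R(1) by simp
  finally show False using R(2) by simp
qed

end

section \<open>Extensions to a group with cyclic quotient\<close>

definition mat_sum :: "nat \<Rightarrow> nat \<Rightarrow> (nat \<Rightarrow> 'k::comm_ring_1 mat) \<Rightarrow> 'k mat" where
  "mat_sum n k f = mat n n (\<lambda>(a,b). \<Sum>i<k. f i $$ (a,b))"

lemma mat_sum_carrier [simp]: "mat_sum n k f \<in> carrier_mat n n"
  by (simp add: mat_sum_def)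

lemma mult_mat_sum:
  assumes B: "B \<in> carrier_mat n n" and f: "\<And>i. i < k \<Longrightarrow> f i \<in> carrier_mat n n"
  shows "B * mat_sum n k f = mat_sum n k (\<lambda>i. B * f i)" "mat_sum n k f * B = mat_sum n k (\<lambda>i. f i * B)"
proof -
  show "B * mat_sum n k f = mat_sum n k (\<lambda>i. B * f i)"
  proof (rule eq_matI)
    fix a b assume "a < dim_row (mat_sum n k (\<lambda>i. B * f i))" "b < dim_col (mat_sum n k (\<lambda>i. B * f i))"
    then have ab: "a < n" "b < n" by (auto simp: mat_sum_def)
    have "(B * mat_sum n k f) $$ (a,b) = (\<Sum>c<n. B $$ (a,c) * (\<Sum>i<k. f i $$ (c,b)))"
      using index_mult_mat_sum[OF B mat_sum_carrier ab, of k f] ab by (simp add: mat_sum_def)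
    also have "\<dots> = (\<Sum>i<k. \<Sum>c<n. B $$ (a,c) * f i $$ (c,b))"
      unfolding sum_distrib_left by (rule sum.swap)
    also have "\<dots> = (\<Sum>i<k. (B * f i) $$ (a,b))"
      by (intro sum.cong refl index_mult_mat_sum[symmetric, OF B _ ab]) (use f in auto)
    finally show "(B * mat_sum n k f) $$ (a,b) = mat_sum n k (\<lambda>i. B * f i) $$ (a,b)"
      using ab by (simp add: mat_sum_def)
  qed (use B in \<open>auto simp: mat_sum_def\<close>)
  show "mat_sum n k f * B = mat_sum n k (\<lambda>i. f i * B)"
  proof (rule eq_matI)
    fix a b assume "a < dim_row (mat_sum n k (\<lambda>i. f i * B))" "b < dim_col (mat_sum n k (\<lambda>i. f i * B))"
    then have ab: "a < n" "b < n" by (auto simp: mat_sum_def)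
    have "(mat_sum n k f * B) $$ (a,b) = (\<Sum>c<n. (\<Sum>i<k. f i $$ (a,c)) * B $$ (c,b))"
      using index_mult_mat_sum[OF mat_sum_carrier B ab, of k f] ab by (simp add: mat_sum_def)
    also have "\<dots> = (\<Sum>i<k. \<Sum>c<n. f i $$ (a,c) * B $$ (c,b))"
      unfolding sum_distrib_right by (rule sum.swap)
    also have "\<dots> = (\<Sum>i<k. (f i * B) $$ (a,b))"
      by (intro sum.cong refl index_mult_mat_sum[symmetric, OF _ B ab]) (use f in auto)
    finally show "(mat_sum n k f * B) $$ (a,b) = mat_sum n k (\<lambda>i. f i * B) $$ (a,b)"
      using ab by (simp add: mat_sum_def)
  qed (use B in \<open>auto simp: mat_sum_def\<close>)
qed

lemma mat_sum_cong: "(\<And>i. i < k \<Longrightarrow> f i = g i) \<Longrightarrow> mat_sum n k f = mat_sum n k g"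
  by (auto simp: mat_sum_def intro!: eq_matI)

lemma mat_sum_cyclic_shift:
  assumes "f k = f 0"
  shows "mat_sum n k (\<lambda>i. f (Suc i)) = mat_sum n k f"
proof -
  have "(\<Sum>i<k. f (Suc i) $$ ab) = (\<Sum>i<k. f i $$ ab)" for ab
    using sum.lessThan_Suc_shift[of "\<lambda>i. f i $$ ab" k] assms by simp
  then show ?thesis by (simp add: mat_sum_def)
qed

lemma smult_mat_sum:
  assumes "\<And>i. i < k \<Longrightarrow> f i \<in> carrier_mat n n"
  shows "c \<cdot>\<^sub>m mat_sum n k f = mat_sum n k (\<lambda>i. c \<cdot>\<^sub>m f i)"
proof (rule eq_matI)
  fix a b assume "a < dim_row (mat_sum n k (\<lambda>i. c \<cdot>\<^sub>m f i))" "b < dim_col (mat_sum n k (\<lambda>i. c \<cdot>\<^sub>m f i))"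
  then have ab: "a < n" "b < n" by (auto simp: mat_sum_def)
  have "(c \<cdot>\<^sub>m f i) $$ (a,b) = c * f i $$ (a,b)" if "i < k" for i
    using assms[OF that] ab by simp
  then show "(c \<cdot>\<^sub>m mat_sum n k f) $$ (a,b) = mat_sum n k (\<lambda>i. c \<cdot>\<^sub>m f i) $$ (a,b)"
    using ab by (simp add: mat_sum_def sum_distrib_left)
qed (auto simp: mat_sum_def)

context modular_reduction
begin

lemma unity_root_primitive:
  assumes L: "L > 0" and k: "unity_root L ^ k = 1"
  shows "L dvd k"
proof -
  let ?f = "\<lambda>k. cis (2 * pi * real k / real L)"
  have e: "?f j = unity_root L ^ j" for j by (simp add: unity_root_def DeMoivre mult_ac)
  have "unity_root L ^ (L * (k div L) + k mod L) = unity_root L ^ (k mod L)"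
    unfolding power_add power_mult unity_root_power[OF L] by simp
  then have "?f (k mod L) = ?f 0" using k e by simp
  moreover have "inj_on ?f {..<L}" using bij_betw_roots_unity[OF L] by (simp add: bij_betw_def)
  ultimately have "k mod L = 0" using L by (simp add: inj_on_def)
  then show ?thesis by auto
qed

end

context finite_modular_group
begin

lemma class_fun_add: "class_fun p G f \<Longrightarrow> class_fun p G g \<Longrightarrow> class_fun p G (\<lambda>y. f y + g y)"
  by (simp add: class_fun_def)

lemma class_fun_scale: "class_fun p G f \<Longrightarrow> class_fun p G (\<lambda>y. c * f y)"
  by (simp add: class_fun_def)

lemma class_fun_sum: "(\<And>x. x \<in> A \<Longrightarrow> class_fun p G (f x)) \<Longrightarrow> class_fun p G (\<lambda>y. \<Sum>x\<in>A. f x y)"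
  by (simp add: class_fun_def)

lemma class_fun_lincomb: "(\<And>\<phi>. \<phi> \<in> A \<Longrightarrow> \<phi> \<in> IBr p red G) \<Longrightarrow> class_fun p G (\<lambda>y. \<Sum>\<phi>\<in>A. a \<phi> * \<phi> y)"
  by (intro class_fun_sum class_fun_scale IBr_class_fun) auto

lemma ibr_coef_add:
  assumes "class_fun p G f" "class_fun p G g" "\<phi> \<in> IBr p red G"
  shows "ibr_coef p red G (\<lambda>y. f y + g y) \<phi> = ibr_coef p red G f \<phi> + ibr_coef p red G g \<phi>"
  by (rule ibr_coef_unique[where a = "\<lambda>\<phi>. ibr_coef p red G f \<phi> + ibr_coef p red G g \<phi>"])
    (use assms in \<open>auto simp: distrib_right sum.distrib simp flip: ibr_coef_expand\<close>)

lemma ibr_coef_scale: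
  assumes "class_fun p G f" "\<phi> \<in> IBr p red G"
  shows "ibr_coef p red G (\<lambda>y. c * f y) \<phi> = c * ibr_coef p red G f \<phi>"
  by (rule ibr_coef_unique[where a = "\<lambda>\<phi>. c * ibr_coef p red G f \<phi>"])
    (use assms in \<open>auto simp: mult.assoc simp flip: ibr_coef_expand sum_distrib_left\<close>)

lemma ibr_coef_zero:
  assumes "\<phi> \<in> IBr p red G"
  shows "ibr_coef p red G (\<lambda>y. 0) \<phi> = 0"
  by (rule ibr_coef_unique[where a = "\<lambda>\<phi>. 0"]) (use assms in auto)

lemma ibr_coef_sum:
  assumes "finite A" "\<And>x. x \<in> A \<Longrightarrow> class_fun p G (f x)" "\<phi> \<in> IBr p red G"
  shows "ibr_coef p red G (\<lambda>y. \<Sum>x\<in>A. f x y) \<phi> = (\<Sum>x\<in>A. ibr_coef p red G (f x) \<phi>)"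
  using assms
proof (induction A rule: finite_induct)
  case empty
  then show ?case by (simp add: ibr_coef_zero)
next
  case (insert x A)
  then show ?case by (simp add: ibr_coef_add[of "f x"] class_fun_sum)
qed

lemma ibr_coef_IBr:
  assumes "\<psi> \<in> IBr p red G" "\<phi> \<in> IBr p red G"
  shows "ibr_coef p red G \<psi> \<phi> = (if \<phi> = \<psi> then 1 else 0)"
proof (rule ibr_coef_unique[where a = "\<lambda>\<phi>. if \<phi> = \<psi> then 1 else 0"])
  fix y
  have "(\<Sum>\<phi>\<in>IBr p red G. (if \<phi> = \<psi> then 1 else 0) * \<phi> y) = (\<Sum>\<phi>\<in>IBr p red G. if \<phi> = \<psi> then \<psi> y else 0)"
    by (intro sum.cong) auto
  then show "\<psi> y = (\<Sum>\<phi>\<in>IBr p red G. (if \<phi> = \<psi> then 1 else 0) * \<phi> y)"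
    using assms finite_IBr by simp
qed fact

lemma ibr_coef_lincomb:
  assumes "A \<subseteq> IBr p red G" "\<phi> \<in> IBr p red G"
  shows "ibr_coef p red G (\<lambda>y. \<Sum>\<psi>\<in>A. a \<psi> * \<psi> y) \<phi> = (if \<phi> \<in> A then a \<phi> else 0)"
proof (rule ibr_coef_unique[where a = "\<lambda>\<phi>. if \<phi> \<in> A then a \<phi> else 0"])
  fix y
  have "(\<Sum>\<phi>\<in>IBr p red G. (if \<phi> \<in> A then a \<phi> else 0) * \<phi> y) = (\<Sum>\<phi>\<in>IBr p red G. if \<phi> \<in> A then a \<phi> * \<phi> y else 0)"
    by (intro sum.cong) auto
  also have "\<dots> = (\<Sum>\<psi>\<in>A. a \<psi> * \<psi> y)"
    using finite_IBr assms(1) by (simp add: sum.inter_restrict[symmetric] Int_absorb1)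
  finally show "(\<Sum>\<psi>\<in>A. a \<psi> * \<psi> y) = (\<Sum>\<phi>\<in>IBr p red G. (if \<phi> \<in> A then a \<phi> else 0) * \<phi> y)" by simp
qed fact

end

locale cyclic_extension = modular_normal G p red N
  for G :: "('a, 'm) monoid_scheme" (structure) and p and red :: "complex \<Rightarrow> 'k::alg_closed_field" and N +
  fixes x
  assumes x_regular: "regular x" and generated: "\<And>g. g \<in> carrier G \<Longrightarrow> \<exists>h\<in>N. \<exists>i::nat. g = h \<otimes> x [^] i"
begin

definition ext_order :: nat where
  "ext_order = group.ord (G Mod N) (N #> x)"

lemma x_carrier: "x \<in> carrier G"
  by (rule regular_carrier[OF x_regular])

lemma pow_in_N_iff: "x [^] (i::nat) \<in> N \<longleftrightarrow> ext_order dvd i"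
proof -
  interpret Q: group "G Mod N" by (rule factorgroup_is_group)
  have "N #> x \<in> carrier (G Mod N)" using x_carrier by (auto simp: FactGroup_def RCOSETS_def)
  then have "ext_order dvd i \<longleftrightarrow> (N #> x) [^]\<^bsub>G Mod N\<^esub> i = \<one>\<^bsub>G Mod N\<^esub>"
    by (simp only: Q.pow_eq_id ext_order_def)
  also have "\<dots> \<longleftrightarrow> N #> x [^] i = N" using FactGroup_pow[OF x_carrier] by simp
  also have "\<dots> \<longleftrightarrow> x [^] i \<in> N"
    using x_carrier coset_join1[of N "x [^] i"] coset_join2[of "x [^] i" N] N_subgroup subset by auto
  finally show ?thesis by simp
qed

lemma ext_order: "ext_order > 0" "coprime ext_order p"
proof -
  have d: "ext_order dvd ord x" using pow_in_N_iff[of "ord x"] x_carrier one_closed N.one_closed by simp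
  then show "ext_order > 0" using regular_ord[OF x_regular] by (metis dvd_0_left_iff gr0I less_irrefl)
  show "coprime ext_order p" using d regular_ord[OF x_regular] by (metis coprime_divisors dvd_refl)
qed

text \<open>For \<open>\<omega>\<close> of order dividing \<open>ext_order\<close>, the linear character of \<open>G/N\<close> with value \<open>\<omega>\<close> at \<open>x\<close>.\<close>

definition lam :: "complex \<Rightarrow> 'a \<Rightarrow> complex" where
  "lam \<omega> g = \<omega> ^ (LEAST i. \<exists>h\<in>N. g = h \<otimes> x [^] i)"

text \<open>Two exponents describing the same coset of \<open>N\<close> differ by a multiple of
  \<open>ext_order\<close>, so the least one in the definition of \<open>lam\<close> may be replaced
  by any other.\<close>

lemma lam_eq:
  assumes h: "h \<in> N" and w: "\<omega> ^ ext_order = 1"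
  shows "lam \<omega> (h \<otimes> x [^] i) = \<omega> ^ i"
proof -
  let ?P = "\<lambda>j. \<exists>k\<in>N. h \<otimes> x [^] i = k \<otimes> x [^] (j::nat)"
  define j where "j = (LEAST j. ?P j)"
  have "?P i" using h by auto
  then have "?P j" "j \<le> i" unfolding j_def by (rule LeastI) (rule Least_le, use h in auto)
  then obtain k where k: "k \<in> N" "h \<otimes> x [^] i = k \<otimes> x [^] j" by auto
  have hk: "h \<in> carrier G" "k \<in> carrier G" using h k N_carrier by auto
  have "h \<otimes> x [^] (i - j) \<otimes> x [^] j = h \<otimes> x [^] i"
    using x_carrier hk \<open>j \<le> i\<close> by (simp add: m_assoc nat_pow_mult)
  then have "h \<otimes> x [^] (i - j) = k" using k(2) x_carrier hk by simp
  then have "x [^] (i - j) = inv h \<otimes> k" using hk x_carrier by (metis inv_solve_left nat_pow_closed m_closed)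
  then have "x [^] (i - j) \<in> N" using h k m_closed m_inv_closed by simp
  then obtain c where c: "i - j = ext_order * c" using pow_in_N_iff by auto
  have "\<omega> ^ i = \<omega> ^ (j + ext_order * c)" using c \<open>j \<le> i\<close> by (metis le_add_diff_inverse)
  also have "\<dots> = \<omega> ^ j" unfolding power_add power_mult w by simp
  finally show ?thesis by (simp add: lam_def j_def)
qed

lemma lam_mult:
  assumes w: "\<omega> ^ ext_order = 1" and g: "g \<in> carrier G" "h \<in> carrier G"
  shows "lam \<omega> (g \<otimes> h) = lam \<omega> g * lam \<omega> h"
proof -
  obtain a i where a: "a \<in> N" "g = a \<otimes> x [^] (i::nat)" using generated[OF g(1)] by auto
  obtain b j where b: "b \<in> N" "h = b \<otimes> x [^] (j::nat)" using generated[OF g(2)] by auto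
  have c: "a \<in> carrier G" "b \<in> carrier G" using a b N_carrier by auto
  have "x [^] i \<otimes> b \<otimes> inv (x [^] i) \<in> N" using inv_op_closed2 x_carrier b by simp
  then have n: "a \<otimes> (x [^] i \<otimes> b \<otimes> inv (x [^] i)) \<in> N" using a by simp
  have "g \<otimes> h = a \<otimes> (x [^] i \<otimes> (b \<otimes> x [^] j))"
    using a b c x_carrier by (simp add: m_assoc)
  also have "b \<otimes> x [^] j = b \<otimes> (inv (x [^] i) \<otimes> (x [^] i \<otimes> x [^] j))"
    using x_carrier by (simp add: mult_inv_cancel)
  finally have "g \<otimes> h = a \<otimes> (x [^] i \<otimes> b \<otimes> inv (x [^] i)) \<otimes> x [^] (i + j)"
    using c x_carrier by (simp add: m_assoc nat_pow_mult)
  then show ?thesis using lam_eq[OF n w, of "i + j"] lam_eq[OF a(1) w, of i] lam_eq[OF b(1) w, of j] a b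
    by (simp add: power_add)
qed

lemma lam_power_order:
  assumes w: "\<omega> ^ ext_order = 1" and g: "g \<in> carrier G"
  shows "lam \<omega> g ^ ext_order = 1"
proof -
  obtain a i where a: "a \<in> N" "g = a \<otimes> x [^] (i::nat)" using generated[OF g(1)] by auto
  have "(\<omega> ^ i) ^ ext_order = 1" using w by (metis power_mult mult.commute power_one)
  then show ?thesis using lam_eq[OF a(1) w, of i] a by simp
qed

lemma lam_N:
  assumes w: "\<omega> ^ ext_order = 1" and h: "h \<in> N"
  shows "lam \<omega> h = 1"
  using lam_eq[OF h w, of 0] N_carrier[OF h] by simp

lemma lam_coset:
  assumes w: "\<omega> ^ ext_order = 1" and y: "y \<in> N #> x"
  shows "lam \<omega> y = \<omega>"
proof -
  obtain h where h: "h \<in> N" "y = h \<otimes> x" using y by (auto simp: r_coset_def)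
  then show ?thesis using lam_eq[OF h(1) w, of 1] x_carrier by simp
qed

lemma lam_pow_base:
  assumes w: "\<omega> ^ ext_order = 1" and g: "g \<in> carrier G"
  shows "lam (\<omega> ^ j) g = lam \<omega> g ^ j"
  by (simp add: lam_def power_mult[symmetric] mult.commute)

abbreviation "\<rho> \<equiv> unity_root ext_order"

lemma rho_power: "\<rho> ^ ext_order = 1" "(\<rho> ^ j) ^ ext_order = 1"
  using unity_root_power[OF ext_order(1)] by (auto simp: power_mult[symmetric]) (metis mult.commute power_mult power_one)

text \<open>\<open>\<rho>\<close> is a primitive root of unity, so its linear character is faithful
  on the cyclic quotient.\<close>

lemma coset_iff_lam:
  assumes y: "y \<in> carrier G"
  shows "y \<in> N #> x \<longleftrightarrow> lam \<rho> y = \<rho>"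
proof
  assume l: "lam \<rho> y = \<rho>"
  obtain a i where a: "a \<in> N" "y = a \<otimes> x [^] (i::nat)" using generated[OF y] by auto
  have ac: "a \<in> carrier G" using a N_carrier by simp
  have "\<rho> ^ i = \<rho>" using l lam_eq[OF a(1) rho_power(1), of i] a by simp
  \<comment> \<open>Adding \<open>ext_order - 1\<close> stands for subtracting 1 from the exponent
    \<open>i\<close>, which may be 0.\<close>
  then have "\<rho> ^ (i + (ext_order - 1)) = \<rho> * \<rho> ^ (ext_order - 1)" by (simp only: power_add)
  also have "\<dots> = \<rho> ^ ext_order" by (simp only: power_Suc[symmetric] Suc_diff_1[OF ext_order(1)])
  finally have "\<rho> ^ (i + (ext_order - 1)) = \<rho> ^ ext_order" .
  then have "ext_order dvd i + (ext_order - 1)" using unity_root_primitive[OF ext_order(1)] rho_power(1) by simp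
  then have k: "x [^] (i + (ext_order - 1)) \<in> N" by (simp add: pow_in_N_iff)
  have o: "x [^] ext_order \<in> N" by (simp add: pow_in_N_iff)
  let ?k = "x [^] (i + (ext_order - 1))"
  have kc: "?k \<in> carrier G" "x [^] ext_order \<in> carrier G" using x_carrier by auto
  have "?k \<otimes> x = x [^] Suc (i + (ext_order - 1))" by simp
  also have "Suc (i + (ext_order - 1)) = ext_order + i" using ext_order(1) by linarith
  also have "x [^] (ext_order + i) = x [^] ext_order \<otimes> x [^] i" by (rule nat_pow_mult[symmetric, OF x_carrier])
  finally have kx: "?k \<otimes> x = x [^] ext_order \<otimes> x [^] i" .
  have "inv (x [^] ext_order) \<otimes> (?k \<otimes> x) = x [^] i"
    unfolding kx by (rule mult_inv_cancel(2)) (use x_carrier in auto)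
  then have xi: "x [^] i = inv (x [^] ext_order) \<otimes> (?k \<otimes> x)" by (rule sym)
  then have "y = a \<otimes> inv (x [^] ext_order) \<otimes> ?k \<otimes> x"
    unfolding a(2) xi using ac x_carrier kc by (simp add: m_assoc)
  moreover have "a \<otimes> inv (x [^] ext_order) \<otimes> ?k \<in> N" using a(1) o k by simp
  ultimately show "y \<in> N #> x" by (auto simp: r_coset_def)
qed (rule lam_coset[OF rho_power(1)])

abbreviation twist :: "complex \<Rightarrow> ('a \<Rightarrow> complex) \<Rightarrow> 'a \<Rightarrow> complex" where
  "twist \<omega> \<psi> \<equiv> (\<lambda>y. lam \<omega> y * \<psi> y)"

lemma twist_IBr:
  assumes w: "\<omega> ^ ext_order = 1" and "\<psi> \<in> IBr p red G"
  shows "twist \<omega> \<psi> \<in> IBr p red G"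
  by (rule IBr_twist(1)[where n = ext_order]) (use assms lam_mult lam_power_order ext_order in auto)

lemma IBr_zero_outside: "\<psi> \<in> IBr p red G \<Longrightarrow> y \<notin> carrier G \<Longrightarrow> \<psi> y = 0"
  using IBr_class_fun[of \<psi>] regular_carrier[of y] unfolding class_fun_def by blast

lemma twist_bchar:
  assumes "\<omega> ^ ext_order = 1" "\<psi> \<in> IBr p red G" "\<psi> = bchar X" "is_rep G n X"
  shows "twist \<omega> \<psi> = bchar (\<lambda>y. red (lam \<omega> y) \<cdot>\<^sub>m X y)"
  by (rule IBr_twist(2)[where n = ext_order and m = n]) (use assms lam_mult lam_power_order ext_order in auto)

lemma twist_irreducible:
  assumes "\<omega> ^ ext_order = 1" "irreducible_rep G n X"
  shows "irreducible_rep G n (\<lambda>y. red (lam \<omega> y) \<cdot>\<^sub>m X y)"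
  by (rule IBr_twist(3)[where n = ext_order and \<phi> = "bchar X"])
    (use assms lam_mult lam_power_order ext_order bchar_in_IBr in auto)

lemma twist_twist:
  assumes "\<omega> ^ ext_order = 1" "\<omega>' ^ ext_order = 1"
  shows "twist \<omega> (twist \<omega>' \<psi>) = twist (\<omega> * \<omega>') \<psi>"
  by (simp add: lam_def power_mult_distrib mult.assoc)

lemma twist_one: "twist 1 \<psi> = \<psi>"
  by (simp add: lam_def)

lemma inverse_root: "(\<omega> :: complex) ^ ext_order = 1 \<Longrightarrow> inverse \<omega> ^ ext_order = 1 \<and> \<omega> \<noteq> 0"
  using ext_order(1) power_inverse[of \<omega> ext_order] by (cases "\<omega> = 0") (auto simp: power_0_left)

lemma twist_inverse:
  assumes w: "\<omega> ^ ext_order = 1"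
  shows "twist (inverse \<omega>) (twist \<omega> \<psi>) = \<psi>" "twist \<omega> (twist (inverse \<omega>) \<psi>) = \<psi>"
proof -
  have "inverse \<omega> * \<omega> = 1" "\<omega> * inverse \<omega> = 1" using inverse_root[OF w] by auto
  then show "twist (inverse \<omega>) (twist \<omega> \<psi>) = \<psi>" "twist \<omega> (twist (inverse \<omega>) \<psi>) = \<psi>"
    using twist_twist[of "inverse \<omega>" \<omega> \<psi>] twist_twist[of \<omega> "inverse \<omega>" \<psi>] inverse_root[OF w] w twist_one by auto
qed

lemma extension_restriction_irreducible:
  assumes X: "is_rep G n (X :: 'a \<Rightarrow> 'k mat)" and e: "res N (bchar X) \<in> IBr p red GN"
  shows "irreducible_rep GN n X"
  by (rule N.bchar_IBr_irreducible[OF is_rep_subgroup[OF N_subgroup X]]) (use e in \<open>simp add: bchar_subgroup[OF N_subgroup]\<close>)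

text \<open>An intertwiner between the representation and its twist commutes with \<open>N\<close>,
  where the twist is trivial. As the restriction to \<open>N\<close> is irreducible, the intertwiner
  is a nonzero scalar, and comparison at \<open>x\<close> gives
  \<open>red \<omega> = 1\<close>.\<close>

lemma extension_twist_inj:
  assumes \<psi>: "\<psi> \<in> IBr p red G" and e: "res N \<psi> \<in> IBr p red GN" and w: "\<omega> ^ ext_order = 1"
    and t: "twist \<omega> \<psi> = \<psi>"
  shows "\<omega> = 1"
proof -
  obtain n X where X: "irreducible_rep G n (X :: 'a \<Rightarrow> 'k mat)" "\<psi> = bchar X" using IBrE[OF \<psi>] .
  note Xr = irreducible_repD(2)[OF X(1)]
  have XN: "irreducible_rep GN n X"
    by (rule extension_restriction_irreducible[OF Xr]) (use e X in simp)
  let ?Y = "\<lambda>y. red (lam \<omega> y) \<cdot>\<^sub>m X y"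
  have "bchar X = bchar ?Y" using twist_bchar[OF w \<psi> X(2) Xr] t X(2) by simp
  from bchar_eq_imp_equivalent[OF X(1) twist_irreducible[OF w X(1)] this] obtain S R where
    S: "S \<in> carrier_mat n n" "R \<in> carrier_mat n n" "S * R = 1\<^sub>m n" "R * S = 1\<^sub>m n"
    "\<And>g. g \<in> carrier G \<Longrightarrow> X g * S = S * ?Y g" by metis
  have "\<exists>c. S = c \<cdot>\<^sub>m 1\<^sub>m n"
  proof (rule N.schur_scalar[OF XN S(1)])
    fix h assume "h \<in> carrier GN"
    then have h: "h \<in> N" by simp
    have "?Y h = X h" using lam_N[OF w h] is_rep_carrier[OF Xr N_carrier[OF h]] by (auto intro!: eq_matI)
    then show "X h * S = S * X h" using S(5)[OF N_carrier[OF h]] by simp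
  qed
  then obtain c where c: "S = c \<cdot>\<^sub>m 1\<^sub>m n" by blast
  have n: "n > 0" using irreducible_repD(1)[OF X(1)] .
  have c0: "c \<noteq> 0"
  proof
    assume "c = 0"
    then have "S * R = 0\<^sub>m n n" using c S(2) by (auto intro!: eq_matI simp: scalar_prod_def)
    then have "(1\<^sub>m n :: 'k mat) $$ (0,0) = 0\<^sub>m n n $$ (0,0)" using S(3) by simp
    then show False using n by simp
  qed
  have Xx: "X x \<in> carrier_mat n n" by (rule is_rep_carrier[OF Xr x_carrier])
  have "lam \<omega> x = \<omega>" by (rule lam_coset[OF w]) (use x_carrier rcos_self[OF x_carrier N_subgroup] in simp)
  then have "X x * S = S * (red \<omega> \<cdot>\<^sub>m X x)" using S(5)[OF x_carrier] by simp
  moreover have "X x * S = c \<cdot>\<^sub>m X x" unfolding c using Xx by (simp add: mult_smult_distrib[of _ n n _ n])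
  moreover have "S * (red \<omega> \<cdot>\<^sub>m X x) = c \<cdot>\<^sub>m (red \<omega> \<cdot>\<^sub>m X x)"
    unfolding c using Xx by (simp add: mult_smult_assoc_mat[of _ n n _ n])
  ultimately have eq: "c \<cdot>\<^sub>m X x = c \<cdot>\<^sub>m (red \<omega> \<cdot>\<^sub>m X x)" by simp
  have "X x \<noteq> 0\<^sub>m n n"
  proof
    assume "X x = 0\<^sub>m n n"
    then have "1\<^sub>m n = 0\<^sub>m n n * X (inv x)" using rep_inv(1)[OF Xr x_carrier] by simp
    also have "\<dots> = 0\<^sub>m n n" using is_rep_carrier[OF Xr, of "inv x"] x_carrier by simp
    finally have "(1\<^sub>m n :: 'k mat) $$ (0,0) = 0\<^sub>m n n $$ (0,0)" by simp
    then show False using n by simp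
  qed
  then obtain a b where ab: "a < n" "b < n" "X x $$ (a,b) \<noteq> 0"
    using Xx by (metis (no_types, lifting) carrier_matD eq_matI index_zero_mat)
  have "(c \<cdot>\<^sub>m X x) $$ (a,b) = (c \<cdot>\<^sub>m (red \<omega> \<cdot>\<^sub>m X x)) $$ (a,b)" using eq by simp
  then have "red \<omega> = 1" using ab Xx c0 by simp
  then show ?thesis using red_eq_1[OF w ext_order] by simp
qed

text \<open>A matrix \<open>S\<close> commuting with \<open>N\<close> is the mean of the sums \<open>B j\<close> of its conjugates under the powers
  of \<open>x\<close>, weighted by a character of the cyclic quotient.  As \<open>B j\<close> intertwines the representation
  with a twist, it vanishes for \<open>j \<noteq> 0\<close>, so \<open>S\<close> is scalar.\<close>

lemma twist_stabilizer_trivial_imp_extension: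
  assumes \<psi>: "\<psi> \<in> IBr p red G" and st: "\<And>\<omega>. \<omega> ^ ext_order = 1 \<Longrightarrow> twist \<omega> \<psi> = \<psi> \<Longrightarrow> \<omega> = 1"
  shows "res N \<psi> \<in> IBr p red GN"
proof -
  obtain n X where X: "irreducible_rep G n (X :: 'a \<Rightarrow> 'k mat)" "\<psi> = bchar X" using IBrE[OF \<psi>] .
  note Xr = irreducible_repD(2)[OF X(1)]
  have n: "n > 0" using irreducible_repD(1)[OF X(1)] .
  have c: "X g \<in> carrier_mat n n" if "g \<in> carrier G" for g by (rule is_rep_carrier[OF Xr that])
  let ?r = "red \<rho>"
  have rp: "?r ^ ext_order = 1" using red_power[OF rho_power(1) ext_order(1), of ext_order] rho_power(1) by simp
  have xi: "x [^] (i::nat) \<in> carrier G" "inv (x [^] i) \<in> carrier G" for i using x_carrier by auto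
  have "\<exists>c. S = c \<cdot>\<^sub>m 1\<^sub>m n" if S: "S \<in> carrier_mat n n" and comm: "\<And>h. h \<in> N \<Longrightarrow> X h * S = S * X h" for S
  proof -
    define A where "A i = X (x [^] (i::nat)) * S * X (inv (x [^] i))" for i
    have A: "A i \<in> carrier_mat n n" for i
      unfolding A_def by (rule mult_carrier_mat[OF mult_carrier_mat[OF c[OF xi(1)] S] c[OF xi(2)]])
    have A0: "A 0 = S" using S is_rep_one[OF Xr] by (simp add: A_def)
    have Ao: "A ext_order = S"
    proof -
      have h: "x [^] ext_order \<in> N" by (simp add: pow_in_N_iff)
      have "A ext_order = S * X (x [^] ext_order) * X (inv (x [^] ext_order))" using comm[OF h] by (simp add: A_def)
      also have "\<dots> = S * (X (x [^] ext_order) * X (inv (x [^] ext_order)))"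
        using c[OF xi(1)] c[OF xi(2)] S by (intro assoc_mult_mat) auto
      finally show ?thesis using rep_inv(1)[OF Xr xi(1)] S by simp
    qed
    have As: "X x * A i = A (Suc i) * X x" for i
    proof -
      have "A (Suc i) = X x * X (x [^] i) * S * X (inv (x [^] Suc i))"
      proof -
        have "x [^] Suc i = x \<otimes> x [^] i" using x_carrier by (rule nat_pow_Suc2)
        then show ?thesis using is_rep_mult[OF Xr x_carrier xi(1), of i] by (simp add: A_def)
      qed
      moreover have "X x * X (x [^] i) * S \<in> carrier_mat n n"
        by (rule mult_carrier_mat[OF mult_carrier_mat[OF c[OF x_carrier] c[OF xi(1)]] S])
      ultimately have "A (Suc i) * X x = X x * X (x [^] i) * S * (X (inv (x [^] Suc i)) * X x)"
        using assoc_mult_mat[OF _ c[OF xi(2)[of "Suc i"]] c[OF x_carrier]] by simp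
      also have "X (inv (x [^] Suc i)) * X x = X (inv (x [^] i))"
      proof -
        have "inv (x [^] Suc i) \<otimes> x = inv (x [^] i)"
        proof -
          have "x [^] Suc i = x \<otimes> x [^] i" using x_carrier by (rule nat_pow_Suc2)
          then have "inv (x [^] Suc i) \<otimes> x = inv (x [^] i) \<otimes> inv x \<otimes> x" using x_carrier by (simp add: inv_mult_group)
          then show ?thesis using x_carrier by (simp add: m_assoc)
        qed
        then show ?thesis using is_rep_mult[OF Xr xi(2) x_carrier, of "Suc i"] by simp
      qed
      also have "X x * X (x [^] i) * S * X (inv (x [^] i)) = X x * A i"
        using c[OF x_carrier] c[OF xi(1)[of i]] c[OF xi(2), of i] S by (simp add: A_def assoc_mult_mat[of _ n n _ n _ n])
      finally show ?thesis by simp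
    qed
    have Ah: "X h * A i = A i * X h" if h: "h \<in> N" for h i
    proof -
      let ?k = "inv (x [^] i) \<otimes> h \<otimes> x [^] i"
      have hc: "h \<in> carrier G" using N_carrier[OF h] .
      have k: "?k \<in> N" using inv_op_closed1 xi(1) h by simp
      have kc: "?k \<in> carrier G" using N_carrier[OF k] .
      have "h \<otimes> x [^] i = x [^] i \<otimes> ?k" using hc xi by (simp add: m_assoc mult_inv_cancel)
      then have e1: "X h * X (x [^] i) = X (x [^] i) * X ?k"
        using is_rep_mult[OF Xr hc xi(1)] is_rep_mult[OF Xr xi(1) kc] by metis
      have "?k \<otimes> inv (x [^] i) = inv (x [^] i) \<otimes> h" using hc xi by (simp add: m_assoc)
      then have e2: "X ?k * X (inv (x [^] i)) = X (inv (x [^] i)) * X h"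
        using is_rep_mult[OF Xr kc xi(2)] is_rep_mult[OF Xr xi(2) hc] by metis
      note cc = c[OF hc] c[OF xi(1)[of i]] c[OF xi(2)[of i]] c[OF kc] S
      have "X h * A i = X h * X (x [^] i) * (S * X (inv (x [^] i)))" using cc by (simp add: A_def assoc_mult_mat[of _ n n _ n _ n])
      also have "\<dots> = X (x [^] i) * (X ?k * S * X (inv (x [^] i)))" unfolding e1 using cc by (simp add: assoc_mult_mat[of _ n n _ n _ n])
      also have "X ?k * S = S * X ?k" by (rule comm[OF k])
      also have "S * X ?k * X (inv (x [^] i)) = S * (X (inv (x [^] i)) * X h)" using cc e2 by (simp add: assoc_mult_mat[of _ n n _ n _ n])
      also have "X (x [^] i) * \<dots> = A i * X h" using cc by (simp add: A_def assoc_mult_mat[of _ n n _ n _ n])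
      finally show ?thesis .
    qed
    \<comment> \<open>The sequence of conjugates \<open>A i\<close> returns to \<open>S\<close> at
      \<open>i = ext_order\<close>, because \<open>x [^] ext_order\<close> lies in \<open>N\<close>;
      \<open>B j\<close> is a discrete Fourier coefficient of this sequence.\<close>
    define B where "B j = mat_sum n ext_order (\<lambda>i. ?r ^ (i * j) \<cdot>\<^sub>m A i)" for j
    have Bc: "B j \<in> carrier_mat n n" for j by (simp add: B_def)
    have Bh: "X h * B j = B j * X h" if h: "h \<in> N" for h j
    proof -
      note hc = c[OF N_carrier[OF h]]
      have "X h * B j = mat_sum n ext_order (\<lambda>i. X h * (?r ^ (i * j) \<cdot>\<^sub>m A i))"
        unfolding B_def by (rule mult_mat_sum(1)[OF hc]) (use A in simp)
      also have "\<dots> = mat_sum n ext_order (\<lambda>i. ?r ^ (i * j) \<cdot>\<^sub>m A i * X h)"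
        using A hc Ah[OF h] by (intro mat_sum_cong) (simp add: mult_smult_distrib[of _ n n _ n] mult_smult_assoc_mat[of _ n n _ n])
      also have "\<dots> = B j * X h"
        unfolding B_def by (rule mult_mat_sum(2)[symmetric, OF hc]) (use A in simp)
      finally show ?thesis .
    qed
    \<comment> \<open>Conjugation by \<open>x\<close> shifts the index \<open>i\<close> by one; the
      cyclic sum absorbs the shift at the cost of the factor \<open>?r ^ j\<close>.\<close>
    have Bx: "?r ^ j \<cdot>\<^sub>m (X x * B j) = B j * X x" for j
    proof -
      let ?f = "\<lambda>i. ?r ^ (i * j) \<cdot>\<^sub>m (A i * X x)"
      have "?f ext_order = ?f 0" using A0 Ao rp by (simp add: power_mult)
      have "?r ^ j \<cdot>\<^sub>m (X x * B j) = ?r ^ j \<cdot>\<^sub>m mat_sum n ext_order (\<lambda>i. X x * (?r ^ (i * j) \<cdot>\<^sub>m A i))"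
        unfolding B_def using A c[OF x_carrier] by (subst mult_mat_sum) auto
      also have "\<dots> = mat_sum n ext_order (\<lambda>i. ?r ^ j \<cdot>\<^sub>m (X x * (?r ^ (i * j) \<cdot>\<^sub>m A i)))"
        by (rule smult_mat_sum) (use A c[OF x_carrier] in auto)
      also have "\<dots> = mat_sum n ext_order (\<lambda>i. ?f (Suc i))"
      proof (rule mat_sum_cong)
        fix i
        have "X x * (?r ^ (i * j) \<cdot>\<^sub>m A i) = ?r ^ (i * j) \<cdot>\<^sub>m (A (Suc i) * X x)"
          using A c[OF x_carrier] As by (simp add: mult_smult_distrib[of _ n n _ n])
        then show "?r ^ j \<cdot>\<^sub>m (X x * (?r ^ (i * j) \<cdot>\<^sub>m A i)) = ?f (Suc i)"
          using A[of "Suc i"] c[OF x_carrier] by (auto simp: power_add mult.assoc intro!: eq_matI)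
      qed
      also have "\<dots> = mat_sum n ext_order ?f" by (rule mat_sum_cyclic_shift) fact
      also have "\<dots> = B j * X x"
        unfolding B_def using A c[OF x_carrier]
        by (subst mult_mat_sum) (auto intro!: mat_sum_cong simp: mult_smult_assoc_mat[of _ n n _ n])
      finally show ?thesis .
    qed
    have Bxi: "?r ^ (i * j) \<cdot>\<^sub>m (X (x [^] i) * B j) = B j * X (x [^] i)" for i j
    proof (induction i)
      case 0
      then show ?case using is_rep_one[OF Xr] Bc[of j] by (auto intro!: eq_matI)
    next
      case (Suc i)
      have e: "X (x [^] Suc i) = X (x [^] i) * X x" using is_rep_mult[OF Xr xi(1) x_carrier] by simp
      note cc = c[OF xi(1)[of i]] c[OF x_carrier] Bc[of j]
      have "B j * X (x [^] Suc i) = B j * X (x [^] i) * X x" unfolding e using cc by (simp add: assoc_mult_mat[of _ n n _ n _ n])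
      also have "\<dots> = ?r ^ (i * j) \<cdot>\<^sub>m (X (x [^] i) * (B j * X x))"
        unfolding Suc[symmetric] using cc by (simp add: mult_smult_assoc_mat[of _ n n _ n] assoc_mult_mat[of _ n n _ n _ n])
      also have "\<dots> = ?r ^ (i * j) \<cdot>\<^sub>m (?r ^ j \<cdot>\<^sub>m (X (x [^] Suc i) * B j))"
        unfolding e Bx[of j, symmetric] using cc by (simp add: mult_smult_distrib[of _ n n _ n] assoc_mult_mat[of _ n n _ n _ n])
      also have "\<dots> = ?r ^ (Suc i * j) \<cdot>\<^sub>m (X (x [^] Suc i) * B j)"
        using cc by (auto simp: power_add mult_ac intro!: eq_matI)
      finally show ?case by simp
    qed
    have Bg: "red (lam (\<rho> ^ j) g) \<cdot>\<^sub>m X g * B j = B j * X g" if g: "g \<in> carrier G" for g j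
    proof -
      obtain h i where h: "h \<in> N" "g = h \<otimes> x [^] (i::nat)" using generated[OF g] by auto
      have l: "red (lam (\<rho> ^ j) g) = ?r ^ (i * j)"
        using lam_eq[OF h(1) rho_power(2), of j i] h(2) red_power[OF rho_power(1) ext_order(1), of "j * i"]
        by (simp add: power_mult[symmetric] mult.commute)
      have e: "X g = X h * X (x [^] i)" using is_rep_mult[OF Xr N_carrier[OF h(1)] xi(1)] h(2) by simp
      note cc = c[OF xi(1)[of i]] c[OF N_carrier[OF h(1)]] Bc[of j]
      have "B j * X g = B j * X h * X (x [^] i)" unfolding e by (rule assoc_mult_mat[symmetric, OF cc(3,2,1)])
      also have "\<dots> = X h * B j * X (x [^] i)" using Bh[OF h(1), of j] by simp
      also have "\<dots> = X h * (B j * X (x [^] i))" by (rule assoc_mult_mat[OF cc(2,3,1)])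
      finally have "B j * X g = X h * (B j * X (x [^] i))" .
      also have "\<dots> = ?r ^ (i * j) \<cdot>\<^sub>m (X g * B j)"
        unfolding Bxi[symmetric] e using cc by (simp add: mult_smult_distrib[of _ n n _ n] assoc_mult_mat[of _ n n _ n _ n])
      finally show ?thesis unfolding l using c[OF g] Bc by (simp add: mult_smult_assoc_mat[of _ n n _ n])
    qed
    have Bj: "B j = 0\<^sub>m n n" if j: "0 < j" "j < ext_order" for j
    proof (rule ccontr)
      assume nz: "B j \<noteq> 0\<^sub>m n n"
      note w = rho_power(2)[of j]

      have "bchar (\<lambda>y. red (lam (\<rho> ^ j) y) \<cdot>\<^sub>m X y) = bchar X"
        by (rule intertwiner_bchar_eq[OF twist_irreducible[OF w X(1)] X(1) Bc Bg nz])
      then have "twist (\<rho> ^ j) \<psi> = \<psi>" using twist_bchar[OF w \<psi> X(2) Xr] X(2) by simp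
      then have "\<rho> ^ j = 1" using st[OF w] by simp
      then have "ext_order dvd j" by (rule unity_root_primitive[OF ext_order(1)])
      then show False using j by (auto dest: dvd_imp_le)
    qed
    have "X g * B 0 = B 0 * X g" if g: "g \<in> carrier G" for g
    proof -
      have "red (lam (\<rho> ^ 0) g) \<cdot>\<^sub>m X g = X g" using c[OF g] by (auto simp: lam_def intro!: eq_matI)
      then show ?thesis using Bg[OF g, of 0] by simp
    qed
    then obtain d where d: "B 0 = d \<cdot>\<^sub>m 1\<^sub>m n" using schur_scalar[OF X(1) Bc[of 0]] by blast
    \<comment> \<open>Fourier inversion recovers \<open>S\<close> from the sum of all
      \<open>B j\<close>, of which only \<open>B 0\<close> is left; the division by
      \<open>ext_order\<close> is possible because this order is prime to p.\<close>
    have o: "(of_nat ext_order :: 'k) \<noteq> 0" by (rule coprime_of_nat_neq_0[OF ext_order(2)])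
    have "S = (d / of_nat ext_order) \<cdot>\<^sub>m 1\<^sub>m n"
    proof (rule eq_matI)
      fix a b assume "a < dim_row ((d / of_nat ext_order) \<cdot>\<^sub>m 1\<^sub>m n)" "b < dim_col ((d / of_nat ext_order) \<cdot>\<^sub>m 1\<^sub>m n)"
      then have ab: "a < n" "b < n" by auto
      have geo: "(\<Sum>j<ext_order. ?r ^ (i * j)) = (if i = 0 then of_nat ext_order else 0)" if i: "i < ext_order" for i
      proof (cases "i = 0")
        case False
        have "?r ^ i \<noteq> 1"
        proof
          assume "?r ^ i = 1"
          then have "red (\<rho> ^ i) = 1" using red_power[OF rho_power(1) ext_order(1), of i] by simp
          then have "\<rho> ^ i = 1" by (rule red_eq_1[OF rho_power(2) ext_order])
          then have "ext_order dvd i" by (rule unity_root_primitive[OF ext_order(1)])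
          then show False using False i by (auto dest: dvd_imp_le)
        qed
        moreover have "(?r ^ i) ^ ext_order = 1" using rp by (metis power_mult mult.commute power_one)
        ultimately show ?thesis using False by (simp add: power_mult sum_gp_strict)
      qed simp
      have "B 0 $$ (a,b) = (\<Sum>j<ext_order. B j $$ (a,b))"
      proof -
        have "(\<Sum>j<ext_order. B j $$ (a,b)) = (\<Sum>j\<in>{0}. B j $$ (a,b))"
          by (rule sum.mono_neutral_right) (use Bj ab ext_order(1) in auto)
        then show ?thesis by simp
      qed
      also have "\<dots> = (\<Sum>j<ext_order. \<Sum>i<ext_order. ?r ^ (i * j) * A i $$ (a,b))"
        using ab by (auto simp: B_def mat_sum_def carrier_matD[OF A] intro!: sum.cong)
      also have "\<dots> = (\<Sum>i<ext_order. (\<Sum>j<ext_order. ?r ^ (i * j)) * A i $$ (a,b))"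
        unfolding sum_distrib_right by (rule sum.swap)
      also have "\<dots> = (\<Sum>i<ext_order. if i = 0 then of_nat ext_order * S $$ (a,b) else 0)"
        using geo A0 by (intro sum.cong) auto
      also have "\<dots> = of_nat ext_order * S $$ (a,b)" using ext_order(1) by simp
      finally show "S $$ (a,b) = ((d / of_nat ext_order) \<cdot>\<^sub>m 1\<^sub>m n) $$ (a,b)"
        using ab d o by (simp add: field_simps)
    qed (use S in auto)
    then show ?thesis by blast
  qed
  then have "irreducible_rep GN n X" by (rule endomorphisms_scalar_imp_irreducible[OF X(1)])
  then show ?thesis using N.bchar_in_IBr bchar_subgroup[OF N_subgroup, of X] X(2) by metis
qed

text \<open>After a change of basis the second representation, then called \<open>Z\<close>, agrees
  with \<open>X\<close> on \<open>N\<close>. Then \<open>X (inv x) * Z x\<close> commutes with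
  \<open>N\<close> and is a scalar \<open>a\<close> by Schur's lemma. Agreement at
  \<open>x [^] ext_order\<close>, which lies in \<open>N\<close>, gives
  \<open>a ^ ext_order = 1\<close>, and \<open>\<omega>\<close> is the lift of
  \<open>a\<close>.\<close>

lemma extensions_twist:
  assumes \<psi>: "\<psi> \<in> IBr p red G" "\<psi>' \<in> IBr p red G" and r: "res N \<psi> = res N \<psi>'" "res N \<psi> \<in> IBr p red GN"
  obtains \<omega> where "\<omega> ^ ext_order = 1" "\<psi>' = twist \<omega> \<psi>"
proof -
  obtain n X where X: "irreducible_rep G n (X :: 'a \<Rightarrow> 'k mat)" "\<psi> = bchar X" using IBrE[OF \<psi>(1)] .
  obtain m Y where Y: "irreducible_rep G m (Y :: 'a \<Rightarrow> 'k mat)" "\<psi>' = bchar Y" using IBrE[OF \<psi>(2)] .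
  note Xr = irreducible_repD(2)[OF X(1)] and Yr = irreducible_repD(2)[OF Y(1)]
  have XN: "irreducible_rep GN n X" by (rule extension_restriction_irreducible[OF Xr]) (use r X in simp)
  have YN: "irreducible_rep GN m Y" by (rule extension_restriction_irreducible[OF Yr]) (use r Y in simp)
  have "brauer_char p red GN X = brauer_char p red GN Y"
    using r(1) X(2) Y(2) bchar_subgroup[OF N_subgroup, of X] bchar_subgroup[OF N_subgroup, of Y] by simp
  from N.bchar_eq_imp_equivalent[OF XN YN this] obtain S R where nm: "n = m" and
    S: "S \<in> carrier_mat n n" "R \<in> carrier_mat n n" "S * R = 1\<^sub>m n" "R * S = 1\<^sub>m n"
    "\<And>h. h \<in> carrier GN \<Longrightarrow> X h * S = S * Y h" by metis
  have c: "X g \<in> carrier_mat n n" "Y g \<in> carrier_mat n n" if "g \<in> carrier G" for g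
    using is_rep_carrier[OF Xr that] is_rep_carrier[OF Yr that] nm by auto
  define Z where "Z g = S * Y g * R" for g
  have Zr: "is_rep G n Z" unfolding Z_def by (rule is_rep_conj[OF _ S(2,1,4,3)]) (use Yr nm in simp)
  have Zb: "bchar Z = \<psi>'" unfolding Z_def using bchar_conj[OF _ S(2,1,4,3), of Y] Yr nm Y(2) by simp
  have Zc: "Z g \<in> carrier_mat n n" if "g \<in> carrier G" for g by (rule is_rep_carrier[OF Zr that])
  have ZX: "Z h = X h" if h: "h \<in> N" for h
  proof -
    note hc = N_carrier[OF h]
    have "Z h = X h * S * R" using S(5)[of h] h by (simp add: Z_def)
    also have "\<dots> = X h * (S * R)" using c[OF hc] S by (intro assoc_mult_mat) auto
    finally show ?thesis using S(3) c[OF hc] by simp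
  qed
  let ?C = "X (inv x) * Z x"
  note xc = x_carrier inv_closed[OF x_carrier]
  have C: "?C \<in> carrier_mat n n" using c[OF xc(2)] Zc[OF xc(1)] by simp
  have "\<exists>a. ?C = a \<cdot>\<^sub>m 1\<^sub>m n"
  proof (rule N.schur_scalar[OF XN C])
    fix h assume "h \<in> carrier GN"
    then have h: "h \<in> N" by simp
    note hc = N_carrier[OF h]
    let ?k = "x \<otimes> h \<otimes> inv x"
    have k: "?k \<in> N" using inv_op_closed2 x_carrier h by simp
    note kc = N_carrier[OF k]
    have "h \<otimes> inv x = inv x \<otimes> ?k" using hc xc by (simp add: m_assoc mult_inv_cancel)
    then have e1: "X h * X (inv x) = X (inv x) * X ?k"
      using is_rep_mult[OF Xr hc xc(2)] is_rep_mult[OF Xr xc(2) kc] by metis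
    have "?k \<otimes> x = x \<otimes> h" using hc xc by (simp add: m_assoc)
    then have e2: "Z ?k * Z x = Z x * Z h"
      using is_rep_mult[OF Zr kc xc(1)] is_rep_mult[OF Zr xc(1) hc] by metis
    note cc = c(1)[OF hc] c(1)[OF xc(2)] c(1)[OF kc] Zc[OF xc(1)] Zc[OF hc] Zc[OF kc]
    have "X h * ?C = X h * X (inv x) * Z x" using cc by (simp add: assoc_mult_mat[of _ n n _ n _ n])
    also have "\<dots> = X (inv x) * (X ?k * Z x)" unfolding e1 using cc by (simp add: assoc_mult_mat[of _ n n _ n _ n])
    also have "X ?k * Z x = Z x * X h" using e2 ZX[OF k] ZX[OF h] by simp
    also have "X (inv x) * (Z x * X h) = ?C * X h" using cc by (simp add: assoc_mult_mat[of _ n n _ n _ n])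
    finally show "X h * ?C = ?C * X h" .
  qed
  then obtain a where a: "?C = a \<cdot>\<^sub>m 1\<^sub>m n" by blast
  have Zx: "Z x = a \<cdot>\<^sub>m X x"
  proof -
    have "Z x = X x * X (inv x) * Z x" using rep_inv(1)[OF Xr x_carrier] Zc[OF x_carrier] by simp
    also have "\<dots> = X x * ?C" using c[OF xc(1)] c[OF xc(2)] Zc[OF xc(1)] by (intro assoc_mult_mat) auto
    finally show ?thesis unfolding a using c[OF xc(1)] by (simp add: mult_smult_distrib[of _ n n _ n])
  qed
  have Zi: "Z (x [^] i) = a ^ i \<cdot>\<^sub>m X (x [^] i)" for i :: nat
  proof (induction i)
    case 0
    then show ?case using is_rep_one[OF Xr] is_rep_one[OF Zr] by (auto intro!: eq_matI)
  next
    case (Suc i)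
    have xi: "x [^] i \<in> carrier G" using x_carrier by simp
    have "Z (x [^] Suc i) = (a ^ i \<cdot>\<^sub>m X (x [^] i)) * (a \<cdot>\<^sub>m X x)" using is_rep_mult[OF Zr xi x_carrier] Suc Zx by simp
    also have "\<dots> = a ^ Suc i \<cdot>\<^sub>m (X (x [^] i) * X x)"
      using c[OF xi] c[OF x_carrier]
      by (simp add: mult_smult_assoc_mat[of _ n n _ n] mult_smult_distrib[of _ n n _ n]) (auto simp: mult_ac intro!: eq_matI)
    finally show ?case using is_rep_mult[OF Xr xi x_carrier] by simp
  qed
  have ao: "a ^ ext_order = 1"
  proof -
    have h: "x [^] ext_order \<in> N" by (simp add: pow_in_N_iff)
    have e: "X (x [^] ext_order) = a ^ ext_order \<cdot>\<^sub>m X (x [^] ext_order)" using ZX[OF h] Zi[of ext_order] by simp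
    note hc = N_carrier[OF h]
    have "1\<^sub>m n = a ^ ext_order \<cdot>\<^sub>m X (x [^] ext_order) * X (inv (x [^] ext_order))"
      using rep_inv(1)[OF Xr hc] e by simp
    also have "\<dots> = a ^ ext_order \<cdot>\<^sub>m 1\<^sub>m n"
      using rep_inv(1)[OF Xr hc] c[OF hc] c[OF inv_closed[OF hc]] by (simp add: mult_smult_assoc_mat[of _ n n _ n])
    finally have "(1\<^sub>m n :: 'k mat) $$ (0,0) = (a ^ ext_order \<cdot>\<^sub>m 1\<^sub>m n) $$ (0,0)" by simp
    then show ?thesis using irreducible_repD(1)[OF X(1)] by simp
  qed
  let ?w = "lift a"
  have w: "?w ^ ext_order = 1" by (rule lift_power_eq_1[OF ext_order ao])
  have ra: "red ?w = a" by (rule red_lift[OF ext_order ao])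
  have Zg: "Z g = red (lam ?w g) \<cdot>\<^sub>m X g" if g: "g \<in> carrier G" for g
  proof -
    obtain h i where h: "h \<in> N" "g = h \<otimes> x [^] (i::nat)" using generated[OF g] by auto
    have xi: "x [^] i \<in> carrier G" using x_carrier by simp
    note hc = N_carrier[OF h(1)]
    have "Z g = X h * (a ^ i \<cdot>\<^sub>m X (x [^] i))" using is_rep_mult[OF Zr hc xi] h(2) ZX[OF h(1)] Zi by simp
    also have "\<dots> = a ^ i \<cdot>\<^sub>m X g" using c[OF hc] c[OF xi] is_rep_mult[OF Xr hc xi] h(2) by (simp add: mult_smult_distrib[of _ n n _ n])
    also have "a ^ i = red (lam ?w g)" using lam_eq[OF h(1) w, of i] h(2) red_power[OF w ext_order(1), of i] ra by simp
    finally show ?thesis .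
  qed
  have "bchar Z = bchar (\<lambda>y. red (lam ?w y) \<cdot>\<^sub>m X y)" using Zg regular_carrier by (auto simp: bchar_eq fun_eq_iff)
  then have "\<psi>' = twist ?w \<psi>"
    using twist_bchar[OF w \<psi>(1) X(2) Xr] Zb by simp
  then show thesis using that w by blast
qed

end

section \<open>Coefficients of class functions on a coset\<close>

definition coset_cut :: "('a, 'm) monoid_scheme \<Rightarrow> 'a set \<Rightarrow> 'a \<Rightarrow> ('a \<Rightarrow> complex) \<Rightarrow> 'a \<Rightarrow> complex" where
  "coset_cut G N x f y = (if y \<in> N #>\<^bsub>G\<^esub> x then f y else 0)"

text \<open>A bijection between the two bases carries coordinates along. It is applied to twisting,
  to conjugation in the group and to complex conjugation.\<close>

lemma ibr_coef_transport:
  assumes H: "finite_modular_group H p red" and K: "finite_modular_group K p red"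
    and b: "bij_betw T (IBr p red H) (IBr p red K)"
    and f': "\<And>y. f' y = (\<Sum>\<phi>\<in>IBr p red H. ibr_coef p red H f \<phi> * T \<phi> y)" and \<psi>: "\<psi> \<in> IBr p red H"
  shows "ibr_coef p red K f' (T \<psi>) = ibr_coef p red H f \<psi>"
proof -
  interpret K: finite_modular_group K p red by fact
  let ?I = "the_inv_into (IBr p red H) T"
  have inv: "?I (T \<phi>) = \<phi>" if "\<phi> \<in> IBr p red H" for \<phi>
    using b that by (auto simp: bij_betw_def intro: the_inv_into_f_f)
  have "ibr_coef p red K f' (T \<psi>) = ibr_coef p red H f (?I (T \<psi>))"
  proof (rule K.ibr_coef_unique[where a = "\<lambda>\<phi>. ibr_coef p red H f (?I \<phi>)"])
    fix y
    have "(\<Sum>\<phi>\<in>IBr p red K. ibr_coef p red H f (?I \<phi>) * \<phi> y) = (\<Sum>\<phi>\<in>IBr p red H. ibr_coef p red H f (?I (T \<phi>)) * T \<phi> y)"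
      using sum.reindex_bij_betw[OF b, of "\<lambda>\<phi>. ibr_coef p red H f (?I \<phi>) * \<phi> y"] by simp
    also have "\<dots> = f' y" unfolding f' using inv by (intro sum.cong) auto
    finally show "f' y = (\<Sum>\<phi>\<in>IBr p red K. ibr_coef p red H f (?I \<phi>) * \<phi> y)" by simp
    show "T \<psi> \<in> IBr p red K" using b \<psi> by (auto simp: bij_betw_def)
  qed
  then show ?thesis using inv[OF \<psi>] by simp
qed

context cyclic_extension
begin

abbreviation "xcut \<equiv> coset_cut G N x"

text \<open>Fourier inversion on the cyclic quotient: \<open>lam \<rho> y / \<rho>\<close> is a root
  of unity of order dividing \<open>ext_order\<close> and equals 1 exactly on the coset of
  \<open>x\<close>, so its powers sum to \<open>ext_order\<close> there and to 0 on the other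
  cosets.\<close>

lemma cut_formula:
  assumes \<psi>: "\<psi> \<in> IBr p red G"
  shows "xcut \<psi> y = (1 / of_nat ext_order) * (\<Sum>j<ext_order. inverse (\<rho> ^ j) * twist (\<rho> ^ j) \<psi> y)"
proof (cases "y \<in> carrier G")
  case True
  let ?w = "lam \<rho> y / \<rho>"
  have r0: "\<rho> \<noteq> 0" using inverse_root[OF rho_power(1)] by simp
  have wo: "?w ^ ext_order = 1" using lam_power_order[OF rho_power(1) True] rho_power(1) by (simp add: power_divide)
  have w1: "?w = 1 \<longleftrightarrow> y \<in> N #> x" using coset_iff_lam[OF True] r0 by simp
  have "(\<Sum>j<ext_order. inverse (\<rho> ^ j) * twist (\<rho> ^ j) \<psi> y) = (\<Sum>j<ext_order. ?w ^ j) * \<psi> y"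
    unfolding sum_distrib_right
    by (intro sum.cong refl) (simp add: lam_pow_base[OF rho_power(1) True] power_mult_distrib power_inverse divide_inverse mult_ac)
  also have "(\<Sum>j<ext_order. ?w ^ j) = (if y \<in> N #> x then of_nat ext_order else 0)"
  proof (cases "y \<in> N #> x")
    case False
    then have "?w \<noteq> 1" using w1 by blast
    then show ?thesis using False wo sum_gp_strict[of ?w ext_order] by auto
  qed (use w1 in simp)
  finally show ?thesis using ext_order(1) by (simp add: coset_cut_def)
next
  case False
  then show ?thesis using IBr_zero_outside[OF \<psi> False] by (simp add: coset_cut_def)
qed

lemma coset_conj_iff:
  assumes "g \<in> carrier G" "y \<in> carrier G"
  shows "g \<otimes> y \<otimes> inv g \<in> N #> x \<longleftrightarrow> y \<in> N #> x"
proof -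
  note w = rho_power(1)
  have "lam \<rho> g * lam \<rho> (inv g) = lam \<rho> (g \<otimes> inv g)" using lam_mult[OF w, of g "inv g"] assms by simp
  also have "\<dots> = 1" using lam_N[OF w, of \<one>] assms N.one_closed by simp
  finally have "lam \<rho> (g \<otimes> y \<otimes> inv g) = lam \<rho> y"
    using assms lam_mult[OF w] by (simp add: mult_ac)
  then show ?thesis using coset_iff_lam assms by simp
qed

lemma cut_class_fun: "class_fun p G f \<Longrightarrow> class_fun p G (xcut f)"
  using coset_conj_iff regular_carrier by (auto simp: class_fun_def coset_cut_def)

lemma bij_twist:
  assumes w: "\<omega> ^ ext_order = 1"
  shows "bij_betw (twist \<omega>) (IBr p red G) (IBr p red G)"
proof (rule bij_betwI[where g = "twist (inverse \<omega>)"])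
  have w': "inverse \<omega> ^ ext_order = 1" using inverse_root[OF w] by simp
  show "twist \<omega> \<in> IBr p red G \<rightarrow> IBr p red G" using twist_IBr[OF w] by blast
  show "twist (inverse \<omega>) \<in> IBr p red G \<rightarrow> IBr p red G" using twist_IBr[OF w'] by blast
qed (rule twist_inverse[OF w])+

text \<open>On the coset of \<open>x\<close>, outside which \<open>f\<close> vanishes,
  \<open>lam \<omega>\<close> is the constant \<omega>; so twisting the expansion of
  \<open>f\<close> gives an expansion of \<omega> times \<open>f\<close>, and twisting permutes the
  basis.\<close>

lemma coef_twist:
  assumes f: "class_fun p G f" "\<And>y. y \<notin> N #> x \<Longrightarrow> f y = 0" and \<psi>: "\<psi> \<in> IBr p red G" and w: "\<omega> ^ ext_order = 1"
  shows "ibr_coef p red G f (twist \<omega> \<psi>) = inverse \<omega> * ibr_coef p red G f \<psi>"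
proof -
  have "\<omega> * f y = (\<Sum>\<phi>\<in>IBr p red G. ibr_coef p red G f \<phi> * twist \<omega> \<phi> y)" for y
  proof -
    have "\<omega> * f y = lam \<omega> y * f y" using lam_coset[OF w] f(2) by (cases "y \<in> N #> x") auto
    also have "\<dots> = lam \<omega> y * (\<Sum>\<phi>\<in>IBr p red G. ibr_coef p red G f \<phi> * \<phi> y)" using ibr_coef_expand[OF f(1), of y] by simp
    finally show ?thesis by (simp add: sum_distrib_left mult_ac)
  qed
  from ibr_coef_transport[OF finite_modular_group_axioms finite_modular_group_axioms bij_twist[OF w], of "\<lambda>y. \<omega> * f y", OF this \<psi>]
  have "\<omega> * ibr_coef p red G f (twist \<omega> \<psi>) = ibr_coef p red G f \<psi>"
    using ibr_coef_scale[OF f(1) twist_IBr[OF w \<psi>], of \<omega>] by simp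
  then show ?thesis using inverse_root[OF w] by (simp add: field_simps)
qed

lemma coef_nonzero_extension:
  assumes f: "class_fun p G f" "\<And>y. y \<notin> N #> x \<Longrightarrow> f y = 0" and \<psi>: "\<psi> \<in> IBr p red G" and nz: "ibr_coef p red G f \<psi> \<noteq> 0"
  shows "res N \<psi> \<in> IBr p red GN"
proof (rule twist_stabilizer_trivial_imp_extension[OF \<psi>])
  fix \<omega> assume "\<omega> ^ ext_order = 1" "twist \<omega> \<psi> = \<psi>"
  then show "\<omega> = 1" using coef_twist[OF f \<psi>, of \<omega>] nz by simp
qed

lemma cut_coef:
  assumes "\<psi> \<in> IBr p red G" "\<phi> \<in> IBr p red G"
  shows "ibr_coef p red G (xcut \<psi>) \<phi> = (1 / of_nat ext_order) * (\<Sum>j<ext_order. inverse (\<rho> ^ j) * (if \<phi> = twist (\<rho> ^ j) \<psi> then 1 else 0))"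
proof -
  have tw: "twist (\<rho> ^ j) \<psi> \<in> IBr p red G" for j by (rule twist_IBr[OF rho_power(2) assms(1)])
  note cf = class_fun_scale[OF IBr_class_fun[OF tw]]
  have "ibr_coef p red G (xcut \<psi>) \<phi> = ibr_coef p red G (\<lambda>y. (1 / of_nat ext_order) * (\<Sum>j<ext_order. inverse (\<rho> ^ j) * twist (\<rho> ^ j) \<psi> y)) \<phi>"
    using cut_formula[OF assms(1)] by presburger
  also have "\<dots> = (1 / of_nat ext_order) * ibr_coef p red G (\<lambda>y. \<Sum>j<ext_order. inverse (\<rho> ^ j) * twist (\<rho> ^ j) \<psi> y) \<phi>"
    by (rule ibr_coef_scale[OF class_fun_sum[OF cf] assms(2)])
  also have "ibr_coef p red G (\<lambda>y. \<Sum>j<ext_order. inverse (\<rho> ^ j) * twist (\<rho> ^ j) \<psi> y) \<phi>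
      = (\<Sum>j<ext_order. ibr_coef p red G (\<lambda>y. inverse (\<rho> ^ j) * twist (\<rho> ^ j) \<psi> y) \<phi>)"
    by (rule ibr_coef_sum[OF _ cf assms(2)]) simp
  also have "\<dots> = (\<Sum>j<ext_order. inverse (\<rho> ^ j) * (if \<phi> = twist (\<rho> ^ j) \<psi> then 1 else 0))"
    using ibr_coef_scale[OF IBr_class_fun[OF tw] assms(2)] ibr_coef_IBr[OF tw assms(2)] by (intro sum.cong) auto
  finally show ?thesis .
qed

lemma cut_coef_nonzero:
  assumes "\<psi> \<in> IBr p red G" "\<phi> \<in> IBr p red G" "ibr_coef p red G (xcut \<psi>) \<phi> \<noteq> 0"
  obtains \<omega> where "\<omega> ^ ext_order = 1" "\<phi> = twist \<omega> \<psi>"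
proof -
  have "\<exists>j<ext_order. \<phi> = twist (\<rho> ^ j) \<psi>"
  proof (rule ccontr)
    assume "\<not> ?thesis"
    then have "(\<Sum>j<ext_order. inverse (\<rho> ^ j) * (if \<phi> = twist (\<rho> ^ j) \<psi> then 1 else 0)) = 0"
      by (intro sum.neutral) auto
    then show False using cut_coef[OF assms(1,2)] assms(3) by simp
  qed
  then show thesis using that rho_power(2) by blast
qed

text \<open>Distinct powers of \<open>\<rho>\<close> twist an extension to distinct characters, so
  only the term \<open>j = 0\<close> contributes.\<close>

lemma cut_coef_self:
  assumes \<psi>: "\<psi> \<in> IBr p red G" and e: "res N \<psi> \<in> IBr p red GN"
  shows "ibr_coef p red G (xcut \<psi>) \<psi> = 1 / of_nat ext_order"
proof -
  have "\<psi> \<noteq> twist (\<rho> ^ j) \<psi>" if "0 < j" "j < ext_order" for j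
  proof
    assume "\<psi> = twist (\<rho> ^ j) \<psi>"
    then have "\<rho> ^ j = 1" using extension_twist_inj[OF \<psi> e rho_power(2)] by metis
    then have "ext_order dvd j" by (rule unity_root_primitive[OF ext_order(1)])
    then show False using that by (auto dest: dvd_imp_le)
  qed
  then have "(\<Sum>j<ext_order. inverse (\<rho> ^ j) * (if \<psi> = twist (\<rho> ^ j) \<psi> then 1 else 0)) =
    (\<Sum>j\<in>{0}. inverse (\<rho> ^ j) * (if \<psi> = twist (\<rho> ^ j) \<psi> then 1 else 0))"
    using ext_order(1) by (intro sum.mono_neutral_right) auto
  then show ?thesis using cut_coef[OF \<psi> \<psi>] twist_one[of \<psi>] by simp
qed

lemma res_twist:
  assumes "\<omega> ^ ext_order = 1"
  shows "res N (twist \<omega> \<psi>) = res N \<psi>"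
  using lam_N[OF assms] by (auto simp: res_def fun_eq_iff)

end

section \<open>Coset coefficients relative to a normal subgroup\<close>

context modular_normal
begin

lemma coset_eq_iff:
  assumes "a \<in> carrier G" "b \<in> carrier G"
  shows "N #> a = N #> b \<longleftrightarrow> a \<in> N #> b"
  using assms repr_independence[OF _ assms(2) N_subgroup] rcos_self[OF assms(1) N_subgroup] by auto

lemma coset_mult_cong:
  assumes "a \<in> carrier G" "b \<in> carrier G" "a' \<in> carrier G" "b' \<in> carrier G" "N #> a = N #> a'" "N #> b = N #> b'"
  shows "N #> (a \<otimes> b) = N #> (a' \<otimes> b')"
  using rcos_sum[OF assms(1,2)] rcos_sum[OF assms(3,4)] assms(5,6) by simp

lemma coset_inv_cong:
  assumes "a \<in> carrier G" "b \<in> carrier G" "N #> a = N #> b"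
  shows "N #> inv a = N #> inv b"
  using rcos_inv[OF assms(1)] rcos_inv[OF assms(2)] assms(3) by simp

lemma coset_conj_cong:
  assumes "g \<in> carrier G" "a \<in> carrier G" "b \<in> carrier G" "N #> a = N #> b"
  shows "N #> (g \<otimes> a \<otimes> inv g) = N #> (g \<otimes> b \<otimes> inv g)"
  by (intro coset_mult_cong) (use assms in auto)

lemma coset_pow_cong:
  assumes "a \<in> carrier G" "b \<in> carrier G" "N #> a = N #> b"
  shows "N #> a [^] (i::nat) = N #> b [^] i"
  using FactGroup_pow[OF assms(1), of i] FactGroup_pow[OF assms(2), of i] assms(3) by simp

definition ext_group :: "'a \<Rightarrow> 'a set" where
  "ext_group x = N <#> generate G {x}"

lemma ext_group_iff:
  assumes x: "x \<in> carrier G"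
  shows "z \<in> ext_group x \<longleftrightarrow> z \<in> carrier G \<and> (\<exists>i::nat. N #> z = N #> x [^] i)"
proof -
  have "generate G {x} = {x [^] k | k::nat. True}"
    using generate_pow_on_finite_carrier[OF fin x] by auto
  then have "z \<in> ext_group x \<longleftrightarrow> (\<exists>i::nat. z \<in> N #> x [^] i)"
    by (auto simp: ext_group_def set_mult_def r_coset_def)
  also have "\<dots> \<longleftrightarrow> z \<in> carrier G \<and> (\<exists>i::nat. N #> z = N #> x [^] i)"
    using coset_eq_iff[of z] x r_coset_subset_G[OF subset] by (metis nat_pow_closed subsetD)
  finally show ?thesis .
qed

lemma ext_group_subgroup: "x \<in> carrier G \<Longrightarrow> subgroup (ext_group x) G"
  unfolding ext_group_def
  by (intro mult_norm_subgroup normal_axioms generate_is_subgroup) auto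

lemma N_subset_ext_group: "x \<in> carrier G \<Longrightarrow> N \<subseteq> ext_group x"
proof
  fix h assume x: "x \<in> carrier G" and h: "h \<in> N"
  have "N #> h = N" by (rule coset_join2[OF N_carrier[OF h] N_subgroup h])
  then have "N #> h = N #> x [^] (0::nat)" using subset by simp
  then show "h \<in> ext_group x" unfolding ext_group_iff[OF x] using N_carrier[OF h] by blast
qed

lemma coset_subset_ext_group: "x \<in> carrier G \<Longrightarrow> N #> x \<subseteq> ext_group x"
proof
  fix y assume x: "x \<in> carrier G" and y: "y \<in> N #> x"
  have yc: "y \<in> carrier G" using y r_coset_subset_G[OF subset x] by auto
  have "N #> y = N #> x [^] (1::nat)" using coset_eq_iff[OF yc x] y x by simp
  then show "y \<in> ext_group x" unfolding ext_group_iff[OF x] using yc by blast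
qed

lemma ext_group_conj:
  assumes g: "g \<in> carrier G" and x: "x \<in> carrier G" and y: "y \<in> carrier G" and e: "N #> (g \<otimes> y \<otimes> inv g) = N #> x"
    and z: "z \<in> carrier G"
  shows "z \<in> ext_group y \<longleftrightarrow> g \<otimes> z \<otimes> inv g \<in> ext_group x"
proof -
  have xe: "N #> x [^] i = N #> (g \<otimes> y [^] i \<otimes> inv g)" for i :: nat
    using coset_pow_cong[OF _ x e, of i] g y by (simp add: conj_pow_group)
  have "N #> z = N #> y [^] i \<longleftrightarrow> N #> (g \<otimes> z \<otimes> inv g) = N #> x [^] i" for i :: nat
  proof
    assume "N #> z = N #> y [^] i"
    then show "N #> (g \<otimes> z \<otimes> inv g) = N #> x [^] i" unfolding xe by (rule coset_conj_cong[rotated 3]) (use g z y in auto)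
  next
    assume "N #> (g \<otimes> z \<otimes> inv g) = N #> x [^] i"
    then have "N #> (inv g \<otimes> (g \<otimes> z \<otimes> inv g) \<otimes> inv (inv g)) = N #> (inv g \<otimes> (g \<otimes> y [^] i \<otimes> inv g) \<otimes> inv (inv g))"
      unfolding xe by (rule coset_conj_cong[rotated 3]) (use g z y in auto)
    then show "N #> z = N #> y [^] i" using g z y by (simp add: conj_cancel)
  qed
  then show ?thesis using ext_group_iff[OF x] ext_group_iff[OF y] g z by auto
qed

lemma cyclic_extension_ext_group:
  assumes x: "regular x"
  shows "cyclic_extension (G\<lparr>carrier := ext_group x\<rparr>) p red N x"
proof -
  note xc = regular_carrier[OF x]
  note sub = ext_group_subgroup[OF xc]
  interpret M: finite_modular_group "G\<lparr>carrier := ext_group x\<rparr>" p red by (rule subgroup_modular[OF sub])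
  have n: "normal N (G\<lparr>carrier := ext_group x\<rparr>)"
    by (rule normal_restrict_supergroup[OF sub normal_axioms N_subset_ext_group[OF xc]])
  have xM: "x \<in> ext_group x" using coset_subset_ext_group[OF xc] rcos_self[OF xc N_subgroup] by auto
  have pw: "y [^]\<^bsub>G\<lparr>carrier := ext_group x\<rparr>\<^esub> i = y [^] i" for y and i :: nat by (simp add: nat_pow_def)
  show ?thesis
  proof (intro cyclic_extension.intro modular_normal.intro cyclic_extension_axioms.intro)
    show "finite_modular_group (G\<lparr>carrier := ext_group x\<rparr>) p red" by (rule M.finite_modular_group_axioms)
    show "p_regular (G\<lparr>carrier := ext_group x\<rparr>) p x" using p_regular_subgroup[OF sub] xM x by simp
    fix g assume "g \<in> carrier (G\<lparr>carrier := ext_group x\<rparr>)"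
    then obtain i :: nat where g: "g \<in> carrier G" "N #> g = N #> x [^] i" using ext_group_iff[OF xc] by auto
    then have "g \<in> N #> x [^] i" using coset_eq_iff xc by simp
    then show "\<exists>h\<in>N. \<exists>i::nat. g = h \<otimes>\<^bsub>G\<lparr>carrier := ext_group x\<rparr>\<^esub> x [^]\<^bsub>G\<lparr>carrier := ext_group x\<rparr>\<^esub> i"
      unfolding pw by (auto simp: r_coset_def)
  qed (rule n)
qed

abbreviation "EG x \<equiv> G\<lparr>carrier := ext_group x\<rparr>"

text \<open>The number c(x, \<psi>, f) of the overview. It is formed in N\<langle>x\<rangle> because
  the coset of \<open>x\<close> is stable under conjugation there, which makes the cut function a
  class function.\<close>

definition coset_coef :: "'a \<Rightarrow> ('a \<Rightarrow> complex) \<Rightarrow> ('a \<Rightarrow> complex) \<Rightarrow> complex" where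
  "coset_coef x \<psi> f = ibr_coef p red (EG x) (coset_cut G N x f) \<psi>"

lemma r_coset_subgroup: "N #>\<^bsub>G\<lparr>carrier := H\<rparr>\<^esub> x = N #> x"
  by (simp add: r_coset_def)

lemma coset_cut_subgroup: "coset_cut (G\<lparr>carrier := H\<rparr>) N x f = coset_cut G N x f"
  by (simp add: coset_cut_def fun_eq_iff r_coset_subgroup)

lemma class_fun_res:
  assumes H: "subgroup H G" and f: "class_fun p G f"
  shows "class_fun p (G\<lparr>carrier := H\<rparr>) (res H f)"
proof -
  have i: "inv\<^bsub>G\<lparr>carrier := H\<rparr>\<^esub> g = inv g" if "g \<in> H" for g using m_inv_consistent[OF H that] .
  have "g \<otimes> y \<otimes> inv g \<in> H" if "g \<in> H" "y \<in> H" for g y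
    using subgroup.m_closed[OF H] subgroup.m_inv_closed[OF H] that by simp
  then show ?thesis using f subgroup.mem_carrier[OF H]
    by (auto simp: class_fun_def res_def p_regular_subgroup[OF H] i)
qed

lemma coset_cut_class_fun:
  assumes x: "regular x" and f: "class_fun p G f"
  shows "class_fun p (EG x) (coset_cut G N x f)"
proof -
  interpret C: cyclic_extension "EG x" p red N x by (rule cyclic_extension_ext_group[OF x])
  note xc = regular_carrier[OF x]
  have "class_fun p (EG x) (coset_cut G N x (res (ext_group x) f))"
    using C.cut_class_fun[OF class_fun_res[OF ext_group_subgroup[OF xc] f]] by (simp add: coset_cut_subgroup)
  moreover have "coset_cut G N x (res (ext_group x) f) = coset_cut G N x f"
    using coset_subset_ext_group[OF xc] by (auto simp: coset_cut_def res_def fun_eq_iff)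
  ultimately show ?thesis by simp
qed

lemma coset_coef_add:
  assumes "regular x" "class_fun p G f" "class_fun p G g" "\<psi> \<in> IBr p red (EG x)"
  shows "coset_coef x \<psi> (\<lambda>y. f y + g y) = coset_coef x \<psi> f + coset_coef x \<psi> g"
proof -
  interpret C: cyclic_extension "EG x" p red N x by (rule cyclic_extension_ext_group[OF assms(1)])
  have "coset_cut G N x (\<lambda>y. f y + g y) = (\<lambda>y. coset_cut G N x f y + coset_cut G N x g y)"
    by (auto simp: coset_cut_def)
  then show ?thesis unfolding coset_coef_def
    using C.ibr_coef_add[OF coset_cut_class_fun[OF assms(1,2)] coset_cut_class_fun[OF assms(1,3)] assms(4)] by simp
qed

lemma coset_coef_scale:
  assumes "regular x" "class_fun p G f" "\<psi> \<in> IBr p red (EG x)"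
  shows "coset_coef x \<psi> (\<lambda>y. c * f y) = c * coset_coef x \<psi> f"
proof -
  interpret C: cyclic_extension "EG x" p red N x by (rule cyclic_extension_ext_group[OF assms(1)])
  have "coset_cut G N x (\<lambda>y. c * f y) = (\<lambda>y. c * coset_cut G N x f y)"
    by (auto simp: coset_cut_def)
  then show ?thesis unfolding coset_coef_def
    using C.ibr_coef_scale[OF coset_cut_class_fun[OF assms(1,2)] assms(3)] by simp
qed

lemma coset_coef_zero:
  assumes "regular x" "\<psi> \<in> IBr p red (EG x)"
  shows "coset_coef x \<psi> (\<lambda>y. 0) = 0"
proof -
  interpret C: cyclic_extension "EG x" p red N x by (rule cyclic_extension_ext_group[OF assms(1)])
  have "coset_cut G N x (\<lambda>y. 0) = (\<lambda>y. 0)" by (auto simp: coset_cut_def)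
  then show ?thesis unfolding coset_coef_def using C.ibr_coef_zero[OF assms(2)] by simp
qed

lemma coset_coef_sum:
  assumes "finite A" "regular x" "\<And>i. i \<in> A \<Longrightarrow> class_fun p G (f i)" "\<psi> \<in> IBr p red (EG x)"
  shows "coset_coef x \<psi> (\<lambda>y. \<Sum>i\<in>A. f i y) = (\<Sum>i\<in>A. coset_coef x \<psi> (f i))"
  using assms
  by (induction A rule: finite_induct) (simp_all add: coset_coef_zero coset_coef_add class_fun_sum)

text \<open>The scalar is the inverse of the root of unity relating the two extensions by a twist,
  and by \<open>extension_twist_inj\<close> it is 1 only if they coincide. Equality of extensions
  can thus be tested on a single nonvanishing coefficient.\<close>

lemma coset_coef_twist:
  assumes x: "regular x" and \<psi>: "\<psi> \<in> IBr p red (EG x)" "\<psi>' \<in> IBr p red (EG x)"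
    and e: "res N \<psi> = res N \<psi>'" "res N \<psi> \<in> IBr p red GN"
  obtains c where "c \<noteq> 0" "\<psi> = \<psi>' \<longleftrightarrow> c = 1" "\<And>f. class_fun p G f \<Longrightarrow> coset_coef x \<psi> f = c * coset_coef x \<psi>' f"
proof -
  interpret C: cyclic_extension "EG x" p red N x by (rule cyclic_extension_ext_group[OF x])
  have G2: "EG x\<lparr>carrier := N\<rparr> = GN" by simp
  have e': "res N \<psi>' = res N \<psi>" "res N \<psi>' \<in> IBr p red (EG x\<lparr>carrier := N\<rparr>)" using e by auto
  obtain \<omega> where w: "\<omega> ^ C.ext_order = 1" "\<psi> = C.twist \<omega> \<psi>'" using C.extensions_twist[OF \<psi>(2,1) e'] .
  have supp: "coset_cut G N x f y = 0" if "y \<notin> N #>\<^bsub>EG x\<^esub> x" for f y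
    using that by (simp add: coset_cut_def r_coset_subgroup)
  have w0: "inverse \<omega> \<noteq> 0" using C.inverse_root[OF w(1)] by simp
  show thesis
  proof (rule that[of "inverse \<omega>"])
    show "coset_coef x \<psi> f = inverse \<omega> * coset_coef x \<psi>' f" if "class_fun p G f" for f
      unfolding coset_coef_def w(2) by (rule C.coef_twist[OF coset_cut_class_fun[OF x that] supp \<psi>(2) w(1)])
    show "\<psi> = \<psi>' \<longleftrightarrow> inverse \<omega> = 1"
      using w C.twist_one[of \<psi>'] C.extension_twist_inj[OF \<psi>(2) e'(2) w(1)] by auto
  qed (rule w0)
qed

lemma coset_coef_nonzero_extension:
  assumes x: "regular x" and f: "class_fun p G f" and \<psi>: "\<psi> \<in> IBr p red (EG x)" and nz: "coset_coef x \<psi> f \<noteq> 0"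
  shows "res N \<psi> \<in> IBr p red GN"
proof -
  interpret C: cyclic_extension "EG x" p red N x by (rule cyclic_extension_ext_group[OF x])
  have "res N \<psi> \<in> IBr p red (EG x\<lparr>carrier := N\<rparr>)"
    by (rule C.coef_nonzero_extension[OF coset_cut_class_fun[OF x f] _ \<psi>])
      (use nz in \<open>auto simp: coset_coef_def coset_cut_def r_coset_subgroup\<close>)
  then show ?thesis by simp
qed

lemma bij_conj_fun:
  assumes H: "subgroup H G" and K: "subgroup K G" and g: "g \<in> carrier G"
    and HK: "\<And>y. y \<in> carrier G \<Longrightarrow> y \<in> K \<longleftrightarrow> g \<otimes> y \<otimes> inv g \<in> H"
  shows "bij_betw (\<lambda>\<psi>. conj_fun G \<psi> g) (IBr p red (G\<lparr>carrier := H\<rparr>)) (IBr p red (G\<lparr>carrier := K\<rparr>))"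
proof (rule bij_betwI[where g = "\<lambda>\<psi>. conj_fun G \<psi> (inv g)"])
  have HK': "y \<in> H \<longleftrightarrow> inv g \<otimes> y \<otimes> inv (inv g) \<in> K" if "y \<in> carrier G" for y
    using HK[of "inv g \<otimes> y \<otimes> g"] that g conj_cancel(2)[OF g that] by simp
  have z: "\<psi> y = 0" if L: "subgroup L G" and "\<psi> \<in> IBr p red (G\<lparr>carrier := L\<rparr>)" "y \<notin> carrier G" for L \<psi> y
  proof -
    interpret L: finite_modular_group "G\<lparr>carrier := L\<rparr>" p red by (rule subgroup_modular[OF L])
    have "\<not> p_regular (G\<lparr>carrier := L\<rparr>) p y" using that subgroup.mem_carrier[OF L] by (auto simp: p_regular_def)
    then show ?thesis using L.IBr_class_fun[OF that(2)] by (simp add: class_fun_def)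
  qed
  show "(\<lambda>\<psi>. conj_fun G \<psi> g) \<in> IBr p red (G\<lparr>carrier := H\<rparr>) \<rightarrow> IBr p red (G\<lparr>carrier := K\<rparr>)"
    using conj_fun_IBr[OF H K g HK] by blast
  show "(\<lambda>\<psi>. conj_fun G \<psi> (inv g)) \<in> IBr p red (G\<lparr>carrier := K\<rparr>) \<rightarrow> IBr p red (G\<lparr>carrier := H\<rparr>)"
    using conj_fun_IBr[OF K H inv_closed[OF g] HK'] by blast
  show "conj_fun G (conj_fun G \<psi> g) (inv g) = \<psi>" if "\<psi> \<in> IBr p red (G\<lparr>carrier := H\<rparr>)" for \<psi>
    using z[OF H that] g by (auto simp: conj_fun_def fun_eq_iff conj_cancel)
  show "conj_fun G (conj_fun G \<psi> (inv g)) g = \<psi>" if "\<psi> \<in> IBr p red (G\<lparr>carrier := K\<rparr>)" for \<psi>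
    using z[OF K that] g by (auto simp: conj_fun_def fun_eq_iff conj_cancel)
qed

text \<open>\<open>conj_fun G \<psi> g\<close> evaluates \<psi> after conjugation by
  \<open>g\<close>, which carries the coset of \<open>y\<close> to that of \<open>x\<close>. A class
  function of \<open>G\<close> is unchanged, so its cuts to the two cosets correspond.\<close>

lemma coset_coef_conj:
  assumes g: "g \<in> carrier G" and x: "regular x" and y: "regular y" and e: "N #> (g \<otimes> y \<otimes> inv g) = N #> x"
    and \<psi>: "\<psi> \<in> IBr p red (EG x)"
  shows "conj_fun G \<psi> g \<in> IBr p red (EG y)"
    and "class_fun p G f \<Longrightarrow> coset_coef y (conj_fun G \<psi> g) f = coset_coef x \<psi> f"
proof -
  note xc = regular_carrier[OF x] and yc = regular_carrier[OF y]
  note H = ext_group_subgroup[OF xc] and K = ext_group_subgroup[OF yc]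
  note b = bij_conj_fun[OF H K g ext_group_conj[OF g xc yc e]]
  show "conj_fun G \<psi> g \<in> IBr p red (EG y)" using b \<psi> by (auto simp: bij_betw_def)
  assume f: "class_fun p G f"
  interpret C: cyclic_extension "EG x" p red N x by (rule cyclic_extension_ext_group[OF x])
  have "coset_cut G N y f z = (\<Sum>\<phi>\<in>IBr p red (EG x). ibr_coef p red (EG x) (coset_cut G N x f) \<phi> * conj_fun G \<phi> g z)" for z
  proof (cases "z \<in> carrier G")
    case True
    have c: "z \<in> N #> y \<longleftrightarrow> g \<otimes> z \<otimes> inv g \<in> N #> x"
    proof -
      have "z \<in> N #> y \<longleftrightarrow> N #> z = N #> y" using coset_eq_iff[OF True yc] by simp
      also have "\<dots> \<longleftrightarrow> N #> (g \<otimes> z \<otimes> inv g) = N #> (g \<otimes> y \<otimes> inv g)"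
      proof
        assume "N #> (g \<otimes> z \<otimes> inv g) = N #> (g \<otimes> y \<otimes> inv g)"
        then have "N #> (inv g \<otimes> (g \<otimes> z \<otimes> inv g) \<otimes> inv (inv g)) = N #> (inv g \<otimes> (g \<otimes> y \<otimes> inv g) \<otimes> inv (inv g))"
          by (rule coset_conj_cong[rotated 3]) (use g True yc in auto)
        then show "N #> z = N #> y" using g True yc by (simp add: conj_cancel)
      qed (intro coset_conj_cong g True yc)
      also have "\<dots> \<longleftrightarrow> g \<otimes> z \<otimes> inv g \<in> N #> x" unfolding e using coset_eq_iff[OF _ xc] g True by simp
      finally show ?thesis .
    qed
    have fz: "f (g \<otimes> z \<otimes> inv g) = f z"
      using f g True regular_conj[OF g True] unfolding class_fun_def by (cases "regular z") auto
    have "coset_cut G N y f z = coset_cut G N x f (g \<otimes> z \<otimes> inv g)" using c fz by (simp add: coset_cut_def)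
    also have "\<dots> = (\<Sum>\<phi>\<in>IBr p red (EG x). ibr_coef p red (EG x) (coset_cut G N x f) \<phi> * \<phi> (g \<otimes> z \<otimes> inv g))"
      by (rule C.ibr_coef_expand[OF coset_cut_class_fun[OF x f]])
    finally show ?thesis using True by (simp add: conj_fun_def)
  next
    case False
    then have "coset_cut G N y f z = 0" using f regular_carrier unfolding class_fun_def coset_cut_def by auto
    then show ?thesis using False by (simp add: conj_fun_def)
  qed
  from ibr_coef_transport[OF C.finite_modular_group_axioms subgroup_modular[OF K] b this \<psi>]
  show "coset_coef y (conj_fun G \<psi> g) f = coset_coef x \<psi> f" by (simp add: coset_coef_def)
qed

definition invert_fun :: "('a \<Rightarrow> complex) \<Rightarrow> 'a \<Rightarrow> complex" where
  "invert_fun f y = (if y \<in> carrier G then f (inv y) else 0)"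

lemma class_fun_invert:
  assumes f: "class_fun p G f"
  shows "class_fun p G (invert_fun f)"
  unfolding class_fun_def
proof (intro conjI allI impI)
  fix y assume "\<not> regular y"
  then show "invert_fun f y = 0" using f p_regular_inv[of y p] by (auto simp: invert_fun_def class_fun_def)
next
  fix y g assume y: "regular y" and g: "g \<in> carrier G"
  note yc = regular_carrier[OF y]
  have "inv (g \<otimes> y \<otimes> inv g) = g \<otimes> inv y \<otimes> inv g" using g yc by (simp add: inv_mult_group m_assoc)
  moreover have "regular (inv y)" using y yc by (simp add: p_regular_inv)
  ultimately show "invert_fun f (g \<otimes> y \<otimes> inv g) = invert_fun f y"
    using f g yc by (simp add: invert_fun_def class_fun_def)
qed

lemma invert_invert: "class_fun p G f \<Longrightarrow> invert_fun (invert_fun f) = f"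
  using regular_carrier by (fastforce simp: invert_fun_def class_fun_def)

lemma invert_IBr: "\<phi> \<in> IBr p red G \<Longrightarrow> invert_fun \<phi> = cnj_fun \<phi>"
  using IBr_inv[of \<phi>] IBr_class_fun[of \<phi>] regular_carrier
  by (fastforce simp: invert_fun_def cnj_fun_def class_fun_def)

lemma ext_group_inv:
  assumes x: "regular x"
  shows "ext_group (inv x) = ext_group x"
proof -
  have sub: "ext_group (inv x) \<subseteq> ext_group x" if x: "x \<in> carrier G" for x
  proof
    fix z assume "z \<in> ext_group (inv x)"
    then obtain i :: nat where z: "z \<in> carrier G" "N #> z = N #> inv x [^] i" using ext_group_iff[of "inv x"] x by auto
    have "ord x > 0" using ord_ge_1[OF fin x] by simp
    have "inv x = x [^] (ord x - 1)"
    proof (rule inv_equality)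
      show "x [^] (ord x - 1) \<otimes> x = \<one>" using \<open>ord x > 0\<close> x by (simp flip: nat_pow_Suc)
    qed (use x in auto)
    then have "inv x [^] i = x [^] ((ord x - 1) * i)" using x by (simp add: nat_pow_pow)
    then show "z \<in> ext_group x" using z ext_group_iff[OF x] by auto
  qed
  show ?thesis using sub[of x] sub[of "inv x"] regular_carrier[OF x] by auto
qed

text \<open>Inversion exchanges the cosets of \<open>x\<close> and \<open>inv x\<close> inside the
  same group N\<langle>x\<rangle> and turns each Brauer character of that group into its complex
  conjugate.\<close>

lemma coset_coef_invert:
  assumes x: "regular x" and \<psi>: "\<psi> \<in> IBr p red (EG x)" and f: "class_fun p G f"
  shows "coset_coef x \<psi> (invert_fun f) = coset_coef (inv x) (cnj_fun \<psi>) f"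
proof -
  note xc = regular_carrier[OF x]
  have xi: "regular (inv x)" using x xc by (simp add: p_regular_inv)
  interpret C: cyclic_extension "EG x" p red N x by (rule cyclic_extension_ext_group[OF x])
  have EE: "EG (inv x) = EG x" using ext_group_inv[OF x] by simp
  let ?f = "coset_cut G N (inv x) f"
  have b: "bij_betw cnj_fun (IBr p red (EG x)) (IBr p red (EG x))"
    by (rule bij_betwI[where g = cnj_fun]) (use C.cnj_fun_IBr in \<open>auto simp: cnj_fun_def\<close>)
  have cf: "class_fun p (EG x) ?f" using coset_cut_class_fun[OF xi f] EE by simp
  have "coset_cut G N x (invert_fun f) z = (\<Sum>\<phi>\<in>IBr p red (EG x). ibr_coef p red (EG x) ?f \<phi> * cnj_fun \<phi> z)" for z
  proof (cases "z \<in> ext_group x")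
    case True
    note M = ext_group_subgroup[OF xc]
    have zc: "z \<in> carrier G" by (rule subgroup.mem_carrier[OF M True])
    have ziM: "inv z \<in> ext_group x" by (rule subgroup.m_inv_closed[OF M True])
    have "z \<in> N #> x \<longleftrightarrow> inv z \<in> N #> inv x"
      using coset_eq_iff[OF zc xc] coset_eq_iff[of "inv z" "inv x"] coset_inv_cong[OF zc xc] coset_inv_cong[of "inv z" "inv x"] zc xc by auto
    then have "coset_cut G N x (invert_fun f) z = ?f (inv z)" using zc by (simp add: coset_cut_def invert_fun_def)
    also have "\<dots> = (\<Sum>\<phi>\<in>IBr p red (EG x). ibr_coef p red (EG x) ?f \<phi> * \<phi> (inv z))"
      by (rule C.ibr_coef_expand[OF cf])
    also have "\<dots> = (\<Sum>\<phi>\<in>IBr p red (EG x). ibr_coef p red (EG x) ?f \<phi> * cnj_fun \<phi> z)"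
      using C.IBr_inv[of _ z] True m_inv_consistent[OF M True] by (intro sum.cong) (auto simp: cnj_fun_def)
    finally show ?thesis .
  next
    case False
    then have "coset_cut G N x (invert_fun f) z = 0" using coset_subset_ext_group[OF xc] by (auto simp: coset_cut_def)
    moreover have "\<phi> z = 0" if "\<phi> \<in> IBr p red (EG x)" for \<phi> using C.IBr_zero_outside[OF that, of z] False by simp
    ultimately show ?thesis by (simp add: cnj_fun_def)
  qed
  from ibr_coef_transport[OF C.finite_modular_group_axioms C.finite_modular_group_axioms b this C.cnj_fun_IBr[OF \<psi>]]
  show ?thesis using EE by (simp add: coset_coef_def cnj_fun_def[abs_def])
qed

lemma IBr_subgroup_zero:
  assumes H: "subgroup H G" and \<psi>: "\<psi> \<in> IBr p red (G\<lparr>carrier := H\<rparr>)" and y: "y \<notin> H"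
  shows "\<psi> y = 0"
proof -
  interpret H: finite_modular_group "G\<lparr>carrier := H\<rparr>" p red by (rule subgroup_modular[OF H])
  have "\<not> p_regular (G\<lparr>carrier := H\<rparr>) p y" using y by (auto simp: p_regular_def)
  then show ?thesis using H.IBr_class_fun[OF \<psi>] by (simp add: class_fun_def)
qed

lemma conj_fun_mult: "g \<in> carrier G \<Longrightarrow> h \<in> carrier G \<Longrightarrow> conj_fun G (conj_fun G \<psi> g) h = conj_fun G \<psi> (g \<otimes> h)"
  by (auto simp: conj_fun_def fun_eq_iff inv_mult_group m_assoc)

lemma conj_fun_one: "(\<And>y. y \<notin> carrier G \<Longrightarrow> \<psi> y = 0) \<Longrightarrow> conj_fun G \<psi> \<one> = \<psi>"
  by (auto simp: conj_fun_def fun_eq_iff)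

lemma conj_fun_one_N: "\<mu> \<in> IBr p red GN \<Longrightarrow> conj_fun G \<mu> \<one> = \<mu>"
  using IBr_subgroup_zero[OF N_subgroup] N_carrier by (intro conj_fun_one) blast

lemma conj_fun_inverse:
  assumes "\<mu> \<in> IBr p red GN" "g \<in> carrier G"
  shows "conj_fun G (conj_fun G \<mu> g) (inv g) = \<mu>" "conj_fun G (conj_fun G \<mu> (inv g)) g = \<mu>"
  using assms by (simp_all add: conj_fun_mult conj_fun_one_N)

lemma cnj_conj_fun: "cnj_fun (conj_fun G \<psi> g) = conj_fun G (cnj_fun \<psi>) g"
  by (auto simp: cnj_fun_def conj_fun_def fun_eq_iff)

lemma cnj_cnj_fun: "cnj_fun (cnj_fun \<psi>) = \<psi>"
  by (simp add: cnj_fun_def fun_eq_iff)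

lemma res_cnj_fun: "res N (cnj_fun \<psi>) = cnj_fun (res N \<psi>)"
  by (auto simp: res_def cnj_fun_def fun_eq_iff)

lemma res_conj_fun: "g \<in> carrier G \<Longrightarrow> res N (conj_fun G \<psi> g) = conj_fun G (res N \<psi>) g"
  using N_conj_iff[of g] N_carrier by (auto simp: res_def conj_fun_def fun_eq_iff)

lemma class_fun_conj_fun:
  assumes f: "class_fun p G f" and g: "g \<in> carrier G"
  shows "conj_fun G f g = f"
proof
  fix y
  show "conj_fun G f g y = f y"
    using f g regular_carrier[of y] regular_conj[OF g, of y] unfolding conj_fun_def class_fun_def
    by (cases "regular y") auto
qed

lemma class_fun_conj_N:
  assumes f: "class_fun p GN f" and h: "h \<in> N"
  shows "conj_fun G f h = f"
proof
  fix y
  have hc: "h \<in> carrier G" by (rule N_carrier[OF h])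
  have i: "inv\<^bsub>GN\<^esub> h = inv h" by (rule m_inv_consistent[OF N_subgroup h])
  have z: "f y = 0" if "\<not> (y \<in> N \<and> regular y)" for y using f that by (auto simp: class_fun_def p_regular_subgroup[OF N_subgroup])
  show "conj_fun G f h y = f y"
  proof (cases "y \<in> N \<and> regular y")
    case True
    then have "f (h \<otimes> y \<otimes> inv\<^bsub>GN\<^esub> h) = f y"
      using f h by (simp add: class_fun_def p_regular_subgroup[OF N_subgroup])
    then have "f (h \<otimes> y \<otimes> inv h) = f y" by (simp only: i)
    then show ?thesis using True N_carrier by (simp add: conj_fun_def)
  next
    case False
    then have "y \<in> carrier G \<Longrightarrow> \<not> (h \<otimes> y \<otimes> inv h \<in> N \<and> regular (h \<otimes> y \<otimes> inv h))"
      using N_conj_iff[OF hc] regular_conj[OF hc] by blast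
    then show ?thesis using z False by (auto simp: conj_fun_def)
  qed
qed

text \<open>The restriction of a class function of \<open>G\<close> is fixed by conjugation, so
  conjugating a decomposition of it gives a decomposition of the same function.\<close>

lemma lies_over_conj:
  assumes \<phi>: "\<phi> \<in> IBr p red G" and l: "lies_over p red G N \<mu> \<phi>" and g: "g \<in> carrier G"
  shows "lies_over p red G N (conj_fun G \<mu> g) \<phi>"
proof -
  obtain M where M: "set_mset M \<subseteq> IBr p red GN" "\<mu> \<in># M" "\<And>y. res N \<phi> y = (\<Sum>\<nu>\<in>#M. \<nu> y)"
    using l unfolding lies_over_def constituent_def by blast
  let ?M = "image_mset (\<lambda>\<nu>. conj_fun G \<nu> g) M"
  have "res N \<phi> y = (\<Sum>\<nu>\<in>#?M. \<nu> y)" for y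
  proof -
    have "res N \<phi> y = conj_fun G (res N \<phi>) g y"
      using res_conj_fun[OF g, of \<phi>] class_fun_conj_fun[OF IBr_class_fun[OF \<phi>] g] by simp
    also have "\<dots> = (\<Sum>\<nu>\<in>#?M. \<nu> y)"
      by (cases "y \<in> carrier G") (simp_all add: conj_fun_def M(3) multiset.map_comp comp_def)
    finally show ?thesis .
  qed
  moreover have "set_mset ?M \<subseteq> IBr p red GN" using M(1) conj_fun_IBr_N[OF _ g] by auto
  moreover have "conj_fun G \<mu> g \<in># ?M" using M(2) by auto
  ultimately show ?thesis unfolding lies_over_def constituent_def by blast
qed

text \<open>Clifford's theorem provides one decomposition inside a single orbit, and decompositions
  are unique, so every constituent belongs to that orbit.\<close>

lemma lies_over_conjugate:
  assumes \<phi>: "\<phi> \<in> IBr p red G" and l: "lies_over p red G N \<mu> \<phi>" "lies_over p red G N \<nu> \<phi>"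
  shows "\<nu> \<in> conj_fun G \<mu> ` carrier G"
proof -
  obtain \<kappa> M where k: "\<kappa> \<in> IBr p red GN" and M: "set_mset M \<subseteq> conj_fun G \<kappa> ` carrier G" "\<And>y. res N \<phi> y = (\<Sum>\<nu>\<in>#M. \<nu> y)"
    using clifford[OF \<phi>] by metis
  have MI: "set_mset M \<subseteq> IBr p red GN" using M(1) conj_fun_IBr_N[OF k] by auto
  have mem: "\<xi> \<in># M" if lx: "lies_over p red G N \<xi> \<phi>" for \<xi>
  proof -
    from lx obtain M' where M': "set_mset M' \<subseteq> IBr p red GN \<and> \<xi> \<in># M' \<and> (\<forall>y. res N \<phi> y = (\<Sum>\<nu>\<in>#M'. \<nu> y))"
      unfolding lies_over_def constituent_def by (elim exE)
    have "M = M'"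
    proof (rule N.sum_IBr_unique[OF MI])
      show "(\<Sum>\<mu>\<in>#M. \<mu> y) = (\<Sum>\<mu>\<in>#M'. \<mu> y)" for y using M(2)[of y] M' by simp
    qed (use M' in simp)
    with M' show ?thesis by simp
  qed
  obtain a where a: "a \<in> carrier G" "\<mu> = conj_fun G \<kappa> a" using mem[OF l(1)] M(1) by auto
  obtain b where b: "b \<in> carrier G" "\<nu> = conj_fun G \<kappa> b" using mem[OF l(2)] M(1) by auto
  have "conj_fun G \<mu> (inv a \<otimes> b) = \<nu>"
    using a b conj_fun_inverse(1)[OF k a(1)] by (simp flip: conj_fun_mult)
  then show ?thesis using a(1) b(1) by (intro image_eqI[of _ _ "inv a \<otimes> b"]) auto
qed

text \<open>Restrict \<phi> to N\<langle>y\<rangle> and decompose. Cutting a constituent \<nu> to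
  the coset produces only twists of \<nu>, so \<psi> is a twist of some \<nu> and has the same
  restriction to \<open>N\<close>. That restriction is irreducible because the coefficient is
  nonzero, hence it is a constituent of \<phi> restricted to \<open>N\<close>.\<close>

lemma coset_coef_nonzero_lies_over:
  assumes y: "regular y" and \<psi>: "\<psi> \<in> IBr p red (EG y)" and \<phi>: "\<phi> \<in> IBr p red G" and nz: "coset_coef y \<psi> \<phi> \<noteq> 0"
  shows "lies_over p red G N (res N \<psi>) \<phi>"
proof -
  note yc = regular_carrier[OF y]
  note H = ext_group_subgroup[OF yc]
  interpret C: cyclic_extension "EG y" p red N y by (rule cyclic_extension_ext_group[OF y])
  obtain M where M: "set_mset M \<subseteq> IBr p red (EG y)" "\<And>z. res (ext_group y) \<phi> z = (\<Sum>\<mu>\<in>#M. \<mu> z)"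
    using res_IBr_sum[OF H \<phi>] by metis
  let ?I = "IBr p red (EG y)"
  have cut: "coset_cut G N y \<phi> = (\<lambda>z. \<Sum>\<nu>\<in>?I. of_nat (count M \<nu>) * coset_cut G N y \<nu> z)"
  proof
    fix z
    have "coset_cut G N y \<phi> z = coset_cut G N y (res (ext_group y) \<phi>) z"
      using coset_subset_ext_group[OF yc] by (auto simp: coset_cut_def res_def)
    also have "\<dots> = (\<Sum>\<nu>\<in>?I. of_nat (count M \<nu>) * coset_cut G N y \<nu> z)"
      unfolding coset_cut_def M(2) sum_mset_count[OF C.finite_IBr M(1)] by simp
    finally show "coset_cut G N y \<phi> z = (\<Sum>\<nu>\<in>?I. of_nat (count M \<nu>) * coset_cut G N y \<nu> z)" .
  qed
  have cf: "class_fun p (EG y) (coset_cut G N y \<nu>)" if "\<nu> \<in> ?I" for \<nu>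
    using C.cut_class_fun[OF C.IBr_class_fun[OF that]] by (simp add: coset_cut_subgroup)
  have "coset_coef y \<psi> \<phi> = (\<Sum>\<nu>\<in>?I. ibr_coef p red (EG y) (\<lambda>z. of_nat (count M \<nu>) * coset_cut G N y \<nu> z) \<psi>)"
    unfolding coset_coef_def cut by (rule C.ibr_coef_sum[OF C.finite_IBr C.class_fun_scale[OF cf] \<psi>])
  also have "\<dots> = (\<Sum>\<nu>\<in>?I. of_nat (count M \<nu>) * ibr_coef p red (EG y) (coset_cut G N y \<nu>) \<psi>)"
    by (intro sum.cong refl C.ibr_coef_scale[OF cf \<psi>])
  finally obtain \<nu> where n: "\<nu> \<in> ?I" "of_nat (count M \<nu>) * ibr_coef p red (EG y) (coset_cut G N y \<nu>) \<psi> \<noteq> 0"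
    using nz by (metis (no_types, lifting) sum.neutral)
  then have nM: "\<nu> \<in># M" and "ibr_coef p red (EG y) (coset_cut (EG y) N y \<nu>) \<psi> \<noteq> 0"
    by (auto simp: coset_cut_subgroup count_eq_zero_iff)
  then obtain \<omega> where w: "\<omega> ^ C.ext_order = 1" "\<psi> = C.twist \<omega> \<nu>" using C.cut_coef_nonzero[OF n(1) \<psi>] by metis
  have rn: "res N \<nu> = res N \<psi>" using C.res_twist[OF w(1), of \<nu>] w(2) by simp
  have irr: "res N \<psi> \<in> IBr p red GN" by (rule coset_coef_nonzero_extension[OF y IBr_class_fun[OF \<phi>] \<psi> nz])
  have NH: "subgroup N (EG y)" by (rule C.N_subgroup)
  have "\<exists>L. set_mset L \<subseteq> IBr p red GN \<and> (\<forall>z. res N \<mu> z = (\<Sum>\<xi>\<in>#L. \<xi> z))" if "\<mu> \<in># M" for \<mu>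
  proof -
    have "\<mu> \<in> IBr p red (EG y)" using that M(1) by blast
    from C.res_IBr_sum[OF NH this] obtain L where "set_mset L \<subseteq> IBr p red (EG y\<lparr>carrier := N\<rparr>)" "\<And>z. res N \<mu> z = (\<Sum>\<xi>\<in>#L. \<xi> z)"
      by metis
    then show ?thesis by (intro exI[of _ L]) auto
  qed
  then obtain L where L: "\<And>\<mu>. \<mu> \<in># M \<Longrightarrow> set_mset (L \<mu>) \<subseteq> IBr p red GN" "\<And>\<mu> z. \<mu> \<in># M \<Longrightarrow> res N \<mu> z = (\<Sum>\<xi>\<in>#L \<mu>. \<xi> z)"
    by metis
  obtain M' where M': "M = add_mset \<nu> M'" using nM by (metis multi_member_split)
  let ?L = "add_mset (res N \<psi>) (\<Sum>\<mu>\<in>#M'. L \<mu>)"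
  have "res N \<phi> z = (\<Sum>\<xi>\<in>#?L. \<xi> z)" for z
  proof -
    have aux: "(\<Sum>\<mu>\<in>#A. \<Sum>\<xi>\<in>#L \<mu>. \<xi> z) = (\<Sum>\<xi>\<in>#(\<Sum>\<mu>\<in>#A. L \<mu>). \<xi> z)" for A
      by (induction A) auto
    have "res N \<phi> z = (if z \<in> N then res (ext_group y) \<phi> z else 0)"
      using N_subset_ext_group[OF yc] by (auto simp: res_def)
    also have "\<dots> = (\<Sum>\<mu>\<in>#M. res N \<mu> z)" unfolding M(2) by (simp add: res_def)
    also have "\<dots> = res N \<psi> z + (\<Sum>\<mu>\<in>#M'. res N \<mu> z)" using M' rn by simp
    also have "(\<Sum>\<mu>\<in>#M'. res N \<mu> z) = (\<Sum>\<mu>\<in>#M'. \<Sum>\<xi>\<in>#L \<mu>. \<xi> z)"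
      using L(2) M' by (intro arg_cong[where f = sum_mset] image_mset_cong) auto
    also have "\<dots> = (\<Sum>\<xi>\<in>#(\<Sum>\<mu>\<in>#M'. L \<mu>). \<xi> z)" by (rule aux)
    finally show ?thesis by simp
  qed
  moreover have "set_mset ?L \<subseteq> IBr p red GN" using irr L(1) M' by auto
  ultimately show ?thesis unfolding lies_over_def constituent_def
    by (intro exI[of _ ?L]) auto
qed

text \<open>A p-regular \<open>y\<close> lies in its own coset, where the expansion of the cut
  function recovers \<open>f y\<close>.\<close>

lemma coset_coefs_zero:
  assumes f: "class_fun p G f" and z: "\<And>y \<psi>. regular y \<Longrightarrow> \<psi> \<in> IBr p red (EG y) \<Longrightarrow> coset_coef y \<psi> f = 0"
  shows "f y = 0"
proof (cases "regular y")
  case True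
  interpret C: cyclic_extension "EG y" p red N y by (rule cyclic_extension_ext_group[OF True])
  have "f y = coset_cut G N y f y" using rcos_self[OF regular_carrier[OF True] N_subgroup] by (simp add: coset_cut_def)
  also have "\<dots> = (\<Sum>\<psi>\<in>IBr p red (EG y). coset_coef y \<psi> f * \<psi> y)"
    unfolding coset_coef_def by (rule C.ibr_coef_expand[OF coset_cut_class_fun[OF True f]])
  also have "\<dots> = 0" using z[OF True] by (intro sum.neutral) simp
  finally show ?thesis .
qed (use f in \<open>simp add: class_fun_def\<close>)

lemma coset_coef_lincomb:
  assumes x: "regular x" and \<psi>: "\<psi> \<in> IBr p red (EG x)" and A: "finite A" "\<And>i. i \<in> A \<Longrightarrow> class_fun p G (f i)"
  shows "coset_coef x \<psi> (\<lambda>y. \<Sum>i\<in>A. a i * f i y) = (\<Sum>i\<in>A. a i * coset_coef x \<psi> (f i))"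
proof -
  have "coset_coef x \<psi> (\<lambda>y. \<Sum>i\<in>A. a i * f i y) = (\<Sum>i\<in>A. coset_coef x \<psi> (\<lambda>y. a i * f i y))"
    by (rule coset_coef_sum[OF A(1) x class_fun_scale[OF A(2)] \<psi>])
  also have "\<dots> = (\<Sum>i\<in>A. a i * coset_coef x \<psi> (f i))"
    by (intro sum.cong refl coset_coef_scale[OF x A(2) \<psi>])
  finally show ?thesis .
qed

end

section \<open>Functions over a fixed Brauer character\<close>

locale theta_setup = modular_normal G p red N
  for G :: "('a, 'm) monoid_scheme" (structure) and p and red :: "complex \<Rightarrow> 'k::alg_closed_field" and N +
  fixes \<theta> e
  assumes theta: "\<theta> \<in> IBr p red GN" and e_carrier: "e \<in> carrier G" and e_conj: "conj_fun G \<theta> e = cnj_fun \<theta>"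
begin

abbreviation "T \<equiv> inertia G \<theta>"
abbreviation "Q \<equiv> inertia_quot G N \<theta>"
abbreviation "orb \<equiv> conj_fun G \<theta> ` carrier G"
abbreviation "ext \<equiv> extensions p red G N \<theta>"

definition over :: "('a \<Rightarrow> complex) set" where
  "over = {\<phi> \<in> IBr p red G. lies_over p red G N \<theta> \<phi>}"

text \<open>This is the linear span of \<open>over\<close>; see
  \<open>over_span_expand\<close>.\<close>

definition over_span :: "('a \<Rightarrow> complex) \<Rightarrow> bool" where
  "over_span f \<longleftrightarrow> class_fun p G f \<and> (\<forall>\<phi>\<in>IBr p red G - over. ibr_coef p red G f \<phi> = 0)"

lemma over_IBr: "over \<subseteq> IBr p red G" "finite over"
  using finite_IBr by (auto simp: over_def)

lemma theta_self: "conj_fun G \<theta> \<one> = \<theta>"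
  by (rule conj_fun_one_N[OF theta])

lemma T_iff: "t \<in> T \<longleftrightarrow> t \<in> carrier G \<and> conj_fun G \<theta> t = \<theta>"
  by (simp add: inertia_def)

lemma T_subgroup: "subgroup T G"
proof
  fix t assume "t \<in> T"
  then show "inv t \<in> T" using conj_fun_inverse(1)[OF theta, of t] by (auto simp: T_iff)
qed (auto simp: T_iff theta_self conj_fun_mult[symmetric])

lemma N_subset_T: "N \<subseteq> T"
  using class_fun_conj_N[OF N.IBr_class_fun[OF theta]] N_carrier by (auto simp: T_iff)

lemma T_carrier: "t \<in> T \<Longrightarrow> t \<in> carrier G"
  by (simp add: T_iff)

lemma lies_over_orb: "\<phi> \<in> IBr p red G \<Longrightarrow> lies_over p red G N \<mu> \<phi> \<Longrightarrow> \<phi> \<in> over \<longleftrightarrow> \<mu> \<in> orb"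
proof
  assume p: "\<phi> \<in> IBr p red G" and l: "lies_over p red G N \<mu> \<phi>" and "\<mu> \<in> orb"
  then obtain g where g: "g \<in> carrier G" "\<mu> = conj_fun G \<theta> g" by auto
  have "lies_over p red G N (conj_fun G \<mu> (inv g)) \<phi>" by (rule lies_over_conj[OF p l]) (use g in simp)
  then show "\<phi> \<in> over" using g conj_fun_inverse(1)[OF theta g(1)] p by (simp add: over_def)
qed (use lies_over_conjugate in \<open>auto simp: over_def\<close>)

text \<open>Expanding \<open>f\<close> in Brauer characters over \<theta>, one of them has a nonzero
  coefficient at \<psi>; it lies over the restriction of \<psi>, which by Clifford's theorem is then
  conjugate to \<theta>.\<close>

lemma over_span_coef:
  assumes f: "over_span f" and y: "regular y" "\<psi> \<in> IBr p red (EG y)" and nz: "coset_coef y \<psi> f \<noteq> 0"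
  shows "res N \<psi> \<in> orb"
proof -
  have cf: "class_fun p G f" using f by (simp add: over_span_def)
  have "coset_coef y \<psi> (\<lambda>y. \<Sum>\<phi>\<in>IBr p red G. ibr_coef p red G f \<phi> * \<phi> y) = (\<Sum>\<phi>\<in>IBr p red G. ibr_coef p red G f \<phi> * coset_coef y \<psi> \<phi>)"
    by (rule coset_coef_lincomb[OF y finite_IBr IBr_class_fun])
  then have "coset_coef y \<psi> f = (\<Sum>\<phi>\<in>IBr p red G. ibr_coef p red G f \<phi> * coset_coef y \<psi> \<phi>)"
    by (simp flip: ibr_coef_expand[OF cf])
  then obtain \<phi> where \<phi>: "\<phi> \<in> IBr p red G" "ibr_coef p red G f \<phi> * coset_coef y \<psi> \<phi> \<noteq> 0"
    using nz by (metis (no_types, lifting) sum.neutral)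
  then have "\<phi> \<in> over" using f by (auto simp: over_span_def)
  moreover have "lies_over p red G N (res N \<psi>) \<phi>" by (rule coset_coef_nonzero_lies_over[OF y \<phi>(1)]) (use \<phi>(2) in simp)
  ultimately show ?thesis using lies_over_orb \<phi>(1) by blast
qed

text \<open>Split \<open>f\<close> into its part \<open>f1\<close> in the span of
  \<open>over\<close> and the rest \<open>f2\<close>. The coefficients of \<open>f\<close> and
  \<open>f1\<close> are supported at characters above the orbit of \<theta>, those of
  \<open>f2\<close> at characters above other orbits. So all coefficients of \<open>f2\<close>
  vanish, and with them \<open>f2\<close>.\<close>

lemma over_spanI:
  assumes f: "class_fun p G f"
    and z: "\<And>y \<psi>. regular y \<Longrightarrow> \<psi> \<in> IBr p red (EG y) \<Longrightarrow> coset_coef y \<psi> f \<noteq> 0 \<Longrightarrow> res N \<psi> \<in> orb"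
  shows "over_span f"
proof -
  let ?a = "ibr_coef p red G f"
  let ?B = "IBr p red G - over"
  define f2 where "f2 = (\<lambda>y. \<Sum>\<phi>\<in>?B. ?a \<phi> * \<phi> y)"
  define f1 where "f1 = (\<lambda>y. \<Sum>\<phi>\<in>over. ?a \<phi> * \<phi> y)"
  have B: "finite ?B" "?B \<subseteq> IBr p red G" using finite_IBr by auto
  have c2: "class_fun p G f2" unfolding f2_def by (rule class_fun_lincomb) (use B in auto)
  have c1: "class_fun p G f1" unfolding f1_def by (rule class_fun_lincomb) (use over_IBr in auto)
  have f12: "f = (\<lambda>y. f1 y + f2 y)"
  proof
    fix y
    have "f y = (\<Sum>\<phi>\<in>IBr p red G. ?a \<phi> * \<phi> y)" by (rule ibr_coef_expand[OF f])
    then show "f y = f1 y + f2 y"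
      using sum.subset_diff[OF over_IBr(1) finite_IBr, of "\<lambda>\<phi>. ?a \<phi> * \<phi> y"] by (simp add: f1_def f2_def)
  qed
  have "f2 y = 0" for y
  proof (rule coset_coefs_zero[OF c2], rule ccontr)
    fix y \<psi> assume y: "regular y" "\<psi> \<in> IBr p red (EG y)" and nz: "coset_coef y \<psi> f2 \<noteq> 0"
    have "coset_coef y \<psi> f2 = (\<Sum>\<phi>\<in>?B. ?a \<phi> * coset_coef y \<psi> \<phi>)"
      unfolding f2_def by (rule coset_coef_lincomb[OF y B(1) IBr_class_fun]) (use B in auto)
    then obtain \<phi> where \<phi>: "\<phi> \<in> ?B" "?a \<phi> * coset_coef y \<psi> \<phi> \<noteq> 0"
      using nz by (metis (no_types, lifting) sum.neutral)
    have "lies_over p red G N (res N \<psi>) \<phi>" by (rule coset_coef_nonzero_lies_over[OF y]) (use \<phi> in auto)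
    then have no: "res N \<psi> \<notin> orb" using lies_over_orb \<phi>(1) by blast
    have "over_span f1" unfolding over_span_def
    proof (intro conjI ballI c1)
      fix \<phi> assume "\<phi> \<in> ?B"
      then show "ibr_coef p red G f1 \<phi> = 0" unfolding f1_def using ibr_coef_lincomb[OF over_IBr(1)] by auto
    qed
    then have "coset_coef y \<psi> f1 = 0" using over_span_coef[OF _ y] no by blast
    then have "coset_coef y \<psi> f = coset_coef y \<psi> f2"
      unfolding f12 using coset_coef_add[OF y(1) c1 c2 y(2)] by simp
    then show False using z[OF y] nz no by simp
  qed
  then have "f2 = (\<lambda>y. 0)" by blast
  then have "?a \<phi> = 0" if "\<phi> \<in> ?B" for \<phi>
    using ibr_coef_lincomb[OF B(2), of \<phi> ?a] ibr_coef_zero[of \<phi>] that B(2) by (auto simp: f2_def)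
  then show ?thesis using f by (simp add: over_span_def)
qed

section \<open>Classes of the inertia quotient and good cosets\<close>

lemma normal_T: "normal N (G\<lparr>carrier := T\<rparr>)"
  by (rule normal_restrict_supergroup[OF T_subgroup normal_axioms N_subset_T])

lemma Q_carrier: "carrier Q = {N #> t | t. t \<in> T}"
  by (auto simp: inertia_quot_def FactGroup_def RCOSETS_def r_coset_def)

lemma Q_conj:
  assumes "t \<in> T" "x \<in> T"
  shows "(N #> t) \<otimes>\<^bsub>Q\<^esub> (N #> x) \<otimes>\<^bsub>Q\<^esub> inv\<^bsub>Q\<^esub> (N #> t) = N #> (t \<otimes> x \<otimes> inv t)"
proof -
  interpret TN: normal N "G\<lparr>carrier := T\<rparr>" by (rule normal_T)
  have m: "a \<otimes>\<^bsub>Q\<^esub> b = a <#> b" for a b by (simp add: inertia_quot_def FactGroup_def set_mult_def)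
  have "N #> t \<in> carrier Q" using assms Q_carrier by auto
  then have "inv\<^bsub>Q\<^esub> (N #> t) = set_inv\<^bsub>G\<lparr>carrier := T\<rparr>\<^esub> (N #> t)"
    unfolding inertia_quot_def by (rule TN.inv_FactGroup)
  also have "\<dots> = N #> inv t"
    using TN.rcos_inv[of t] assms m_inv_consistent[OF T_subgroup assms(1)] by (simp add: r_coset_subgroup)
  finally show ?thesis using assms T_carrier by (simp add: m rcos_sum)
qed

lemma conj_class_coset:
  assumes x: "x \<in> T"
  shows "conj_class Q (N #> x) = {N #> (t \<otimes> x \<otimes> inv t) | t. t \<in> T}"
proof -
  have "N #> x \<in> carrier Q" using x Q_carrier by auto
  then have "conj_class Q (N #> x) = {C \<otimes>\<^bsub>Q\<^esub> (N #> x) \<otimes>\<^bsub>Q\<^esub> inv\<^bsub>Q\<^esub> C | C. C \<in> carrier Q}"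
    by (simp add: conj_class_def orbit_def)
  also have "\<dots> = {N #> (t \<otimes> x \<otimes> inv t) | t. t \<in> T}"
    unfolding Q_carrier using Q_conj[OF _ x] by force
  finally show ?thesis .
qed

lemma conj_class_eq_iff:
  assumes x: "x \<in> T" and y: "y \<in> T"
  shows "conj_class Q (N #> x) = conj_class Q (N #> y) \<longleftrightarrow> (\<exists>t\<in>T. N #> (t \<otimes> y \<otimes> inv t) = N #> x)"
proof
  assume "conj_class Q (N #> x) = conj_class Q (N #> y)"
  moreover have "N #> x \<in> conj_class Q (N #> x)"
    unfolding conj_class_coset[OF x] using subgroup.one_closed[OF T_subgroup] T_carrier[OF x] by (force intro: exI[of _ \<one>])
  ultimately show "\<exists>t\<in>T. N #> (t \<otimes> y \<otimes> inv t) = N #> x" using conj_class_coset[OF y] by force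
next
  have sub: "conj_class Q (N #> x) \<subseteq> conj_class Q (N #> y)" if x: "x \<in> T" and y: "y \<in> T" and t: "t \<in> T" "N #> (t \<otimes> y \<otimes> inv t) = N #> x" for x y t
  proof
    fix C assume "C \<in> conj_class Q (N #> x)"
    then obtain s where s: "s \<in> T" "C = N #> (s \<otimes> x \<otimes> inv s)" using conj_class_coset[OF x] by auto
    note c = T_carrier[OF x] T_carrier[OF y] T_carrier[OF t(1)] T_carrier[OF s(1)]
    have "C = N #> (s \<otimes> (t \<otimes> y \<otimes> inv t) \<otimes> inv s)" unfolding s(2) by (rule coset_conj_cong) (use c t in auto)
    also have "s \<otimes> (t \<otimes> y \<otimes> inv t) \<otimes> inv s = (s \<otimes> t) \<otimes> y \<otimes> inv (s \<otimes> t)" using c by (simp add: m_assoc inv_mult_group)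
    finally show "C \<in> conj_class Q (N #> y)" using conj_class_coset[OF y] subgroup.m_closed[OF T_subgroup s(1) t(1)] by blast
  qed
  assume "\<exists>t\<in>T. N #> (t \<otimes> y \<otimes> inv t) = N #> x"
  then obtain t where t: "t \<in> T" "N #> (t \<otimes> y \<otimes> inv t) = N #> x" by blast
  note c = T_carrier[OF x] T_carrier[OF y] T_carrier[OF t(1)]
  have "N #> (inv t \<otimes> x \<otimes> inv (inv t)) = N #> (inv t \<otimes> (t \<otimes> y \<otimes> inv t) \<otimes> inv (inv t))"
    by (rule coset_conj_cong) (use c t in auto)
  then have "N #> (inv t \<otimes> x \<otimes> inv (inv t)) = N #> y" using c by (simp add: conj_cancel)
  then show "conj_class Q (N #> x) = conj_class Q (N #> y)"
    using sub[OF x y t] sub[OF y x subgroup.m_inv_closed[OF T_subgroup t(1)]] by blast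
qed

lemma regular_Q:
  assumes x: "x \<in> T" "regular x"
  shows "p_regular Q p (N #> x)"
proof -
  interpret TN: normal N "G\<lparr>carrier := T\<rparr>" by (rule normal_T)
  have gr: "group Q" unfolding inertia_quot_def by (rule TN.factorgroup_is_group)
  obtain n :: nat where n: "coprime n p" "x [^] n = \<one>" using x(2) p_regular_iff by blast
  have c: "N #> x \<in> carrier Q" using x Q_carrier by auto
  have "(N #> x) [^]\<^bsub>Q\<^esub> n = N #> x [^] n"
    using TN.FactGroup_pow[of x n] x by (simp add: inertia_quot_def r_coset_subgroup nat_pow_def)
  also have "\<dots> = \<one>\<^bsub>Q\<^esub>" using n(2) subset by (simp add: inertia_quot_def FactGroup_def)
  finally show ?thesis using group.p_regular_iff[OF gr] n(1) c by blast
qed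

lemma ext_iff: "\<psi> \<in> ext x \<longleftrightarrow> \<psi> \<in> IBr p red (EG x) \<and> res N \<psi> = \<theta>"
  by (simp add: extensions_def ext_group_def)

lemma IBr_ext_group_conj_self:
  assumes x: "regular x" and \<psi>: "\<psi> \<in> IBr p red (EG x)"
  shows "conj_fun G \<psi> x = \<psi>"
proof -
  note xc = regular_carrier[OF x]
  note H = ext_group_subgroup[OF xc]
  interpret C: cyclic_extension "EG x" p red N x by (rule cyclic_extension_ext_group[OF x])
  have xH: "x \<in> ext_group x" using C.x_carrier by simp
  have i: "inv\<^bsub>EG x\<^esub> x = inv x" by (rule m_inv_consistent[OF H xH])
  have iff: "x \<otimes> y \<otimes> inv x \<in> ext_group x \<longleftrightarrow> y \<in> ext_group x" if "y \<in> carrier G" for y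
    using ext_group_conj[OF xc xc xc _ that] xc by (simp add: m_assoc)
  show ?thesis
  proof
    fix y
    show "conj_fun G \<psi> x y = \<psi> y"
    proof (cases "y \<in> ext_group x")
      case True
      have "conj_fun (EG x) \<psi> x y = \<psi> y" using C.class_fun_conj_fun[OF C.IBr_class_fun[OF \<psi>] C.x_carrier] by simp
      then show ?thesis using True subgroup.mem_carrier[OF H True] by (simp add: conj_fun_def i)
    next
      case False
      then show ?thesis using IBr_subgroup_zero[OF H \<psi>] iff[of y] by (simp add: conj_fun_def)
    qed
  qed
qed

text \<open>A Brauer character of N\<langle>x\<rangle> is fixed under conjugation by
  \<open>x\<close>, and so is its restriction \<theta>.\<close>

lemma ext_in_T:
  assumes x: "regular x" and \<psi>: "\<psi> \<in> ext x"
  shows "x \<in> T"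
  using IBr_ext_group_conj_self[OF x, of \<psi>] res_conj_fun[OF regular_carrier[OF x], of \<psi>] \<psi> regular_carrier[OF x]
  by (auto simp: ext_iff T_iff)

lemma ext_conj:
  assumes t: "t \<in> T" and x: "regular x" and y: "regular y" and e: "N #> (t \<otimes> y \<otimes> inv t) = N #> x" and \<psi>: "\<psi> \<in> ext x"
  shows "conj_fun G \<psi> t \<in> ext y"
  using coset_coef_conj(1)[OF T_carrier[OF t] x y e] res_conj_fun[OF T_carrier[OF t], of \<psi>] \<psi> t
  by (auto simp: ext_iff T_iff)

text \<open>Conjugating by \<open>t\<close> and then twisting takes one extension to the other.
  Hence the vanishing of a coefficient, and the quotient of the coefficients of two functions,
  depend only on the class in the inertia quotient.\<close>

lemma coset_coef_proportional:
  assumes t: "t \<in> T" and x: "regular x" "\<psi> \<in> ext x" and y: "regular y" "\<psi>' \<in> ext y" and e: "N #> (t \<otimes> y \<otimes> inv t) = N #> x"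
  obtains c where "c \<noteq> 0" "\<And>f. class_fun p G f \<Longrightarrow> coset_coef y \<psi>' f = c * coset_coef x \<psi> f"
proof -
  have \<psi>: "\<psi> \<in> IBr p red (EG x)" and \<psi>': "\<psi>' \<in> IBr p red (EG y)" "res N \<psi>' = \<theta>" using x y by (auto simp: ext_iff)
  have ct: "conj_fun G \<psi> t \<in> IBr p red (EG y)" "res N (conj_fun G \<psi> t) = \<theta>"
    using ext_conj[OF t x(1) y(1) e x(2)] by (auto simp: ext_iff)
  have "res N \<psi>' = res N (conj_fun G \<psi> t)" "res N \<psi>' \<in> IBr p red GN" using ct \<psi>' theta by auto
  from coset_coef_twist[OF y(1) \<psi>'(1) ct(1) this] obtain c where c: "c \<noteq> 0"
    "\<And>f. class_fun p G f \<Longrightarrow> coset_coef y \<psi>' f = c * coset_coef y (conj_fun G \<psi> t) f" by metis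
  show thesis
    by (rule that[OF c(1)]) (use c(2) coset_coef_conj(2)[OF T_carrier[OF t] x(1) y(1) e \<psi>] in auto)
qed

text \<open>Conjugating the commutator first by \<open>c\<close> and then by \<open>x\<close> yields
  \<open>c \<otimes> x \<otimes> inv c \<otimes> inv x\<close>, and \<open>N\<close> is
  normal.\<close>

lemma centralizer_iff:
  assumes x: "x \<in> carrier G"
  shows "c \<in> coset_centralizer G N \<theta> x \<longleftrightarrow> c \<in> T \<and> N #> (c \<otimes> x \<otimes> inv c) = N #> x"
proof (cases "c \<in> T")
  case True
  then have c: "c \<in> carrier G" by (rule T_carrier)
  have "inv c \<otimes> inv x \<otimes> c \<otimes> x \<in> N \<longleftrightarrow> c \<otimes> (inv c \<otimes> inv x \<otimes> c \<otimes> x) \<otimes> inv c \<in> N"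
    using N_conj_iff[OF c] c x by simp
  also have "c \<otimes> (inv c \<otimes> inv x \<otimes> c \<otimes> x) \<otimes> inv c = inv x \<otimes> (c \<otimes> x \<otimes> inv c)"
    using c x by (simp add: m_assoc mult_inv_cancel)
  also have "inv x \<otimes> (c \<otimes> x \<otimes> inv c) \<in> N \<longleftrightarrow> x \<otimes> (inv x \<otimes> (c \<otimes> x \<otimes> inv c)) \<otimes> inv x \<in> N"
    using N_conj_iff[OF x] c x by simp
  also have "x \<otimes> (inv x \<otimes> (c \<otimes> x \<otimes> inv c)) \<otimes> inv x = c \<otimes> x \<otimes> inv c \<otimes> inv x"
    using c x by (simp add: mult_inv_cancel)
  also have "\<dots> \<in> N \<longleftrightarrow> N #> (c \<otimes> x \<otimes> inv c) = N #> x"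
    using coset_eq_iff[of "c \<otimes> x \<otimes> inv c" x] rcos_module[OF is_group x, of "c \<otimes> x \<otimes> inv c"] c x by simp
  finally show ?thesis using True by (simp add: coset_centralizer_def)
qed (simp add: coset_centralizer_def)

text \<open>For \<open>c\<close> centralizing the coset, the conjugate of \<psi> by \<open>c\<close>
  is another extension to the same group. Its coefficient is a multiple of that of \<psi>, because
  it is a twist, and equal to it, because it is a conjugate. The coefficient being nonzero, the
  factor is 1 and the two extensions coincide.\<close>

lemma nonzero_imp_good:
  assumes x: "regular x" "\<psi> \<in> ext x" and f: "class_fun p G f" and nz: "coset_coef x \<psi> f \<noteq> 0"
  shows "coset_rep p G N \<theta> (N #> x) x" "\<And>c. c \<in> coset_centralizer G N \<theta> x \<Longrightarrow> conj_fun G \<psi> c = \<psi>"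
    "theta_good p red G N \<theta> (N #> x)"
proof -
  show r: "coset_rep p G N \<theta> (N #> x) x" using ext_in_T[OF x] x(1) by (simp add: coset_rep_def)
  show c: "conj_fun G \<psi> c = \<psi>" if "c \<in> coset_centralizer G N \<theta> x" for c
  proof -
    have ct: "c \<in> T" "N #> (c \<otimes> x \<otimes> inv c) = N #> x" using that centralizer_iff[OF regular_carrier[OF x(1)]] by auto
    have \<psi>: "\<psi> \<in> IBr p red (EG x)" "res N \<psi> = \<theta>" using x by (auto simp: ext_iff)
    have c': "conj_fun G \<psi> c \<in> IBr p red (EG x)" "res N (conj_fun G \<psi> c) = \<theta>"
      using ext_conj[OF ct(1) x(1) x(1) ct(2) x(2)] by (auto simp: ext_iff)
    have "res N (conj_fun G \<psi> c) = res N \<psi>" "res N (conj_fun G \<psi> c) \<in> IBr p red GN" using \<psi>(2) c'(2) theta by auto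
    from coset_coef_twist[OF x(1) c'(1) \<psi>(1) this] obtain k where k: "conj_fun G \<psi> c = \<psi> \<longleftrightarrow> k = 1"
      "\<And>f. class_fun p G f \<Longrightarrow> coset_coef x (conj_fun G \<psi> c) f = k * coset_coef x \<psi> f" by metis
    have "coset_coef x (conj_fun G \<psi> c) f = coset_coef x \<psi> f"
      by (rule coset_coef_conj(2)[OF T_carrier[OF ct(1)] x(1) x(1) ct(2) \<psi>(1) f])
    then show ?thesis using k(1) k(2)[OF f] nz by simp
  qed
  show "theta_good p red G N \<theta> (N #> x)" unfolding theta_good_def using r x(2) c by blast
qed

lemma conj_regular_ext:
  assumes t: "t \<in> T" and x: "regular x" "\<psi> \<in> ext x"
  obtains y \<psi>' where "y = t \<otimes> x \<otimes> inv t" "regular y" "\<psi>' \<in> ext y" "N #> (t \<otimes> x \<otimes> inv t) = N #> y"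
proof -
  note xc = regular_carrier[OF x(1)] and tc = T_carrier[OF t]
  let ?y = "t \<otimes> x \<otimes> inv t"
  have y: "regular ?y" using regular_conj[OF tc xc] x(1) by simp
  have ti: "inv t \<in> T" by (rule subgroup.m_inv_closed[OF T_subgroup t])
  have "inv t \<otimes> ?y \<otimes> inv (inv t) = x" using conj_cancel(1)[OF tc xc] tc by simp
  then have "conj_fun G \<psi> (inv t) \<in> ext ?y" by (intro ext_conj[OF ti x(1) y _ x(2)]) simp
  then show thesis using that y by blast
qed

lemma nonzero_imp_good_class:
  assumes x: "regular x" "\<psi> \<in> ext x" and f: "class_fun p G f" and nz: "coset_coef x \<psi> f \<noteq> 0"
  shows "conj_class Q (N #> x) \<in> good_classes p red G N \<theta>"
proof -
  have xT: "x \<in> T" by (rule ext_in_T[OF x])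
  have "p_regular Q p C \<and> theta_good p red G N \<theta> C" if C: "C \<in> conj_class Q (N #> x)" for C
  proof -
    obtain t where t: "t \<in> T" "C = N #> (t \<otimes> x \<otimes> inv t)" using C unfolding conj_class_coset[OF xT] by blast
    obtain y \<psi>' where y: "y = t \<otimes> x \<otimes> inv t" "regular y" "\<psi>' \<in> ext y" "N #> (t \<otimes> x \<otimes> inv t) = N #> y"
      using conj_regular_ext[OF t(1) x] by metis
    obtain c where "c \<noteq> 0" "coset_coef x \<psi> f = c * coset_coef y \<psi>' f"
      using coset_coef_proportional[OF t(1) y(2,3) x y(4)] f by metis
    then have "coset_coef y \<psi>' f \<noteq> 0" using nz by auto
    then show ?thesis using nonzero_imp_good(3)[OF y(2,3) f] regular_Q[of y] ext_in_T[OF y(2,3)] y(2,4) t(2) by simp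
  qed
  moreover have "N #> x \<in> carrier Q" using xT Q_carrier by auto
  ultimately show ?thesis by (auto simp: good_classes_def)
qed

text \<open>The dual function of the overview: the cut character induced from N\<langle>x\<rangle>
  to \<open>G\<close>, without the usual division by the order of N\<langle>x\<rangle>, as the dual
  basis is taken up to scalars.\<close>

definition induced :: "'a \<Rightarrow> ('a \<Rightarrow> complex) \<Rightarrow> 'a \<Rightarrow> complex" where
  "induced x \<psi> y = (\<Sum>g\<in>carrier G. conj_fun G (coset_cut G N x \<psi>) g y)"

lemma induced_class_fun:
  assumes x: "regular x" "\<psi> \<in> IBr p red (EG x)"
  shows "class_fun p G (induced x \<psi>)"
  unfolding class_fun_def
proof (intro conjI allI impI)
  note H = ext_group_subgroup[OF regular_carrier[OF x(1)]]
  interpret H: finite_modular_group "EG x" p red by (rule subgroup_modular[OF H])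
  have z: "\<psi> y = 0" if "\<not> regular y" for y
    using H.IBr_class_fun[OF x(2)] that by (simp add: class_fun_def p_regular_subgroup[OF H])
  fix y assume "\<not> regular y"
  then show "induced x \<psi> y = 0" unfolding induced_def
    using z regular_conj[of _ y] by (intro sum.neutral) (auto simp: conj_fun_def coset_cut_def)
next
  fix y h assume "regular y" and h: "h \<in> carrier G"
  then have y: "y \<in> carrier G" using regular_carrier by blast
  have "induced x \<psi> (h \<otimes> y \<otimes> inv h) = (\<Sum>g\<in>carrier G. conj_fun G (coset_cut G N x \<psi>) (g \<otimes> h) y)"
    unfolding induced_def using h y by (intro sum.cong refl) (simp add: conj_fun_def inv_mult_group m_assoc)
  also have "\<dots> = induced x \<psi> y"
    unfolding induced_def
    by (rule sum.reindex_bij_witness[where i = "\<lambda>g. g \<otimes> inv h" and j = "\<lambda>g. g \<otimes> h"]) (use h in \<open>auto simp: m_assoc\<close>)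
  finally show "induced x \<psi> (h \<otimes> y \<otimes> inv h) = induced x \<psi> y" .
qed

text \<open>Cut to the coset of \<open>y\<close>, the summand at \<open>g\<close> survives only if
  conjugation by \<open>g\<close> carries this coset to that of \<open>x\<close>.\<close>

lemma coset_coef_induced:
  assumes x: "regular x" "\<psi> \<in> IBr p red (EG x)" and y: "regular y" "\<psi>' \<in> IBr p red (EG y)"
  shows "coset_coef y \<psi>' (induced x \<psi>) =
    (\<Sum>g\<in>{g \<in> carrier G. N #> (g \<otimes> y \<otimes> inv g) = N #> x}. coset_coef y \<psi>' (conj_fun G \<psi> g))"
proof -
  note xc = regular_carrier[OF x(1)] and yc = regular_carrier[OF y(1)]
  interpret C: cyclic_extension "EG y" p red N y by (rule cyclic_extension_ext_group[OF y(1)])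
  let ?S = "{g \<in> carrier G. N #> (g \<otimes> y \<otimes> inv g) = N #> x}"
  have "coset_cut G N y (induced x \<psi>) z = (\<Sum>g\<in>?S. coset_cut G N y (conj_fun G \<psi> g) z)" for z
  proof (cases "z \<in> N #> y")
    case True
    then have zc: "z \<in> carrier G" using coset_subset_ext_group[OF yc] subgroup.mem_carrier[OF ext_group_subgroup[OF yc]] by blast
    have e: "g \<otimes> z \<otimes> inv g \<in> N #> x \<longleftrightarrow> N #> (g \<otimes> y \<otimes> inv g) = N #> x" if g: "g \<in> carrier G" for g
    proof -
      have "N #> z = N #> y" using coset_eq_iff[OF zc yc] True by simp
      then have "N #> (g \<otimes> z \<otimes> inv g) = N #> (g \<otimes> y \<otimes> inv g)" by (rule coset_conj_cong[OF g zc yc])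
      then show ?thesis using coset_eq_iff[of "g \<otimes> z \<otimes> inv g" x] g zc xc by simp
    qed
    have "coset_cut G N y (induced x \<psi>) z = (\<Sum>g\<in>carrier G. if g \<in> ?S then coset_cut G N y (conj_fun G \<psi> g) z else 0)"
      unfolding coset_cut_def[of G N y] induced_def using True zc e
      by (auto simp: conj_fun_def coset_cut_def intro!: sum.cong)
    also have "\<dots> = (\<Sum>g\<in>?S. coset_cut G N y (conj_fun G \<psi> g) z)"
      by (rule sum.mono_neutral_cong_right) (use fin in auto)
    finally show ?thesis .
  qed (simp add: coset_cut_def)
  then have s: "coset_cut G N y (induced x \<psi>) = (\<lambda>z. \<Sum>g\<in>?S. coset_cut G N y (conj_fun G \<psi> g) z)" by blast
  have cf: "class_fun p (EG y) (coset_cut G N y (conj_fun G \<psi> g))" if "g \<in> ?S" for g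
    using C.cut_class_fun[OF C.IBr_class_fun] coset_coef_conj(1)[OF _ x(1) y(1) _ x(2), of g] that
    by (simp add: coset_cut_subgroup)
  show ?thesis unfolding coset_coef_def s
    by (rule C.ibr_coef_sum[OF _ cf y(2)]) (use fin in auto)
qed

lemma coset_coef_IBr_nonzero:
  assumes "regular y" "\<psi> \<in> IBr p red (EG y)" "\<psi>' \<in> IBr p red (EG y)" "coset_coef y \<psi>' \<psi> \<noteq> 0"
  shows "res N \<psi>' = res N \<psi>"
proof -
  interpret C: cyclic_extension "EG y" p red N y by (rule cyclic_extension_ext_group[OF assms(1)])
  obtain \<omega> where "\<omega> ^ C.ext_order = 1" "\<psi>' = C.twist \<omega> \<psi>"
    using C.cut_coef_nonzero[OF assms(2,3)] assms(4) unfolding coset_coef_def coset_cut_subgroup by metis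
  then show ?thesis using C.res_twist[of \<omega> \<psi>] by simp
qed

lemma coset_coef_induced_nonzero:
  assumes x: "regular x" "\<psi> \<in> ext x" and y: "regular y" "\<psi>' \<in> IBr p red (EG y)"
    and nz: "coset_coef y \<psi>' (induced x \<psi>) \<noteq> 0"
  obtains g where "g \<in> carrier G" "N #> (g \<otimes> y \<otimes> inv g) = N #> x" "res N \<psi>' = conj_fun G \<theta> g"
proof -
  have \<psi>: "\<psi> \<in> IBr p red (EG x)" "res N \<psi> = \<theta>" using x by (auto simp: ext_iff)
  obtain g where g: "g \<in> carrier G" "N #> (g \<otimes> y \<otimes> inv g) = N #> x" "coset_coef y \<psi>' (conj_fun G \<psi> g) \<noteq> 0"
    using nz unfolding coset_coef_induced[OF x(1) \<psi>(1) y]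
    by (elim sum.not_neutral_contains_not_neutral) blast
  have "res N \<psi>' = res N (conj_fun G \<psi> g)"
    by (rule coset_coef_IBr_nonzero[OF y(1) coset_coef_conj(1)[OF g(1) x(1) y(1) g(2) \<psi>(1)] y(2) g(3)])
  then show thesis using that g(1,2) res_conj_fun[OF g(1), of \<psi>] \<psi>(2) by simp
qed

lemma induced_over_span:
  assumes x: "regular x" "\<psi> \<in> ext x"
  shows "over_span (induced x \<psi>)"
proof (rule over_spanI)
  show "class_fun p G (induced x \<psi>)" using induced_class_fun x by (auto simp: ext_iff)
  show "res N \<psi>' \<in> orb" if "regular y" "\<psi>' \<in> IBr p red (EG y)" "coset_coef y \<psi>' (induced x \<psi>) \<noteq> 0" for y \<psi>'
    using coset_coef_induced_nonzero[OF x that] by blast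
qed

text \<open>Elements of the inertia group that fix the coset all contribute the same positive
  number, since they fix \<psi> by hypothesis; other elements contribute zero, since they move
  \<theta>. The identity is of the first kind, so the sum is positive.\<close>

lemma coset_coef_induced_self:
  assumes x: "regular x" "\<psi> \<in> ext x" and good: "\<And>c. c \<in> coset_centralizer G N \<theta> x \<Longrightarrow> conj_fun G \<psi> c = \<psi>"
  shows "coset_coef x \<psi> (induced x \<psi>) \<noteq> 0"
proof -
  note xc = regular_carrier[OF x(1)]
  interpret C: cyclic_extension "EG x" p red N x by (rule cyclic_extension_ext_group[OF x(1)])
  have \<psi>: "\<psi> \<in> IBr p red (EG x)" "res N \<psi> = \<theta>" using x by (auto simp: ext_iff)
  let ?S = "{g \<in> carrier G. N #> (g \<otimes> x \<otimes> inv g) = N #> x}"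
  have "coset_coef x \<psi> (conj_fun G \<psi> g) = (if g \<in> T then 1 / of_nat C.ext_order else 0)" if g: "g \<in> ?S" for g
  proof (cases "g \<in> T")
    case True
    then have "conj_fun G \<psi> g = \<psi>" using good centralizer_iff[OF xc] g by simp
    moreover have "coset_coef x \<psi> \<psi> = 1 / of_nat C.ext_order"
      unfolding coset_coef_def using C.cut_coef_self[OF \<psi>(1)] \<psi>(2) theta by (simp add: coset_cut_subgroup)
    ultimately show ?thesis using True by simp
  next
    case False
    have "coset_coef x \<psi> (conj_fun G \<psi> g) = 0"
    proof (rule ccontr)
      assume "coset_coef x \<psi> (conj_fun G \<psi> g) \<noteq> 0"
      then have "res N \<psi> = res N (conj_fun G \<psi> g)"
        using coset_coef_IBr_nonzero[OF x(1) coset_coef_conj(1)[OF _ x(1) x(1) _ \<psi>(1)] \<psi>(1)] g by blast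
      then have "conj_fun G \<theta> g = \<theta>" using res_conj_fun[of g \<psi>] \<psi>(2) g by simp
      then show False using False g T_iff by blast
    qed
    then show ?thesis using False by simp
  qed
  then have "coset_coef x \<psi> (induced x \<psi>) = (\<Sum>g\<in>?S. if g \<in> T then 1 / of_nat C.ext_order else 0)"
    unfolding coset_coef_induced[OF x(1) \<psi>(1) x(1) \<psi>(1)] by (intro sum.cong) auto
  also have "\<dots> = of_nat (card (?S \<inter> T)) / of_nat C.ext_order"
    using fin by (simp add: sum.If_cases Int_def)
  finally have s: "coset_coef x \<psi> (induced x \<psi>) = of_nat (card (?S \<inter> T)) / of_nat C.ext_order" .
  have "\<one> \<in> ?S \<inter> T" using xc subgroup.one_closed[OF T_subgroup] by simp
  moreover have "finite (?S \<inter> T)" using fin by auto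
  ultimately have "card (?S \<inter> T) > 0" unfolding card_gt_0_iff by blast
  then show ?thesis using s C.ext_order(1) by simp
qed

section \<open>The indicator as a diagonal coefficient of inversion\<close>

lemma cnj_ext:
  assumes x: "regular x" "\<psi> \<in> ext x"
  shows "cnj_fun \<psi> \<in> IBr p red (EG (inv x))" "res N (cnj_fun \<psi>) = cnj_fun \<theta>"
proof -
  interpret C: cyclic_extension "EG x" p red N x by (rule cyclic_extension_ext_group[OF x(1)])
  show "cnj_fun \<psi> \<in> IBr p red (EG (inv x))" using C.cnj_fun_IBr x ext_group_inv[OF x(1)] by (simp add: ext_iff)
  show "res N (cnj_fun \<psi>) = cnj_fun \<theta>" using x(2) res_cnj_fun[of \<psi>] by (simp add: ext_iff)
qed

lemma cnj_theta: "cnj_fun \<theta> \<in> IBr p red GN"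
  using conj_fun_IBr_N[OF theta e_carrier] e_conj by simp

lemma conj_inv_e: "conj_fun G (cnj_fun \<theta>) (inv e) = \<theta>" "conj_fun G \<theta> (inv e) = cnj_fun \<theta>"
proof -
  show 1: "conj_fun G (cnj_fun \<theta>) (inv e) = \<theta>" using conj_fun_inverse(1)[OF theta e_carrier] e_conj by simp
  have "cnj_fun (conj_fun G (cnj_fun \<theta>) (inv e)) = conj_fun G \<theta> (inv e)" by (simp add: cnj_conj_fun cnj_cnj_fun)
  then show "conj_fun G \<theta> (inv e) = cnj_fun \<theta>" using 1 by simp
qed

lemma conj_T_cnj: "t \<in> T \<Longrightarrow> conj_fun G (cnj_fun \<theta>) t = cnj_fun \<theta>"
  by (simp add: T_iff flip: cnj_conj_fun)

text \<open>The conjugate of \<psi> by \<epsilon> and the complex conjugate of \<psi> extend the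
  same character to the same group. So inversion multiplies the coefficient by a scalar
  \<open>c\<close> that is 1 exactly if the two extensions agree. Inverting twice is the identity,
  hence \<open>c * c = 1\<close>, and \<open>c\<close> is -1 if they differ.\<close>

lemma coset_coef_invert_sign:
  assumes x: "regular x" "\<psi> \<in> ext x" and \<epsilon>: "\<epsilon> \<in> carrier G" "conj_fun G \<theta> \<epsilon> = cnj_fun \<theta>"
    and e: "N #> (\<epsilon> \<otimes> x \<otimes> inv \<epsilon>) = N #> inv x" and f: "class_fun p G f" and nz: "coset_coef x \<psi> f \<noteq> 0"
  shows "coset_coef x \<psi> (invert_fun f) = (if conj_fun G \<psi> \<epsilon> = cnj_fun \<psi> then 1 else -1) * coset_coef x \<psi> f"
proof -
  note xc = regular_carrier[OF x(1)]
  have xi: "regular (inv x)" using x(1) xc by (simp add: p_regular_inv)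
  have \<psi>: "\<psi> \<in> IBr p red (EG x)" "res N \<psi> = \<theta>" using x by (auto simp: ext_iff)
  have "N #> inv (\<epsilon> \<otimes> x \<otimes> inv \<epsilon>) = N #> inv (inv x)" by (rule coset_inv_cong[OF _ _ e]) (use \<epsilon> xc in auto)
  then have e': "N #> (\<epsilon> \<otimes> inv x \<otimes> inv \<epsilon>) = N #> x" using \<epsilon> xc by (simp add: inv_mult_group m_assoc)
  note cj = coset_coef_conj[OF \<epsilon>(1) x(1) xi e' \<psi>(1)]
  have "res N (cnj_fun \<psi>) = res N (conj_fun G \<psi> \<epsilon>)" "res N (cnj_fun \<psi>) \<in> IBr p red GN"
    using cnj_ext[OF x] cnj_theta res_conj_fun[OF \<epsilon>(1), of \<psi>] \<psi>(2) \<epsilon>(2) by auto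
  from coset_coef_twist[OF xi cnj_ext(1)[OF x] cj(1) this] obtain c where c: "cnj_fun \<psi> = conj_fun G \<psi> \<epsilon> \<longleftrightarrow> c = 1"
    "\<And>f. class_fun p G f \<Longrightarrow> coset_coef (inv x) (cnj_fun \<psi>) f = c * coset_coef (inv x) (conj_fun G \<psi> \<epsilon>) f" by metis
  have inv: "coset_coef x \<psi> (invert_fun f) = c * coset_coef x \<psi> f" if f: "class_fun p G f" for f
    using c(2)[OF f] cj(2)[OF f] coset_coef_invert[OF x(1) \<psi>(1) f] by simp
  have "coset_coef x \<psi> f = c * (c * coset_coef x \<psi> f)"
    using inv[OF class_fun_invert[OF f]] inv[OF f] invert_invert[OF f] by simp
  then have "c * c = 1" using nz by simp
  then have "c = 1 \<or> c = -1" by (simp add: square_eq_1_iff)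
  then show ?thesis using inv[OF f] c(1) by auto
qed

lemma conj_e_T:
  assumes x: "x \<in> T"
  shows "e \<otimes> inv x \<otimes> inv e \<in> T"
proof -
  have xi: "inv x \<in> T" by (rule subgroup.m_inv_closed[OF T_subgroup x])
  have "conj_fun G \<theta> (e \<otimes> inv x \<otimes> inv e) = conj_fun G (conj_fun G (conj_fun G \<theta> e) (inv x)) (inv e)"
    using e_carrier T_carrier[OF x] by (simp add: conj_fun_mult)
  also have "\<dots> = \<theta>" unfolding e_conj conj_T_cnj[OF xi] by (rule conj_inv_e)
  finally show ?thesis using e_carrier T_carrier[OF x] by (simp add: T_iff)
qed

text \<open>By \<open>coset_coef_proportional\<close> the factor by which inversion multiplies the
  coefficient of the induced function may be computed at any representative and extension belonging
  to the class, in particular at those chosen in \<open>has_indicator\<close>.\<close>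

lemma has_indicator_coef:
  assumes x0: "regular x0" "\<psi>0 \<in> ext x0" and C: "C \<in> conj_class Q (N #> x0)"
    and nz: "coset_coef x0 \<psi>0 (induced x0 \<psi>0) \<noteq> 0" and s: "has_indicator p red G N \<theta> e C s"
  shows "s \<in> {1,0,-1}"
    and "coset_coef x0 \<psi>0 (invert_fun (induced x0 \<psi>0)) = of_int s * coset_coef x0 \<psi>0 (induced x0 \<psi>0)"
proof -
  let ?h = "induced x0 \<psi>0"
  let ?z = "\<lambda>x. e \<otimes> inv x \<otimes> inv e"
  obtain x \<psi> where x: "coset_rep p G N \<theta> C x" "\<psi> \<in> ext x" and
    s: "if conj_class Q (N #> x) = conj_class Q (N #> ?z x)
         then \<exists>\<epsilon>\<in>ext_inertia G \<theta>. conj_fun G \<theta> \<epsilon> = cnj_fun \<theta> \<and> N #> (\<epsilon> \<otimes> x \<otimes> inv \<epsilon>) = N #> inv x \<and>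
                s = (if conj_fun G \<psi> \<epsilon> = cnj_fun \<psi> then 1 else -1)
         else s = 0"
    using s unfolding has_indicator_def by (elim exE conjE)
  have xT: "x \<in> T" and xr: "regular x" and Cx: "C = N #> x" using x(1) by (auto simp: coset_rep_def)
  note x0T = ext_in_T[OF x0]
  have \<psi>: "\<psi> \<in> IBr p red (EG x)" using x by (auto simp: ext_iff)
  have h: "class_fun p G ?h" using induced_over_span[OF x0] by (simp add: over_span_def)
  obtain t where t: "t \<in> T" "N #> (t \<otimes> x0 \<otimes> inv t) = N #> x" using C Cx unfolding conj_class_coset[OF x0T] by auto
  obtain c where c: "c \<noteq> 0" "\<And>f. class_fun p G f \<Longrightarrow> coset_coef x0 \<psi>0 f = c * coset_coef x \<psi> f"
    using coset_coef_proportional[OF t(1) xr x(2) x0 t(2)] by metis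
  have nz': "coset_coef x \<psi> ?h \<noteq> 0" using nz c(2)[OF h] by auto
  have "s \<in> {1,0,-1} \<and> coset_coef x \<psi> (invert_fun ?h) = of_int s * coset_coef x \<psi> ?h"
  proof (cases "conj_class Q (N #> x) = conj_class Q (N #> ?z x)")
    case True
    then obtain \<epsilon> where "\<epsilon> \<in> ext_inertia G \<theta>" "conj_fun G \<theta> \<epsilon> = cnj_fun \<theta>" "N #> (\<epsilon> \<otimes> x \<otimes> inv \<epsilon>) = N #> inv x"
      "s = (if conj_fun G \<psi> \<epsilon> = cnj_fun \<psi> then 1 else -1)" using s by auto
    then show ?thesis using coset_coef_invert_sign[OF xr x(2) _ _ _ h nz', of \<epsilon>] by (auto simp: ext_inertia_def)
  next
    case False
    have xi: "regular (inv x)" using xr regular_carrier[OF xr] by (simp add: p_regular_inv)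
    have "coset_coef (inv x) (cnj_fun \<psi>) ?h = 0"
    proof (rule ccontr)
      assume nz2: "coset_coef (inv x) (cnj_fun \<psi>) ?h \<noteq> 0"
      obtain g where g: "g \<in> carrier G" "N #> (g \<otimes> inv x \<otimes> inv g) = N #> x0" "res N (cnj_fun \<psi>) = conj_fun G \<theta> g"
        using coset_coef_induced_nonzero[OF x0 xi cnj_ext(1)[OF xr x(2)] nz2] .
      \<comment> \<open>\<open>g\<close> carries the coset of \<open>inv x\<close> to that of
        \<open>x0\<close> and \<theta> to its complex conjugate. Correcting it by
        \<open>inv e\<close> gives an element of the inertia group that puts \<open>?z x\<close>
        into the class of \<open>x0\<close>, contrary to the case assumption.\<close>
      let ?t = "g \<otimes> inv e"
      note cc = g(1) e_carrier regular_carrier[OF xr]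
      have "conj_fun G \<theta> ?t = conj_fun G (conj_fun G \<theta> g) (inv e)" using cc by (simp add: conj_fun_mult)
      also have "\<dots> = \<theta>" using g(3) cnj_ext(2)[OF xr x(2)] conj_inv_e(1) by simp
      finally have tT: "?t \<in> T" using cc by (simp add: T_iff)
      have "?t \<otimes> ?z x \<otimes> inv ?t = g \<otimes> inv x \<otimes> inv g" using cc by (simp add: m_assoc inv_mult_group mult_inv_cancel)
      then have "conj_class Q (N #> x0) = conj_class Q (N #> ?z x)"
        using conj_class_eq_iff[OF x0T conj_e_T[OF xT]] g(2) tT by force
      moreover have "conj_class Q (N #> x) = conj_class Q (N #> x0)" using conj_class_eq_iff[OF xT x0T] t by blast
      ultimately show False using False by simp
    qed
    then show ?thesis using coset_coef_invert[OF xr \<psi> h] s False by simp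
  qed
  then show "s \<in> {1,0,-1}" and "coset_coef x0 \<psi>0 (invert_fun ?h) = of_int s * coset_coef x0 \<psi>0 ?h"
    using c(2)[OF h] c(2)[OF class_fun_invert[OF h]] by auto
qed

lemma has_indicator_exists:
  assumes x0: "regular x0" "\<psi>0 \<in> ext x0" and C: "C \<in> conj_class Q (N #> x0)"
  shows "\<exists>s. has_indicator p red G N \<theta> e C s"
proof -
  obtain t where t: "t \<in> T" "C = N #> (t \<otimes> x0 \<otimes> inv t)" using C unfolding conj_class_coset[OF ext_in_T[OF x0]] by blast
  obtain x \<psi> where x: "x = t \<otimes> x0 \<otimes> inv t" "regular x" "\<psi> \<in> ext x" using conj_regular_ext[OF t(1) x0] by metis
  note xT = ext_in_T[OF x(2,3)]
  have rep: "coset_rep p G N \<theta> C x" using xT x t(2) by (simp add: coset_rep_def)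
  let ?z = "e \<otimes> inv x \<otimes> inv e"
  show ?thesis
  proof (cases "conj_class Q (N #> x) = conj_class Q (N #> ?z)")
    case True
    then obtain u where u: "u \<in> T" "N #> (u \<otimes> ?z \<otimes> inv u) = N #> x"
      using conj_class_eq_iff[OF xT conj_e_T[OF xT]] by blast
    \<comment> \<open>\<open>u \<otimes> e\<close> conjugates \<open>inv x\<close> into the coset of
      \<open>x\<close>, so its inverse conjugates \<open>x\<close> into the coset of
      \<open>inv x\<close>. On \<theta> the factor \<open>inv e\<close> gives the complex conjugate,
      which \<open>inv u\<close> fixes as an element of the inertia group.\<close>
    let ?\<epsilon> = "inv (u \<otimes> e)"
    note cc = e_carrier T_carrier[OF u(1)] T_carrier[OF xT]
    have "N #> (?\<epsilon> \<otimes> x \<otimes> inv ?\<epsilon>) = N #> (?\<epsilon> \<otimes> (u \<otimes> ?z \<otimes> inv u) \<otimes> inv ?\<epsilon>)"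
      by (rule coset_conj_cong) (use cc u(2) in auto)
    also have "u \<otimes> ?z \<otimes> inv u = (u \<otimes> e) \<otimes> inv x \<otimes> inv (u \<otimes> e)" using cc by (simp add: m_assoc inv_mult_group)
    also have "?\<epsilon> \<otimes> ((u \<otimes> e) \<otimes> inv x \<otimes> inv (u \<otimes> e)) \<otimes> inv ?\<epsilon> = inv x"
      using conj_cancel(1)[of "u \<otimes> e" "inv x"] cc by simp
    finally have 1: "N #> (?\<epsilon> \<otimes> x \<otimes> inv ?\<epsilon>) = N #> inv x" .
    have ui: "inv u \<in> T" by (rule subgroup.m_inv_closed[OF T_subgroup u(1)])
    have "conj_fun G \<theta> ?\<epsilon> = conj_fun G (conj_fun G \<theta> (inv e)) (inv u)" using cc by (simp add: conj_fun_mult inv_mult_group)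
    also have "\<dots> = cnj_fun \<theta>" unfolding conj_inv_e(2) by (rule conj_T_cnj[OF ui])
    finally have 2: "conj_fun G \<theta> ?\<epsilon> = cnj_fun \<theta>" .
    then have 3: "?\<epsilon> \<in> ext_inertia G \<theta>" using cc by (simp add: ext_inertia_def)
    have "has_indicator p red G N \<theta> e C (if conj_fun G \<psi> ?\<epsilon> = cnj_fun \<psi> then 1 else -1)"
      unfolding has_indicator_def if_P[OF True]
      by (intro exI[of _ x] exI[of _ \<psi>] conjI rep x(3)) (use True 1 2 3 in auto)
    then show ?thesis by blast
  next
    case False
    have "has_indicator p red G N \<theta> e C 0"
      unfolding has_indicator_def by (intro exI[of _ x] exI[of _ \<psi>] conjI rep x(3)) (use False in simp)
    then show ?thesis by blast
  qed
qed

text \<open>Every admissible value of the indicator, for every coset of the class, equals the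
  quotient of the same two coefficients. This gives at once the uniqueness that the definite
  description requires and constancy on the class.\<close>

lemma indicator_sigma_eq:
  assumes x0: "regular x0" "\<psi>0 \<in> ext x0" and nz: "coset_coef x0 \<psi>0 (induced x0 \<psi>0) \<noteq> 0"
  obtains s where "s \<in> {1,0,-1}" "\<And>C. C \<in> conj_class Q (N #> x0) \<Longrightarrow> indicator_sigma p red G N \<theta> e C = s"
    "coset_coef x0 \<psi>0 (invert_fun (induced x0 \<psi>0)) = of_int s * coset_coef x0 \<psi>0 (induced x0 \<psi>0)"
proof -
  note x0T = ext_in_T[OF x0]
  have C0: "N #> x0 \<in> conj_class Q (N #> x0)"
    unfolding conj_class_coset[OF x0T] using subgroup.one_closed[OF T_subgroup] T_carrier[OF x0T] by (force intro: exI[of _ \<one>])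
  obtain s where s: "has_indicator p red G N \<theta> e (N #> x0) s" using has_indicator_exists[OF x0 C0] by blast
  note sc = has_indicator_coef[OF x0 C0 nz s]
  have "indicator_sigma p red G N \<theta> e C = s" if C: "C \<in> conj_class Q (N #> x0)" for C
  proof -
    have u: "s' = s" if "has_indicator p red G N \<theta> e C s'" for s'
      using has_indicator_coef(2)[OF x0 C nz that] sc(2) nz by simp
    obtain s' where "has_indicator p red G N \<theta> e C s'" using has_indicator_exists[OF x0 C] by blast
    then show ?thesis unfolding indicator_sigma_def using u by (intro the_equality) auto
  qed
  then show thesis using that[OF sc(1) _ sc(2)] by blast
qed

text \<open>The extension that comes with a good coset is fixed by the coset centralizer, so
  \<open>coset_coef_induced_self\<close> makes the diagonal coefficient nonzero.\<close>

lemma good_class_rep: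
  assumes "K \<in> good_classes p red G N \<theta>"
  shows "\<exists>x \<psi>. regular x \<and> \<psi> \<in> ext x \<and> K = conj_class Q (N #> x) \<and> coset_coef x \<psi> (induced x \<psi>) \<noteq> 0"
proof -
  obtain t where t: "t \<in> T" "K = conj_class Q (N #> t)" and g: "\<And>C. C \<in> K \<Longrightarrow> theta_good p red G N \<theta> C"
    using assms unfolding good_classes_def Q_carrier by auto
  have "N #> t \<in> K"
    unfolding t(2) conj_class_coset[OF t(1)] using subgroup.one_closed[OF T_subgroup] T_carrier[OF t(1)] by (force intro: exI[of _ \<one>])
  from g[OF this] obtain x \<psi> where x: "coset_rep p G N \<theta> (N #> t) x" "\<psi> \<in> ext x"
    "\<And>c. c \<in> coset_centralizer G N \<theta> x \<Longrightarrow> conj_fun G \<psi> c = \<psi>" unfolding theta_good_def by blast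
  then have "regular x" "N #> t = N #> x" by (auto simp: coset_rep_def)
  then show ?thesis using coset_coef_induced_self[OF _ x(2,3)] x(2) t(2) by metis
qed

lemma finite_good_classes: "finite (good_classes p red G N \<theta>)"
proof -
  have "finite T" using fin T_carrier by (meson finite_subset subsetI)
  then have "finite (carrier Q)" unfolding Q_carrier by simp
  then show ?thesis by (simp add: good_classes_def)
qed

text \<open>A nonvanishing coefficient belongs to some \<psi> above a conjugate of \<theta>.
  Conjugating back gives an extension of \<theta> itself with the same coefficient, and its class is
  good by \<open>nonzero_imp_good_class\<close>.\<close>

lemma over_span_zero:
  assumes f: "over_span f"
    and z: "\<And>x \<psi>. regular x \<Longrightarrow> \<psi> \<in> ext x \<Longrightarrow> conj_class Q (N #> x) \<in> good_classes p red G N \<theta> \<Longrightarrow> coset_coef x \<psi> f = 0"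
  shows "f y = 0"
proof (rule coset_coefs_zero)
  show cf: "class_fun p G f" using f by (simp add: over_span_def)
  fix y \<psi> assume y: "regular y" "\<psi> \<in> IBr p red (EG y)"
  show "coset_coef y \<psi> f = 0"
  proof (rule ccontr)
    assume nz: "coset_coef y \<psi> f \<noteq> 0"
    then obtain g where g: "g \<in> carrier G" "res N \<psi> = conj_fun G \<theta> g" using over_span_coef[OF f y] by auto
    note yc = regular_carrier[OF y(1)]
    let ?x = "g \<otimes> y \<otimes> inv g"
    have x: "regular ?x" using regular_conj[OF g(1) yc] y(1) by simp
    have "inv g \<otimes> ?x \<otimes> inv (inv g) = y" using conj_cancel(1)[OF g(1) yc] g(1) by simp
    then have e: "N #> (inv g \<otimes> ?x \<otimes> inv (inv g)) = N #> y" by simp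
    note cj = coset_coef_conj[OF inv_closed[OF g(1)] y(1) x e y(2)]
    have "res N (conj_fun G \<psi> (inv g)) = \<theta>"
      using res_conj_fun[OF inv_closed[OF g(1)], of \<psi>] g(2) conj_fun_inverse(1)[OF theta g(1)] by simp
    then have ex: "conj_fun G \<psi> (inv g) \<in> ext ?x" using cj(1) by (simp add: ext_iff)
    have "coset_coef ?x (conj_fun G \<psi> (inv g)) f \<noteq> 0" using cj(2)[OF cf] nz by simp
    then show False using z[OF x ex] nonzero_imp_good_class[OF x ex cf] by blast
  qed
qed

section \<open>The trace of complex conjugation\<close>

lemma over_span_add: "over_span f \<Longrightarrow> over_span g \<Longrightarrow> over_span (\<lambda>y. f y + g y)"
  by (simp add: over_span_def class_fun_add ibr_coef_add)

lemma over_span_scale: "over_span f \<Longrightarrow> over_span (\<lambda>y. c * f y)"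
  by (simp add: over_span_def class_fun_scale ibr_coef_scale)

lemma over_span_sum: "finite A \<Longrightarrow> (\<And>i. i \<in> A \<Longrightarrow> over_span (f i)) \<Longrightarrow> over_span (\<lambda>y. \<Sum>i\<in>A. f i y)"
  by (simp add: over_span_def class_fun_sum ibr_coef_sum)

text \<open>Conjugating a decomposition shows that the conjugate character lies over the complex
  conjugate of \<theta>, which \<open>e\<close> places in the orbit of \<theta>.\<close>

lemma over_cnj:
  assumes "\<phi> \<in> over"
  shows "cnj_fun \<phi> \<in> over"
proof -
  have \<phi>: "\<phi> \<in> IBr p red G" "lies_over p red G N \<theta> \<phi>" using assms by (auto simp: over_def)
  obtain M where M: "set_mset M \<subseteq> IBr p red GN" "\<theta> \<in># M" "\<And>y. res N \<phi> y = (\<Sum>\<nu>\<in>#M. \<nu> y)"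
    using \<phi>(2) unfolding lies_over_def constituent_def by blast
  have cs: "cnj (\<Sum>\<nu>\<in>#A. \<nu> y) = (\<Sum>\<nu>\<in>#image_mset cnj_fun A. \<nu> y)" for A and y :: 'a
    by (induction A) (auto simp: cnj_fun_def)
  have "set_mset (image_mset cnj_fun M) \<subseteq> IBr p red GN" using M(1) N.cnj_fun_IBr by auto
  moreover have "res N (cnj_fun \<phi>) y = (\<Sum>\<nu>\<in>#image_mset cnj_fun M. \<nu> y)" for y
    using M(3)[of y] cs by (metis cnj_fun_def res_cnj_fun)
  moreover have "cnj_fun \<theta> \<in># image_mset cnj_fun M" using M(2) by auto
  ultimately have "lies_over p red G N (cnj_fun \<theta>) (cnj_fun \<phi>)" unfolding lies_over_def constituent_def by blast
  moreover have "cnj_fun \<theta> \<in> orb" using e_conj e_carrier by force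
  ultimately show ?thesis using lies_over_orb[OF cnj_fun_IBr[OF \<phi>(1)]] by blast
qed

lemma real_over_iff:
  "real_valued \<phi> \<longleftrightarrow> cnj_fun \<phi> = \<phi>"
  by (auto simp: real_valued_def cnj_fun_def fun_eq_iff Reals_cnj_iff)

lemma over_IBr_span: "\<phi> \<in> over \<Longrightarrow> over_span \<phi>"
  using over_IBr(1) IBr_class_fun ibr_coef_IBr by (auto simp: over_span_def)

lemma over_span_expand:
  assumes "over_span f"
  shows "f y = (\<Sum>\<phi>\<in>over. ibr_coef p red G f \<phi> * \<phi> y)"
proof -
  have "f y = (\<Sum>\<phi>\<in>IBr p red G. ibr_coef p red G f \<phi> * \<phi> y)" using assms by (intro ibr_coef_expand) (simp add: over_span_def)
  also have "\<dots> = (\<Sum>\<phi>\<in>over. ibr_coef p red G f \<phi> * \<phi> y)"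
    by (rule sum.mono_neutral_right) (use assms over_IBr finite_IBr in \<open>auto simp: over_span_def\<close>)
  finally show ?thesis .
qed

text \<open>The numbers \<open>c K \<phi> / c K (F K)\<close> and \<open>?co (F K) \<phi>\<close>
  are the two mutually inverse base changes between \<open>over\<close> and the functions
  \<open>F K\<close>; the trace is compared in both bases by exchanging a double sum.\<close>

lemma card_real_over:
  "int (card {\<phi> \<in> over. real_valued \<phi>}) =
     int (card (sigma_classes p red G N \<theta> e 1)) - int (card (sigma_classes p red G N \<theta> e (-1)))"
proof -
  let ?K = "good_classes p red G N \<theta>"
  obtain X \<Psi> where X: "\<And>K. K \<in> ?K \<Longrightarrow> regular (X K)" "\<And>K. K \<in> ?K \<Longrightarrow> \<Psi> K \<in> ext (X K)"
    "\<And>K. K \<in> ?K \<Longrightarrow> K = conj_class Q (N #> X K)" "\<And>K. K \<in> ?K \<Longrightarrow> coset_coef (X K) (\<Psi> K) (induced (X K) (\<Psi> K)) \<noteq> 0"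
    using good_class_rep by metis
  define c where "c K f = coset_coef (X K) (\<Psi> K) f" for K f
  define F where "F K = induced (X K) (\<Psi> K)" for K
  have \<Psi>: "\<Psi> K \<in> IBr p red (EG (X K))" "res N (\<Psi> K) = \<theta>" "X K \<in> T" if "K \<in> ?K" for K
    using X(2)[OF that] ext_in_T[OF X(1,2)[OF that]] by (auto simp: ext_iff)
  have Fs: "over_span (F K)" if "K \<in> ?K" for K unfolding F_def by (rule induced_over_span[OF X(1,2)[OF that]])
  then have Fc: "class_fun p G (F K)" if "K \<in> ?K" for K using that by (simp add: over_span_def)
  have cF: "c K (F K) \<noteq> 0" if "K \<in> ?K" for K using X(4)[OF that] by (simp add: c_def F_def)
  \<comment> \<open>A nonzero value would give some \<open>g\<close> that carries one coset to the
    other and fixes \<theta>, so that the two classes coincide.\<close>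
  have cF0: "c K (F L) = 0" if K: "K \<in> ?K" and L: "L \<in> ?K" and ne: "K \<noteq> L" for K L
  proof (rule ccontr)
    assume "c K (F L) \<noteq> 0"
    then have nz: "coset_coef (X K) (\<Psi> K) (induced (X L) (\<Psi> L)) \<noteq> 0" by (simp add: c_def F_def)
    obtain g where g: "g \<in> carrier G" "N #> (g \<otimes> X K \<otimes> inv g) = N #> X L" "res N (\<Psi> K) = conj_fun G \<theta> g"
      using coset_coef_induced_nonzero[OF X(1,2)[OF L] X(1)[OF K] \<Psi>(1)[OF K] nz] .
    then have "g \<in> T" using \<Psi>(2)[OF K] by (simp add: T_iff)
    then have "conj_class Q (N #> X L) = conj_class Q (N #> X K)"
      using conj_class_eq_iff[OF \<Psi>(3)[OF L] \<Psi>(3)[OF K]] g(2) by blast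
    then show False using X(3)[OF K] X(3)[OF L] ne by simp
  qed
  note c_lin_fun = coset_coef_lincomb[OF X(1) \<Psi>(1), folded c_def]
  have expand: "f y = (\<Sum>K\<in>?K. c K f / c K (F K) * F K y)" if f: "over_span f" for f y
  proof -
    \<comment> \<open>The minus sign makes the remainder of the expansion a sum of two members of
      the span; all functionals \<open>c K\<close> vanish on it, so \<open>over_span_zero\<close>
      applies.\<close>
    let ?S = "\<lambda>y. \<Sum>K\<in>?K. - (c K f / c K (F K)) * F K y"
    have fc: "class_fun p G f" using f by (simp add: over_span_def)
    have Ss: "over_span ?S" by (rule over_span_sum[OF finite_good_classes over_span_scale[OF Fs]])
    then have Sc: "class_fun p G ?S" by (simp add: over_span_def)
    have z: "c K (\<lambda>y. f y + ?S y) = 0" if K: "K \<in> ?K" for K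
    proof -
      have "c K ?S = (\<Sum>L\<in>?K. - (c L f / c L (F L)) * c K (F L))"
        by (rule c_lin_fun[OF K K finite_good_classes Fc])
      also have "\<dots> = (\<Sum>L\<in>{K}. - (c L f / c L (F L)) * c K (F L))"
        by (rule sum.mono_neutral_right) (use K cF0 finite_good_classes in auto)
      also have "\<dots> = - c K f" using cF[OF K] by simp
      finally have "c K ?S = - c K f" .
      moreover have "c K (\<lambda>y. f y + ?S y) = c K f + c K ?S"
        unfolding c_def[of K] by (rule coset_coef_add[OF X(1)[OF K] fc Sc \<Psi>(1)[OF K]])
      ultimately show ?thesis by simp
    qed
    have "f y + ?S y = 0"
    proof (rule over_span_zero[OF over_span_add[OF f Ss]])
      fix x \<psi> assume x: "regular x" "\<psi> \<in> ext x" and K: "conj_class Q (N #> x) \<in> ?K"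
      let ?L = "conj_class Q (N #> x)"
      have "conj_class Q (N #> X ?L) = conj_class Q (N #> x)" using X(3)[OF K] by simp
      then obtain t where t: "t \<in> T" "N #> (t \<otimes> x \<otimes> inv t) = N #> X ?L"
        using conj_class_eq_iff[OF \<Psi>(3)[OF K] ext_in_T[OF x]] by blast
      obtain d where "\<And>f. class_fun p G f \<Longrightarrow> coset_coef x \<psi> f = d * c ?L f"
        using coset_coef_proportional[OF t(1) X(1,2)[OF K] x t(2)] unfolding c_def by metis
      from this[OF class_fun_add[OF fc Sc]] show "coset_coef x \<psi> (\<lambda>y. f y + ?S y) = 0" using z[OF K] by simp
    qed
    then show ?thesis by (simp add: sum_negf)
  qed
  have "\<exists>s. s \<in> {1,0,-1} \<and> (\<forall>C\<in>K. indicator_sigma p red G N \<theta> e C = s) \<and> c K (invert_fun (F K)) = of_int s * c K (F K)"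
    if K: "K \<in> ?K" for K
    using indicator_sigma_eq[OF X(1,2,4)[OF K]] X(3)[OF K] unfolding c_def F_def by metis
  then obtain s where s: "\<And>K. K \<in> ?K \<Longrightarrow> s K \<in> {1,0,-1}" "\<And>K C. K \<in> ?K \<Longrightarrow> C \<in> K \<Longrightarrow> indicator_sigma p red G N \<theta> e C = s K"
    "\<And>K. K \<in> ?K \<Longrightarrow> c K (invert_fun (F K)) = of_int (s K) * c K (F K)" by metis
  \<comment> \<open>\<open>sigma_classes\<close> quantifies over the members of a class, so a class
    must be nonempty for the common value of the indicator to be determined by it.\<close>
  have ne: "K \<noteq> {}" if "K \<in> ?K" for K
    using X(3)[OF that] conj_class_coset[OF \<Psi>(3)[OF that]] subgroup.one_closed[OF T_subgroup] by blast
  have sc: "sigma_classes p red G N \<theta> e k = {K \<in> ?K. s K = k}" for k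
    using s(2) ne by (fastforce simp: sigma_classes_def)

  let ?co = "\<lambda>f \<phi>. ibr_coef p red G f \<phi>"
  have tau: "c K (cnj_fun \<phi>) = c K (invert_fun \<phi>)" if "\<phi> \<in> over" for K \<phi>
    using that invert_IBr over_IBr(1) by (metis subsetD)
  \<comment> \<open>Inversion is linear and acts on the basis \<open>over\<close> as complex
    conjugation, so applying \<open>c K\<close> to the expansion of the inverted \<open>F K\<close>
    gives this sum.\<close>
  have swap: "(\<Sum>\<phi>\<in>over. ?co (F K) \<phi> * c K (cnj_fun \<phi>)) = c K (invert_fun (F K))" if K: "K \<in> ?K" for K
  proof -
    have "invert_fun (F K) = (\<lambda>y. \<Sum>\<phi>\<in>over. ?co (F K) \<phi> * cnj_fun \<phi> y)"
    proof
      fix y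
      have "invert_fun (F K) y = (\<Sum>\<phi>\<in>over. ?co (F K) \<phi> * invert_fun \<phi> y)"
        unfolding invert_fun_def using over_span_expand[OF Fs[OF K], of "inv y"] by simp
      also have "\<dots> = (\<Sum>\<phi>\<in>over. ?co (F K) \<phi> * cnj_fun \<phi> y)"
        using invert_IBr over_IBr(1) by (intro sum.cong refl) (metis subsetD)
      finally show "invert_fun (F K) y = (\<Sum>\<phi>\<in>over. ?co (F K) \<phi> * cnj_fun \<phi> y)" .
    qed
    moreover have "c K (\<lambda>y. \<Sum>\<phi>\<in>over. ?co (F K) \<phi> * cnj_fun \<phi> y) = (\<Sum>\<phi>\<in>over. ?co (F K) \<phi> * c K (cnj_fun \<phi>))"
      by (rule c_lin_fun[OF K K over_IBr(2) IBr_class_fun]) (use over_cnj over_IBr(1) in blast)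
    ultimately show ?thesis by simp
  qed
  \<comment> \<open>A diagonal entry of complex conjugation in the basis of Brauer characters: it is
    1 for a fixed basis element and 0 for one that moves, because the image is again a basis
    element.\<close>
  have diag: "(if real_valued \<phi> then 1 else 0) = (\<Sum>K\<in>?K. c K (cnj_fun \<phi>) / c K (F K) * ?co (F K) \<phi>)" if \<phi>: "\<phi> \<in> over" for \<phi>
  proof -
    have I: "\<phi> \<in> IBr p red G" "cnj_fun \<phi> \<in> IBr p red G" using \<phi> over_cnj[OF \<phi>] over_IBr(1) by auto
    have r: "?co (cnj_fun \<phi>) \<phi> = (if real_valued \<phi> then 1 else 0)"
      using ibr_coef_IBr[OF I(2,1)] real_over_iff[of \<phi>] by auto
    have e: "cnj_fun \<phi> = (\<lambda>y. \<Sum>K\<in>?K. c K (cnj_fun \<phi>) / c K (F K) * F K y)"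
      using expand[OF over_IBr_span[OF over_cnj[OF \<phi>]]] by blast
    moreover have "?co (\<lambda>y. \<Sum>K\<in>?K. c K (cnj_fun \<phi>) / c K (F K) * F K y) \<phi> = (\<Sum>K\<in>?K. ?co (\<lambda>y. c K (cnj_fun \<phi>) / c K (F K) * F K y) \<phi>)"
      by (rule ibr_coef_sum[OF finite_good_classes class_fun_scale[OF Fc] I(1)])
    moreover have "\<dots> = (\<Sum>K\<in>?K. c K (cnj_fun \<phi>) / c K (F K) * ?co (F K) \<phi>)"
      by (intro sum.cong refl ibr_coef_scale[OF Fc I(1)])
    ultimately have "?co (cnj_fun \<phi>) \<phi> = (\<Sum>K\<in>?K. c K (cnj_fun \<phi>) / c K (F K) * ?co (F K) \<phi>)" by (simp flip: e)
    with r show ?thesis by simp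
  qed
  have "(of_nat (card {\<phi> \<in> over. real_valued \<phi>}) :: complex) = (\<Sum>\<phi>\<in>over. if real_valued \<phi> then 1 else 0)"
    using over_IBr(2) by (simp add: sum.If_cases Int_def)
  also have "\<dots> = (\<Sum>\<phi>\<in>over. \<Sum>K\<in>?K. c K (cnj_fun \<phi>) / c K (F K) * ?co (F K) \<phi>)"
    by (intro sum.cong refl diag)
  \<comment> \<open>The exchange of sums passes from the diagonal in the basis of Brauer characters
    to the diagonal in the basis \<open>F K\<close>, whose entries are the indicators.\<close>
  also have "\<dots> = (\<Sum>K\<in>?K. \<Sum>\<phi>\<in>over. c K (cnj_fun \<phi>) / c K (F K) * ?co (F K) \<phi>)" by (rule sum.swap)
  also have "\<dots> = (\<Sum>K\<in>?K. (\<Sum>\<phi>\<in>over. ?co (F K) \<phi> * c K (cnj_fun \<phi>)) / c K (F K))"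
    unfolding sum_divide_distrib by (intro sum.cong refl) simp
  also have "\<dots> = (\<Sum>K\<in>?K. of_int (s K))"
    using swap s(3) cF by (intro sum.cong refl) simp
  finally have "of_int (int (card {\<phi> \<in> over. real_valued \<phi>})) = (of_int (\<Sum>K\<in>?K. s K) :: complex)" by simp
  then have "int (card {\<phi> \<in> over. real_valued \<phi>}) = (\<Sum>K\<in>?K. s K)" by (simp only: of_int_eq_iff)
  also have "\<dots> = (\<Sum>K\<in>?K. (if s K = 1 then 1 else 0) - (if s K = -1 then 1 else 0))"
    using s(1) by (intro sum.cong refl) fastforce
  also have "\<dots> = int (card {K \<in> ?K. s K = 1}) - int (card {K \<in> ?K. s K = -1})"
    using finite_good_classes by (simp add: sum_subtractf sum.If_cases Int_def)
  finally show ?thesis unfolding sc .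
qed

end

theorem theorem2:
  fixes G :: "('a, 'm) monoid_scheme" and N :: "'a set" and p :: nat
    and red :: "complex \<Rightarrow> 'k::alg_closed_field"
    and \<theta> :: "'a \<Rightarrow> complex" and e :: 'a
  assumes "group G" and "finite (carrier G)" and "prime p"
    and "CHAR('k) = p" and "reduction_hom red"
    and "N \<lhd> G"
    and "\<theta> \<in> IBr p red (G\<lparr>carrier := N\<rparr>)"
    and "e \<in> ext_inertia G \<theta>" and "conj_fun G \<theta> e = cnj_fun \<theta>"
  shows "int (card {\<phi> \<in> IBr p red G. real_valued \<phi> \<and> lies_over p red G N \<theta> \<phi>}) =
         int (card (sigma_classes p red G N \<theta> e 1)) - int (card (sigma_classes p red G N \<theta> e (-1)))"
proof -
  interpret theta_setup G p red N \<theta> e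
    using assms
    by (intro theta_setup.intro modular_normal.intro finite_modular_group.intro modular_reduction.intro
        finite_modular_group_axioms.intro theta_setup_axioms.intro) (auto simp: ext_inertia_def)
  have "{\<phi> \<in> IBr p red G. real_valued \<phi> \<and> lies_over p red G N \<theta> \<phi>} = {\<phi> \<in> over. real_valued \<phi>}"
    by (auto simp: over_def)
  then show ?thesis using card_real_over by simp
qed

end
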